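(* Let $\Omega\subset\mathbb{R}^d$ be a centered symmetric convex body and let $q\in\mathbb{R}^d\setminus\{0\}$. Let $\mathrm{Par}_\Omega^q$ denote the class of all stable Nyquist trajectory sets for $\mathcal{B}_\Omega$ consisting of lines parallel to $q$, and $\mathrm{Hom}_\Omega^q\subseteq \mathrm{Par}_\Omega^q$ the subclass of those that are homogeneous. Then \[ \inf_{P\in \mathrm{Par}_\Omega^q}\ell^-(P)=\inf_{P\in \mathrm{Hom}_\Omega^q}\ell(P)=|\Omega\cap q^\perp|. \] Consequently, with $\mathrm{Par}_\Omega=\bigcup_{q\neq 0}\mathrm{Par}_\Omega^q$ and $\mathrm{Hom}_\Omega=\bigcup_{q\neq0}\mathrm{Hom}_\Omega^q$, \[ \inf_{P\in \mathrm{Par}_\Omega}\ell^-(P)=\inf_{P\in \mathrm{Hom}_\Omega}\ell(P)=\min_{q\in\mathbb{R}^d\setminus\{0\}}|\Omega\cap q^\perp|. \]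
   Context: A convex body is a convex compact set with non-empty interior; it is centered if $0$ is an interior point and symmetric if $\Omega=-\Omega$. $q^\perp=\{x:\langle x,q\rangle=0\}$ and $|\Omega\cap q^\perp|$ denotes the $(d-1)$-dimensional Lebesgue measure of this section. Fourier transform: $\widehat f(\omega)=\int_{\mathbb{R}^d} f(r)e^{-2\pi i\langle\omega,r\rangle}dr$. For a closed $\Omega$, $\mathcal{B}_\Omega=\{f\in L^2(\mathbb{R}^d):\widehat f(\omega)=0\text{ for a.e. }\omega\notin\Omega\}$. A set $\Lambda\subseteq\mathbb{R}^d$ is a set of stable sampling for $\mathcal{B}_\Omega$ if there are constants $0<A\le B<\infty$ with $A\|f\|_2^2\le\sum_{\lambda\in\Lambda}|f(\lambda)|^2\le B\|f\|_2^2$ for all $f\in\mathcal{B}_\Omega$. $\Lambda$ is uniformly discrete if $\inf\{\|x-y\|:x,y\in\Lambda,x\ne y\}>0$. A trajectory is a set $\gamma(\mathbb{R})$ where $\gamma:\mathbb{R}\to\mathbb{R}^d$ is a curve whose restriction to every bounded interval is rectifiable; a trajectory set $P$ is a countable collection of trajectories (also identified with their union). $B_a^d(x)$ is the closed Euclidean ball of radius $a$ centered at $x$. $\mathcal{M}^P(a,x)$ is the total arc length of the trajectories of $P$ inside $B_a^d(x)$. Lower/upper path densities: $\ell^-(P)=\liminf_{a\to\infty}\inf_{x}\mathcal{M}^P(a,x)/|B_a^d|$, $\ell^+(P)=\limsup_{a\to\infty}\sup_x\mathcal{M}^P(a,x)/|B_a^d|$; $P$ is homogeneous if $\ell^-(P)=\ell^+(P)=:\ell(P)$.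 Condition (C2) (non-degeneracy): there is $\delta:\mathbb{R}^+\to\mathbb{R}^+$ with $\delta(a)=o(a^d)$ such that for every $x\in\mathbb{R}^d$ and every sufficiently large $a$ there is a rectifiable curve $\alpha:[0,1]\to\mathbb{R}^d$ with length $\ell(\alpha)=\mathcal{M}^P(a,x)+\delta(a)$ and $P\cap B_a^d(x)\subseteq\alpha([0,1])$. $P$ is a stable Nyquist trajectory set for $\mathcal{B}_\Omega$ if it satisfies (C2) and there exists a uniformly discrete set $\Lambda$ of points lying on the trajectories of $P$ that is a set of stable sampling for $\mathcal{B}_\Omega$. *)

theory Defs
  imports "HOL-Analysis.Analysis" "HOL-Library.Landau_Symbols"
begin

definition convex_body :: "'a::euclidean_space set \<Rightarrow> bool" where
  "convex_body S \<longleftrightarrow> convex S \<and> compact S \<and> interior S \<noteq> {}"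

text \<open>(d-1)-dimensional volume of the central section S \<inter> q-perp, computed as the
  d-dimensional Lebesgue measure of the unit-height cylinder over it
  (product-measure definition of the volume on the hyperplane).\<close>
definition section_vol :: "'a::euclidean_space set \<Rightarrow> 'a \<Rightarrow> real" where
  "section_vol S q = measure lebesgue
     {y + t *\<^sub>R (q /\<^sub>R norm q) | y t. y \<in> S \<and> y \<bullet> q = 0 \<and> t \<in> {0..1}}"

definition PW_space :: "'a::euclidean_space set \<Rightarrow> ('a \<Rightarrow> complex) set" where
  "PW_space S = {f. \<exists>g::'a \<Rightarrow> complex. g \<in> borel_measurable lebesgue \<and>
        set_integrable lebesgue S (\<lambda>w. (cmod (g w))\<^sup>2) \<and>
        (\<forall>x. f x = set_lebesgue_integral lebesgue S
                 (\<lambda>w. g w * exp (2 * pi * \<i> * complex_of_real (w \<bullet> x))))}"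

definition L2_norm_sq :: "('a::euclidean_space \<Rightarrow> complex) \<Rightarrow> real" where
  "L2_norm_sq f = integral\<^sup>L lebesgue (\<lambda>x. (cmod (f x))\<^sup>2)"

definition stable_sampling :: "'a::euclidean_space set \<Rightarrow> 'a set \<Rightarrow> bool" where
  "stable_sampling S Lam \<longleftrightarrow> (\<exists>A B. 0 < A \<and> A \<le> B \<and>
     (\<forall>f \<in> PW_space S. (\<lambda>l. (cmod (f l))\<^sup>2) summable_on Lam \<and>
        A * L2_norm_sq f \<le> (\<Sum>\<^sub>\<infinity>l\<in>Lam. (cmod (f l))\<^sup>2) \<and>
        (\<Sum>\<^sub>\<infinity>l\<in>Lam. (cmod (f l))\<^sup>2) \<le> B * L2_norm_sq f))"

definition uniformly_discrete :: "'a::metric_space set \<Rightarrow> bool" where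
  "uniformly_discrete Lam \<longleftrightarrow> (\<exists>e>0. \<forall>x\<in>Lam. \<forall>y\<in>Lam. x \<noteq> y \<longrightarrow> e \<le> dist x y)"

definition poly_lengths :: "(real \<Rightarrow> 'a::metric_space) \<Rightarrow> real set" where
  "poly_lengths \<alpha> = {(\<Sum>i<n. dist (\<alpha> (t (Suc i))) (\<alpha> (t i))) | n t.
      t 0 = 0 \<and> t n = 1 \<and> (\<forall>i<n. t i \<le> t (Suc i))}"

definition rectifiable_curve :: "(real \<Rightarrow> 'a::metric_space) \<Rightarrow> bool" where
  "rectifiable_curve \<alpha> \<longleftrightarrow> continuous_on {0..1} \<alpha> \<and> bdd_above (poly_lengths \<alpha>)"

definition curve_length :: "(real \<Rightarrow> 'a::metric_space) \<Rightarrow> real" where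
  "curve_length \<alpha> = Sup (poly_lengths \<alpha>)"

definition line_through :: "'a::real_vector \<Rightarrow> 'a \<Rightarrow> 'a set" where
  "line_through p q = range (\<lambda>t. p + t *\<^sub>R q)"

definition parallel_lines :: "'a::euclidean_space \<Rightarrow> 'a set set \<Rightarrow> bool" where
  "parallel_lines q P \<longleftrightarrow> countable P \<and> (\<forall>L\<in>P. \<exists>p. L = line_through p q)"

text \<open>Total arc length of the trajectories of P inside the closed ball: for a line L,
  L \<inter> cball x a is a (possibly degenerate/empty) segment whose length is its diameter.\<close>
definition arc_mass :: "'a::euclidean_space set set \<Rightarrow> real \<Rightarrow> 'a \<Rightarrow> ennreal" where
  "arc_mass P a x = (\<Sum>\<^sub>\<infinity>L\<in>P. ennreal (diameter (L \<inter> cball x a)))"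

definition lower_path_density :: "'a::euclidean_space set set \<Rightarrow> ennreal" where
  "lower_path_density P = Liminf at_top
     (\<lambda>a. INF x. arc_mass P a x / ennreal (measure lebesgue (cball (0::'a) a)))"

definition upper_path_density :: "'a::euclidean_space set set \<Rightarrow> ennreal" where
  "upper_path_density P = Limsup at_top
     (\<lambda>a. SUP x. arc_mass P a x / ennreal (measure lebesgue (cball (0::'a) a)))"

definition homogeneous :: "'a::euclidean_space set set \<Rightarrow> bool" where
  "homogeneous P \<longleftrightarrow> lower_path_density P = upper_path_density P"

definition path_density :: "'a::euclidean_space set set \<Rightarrow> ennreal" where
  "path_density P = lower_path_density P"

definition condition_C2 :: "'a::euclidean_space set set \<Rightarrow> bool" where
  "condition_C2 P \<longleftrightarrow> (\<exists>\<delta>::real \<Rightarrow> real. (\<forall>a>0. \<delta> a \<ge> 0) \<and>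
     \<delta> \<in> o(\<lambda>a. a ^ DIM('a)) \<and>
     (\<forall>x::'a. \<forall>\<^sub>F a in at_top. \<exists>\<alpha>::real \<Rightarrow> 'a. rectifiable_curve \<alpha> \<and>
        ennreal (curve_length \<alpha>) = arc_mass P a x + ennreal (\<delta> a) \<and>
        \<Union>P \<inter> cball x a \<subseteq> \<alpha> ` {0..1}))"

definition stable_nyquist :: "'a::euclidean_space set \<Rightarrow> 'a set set \<Rightarrow> bool" where
  "stable_nyquist S P \<longleftrightarrow> condition_C2 P \<and>
     (\<exists>Lam. Lam \<subseteq> \<Union>P \<and> uniformly_discrete Lam \<and> stable_sampling S Lam)"

definition Par :: "'a::euclidean_space set \<Rightarrow> 'a \<Rightarrow> 'a set set set" where
  "Par S q = {P. parallel_lines q P \<and> stable_nyquist S P}"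

definition Hom :: "'a::euclidean_space set \<Rightarrow> 'a \<Rightarrow> 'a set set set" where
  "Hom S q = {P \<in> Par S q. homogeneous P}"

end

theory Submission
  imports Defs
begin

text \<open>After an orthogonal change of coordinates the lines are parallel to a basis vector \<open>b0\<close>.

  Lower bound: fill the section with small cubic cells and attach to each cell translated
  band-limited windows. If some large cube met fewer lines than there are windows, a nontrivial
  combination of the windows would vanish on all these lines; being concentrated near the cube it
  would violate the lower sampling inequality. Hence every large cube meets at least about
  section volume times (cube side to the power \<open>d - 1\<close>) many lines.

  Upper bound: take a union of \<open>N\<close> generic translates of a lattice, where \<open>N\<close> is the largest number
  of points of a shifted dual lattice inside \<open>S\<close>. A Vandermonde argument, applied fibrewise to the
  periodization of the spectrum, shows that this union is sampling. If the lattice is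
  fine along \<open>b0\<close> then only slices parallel to the central section matter, and by
  Brunn--Minkowski and symmetry the central one is largest, so \<open>N\<close> is controlled by its volume.\<close>

subsection \<open>Prekopa--Leindler and Brunn--Minkowski inequalities\<close>

text \<open>Why lines rather than sample points are counted: the frequency cells rest on the
  hyperplane orthogonal to \<open>b0\<close> and the window positions have zero \<open>b0\<close>
  coordinate, so all transforms share one factor along \<open>b0\<close>, and vanishing on a whole
  line is a single linear equation. Three proportional losses occur: the part of the section not
  packed by cells, the shrinking of a cell to the subcell where its window is not small, and the
  guard strip inside the cube. They are fixed first; only then does the cube grow, at fixed
  proportions, which pushes the leakage of the windows below the lower sampling constant. On the
  upper side the generic translates are multiples of one vector, so that their characters are powers
  of fixed distinct nodes. The delicate point there is condition (C2): near the rim of a ball the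
  chord ends move like a square root of the displacement of the line, so lines are traversed back
  and forth in bundles of width \<open>sqrt a\<close>, at a total extra length of order
  \<open>a\<close> to the power \<open>d - 1/4\<close>, which is \<open>o(a ^ d)\<close>.\<close>

lemma add_less_le_mono_ennreal: "a < c \<Longrightarrow> b \<le> d \<Longrightarrow> d \<noteq> top \<Longrightarrow> a + b < c + (d::ennreal)"
  by (cases a; cases b; cases c; cases d) (auto simp: ennreal_plus[symmetric] ennreal_less_iff ennreal_le_iff top_unique simp del: ennreal_plus)

text \<open>Inner regularity by compact sets. Cutting \<open>A\<close> down to
  \<open>{- real n..real n}\<close> first makes the measure finite, so the gap to \<open>r\<close>
  is a positive real, and a closed inner approximation within that gap is also bounded.\<close>

lemma compact_inner_approx:
  fixes A :: "real set"
  assumes A: "A \<in> sets borel" and r: "r < emeasure lborel A"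
  obtains K where "compact K" "K \<subseteq> A" "r < emeasure lborel K"
proof -
  have "(\<lambda>n. emeasure lborel (A \<inter> {- real n..real n})) \<longlonglongrightarrow> emeasure lborel (\<Union>n. A \<inter> {- real n..real n})"
    using A by (intro Lim_emeasure_incseq) (auto simp: incseq_def)
  moreover have "(\<Union>n. A \<inter> {- real n..real n}) = A"
  proof -
    have "\<exists>n. x \<in> {- real n..real n}" for x :: real
      using real_arch_simple[of "\<bar>x\<bar>"] by (auto simp: abs_le_iff minus_le_iff)
    then show ?thesis by blast
  qed
  ultimately have "eventually (\<lambda>n. r < emeasure lborel (A \<inter> {- real n..real n})) sequentially"
    using r by (auto intro: order_tendstoD(1))
  then obtain n where n: "r < emeasure lborel (A \<inter> {- real n..real n})"
    by (auto simp: eventually_sequentially)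
  define A' where "A' = A \<inter> {- real n..real n}"
  have A'm: "A' \<in> sets borel" using A by (auto simp: A'_def)
  have fin: "emeasure lborel A' < \<infinity>"
    by (rule le_less_trans[OF emeasure_mono[of A' "{- real n..real n}"]]) (auto simp: A'_def)
  obtain x where x: "emeasure lborel A' = ennreal x" "x \<ge> 0"
    using fin by (cases "emeasure lborel A'") auto
  obtain s where s: "r = ennreal s" "s \<ge> 0"
    using n fin A'_def by (cases r) auto
  have sx: "s < x" using n x s unfolding A'_def[symmetric] by (simp add: ennreal_less_iff)
  obtain T where T: "closed T" "T \<subseteq> A'" "emeasure lebesgue (A' - T) < ennreal (x - s)"
  proof (rule sets_lebesgue_inner_closed[of A' "x - s"])
    show "A' \<in> sets lebesgue" using A'm by simp
    show "0 < x - s" using sx by simp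
  qed blast
  have "emeasure lborel A' = emeasure lborel (A' - T) + emeasure lborel T"
  proof -
    have "T \<in> sets lborel" using T(1) by (simp add: borel_closed)
    then have "emeasure lborel (A' - T) + emeasure lborel T = emeasure lborel ((A' - T) \<union> T)"
      using A'm by (intro plus_emeasure) auto
    moreover have "(A' - T) \<union> T = A'" using T(2) by auto
    ultimately show ?thesis by simp
  qed
  moreover have "emeasure lborel (A' - T) < ennreal (x - s)"
  proof -
    have "A' - T \<in> sets lborel" using T A'm by auto
    then show ?thesis using T(3) by simp
  qed
  ultimately have le: "ennreal x = emeasure lborel (A' - T) + emeasure lborel T" "emeasure lborel (A' - T) < ennreal (x - s)"
    using x by auto
  have "ennreal s < emeasure lborel T"
  proof (rule ccontr)
    assume "\<not> ?thesis"
    then have "emeasure lborel T \<le> ennreal s" by simp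
    from add_less_le_mono_ennreal[OF le(2) this] have "ennreal x < ennreal (x - s) + ennreal s"
      unfolding le(1) by simp
    then show False using sx s by (simp add: ennreal_plus[symmetric] del: ennreal_plus)
  qed
  moreover have "compact T"
    unfolding compact_eq_bounded_closed using T(1,2) bounded_closed_interval[of "- real n" "real n"]
    by (meson bounded_subset le_inf_iff T(2)[unfolded A'_def])
  moreover have "T \<subseteq> A" using T(2) by (simp add: A'_def)
  ultimately show ?thesis using that s(1) by metis
qed

text \<open>The affine map from \<open>x\<close> to \<open>(x + b) / 2\<close> halves lengths and
  sends \<open>A\<close> into \<open>C\<close>.\<close>

lemma emeasure_halved_shift:
  fixes A C :: "real set"
  assumes A: "A \<in> sets borel" and C: "C \<in> sets borel" and sub: "\<And>x. x \<in> A \<Longrightarrow> (x + b) / 2 \<in> C"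
  shows "emeasure lborel A \<le> 2 * emeasure lborel C"
proof -
  have "emeasure lborel C = (\<integral>\<^sup>+x. indicator C x \<partial>lborel)" using C by simp
  also have "\<dots> = ennreal (1/2) * (\<integral>\<^sup>+x. indicator C (b/2 + (1/2) * x) \<partial>lborel)"
    using C by (subst nn_integral_real_affine[where c="1/2" and t="b/2"]) auto
  also have "\<dots> \<ge> ennreal (1/2) * (\<integral>\<^sup>+x. indicator A x \<partial>lborel)"
    using sub by (intro mult_left_mono nn_integral_mono) (auto simp: indicator_def add_divide_distrib add.commute)
  finally have *: "ennreal (1/2) * emeasure lborel A \<le> emeasure lborel C" using A by simp
  have "emeasure lborel A = 2 * (ennreal (1/2) * emeasure lborel A)"
  proof -
    have "ennreal 2 * ennreal (1/2) = ennreal 1"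
      by (subst ennreal_mult[symmetric]) auto
    then have "2 * ennreal (1/2) = 1" by simp
    then show ?thesis by (simp add: mult.assoc[symmetric])
  qed
  also have "\<dots> \<le> 2 * emeasure lborel C" using * by (rule mult_left_mono) simp
  finally show ?thesis .
qed

text \<open>One-dimensional Brunn-Minkowski. For compact \<open>K\<close> and \<open>L\<close> let
  \<open>a\<close> be the largest point of \<open>K\<close> and \<open>b\<close> the smallest of
  \<open>L\<close>: the midpoints of \<open>K\<close> with \<open>b\<close> lie left of
  \<open>(a + b) / 2\<close>, those of \<open>a\<close> with \<open>L\<close> to its right, so
  \<open>C\<close> contains half-size copies of both that do not overlap. Inner regularity then
  removes compactness, one set at a time.\<close>

lemma measure_midpoint_set_real:
  fixes A B C :: "real set"
  assumes A: "A \<in> sets borel" "A \<noteq> {}" and B: "B \<in> sets borel" "B \<noteq> {}" and C: "C \<in> sets borel"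
    and sub: "\<And>x y. x \<in> A \<Longrightarrow> y \<in> B \<Longrightarrow> (x + y) / 2 \<in> C"
  shows "emeasure lborel A + emeasure lborel B \<le> 2 * emeasure lborel C"
proof -
  have cpt: "emeasure lborel K + emeasure lborel L \<le> 2 * emeasure lborel C"
    if K: "compact K" "K \<noteq> {}" "K \<subseteq> A" and L: "compact L" "L \<noteq> {}" "L \<subseteq> B" for K L
  proof -
    obtain a where a: "a \<in> K" "\<And>x. x \<in> K \<Longrightarrow> x \<le> a" using compact_attains_sup[OF K(1,2)] by blast
    obtain b where b: "b \<in> L" "\<And>x. x \<in> L \<Longrightarrow> b \<le> x" using compact_attains_inf[OF L(1,2)] by blast
    let ?m = "(a + b) / 2"
    have Km: "K \<in> sets borel" and Lm: "L \<in> sets borel"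
      using K(1) L(1) by (auto intro: borel_compact)
    have 1: "emeasure lborel K \<le> 2 * emeasure lborel (C \<inter> {..?m})"
    proof (intro emeasure_halved_shift[where b=b])
      fix x assume x: "x \<in> K"
      have "(x + b) / 2 \<in> C" using sub x b(1) K L by blast
      then show "(x + b) / 2 \<in> C \<inter> {..?m}" using a(2)[OF x] by simp
    qed (use C Km in auto)
    \<comment> \<open>Dropping the point \<open>b\<close>, a null set, puts the right-hand copy
      strictly beyond the midpoint, so that the two pieces of \<open>C\<close> are disjoint.\<close>
    have "emeasure lborel L = emeasure lborel (L - {b})"
      using Lm by (intro emeasure_eq_AE) (auto intro: AE_mp[OF AE_lborel_singleton[of b]])
    also have "\<dots> \<le> 2 * emeasure lborel (C \<inter> {?m<..})"
    proof (intro emeasure_halved_shift[where b=a])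
      fix x assume x: "x \<in> L - {b}"
      then have "b < x" using b(2)[of x] by force
      moreover have "(a + x) / 2 \<in> C" using sub x a(1) K L by blast
      ultimately show "(x + a) / 2 \<in> C \<inter> {?m<..}" by (simp add: add.commute)
    qed (use C Lm in auto)
    finally have "emeasure lborel K + emeasure lborel L
        \<le> 2 * emeasure lborel (C \<inter> {..?m}) + 2 * emeasure lborel (C \<inter> {?m<..})"
      using 1 add_mono by blast
    also have "\<dots> = 2 * (emeasure lborel (C \<inter> {..?m}) + emeasure lborel (C \<inter> {?m<..}))"
      by (simp add: distrib_left)
    also have "emeasure lborel (C \<inter> {..?m}) + emeasure lborel (C \<inter> {?m<..}) = emeasure lborel C"
      using C by (subst plus_emeasure) (auto intro!: arg_cong[where f="emeasure lborel"])
    finally show ?thesis .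
  qed
  obtain x0 y0 where xy0: "x0 \<in> A" "y0 \<in> B" using A B by auto
  have 1: "emeasure lborel A + emeasure lborel L \<le> 2 * emeasure lborel C"
    if L: "compact L" "L \<noteq> {}" "L \<subseteq> B" for L
  proof (rule ccontr)
    assume "\<not> ?thesis"
    then have lt: "2 * emeasure lborel C < emeasure lborel A + emeasure lborel L" by simp
    have "2 * emeasure lborel C - emeasure lborel L < emeasure lborel A"
    proof -
      have Lf: "emeasure lborel L < top" using emeasure_bounded_finite[OF compact_imp_bounded[OF L(1)]] by simp
      \<comment> \<open>Nonemptiness of \<open>A\<close> enters here: it shows that the subtraction
        in \<open>ennreal\<close> is not truncated.\<close>
      have "emeasure lborel L \<le> 2 * emeasure lborel C"
        using cpt[of "{x0}" L] L xy0 by auto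
      then have "2 * emeasure lborel C - emeasure lborel L + emeasure lborel L = 2 * emeasure lborel C"
        by (rule diff_add_cancel_ennreal)
      then show ?thesis using lt add_right_mono[of "emeasure lborel A" "2 * emeasure lborel C - emeasure lborel L" "emeasure lborel L"]
        by (force simp: not_le[symmetric])
    qed
    then obtain K where K: "compact K" "K \<subseteq> A" "2 * emeasure lborel C - emeasure lborel L < emeasure lborel K"
      using compact_inner_approx[OF A(1)] by blast
    then have "K \<noteq> {}" by auto
    then have *: "emeasure lborel K + emeasure lborel L \<le> 2 * emeasure lborel C" using cpt K L by blast
    have Lf: "emeasure lborel L < top" using emeasure_bounded_finite[OF compact_imp_bounded[OF L(1)]] by simp
    have "emeasure lborel K \<le> 2 * emeasure lborel C - emeasure lborel L"
      using * Lf by (metis add.commute ennreal_le_minus_iff nless_le)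
    then show False using K by simp
  qed
  show ?thesis
  proof (rule ccontr)
    assume "\<not> ?thesis"
    then have lt: "2 * emeasure lborel C < emeasure lborel A + emeasure lborel B" by simp
    show False
    proof (cases "emeasure lborel A = top")
      case True
      then show ?thesis using 1[of "{y0}"] xy0 lt by (auto simp: top_unique)
    next
      case False
      have "emeasure lborel A \<le> 2 * emeasure lborel C"
        using 1[of "{y0}"] xy0 by auto
      then have "2 * emeasure lborel C - emeasure lborel A + emeasure lborel A = 2 * emeasure lborel C"
        by (rule diff_add_cancel_ennreal)
      then have "2 * emeasure lborel C - emeasure lborel A < emeasure lborel B"
        using lt add_left_mono[of "emeasure lborel B" "2 * emeasure lborel C - emeasure lborel A" "emeasure lborel A"]
        by (metis add.commute leD leI)
      then obtain K where K: "compact K" "K \<subseteq> B" "2 * emeasure lborel C - emeasure lborel A < emeasure lborel K"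
        using compact_inner_approx[OF B(1)] by blast
      then have "K \<noteq> {}" by auto
      then have *: "emeasure lborel A + emeasure lborel K \<le> 2 * emeasure lborel C" using 1 K by blast
      have "emeasure lborel K \<le> 2 * emeasure lborel C - emeasure lborel A"
        using * False by (metis add.commute ennreal_le_minus_iff)
      then show False using K by simp
    qed
  qed
qed

text \<open>Tonelli for the region under the graph of \<open>f\<close>. The conjunct
  \<open>0 < t\<close> is essential: \<open>ennreal t\<close> is \<open>0\<close> for negative
  \<open>t\<close>, so without it every negative level would contribute.\<close>

lemma nn_integral_layer_cake:
  fixes f :: "real \<Rightarrow> ennreal"
  assumes [measurable]: "f \<in> borel_measurable borel"
  shows "(\<integral>\<^sup>+x. f x \<partial>lborel) = (\<integral>\<^sup>+t. emeasure lborel {x. 0 < t \<and> ennreal t < f x} \<partial>lborel)"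
proof -
  have len: "(\<integral>\<^sup>+t. indicator {t. 0 < t \<and> ennreal t < c} t \<partial>lborel) = c" for c
  proof (cases c)
    case (real r)
    then have "{t. 0 < t \<and> ennreal t < c} = {0<..<r}"
      by (auto simp: ennreal_less_iff)
    then show ?thesis using real by simp
  next
    case top
    then have "{t. 0 < t \<and> ennreal t < c} = {0<..}" by (auto simp: less_top)
    moreover have "emeasure lborel {0::real<..} = top"
    proof (rule ccontr)
      assume "emeasure lborel {0::real<..} \<noteq> top"
      then obtain r where r: "emeasure lborel {0::real<..} = ennreal r" "r \<ge> 0"
        by (cases "emeasure lborel {0::real<..}") auto
      have "emeasure lborel {0::real<..<r+1} \<le> emeasure lborel {0::real<..}"
        by (intro emeasure_mono) auto
      then show False using r by (simp add: ennreal_le_iff)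
    qed
    ultimately show ?thesis using top by simp
  qed
  have "(\<integral>\<^sup>+x. f x \<partial>lborel) = (\<integral>\<^sup>+x. \<integral>\<^sup>+t. indicator {t. 0 < t \<and> ennreal t < f x} t \<partial>lborel \<partial>lborel)"
    by (simp only: len)
  also have "\<dots> = (\<integral>\<^sup>+x. \<integral>\<^sup>+t. indicator {p::real\<times>real. 0 < snd p \<and> ennreal (snd p) < f (fst p)} (x,t) \<partial>lborel \<partial>lborel)"
    by (intro nn_integral_cong) (auto simp: indicator_def)
  also have "\<dots> = (\<integral>\<^sup>+t. \<integral>\<^sup>+x. indicator {p::real\<times>real. 0 < snd p \<and> ennreal (snd p) < f (fst p)} (x,t) \<partial>lborel \<partial>lborel)"
  proof (rule lborel_pair.Fubini'[symmetric])
    have "{p \<in> space (lborel \<Otimes>\<^sub>M lborel). 0 < snd p \<and> ennreal (snd p) < f (fst p)} \<in> sets (lborel \<Otimes>\<^sub>M lborel)"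
      by measurable
    then have "{p. 0 < snd p \<and> ennreal (snd p) < f (fst p)} \<in> sets (lborel \<Otimes>\<^sub>M lborel)"
      by (simp add: space_pair_measure)
    then show "case_prod (\<lambda>x t. indicator {p. 0 < snd p \<and> ennreal (snd p) < f (fst p)} (x, t) :: ennreal)
        \<in> borel_measurable (lborel \<Otimes>\<^sub>M lborel)"
      by (simp add: case_prod_eta borel_measurable_indicator)
  qed
  also have "\<dots> = (\<integral>\<^sup>+t. \<integral>\<^sup>+x. indicator {x. 0 < t \<and> ennreal t < f x} x \<partial>lborel \<partial>lborel)"
    by (intro nn_integral_cong) (auto simp: indicator_def)
  also have "\<dots> = (\<integral>\<^sup>+t. emeasure lborel {x. 0 < t \<and> ennreal t < f x} \<partial>lborel)"
    by (intro nn_integral_cong) simp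
  finally show ?thesis .
qed

lemma ennreal_mult_le_square_half_sum:
  fixes a b c :: ennreal
  assumes "a + b \<le> 2 * c"
  shows "a * b \<le> c\<^sup>2"
proof (cases "c = top")
  case True then show ?thesis by simp
next
  case False
  then obtain z where z: "c = ennreal z" "z \<ge> 0" by (cases c) auto
  have fin: "a + b < top" using assms False
    by (metis ennreal_mult_less_top le_less_trans ennreal_numeral_less_top less_top)
  then obtain x y where xy: "a = ennreal x" "x \<ge> 0" "b = ennreal y" "y \<ge> 0"
    by (cases a; cases b) auto
  have "ennreal (x + y) \<le> ennreal (2 * z)"
    using assms xy z by (simp add: ennreal_plus ennreal_mult)
  then have "x + y \<le> 2 * z" using z by (simp add: ennreal_le_iff)
  then have "(x + y)\<^sup>2 \<le> (2 * z)\<^sup>2" using xy by (intro power_mono) auto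
  moreover have "4 * (x * y) \<le> (x + y)\<^sup>2" using zero_le_power2[of "x - y"] by (simp add: power2_eq_square algebra_simps)
  ultimately have "x * y \<le> z\<^sup>2" by (simp add: power_mult_distrib)
  then show ?thesis using xy z by (simp add: ennreal_mult[symmetric] ennreal_power ennreal_le_iff)
qed

text \<open>When both suprema equal 1, the level sets of \<open>f\<close> and \<open>g\<close> at a
  level \<open>t\<close> strictly between 0 and 1 are both nonempty, and their midpoints lie in the
  level set of \<open>h\<close>. Integrating the one-dimensional inequality over \<open>t\<close>
  gives the arithmetic-mean form, which implies the product form.\<close>

lemma Prekopa_Leindler_real_normalized:
  fixes f g h :: "real \<Rightarrow> ennreal"
  assumes [measurable]: "f \<in> borel_measurable borel" "g \<in> borel_measurable borel" "h \<in> borel_measurable borel"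
    and f: "(SUP x. f x) = 1" and g: "(SUP x. g x) = 1"
    and le: "\<And>x y. f x * g y \<le> (h ((x + y) / 2))\<^sup>2"
  shows "(\<integral>\<^sup>+x. f x \<partial>lborel) * (\<integral>\<^sup>+x. g x \<partial>lborel) \<le> (\<integral>\<^sup>+x. h x \<partial>lborel)\<^sup>2"
proof (rule ennreal_mult_le_square_half_sum)
  have fm: "{x. 0 < t \<and> ennreal t < u x} \<in> sets borel" if [measurable]: "u \<in> borel_measurable borel" for t and u :: "real \<Rightarrow> ennreal"
  proof -
    have "{x \<in> space borel. 0 < t \<and> ennreal t < u x} \<in> sets borel" by measurable
    then show ?thesis by simp
  qed
  have *: "emeasure lborel {x. 0 < t \<and> ennreal t < f x} + emeasure lborel {x. 0 < t \<and> ennreal t < g x}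
      \<le> 2 * emeasure lborel {x. 0 < t \<and> ennreal t < h x}" for t
  proof (cases "0 < t \<and> t < 1")
    case True
    then have t1: "ennreal t < 1" by (metis ennreal_1 ennreal_lessI zero_less_one)
    obtain x0 where x0: "ennreal t < f x0" using t1 f by (metis less_SUP_iff)
    obtain y0 where y0: "ennreal t < g y0" using t1 g by (metis less_SUP_iff)
    show ?thesis
    proof (rule measure_midpoint_set_real)
      fix x y assume "x \<in> {x. 0 < t \<and> ennreal t < f x}" "y \<in> {x. 0 < t \<and> ennreal t < g x}"
      from this have "ennreal t * ennreal t < f x * g y"
      proof -
        assume "x \<in> {x. 0 < t \<and> ennreal t < f x}" "y \<in> {x. 0 < t \<and> ennreal t < g x}"
        then have *: "ennreal t < f x" "ennreal t \<le> g y" by auto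
        have "ennreal t * ennreal t < f x * ennreal t"
          using * True by (intro ennreal_mult_strict_right_mono) auto
        also have "\<dots> \<le> f x * g y" using * by (intro mult_left_mono) auto
        finally show ?thesis .
      qed
      then have "(ennreal t)\<^sup>2 < (h ((x + y) / 2))\<^sup>2"
        using le[of x y] by (simp add: power2_eq_square)
      then have "ennreal t < h ((x + y) / 2)"
        by (meson not_le power_mono zero_le)
      then show "(x + y) / 2 \<in> {x. 0 < t \<and> ennreal t < h x}" using True by simp
    qed (use fm x0 y0 True in auto)
  next
    case False
    \<comment> \<open>The remaining levels contribute nothing on the left: nonpositive ones are
      excluded by \<open>0 < t\<close>, and levels from 1 on are not exceeded.\<close>
    have "{x. 0 < t \<and> ennreal t < u x} = {}" if "(SUP x. u x) = (1::ennreal)" for u :: "real \<Rightarrow> ennreal"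
    proof -
      have "u x \<le> 1" for x using that by (metis SUP_upper UNIV_I)
      moreover have "1 \<le> ennreal t" if "0 < t"
        using False that by (simp add: ennreal_ge_1)
      ultimately have "\<not> (0 < t \<and> ennreal t < u x)" for x
        by (meson le_less_trans not_less)
      then show ?thesis by blast
    qed
    from this[OF f] this[OF g] show ?thesis by (simp only: emeasure_empty) simp
  qed
  have m: "(\<lambda>t. emeasure lborel {x. 0 < t \<and> ennreal t < u x}) \<in> borel_measurable borel"
    if [measurable]: "u \<in> borel_measurable borel" for u :: "real \<Rightarrow> ennreal"
  proof -
    have "{p \<in> space (lborel \<Otimes>\<^sub>M lborel). 0 < fst p \<and> ennreal (fst p) < u (snd p)} \<in> sets (lborel \<Otimes>\<^sub>M lborel)"
      by measurable
    then have "(\<lambda>t. emeasure lborel (Pair t -` {p \<in> space (lborel \<Otimes>\<^sub>M lborel). 0 < fst p \<and> ennreal (fst p) < u (snd p)})) \<in> borel_measurable lborel"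
      by (rule lborel.measurable_emeasure_Pair)
    then show ?thesis by (simp add: vimage_def space_pair_measure)
  qed
  let ?L = "\<lambda>u t. emeasure lborel {x. 0 < t \<and> ennreal t < (u x :: ennreal)}"
  have "(\<integral>\<^sup>+t. ?L f t \<partial>lborel) + (\<integral>\<^sup>+t. ?L g t \<partial>lborel) = (\<integral>\<^sup>+t. ?L f t + ?L g t \<partial>lborel)"
    using m[OF assms(1)] m[OF assms(2)] by (intro nn_integral_add[symmetric]) auto
  also have "\<dots> \<le> (\<integral>\<^sup>+t. 2 * ?L h t \<partial>lborel)"
    by (intro nn_integral_mono *)
  also have "\<dots> = 2 * (\<integral>\<^sup>+t. ?L h t \<partial>lborel)"
    using m[OF assms(3)] by (intro nn_integral_cmult) auto
  finally show "(\<integral>\<^sup>+x. f x \<partial>lborel) + (\<integral>\<^sup>+x. g x \<partial>lborel) \<le> 2 * (\<integral>\<^sup>+x. h x \<partial>lborel)"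
    by (simp only: nn_integral_layer_cake[OF assms(1)] nn_integral_layer_cake[OF assms(2)] nn_integral_layer_cake[OF assms(3)])
qed

text \<open>Dividing \<open>f\<close> and \<open>g\<close> by their suprema \<open>a\<close> and
  \<open>b\<close>, and \<open>h\<close> by the geometric mean \<open>c = sqrt (a * b)\<close>,
  preserves the hypothesis and changes both sides of the conclusion by the same factor.\<close>

lemma Prekopa_Leindler_real_bounded:
  fixes f g h :: "real \<Rightarrow> ennreal"
  assumes [measurable]: "f \<in> borel_measurable borel" "g \<in> borel_measurable borel" "h \<in> borel_measurable borel"
    and f: "(SUP x. f x) < top" and g: "(SUP x. g x) < top"
    and le: "\<And>x y. f x * g y \<le> (h ((x + y) / 2))\<^sup>2"
  shows "(\<integral>\<^sup>+x. f x \<partial>lborel) * (\<integral>\<^sup>+x. g x \<partial>lborel) \<le> (\<integral>\<^sup>+x. h x \<partial>lborel)\<^sup>2"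
proof (cases "(SUP x. f x) = 0 \<or> (SUP x. g x) = 0")
  case True
  then have "(\<forall>x. f x = 0) \<or> (\<forall>x. g x = 0)"
    by (metis SUP_upper UNIV_I le_zero_eq)
  then have "(\<integral>\<^sup>+x. f x \<partial>lborel) = 0 \<or> (\<integral>\<^sup>+x. g x \<partial>lborel) = 0" by auto
  then show ?thesis by auto
next
  case False
  obtain a where a: "(SUP x. f x) = ennreal a" "a \<ge> 0" using f by (cases "(SUP x. f x)") auto
  obtain b where b: "(SUP x. g x) = ennreal b" "b \<ge> 0" using g by (cases "(SUP x. g x)") auto
  have pos: "a > 0" "b > 0" using False a b by (auto simp: le_less)
  define c where "c = sqrt (a * b)"
  have c: "c > 0" "c\<^sup>2 = a * b" using pos by (auto simp: c_def)
  have 1: "(\<integral>\<^sup>+x. ennreal (1/a) * f x \<partial>lborel) * (\<integral>\<^sup>+x. ennreal (1/b) * g x \<partial>lborel)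
     \<le> (\<integral>\<^sup>+x. ennreal (1/c) * h x \<partial>lborel)\<^sup>2"
  proof (rule Prekopa_Leindler_real_normalized)
    show "(SUP x. ennreal (1/a) * f x) = 1"
      using pos by (subst SUP_mult_left_ennreal[symmetric]) (simp add: a ennreal_mult[symmetric])
    show "(SUP x. ennreal (1/b) * g x) = 1"
      using pos by (subst SUP_mult_left_ennreal[symmetric]) (simp add: b ennreal_mult[symmetric])
    fix x y
    have "ennreal (1/a) * f x * (ennreal (1/b) * g y) = ennreal (1/(a*b)) * (f x * g y)"
      using pos by (simp add: ennreal_mult[symmetric] mult.assoc mult.left_commute)
        (simp add: mult.assoc[symmetric] ennreal_mult[symmetric])
    also have "\<dots> \<le> ennreal (1/(a*b)) * (h ((x + y) / 2))\<^sup>2"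
      by (intro mult_left_mono le) auto
    also have "ennreal (1/(a*b)) = (ennreal (1/c))\<^sup>2"
      using c by (simp add: ennreal_power power_divide)
    finally show "ennreal (1/a) * f x * (ennreal (1/b) * g y) \<le> (ennreal (1/c) * h ((x + y) / 2))\<^sup>2"
      by (simp add: power_mult_distrib)
  qed measurable
  have e: "ennreal (a*b) * (ennreal (1/a) * ennreal (1/b)) = 1" "ennreal (a*b) * (ennreal (1/c))\<^sup>2 = 1"
    using pos c by (simp_all add: ennreal_mult[symmetric] ennreal_power power_divide del: ennreal_1)
  have "ennreal (a*b) * ((ennreal (1/a) * (\<integral>\<^sup>+x. f x \<partial>lborel)) * (ennreal (1/b) * (\<integral>\<^sup>+x. g x \<partial>lborel)))
      \<le> ennreal (a*b) * (ennreal (1/c) * (\<integral>\<^sup>+x. h x \<partial>lborel))\<^sup>2"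
    using 1 by (intro mult_left_mono) (simp_all add: nn_integral_cmult)
  then have "(ennreal (a*b) * (ennreal (1/a) * ennreal (1/b))) * ((\<integral>\<^sup>+x. f x \<partial>lborel) * (\<integral>\<^sup>+x. g x \<partial>lborel))
      \<le> (ennreal (a*b) * (ennreal (1/c))\<^sup>2) * (\<integral>\<^sup>+x. h x \<partial>lborel)\<^sup>2"
    by (simp add: power_mult_distrib mult_ac)
  then show ?thesis unfolding e by simp
qed

text \<open>Truncating \<open>f\<close> and \<open>g\<close> at height \<open>k\<close> keeps the
  hypothesis with the same \<open>h\<close>; monotone convergence then removes the bound.\<close>

lemma Prekopa_Leindler_real:
  fixes f g h :: "real \<Rightarrow> ennreal"
  assumes [measurable]: "f \<in> borel_measurable borel" "g \<in> borel_measurable borel" "h \<in> borel_measurable borel"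
    and le: "\<And>x y. f x * g y \<le> (h ((x + y) / 2))\<^sup>2"
  shows "(\<integral>\<^sup>+x. f x \<partial>lborel) * (\<integral>\<^sup>+x. g x \<partial>lborel) \<le> (\<integral>\<^sup>+x. h x \<partial>lborel)\<^sup>2"
proof -
  define t where "t u k x = min (u x) (of_nat k)" for u :: "real \<Rightarrow> ennreal" and k :: nat and x
  have tmono: "t u m x \<le> t u n x" if "m \<le> n" for u m n x
  proof -
    have "(of_nat m :: ennreal) \<le> of_nat n" using that by (rule of_nat_mono)
    then show ?thesis unfolding t_def by (intro min.mono) auto
  qed
  have lim: "(\<lambda>k. \<integral>\<^sup>+x. t u k x \<partial>lborel) \<longlonglongrightarrow> (\<integral>\<^sup>+x. u x \<partial>lborel)"
    if [measurable]: "u \<in> borel_measurable borel" for u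
  proof (rule nn_integral_LIMSEQ)
    show "incseq (t u)" by (auto simp: incseq_def le_fun_def intro: tmono)
    show "\<And>k. t u k \<in> borel_measurable lborel" unfolding t_def by measurable
    show "(\<lambda>k. t u k x) \<longlonglongrightarrow> u x" for x
    proof -
      have "(\<lambda>k. min (u x) (of_nat k)) \<longlonglongrightarrow> min (u x) top"
        by (intro tendsto_min tendsto_const of_nat_tendsto_top_ennreal)
      then show ?thesis by (simp add: t_def min_absorb1)
    qed
  qed
  have le1: "(\<integral>\<^sup>+x. t f k x \<partial>lborel) * (\<integral>\<^sup>+x. t g k x \<partial>lborel) \<le> (\<integral>\<^sup>+x. h x \<partial>lborel)\<^sup>2" for k
  proof (rule Prekopa_Leindler_real_bounded)
    have "(SUP x. t u k x) \<le> of_nat k" for u by (auto simp: t_def intro!: SUP_least)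
    then show "(SUP x. t f k x) < top" "(SUP x. t g k x) < top"
      using of_nat_less_top[of k] le_less_trans by blast+
    show "t f k x * t g k y \<le> (h ((x + y) / 2))\<^sup>2" for x y
      by (rule order_trans[OF _ le[of x y]]) (auto simp: t_def intro!: mult_mono)
  qed (auto simp: t_def)
  \<comment> \<open>Two independent truncation heights, so that the product of the two suprema can
    be expanded into a double supremum.\<close>
  have le: "(\<integral>\<^sup>+x. t f k x \<partial>lborel) * (\<integral>\<^sup>+x. t g l x \<partial>lborel) \<le> (\<integral>\<^sup>+x. h x \<partial>lborel)\<^sup>2" for k l
    by (rule order_trans[OF _ le1[of "max k l"]]) (auto intro!: mult_mono nn_integral_mono tmono)
  have incu: "incseq (\<lambda>k. (\<integral>\<^sup>+x. t u k x \<partial>lborel))" for u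
    by (auto simp: incseq_def intro!: nn_integral_mono tmono)
  have "(\<integral>\<^sup>+x. f x \<partial>lborel) * (\<integral>\<^sup>+x. g x \<partial>lborel) = (SUP k. (\<integral>\<^sup>+x. t f k x \<partial>lborel)) * (SUP l. (\<integral>\<^sup>+x. t g l x \<partial>lborel))"
    using LIMSEQ_unique[OF lim[of f] LIMSEQ_SUP[OF incu[of f]]]
        LIMSEQ_unique[OF lim[of g] LIMSEQ_SUP[OF incu[of g]]] by simp
  also have "\<dots> \<le> (\<integral>\<^sup>+x. h x \<partial>lborel)\<^sup>2"
    unfolding SUP_mult_right_ennreal by (intro SUP_least, unfold SUP_mult_left_ennreal, intro SUP_least le)
  finally show ?thesis .
qed

text \<open>Tensorization: integrating out one coordinate by the one-dimensional inequality yields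
  functions of the remaining coordinates that satisfy the same hypothesis, so the inequality passes
  to any finite number of coordinates.\<close>

lemma Prekopa_Leindler_PiM:
  fixes f g h :: "('i \<Rightarrow> real) \<Rightarrow> ennreal"
  assumes "finite I" and "f \<in> borel_measurable (\<Pi>\<^sub>M i\<in>I. lborel)" "g \<in> borel_measurable (\<Pi>\<^sub>M i\<in>I. lborel)"
    "h \<in> borel_measurable (\<Pi>\<^sub>M i\<in>I. lborel)"
    and "\<And>x y. x \<in> extensional I \<Longrightarrow> y \<in> extensional I \<Longrightarrow> f x * g y \<le> (h (\<lambda>i\<in>I. (x i + y i) / 2))\<^sup>2"
  shows "(\<integral>\<^sup>+x. f x \<partial>(\<Pi>\<^sub>M i\<in>I. lborel)) * (\<integral>\<^sup>+x. g x \<partial>(\<Pi>\<^sub>M i\<in>I. lborel)) \<le> (\<integral>\<^sup>+x. h x \<partial>(\<Pi>\<^sub>M i\<in>I. lborel))\<^sup>2"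
  using assms
proof (induction I arbitrary: f g h rule: finite_induct)
  case empty
  have r: "(\<lambda>i\<in>{}. (x i + y i) / 2) = (\<lambda>i. undefined)" for x y :: "'i \<Rightarrow> real" by (simp add: fun_eq_iff)
  have "(\<lambda>i::'i. undefined :: real) \<in> extensional {}" by simp
  from empty(4)[OF this this] have "f (\<lambda>i. undefined) * g (\<lambda>i. undefined) \<le> (h (\<lambda>i. undefined))\<^sup>2"
    by (simp only: r)
  then show ?case by (simp add: PiM_empty nn_integral_count_space_finite)
next
  case (insert i I)
  interpret product_sigma_finite "\<lambda>_::'i. lborel :: real measure" ..
  note [measurable] = insert.prems(1-3)
  have m: "(\<lambda>x. \<integral>\<^sup>+t. u (x(i := t)) \<partial>lborel) \<in> borel_measurable (\<Pi>\<^sub>M i\<in>I. lborel)"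
    if u: "u \<in> borel_measurable (\<Pi>\<^sub>M i\<in>insert i I. lborel)" for u :: "_ \<Rightarrow> ennreal"
  proof -
    have "(\<lambda>(x, t). u (x(i := t))) \<in> borel_measurable ((\<Pi>\<^sub>M i\<in>I. lborel) \<Otimes>\<^sub>M lborel)"
      using measurable_comp[OF measurable_add_dim[of i I "\<lambda>_. lborel"] u] by (simp add: comp_def case_prod_beta')
    then show ?thesis by (rule lborel.borel_measurable_nn_integral)
  qed
  have m1: "(\<lambda>t. u (x(i := t))) \<in> borel_measurable borel"
    if u: "u \<in> borel_measurable (\<Pi>\<^sub>M i\<in>insert i I. lborel)" and x: "x \<in> extensional I" for u :: "_ \<Rightarrow> ennreal" and x
  proof -
    have "x \<in> space (\<Pi>\<^sub>M i\<in>I. lborel)" using x by (auto simp: space_PiM PiE_def)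
    from measurable_comp[OF measurable_component_update[OF this insert.hyps(2)] u]
    show ?thesis by (simp add: comp_def)
  qed
  show ?case
    unfolding product_nn_integral_insert[OF insert.hyps insert.prems(1)]
      product_nn_integral_insert[OF insert.hyps insert.prems(2)] product_nn_integral_insert[OF insert.hyps insert.prems(3)]
  proof (rule insert.IH)
    fix x y :: "'i \<Rightarrow> real" assume xy: "x \<in> extensional I" "y \<in> extensional I"
    let ?z = "\<lambda>i\<in>I. (x i + y i) / 2"
    show "(\<integral>\<^sup>+t. f (x(i := t)) \<partial>lborel) * (\<integral>\<^sup>+t. g (y(i := t)) \<partial>lborel) \<le> (\<integral>\<^sup>+t. h (?z(i := t)) \<partial>lborel)\<^sup>2"
    proof (rule Prekopa_Leindler_real)
      fix s t :: real
      have "x(i := s) \<in> extensional (insert i I)" "y(i := t) \<in> extensional (insert i I)"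
        using xy by (auto simp: extensional_def)
      from insert.prems(4)[OF this]
      have "f (x(i := s)) * g (y(i := t)) \<le> (h (\<lambda>j\<in>insert i I. ((x(i := s)) j + (y(i := t)) j) / 2))\<^sup>2" .
      also have "(\<lambda>j\<in>insert i I. ((x(i := s)) j + (y(i := t)) j) / 2) = ?z(i := (s + t) / 2)"
        using insert.hyps by (auto simp: fun_eq_iff)
      finally show "f (x(i := s)) * g (y(i := t)) \<le> (h (?z(i := (s + t) / 2)))\<^sup>2" .
    next
      show "(\<lambda>t. f (x(i := t))) \<in> borel_measurable borel" by (rule m1[OF insert.prems(1) xy(1)])
      show "(\<lambda>t. g (y(i := t))) \<in> borel_measurable borel" by (rule m1[OF insert.prems(2) xy(2)])
      show "(\<lambda>t. h (?z(i := t))) \<in> borel_measurable borel" by (rule m1[OF insert.prems(3)]) auto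
    qed
  qed (rule m[OF insert.prems(1)] m[OF insert.prems(2)] m[OF insert.prems(3)])+
qed

text \<open>Prekopa-Leindler for indicators, in coordinates: the multiplicative form of
  Brunn-Minkowski. It involves no roots of measures, and for two sets of equal measure it is already
  the comparison that is wanted.\<close>

lemma measure_midpoint_set:
  fixes A B C :: "'a::euclidean_space set"
  assumes A: "compact A" and B: "compact B" and C: "compact C"
    and sub: "\<And>x y. x \<in> A \<Longrightarrow> y \<in> B \<Longrightarrow> (x + y) /\<^sub>R 2 \<in> C"
  shows "measure lebesgue A * measure lebesgue B \<le> (measure lebesgue C)\<^sup>2"
proof -
  let ?P = "\<Pi>\<^sub>M b\<in>(Basis::'a set). (lborel :: real measure)"
  let ?\<iota> = "\<lambda>f. \<Sum>b\<in>(Basis::'a set). f b *\<^sub>R b"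
  have \<iota>[measurable]: "?\<iota> \<in> borel_measurable ?P" by measurable
  have eq: "ennreal (measure lebesgue X) = (\<integral>\<^sup>+x. indicator X (?\<iota> x) \<partial>?P)" if X: "compact X" for X :: "'a set"
  proof -
    have Xb: "X \<in> sets borel" using X by (rule borel_compact)
    have "ennreal (measure lebesgue X) = emeasure lborel X"
    proof -
      have "emeasure lborel X = ennreal (measure lborel X)"
        using emeasure_compact_finite[OF X] by (intro emeasure_eq_ennreal_measure) simp
      moreover have "measure lebesgue X = measure lborel X"
        using Xb by (intro measure_completion) simp
      ultimately show ?thesis by simp
    qed
    also have "\<dots> = (\<integral>\<^sup>+x. indicator X x \<partial>lborel)" using Xb by simp
    also have "\<dots> = (\<integral>\<^sup>+x. indicator X x \<partial>distr ?P borel ?\<iota>)"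
      by (rule arg_cong[where f="\<lambda>M. integral\<^sup>N M (indicator X)"], rule lborel_eq)
    also have "\<dots> = (\<integral>\<^sup>+x. indicator X (?\<iota> x) \<partial>?P)"
      by (rule nn_integral_distr[OF \<iota> borel_measurable_indicator]) (simp add: Xb)
    finally show ?thesis .
  qed
  have bm: "(\<lambda>x. indicator X (?\<iota> x) :: ennreal) \<in> borel_measurable ?P" if "compact X" for X
    by (rule measurable_compose[OF \<iota> borel_measurable_indicator]) (rule borel_compact[OF that])
  have "ennreal (measure lebesgue A) * ennreal (measure lebesgue B) \<le> (ennreal (measure lebesgue C))\<^sup>2"
    unfolding eq[OF A] eq[OF B] eq[OF C]
  proof (rule Prekopa_Leindler_PiM)
    fix x y :: "'a \<Rightarrow> real"
    have "?\<iota> (\<lambda>i\<in>Basis. (x i + y i) / 2) = (?\<iota> x + ?\<iota> y) /\<^sub>R 2"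
    proof -
      have "(?\<iota> x + ?\<iota> y) /\<^sub>R 2 = (\<Sum>b\<in>Basis. (x b *\<^sub>R b + y b *\<^sub>R b) /\<^sub>R 2)"
        by (simp only: sum.distrib[symmetric] scaleR_sum_right)
      also have "\<dots> = ?\<iota> (\<lambda>i\<in>Basis. (x i + y i) / 2)"
      proof (intro sum.cong refl)
        fix b :: 'a assume "b \<in> Basis"
        then show "(x b *\<^sub>R b + y b *\<^sub>R b) /\<^sub>R 2 = (\<lambda>i\<in>Basis. (x i + y i) / 2) b *\<^sub>R b"
          by (simp only: scaleR_add_left[symmetric] scaleR_scaleR restrict_apply' divide_inverse mult.commute)
      qed
      finally show ?thesis by simp
    qed
    then show "indicator A (?\<iota> x) * indicator B (?\<iota> y) \<le> (indicator C (?\<iota> (\<lambda>i\<in>Basis. (x i + y i) / 2)) :: ennreal)\<^sup>2"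
      using sub[of "?\<iota> x" "?\<iota> y"] by (simp add: indicator_def split: if_splits)
  qed (simp_all add: bm A B C)
  then show ?thesis by (simp add: ennreal_mult[symmetric] ennreal_power ennreal_le_iff)
qed

subsection \<open>Fourier series on a box and Plancherel's theorem\<close>

text \<open>The first argument is the sample point, the second the frequency. The sign in the
  exponent is that of \<open>PW_space\<close>, so band-limited functions are integrals of their
  spectrum against \<open>chr\<close>.\<close>

definition chr :: "'a::euclidean_space \<Rightarrow> 'a \<Rightarrow> complex" where
  "chr x w = exp (2 * pi * \<i> * complex_of_real (w \<bullet> x))"

lemma chr_add_left: "chr (x + y) w = chr x w * chr y w"
  by (simp add: chr_def inner_add_right exp_add[symmetric] distrib_left)

lemma chr_add_right: "chr x (v + w) = chr x v * chr x w"
  by (simp add: chr_def inner_add_left exp_add[symmetric] distrib_left)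

lemma chr_zero [simp]: "chr 0 w = 1" "chr x 0 = 1"
  by (auto simp: chr_def)

lemma norm_chr [simp]: "norm (chr x w) = 1"
  by (simp add: chr_def norm_exp_eq_Re)

lemma cnj_chr: "cnj (chr x w) = chr (- x) w"
  by (simp add: chr_def exp_cnj)

lemma continuous_on_chr [continuous_intros]:
  "continuous_on A f \<Longrightarrow> continuous_on A (\<lambda>w. chr x (f w))"
  unfolding chr_def by (intro continuous_intros)

lemma chr_measurable [measurable]: "chr x \<in> borel_measurable borel"
  by (intro borel_measurable_continuous_onI continuous_on_chr) (auto intro: continuous_intros)

lemma chr_measurable_lebesgue [measurable]: "chr x \<in> borel_measurable lebesgue"
  by (intro measurable_completion) simp

lemma chr_eq_1_iff: "chr x w = 1 \<longleftrightarrow> w \<bullet> x \<in> \<int>"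
proof -
  have "chr x w = 1 \<longleftrightarrow> (\<exists>n::int. 2 * pi * (w \<bullet> x) = of_int (2 * n) * pi)"
    by (simp add: chr_def exp_eq_1)
  also have "\<dots> \<longleftrightarrow> (\<exists>n::int. w \<bullet> x = of_int n)" by auto
  finally show ?thesis by (auto simp: Ints_def)
qed

text \<open>\<open>plat T\<close> is the period lattice with side vector \<open>T\<close> on the frequency side, \<open>glat T\<close> the dual
  lattice on the sampling side.\<close>

definition glat :: "'a::euclidean_space \<Rightarrow> 'a set" where
  "glat T = {x. \<forall>b\<in>Basis. (x \<bullet> b) * (T \<bullet> b) \<in> \<int>}"

definition plat :: "'a::euclidean_space \<Rightarrow> 'a set" where
  "plat T = {x. \<forall>b\<in>Basis. \<exists>k::int. x \<bullet> b = of_int k * (T \<bullet> b)}"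

lemma glat_zero [simp]: "0 \<in> glat T" by (simp add: glat_def)
lemma glat_add: "x \<in> glat T \<Longrightarrow> y \<in> glat T \<Longrightarrow> x + y \<in> glat T"
  by (simp add: glat_def inner_add_left distrib_right)
lemma glat_minus: "x \<in> glat T \<Longrightarrow> - x \<in> glat T"
  by (simp add: glat_def)
lemma glat_diff: "x \<in> glat T \<Longrightarrow> y \<in> glat T \<Longrightarrow> x - y \<in> glat T"
  using glat_add[of x T "- y"] glat_minus[of y T] by simp

lemma plat_add: "x \<in> plat T \<Longrightarrow> y \<in> plat T \<Longrightarrow> x + y \<in> plat T"
  unfolding plat_def by (auto simp: inner_add_left) (metis distrib_right of_int_add)
lemma plat_minus: "x \<in> plat T \<Longrightarrow> - x \<in> plat T"
  unfolding plat_def by (auto simp: inner_minus_left) (metis mult_minus_left of_int_minus)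
lemma plat_diff: "x \<in> plat T \<Longrightarrow> y \<in> plat T \<Longrightarrow> x - y \<in> plat T"
  using plat_add[of x T "- y"] plat_minus[of y T] by simp

lemma chr_glat_plat: "x \<in> glat T \<Longrightarrow> m \<in> plat T \<Longrightarrow> chr x m = 1"
proof -
  assume x: "x \<in> glat T" and m: "m \<in> plat T"
  have "(m \<bullet> b) * (x \<bullet> b) \<in> \<int>" if "b \<in> Basis" for b
  proof -
    have "\<exists>k::int. m \<bullet> b = of_int k * (T \<bullet> b)" using m that by (simp add: plat_def)
    then obtain k :: int where "m \<bullet> b = of_int k * (T \<bullet> b)" ..
    then have "(m \<bullet> b) * (x \<bullet> b) = of_int k * ((x \<bullet> b) * (T \<bullet> b))" by (simp add: mult_ac)
    moreover have "(x \<bullet> b) * (T \<bullet> b) \<in> \<int>" using x that by (simp add: glat_def)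
    ultimately show ?thesis by (metis Ints_mult Ints_of_int)
  qed
  then have "m \<bullet> x \<in> \<int>" by (subst euclidean_inner) (auto intro: Ints_sum)
  then show ?thesis by (simp add: chr_eq_1_iff)
qed

lemma countable_plat: "countable (plat T)"
proof -
  have "plat T \<subseteq> (\<lambda>k. \<Sum>b\<in>Basis. (of_int (k b) * (T \<bullet> b)) *\<^sub>R b) ` (Basis \<rightarrow>\<^sub>E (UNIV::int set))"
  proof
    fix x assume "x \<in> plat T"
    then obtain k :: "'a \<Rightarrow> int" where k: "\<And>b. b \<in> Basis \<Longrightarrow> x \<bullet> b = of_int (k b) * (T \<bullet> b)"
      unfolding plat_def by (auto dest!: bchoice)
    have "x = (\<Sum>b\<in>Basis. (of_int (restrict k Basis b) * (T \<bullet> b)) *\<^sub>R b)"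
      by (subst euclidean_representation[symmetric, of x]) (auto intro!: sum.cong simp: k)
    then show "x \<in> (\<lambda>k. \<Sum>b\<in>Basis. (of_int (k b) * (T \<bullet> b)) *\<^sub>R b) ` (Basis \<rightarrow>\<^sub>E (UNIV::int set))"
      by (intro image_eqI[where x="restrict k Basis"]) auto
  qed
  moreover have "countable (Basis \<rightarrow>\<^sub>E (UNIV::int set) :: ('a \<Rightarrow> int) set)"
    by (intro countable_PiE) auto
  ultimately show ?thesis by (meson countable_image countable_subset)
qed

lemma glat_eq_plat:
  assumes "\<And>b. b \<in> Basis \<Longrightarrow> T \<bullet> b > 0"
  shows "glat T = plat (\<Sum>b\<in>Basis. (1 / (T \<bullet> b)) *\<^sub>R b)"
proof -
  have "((x \<bullet> b) * (T \<bullet> b) \<in> \<int>) = (\<exists>k::int. x \<bullet> b = of_int k * (1 / (T \<bullet> b)))" if "b \<in> Basis" for x b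
    using assms[OF that] by (auto simp: Ints_def field_simps)
  then show ?thesis by (auto simp: glat_def plat_def)
qed

lemma lborel_integral_prod:
  fixes f :: "'a::euclidean_space \<Rightarrow> real \<Rightarrow> complex"
  assumes i: "\<And>b. b \<in> Basis \<Longrightarrow> integrable lborel (f b)"
  shows "integrable lborel (\<lambda>x::'a. \<Prod>b\<in>Basis. f b (x \<bullet> b))"
    and "(\<integral>(x::'a). (\<Prod>b\<in>Basis. f b (x \<bullet> b)) \<partial>lborel) = (\<Prod>b\<in>Basis. (\<integral>t. f b t \<partial>lborel))"
proof -
  interpret product_sigma_finite "\<lambda>_::'a. lborel :: real measure" ..
  let ?P = "\<Pi>\<^sub>M b\<in>(Basis::'a set). (lborel :: real measure)"
  let ?\<iota> = "\<lambda>f. \<Sum>b\<in>(Basis::'a set). f b *\<^sub>R b"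
  have \<iota>: "?\<iota> \<in> measurable ?P borel" by measurable
  have m: "(\<lambda>x::'a. \<Prod>b\<in>Basis. f b (x \<bullet> b)) \<in> borel_measurable borel"
  proof (rule borel_measurable_prod)
    fix b :: 'a assume "b \<in> Basis"
    then have "f b \<in> borel_measurable borel" using i[of b] by auto
    then show "(\<lambda>x. f b (x \<bullet> b)) \<in> borel_measurable borel" by measurable
  qed
  have eq: "(\<Prod>b\<in>Basis. f b (?\<iota> x \<bullet> b)) = (\<Prod>b\<in>Basis. f b (x b))" for x
    by (intro prod.cong) (auto simp: inner_sum_left inner_Basis if_distrib cong: if_cong)
  have "integrable (distr ?P borel ?\<iota>) (\<lambda>x::'a. \<Prod>b\<in>Basis. f b (x \<bullet> b))"
    using product_integrable_prod[of Basis f] i by (subst integrable_distr_eq[OF \<iota> m]) (simp add: eq)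
  then show "integrable lborel (\<lambda>x::'a. \<Prod>b\<in>Basis. f b (x \<bullet> b))"
    by (subst lborel_eq)
  have "(\<integral>(x::'a). (\<Prod>b\<in>Basis. f b (x \<bullet> b)) \<partial>lborel) = (\<integral>(x::'a). (\<Prod>b\<in>Basis. f b (x \<bullet> b)) \<partial>distr ?P borel ?\<iota>)"
    by (subst lborel_eq) (rule refl)
  also have "\<dots> = (\<integral>x. (\<Prod>b\<in>Basis. f b (?\<iota> x \<bullet> b)) \<partial>?P)" by (rule integral_distr[OF \<iota> m])
  also have "\<dots> = (\<integral>x. (\<Prod>b\<in>Basis. f b (x b)) \<partial>?P)" by (simp only: eq)
  also have "\<dots> = (\<Prod>b\<in>Basis. (\<integral>t. f b t \<partial>lborel))" using i by (intro product_integral_prod) auto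
  finally show "(\<integral>(x::'a). (\<Prod>b\<in>Basis. f b (x \<bullet> b)) \<partial>lborel) = (\<Prod>b\<in>Basis. (\<integral>t. f b t \<partial>lborel))" .
qed

lemma integral_exp_period_eq_0:
  fixes c l \<tau> :: real
  assumes "c \<noteq> 0" "c * \<tau> \<in> \<int>" "\<tau> > 0"
  shows "(\<integral>t. indicator {l..l+\<tau>} t *\<^sub>R exp (2 * pi * \<i> * complex_of_real (t * c)) \<partial>lborel) = 0"
proof -
  let ?F = "\<lambda>t::real. exp (2 * pi * \<i> * complex_of_real (t * c)) / (2 * pi * \<i> * complex_of_real c)"
  have c2: "2 * pi * \<i> * complex_of_real c \<noteq> 0" using assms by simp
  have "(\<integral>t. indicator {l..l+\<tau>} t *\<^sub>R exp (2 * pi * \<i> * complex_of_real (t * c)) \<partial>lborel) = ?F (l + \<tau>) - ?F l"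
  proof (rule integral_FTC_Icc)
    fix t assume "l \<le> t" "t \<le> l + \<tau>"
    have "((\<lambda>z. exp (2 * pi * \<i> * (z * c)) / (2 * pi * \<i> * complex_of_real c)) has_field_derivative
        exp (2 * pi * \<i> * (complex_of_real t * c))) (at (complex_of_real t))"
      using assms by (auto intro!: derivative_eq_intros)
    from has_vector_derivative_real_field[OF this]
    show "(?F has_vector_derivative exp (2 * pi * \<i> * complex_of_real (t * c))) (at t within {l..l + \<tau>})"
      by (auto intro: has_vector_derivative_at_within)
  next
    show "l \<le> l + \<tau>" using assms by simp
    show "continuous_on {l..l + \<tau>} (\<lambda>t. exp (2 * pi * \<i> * complex_of_real (t * c)))"
      by (intro continuous_intros)
  qed
  also have "exp (2 * pi * \<i> * complex_of_real ((l + \<tau>) * c)) = exp (2 * pi * \<i> * complex_of_real (l * c))"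
  proof -
    obtain n :: int where n: "c * \<tau> = of_int n" using assms by (auto simp: Ints_def)
    have "exp (2 * pi * \<i> * complex_of_real (c * \<tau>)) = 1"
      unfolding n by (simp add: exp_eq_1) 
    then show ?thesis by (simp add: distrib_right distrib_left exp_add mult.commute[of \<tau> c])
  qed
  then show ?thesis using calculation by simp
qed

text \<open>The integral factors over the coordinates, and in a direction where \<open>x\<close> is
  nonzero the exponential runs through a whole number of periods.\<close>

lemma integral_chr_cbox_eq_0:
  assumes T: "\<And>b. b \<in> Basis \<Longrightarrow> T \<bullet> b > 0" and x: "x \<in> glat T" "x \<noteq> 0"
  shows "(\<integral>w. indicator (cbox a (a + T)) w *\<^sub>R chr x w \<partial>lborel) = 0"
proof -
  define F where "F b t = indicator {a\<bullet>b..a\<bullet>b+T\<bullet>b} t *\<^sub>R exp (2 * pi * \<i> * complex_of_real (t * (x \<bullet> b)))" for b t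
  have eq: "indicator (cbox a (a + T)) w *\<^sub>R chr x w = (\<Prod>b\<in>Basis. F b (w \<bullet> b))" for w
  proof -
    have "chr x w = (\<Prod>b\<in>Basis. exp (2 * pi * \<i> * complex_of_real ((w \<bullet> b) * (x \<bullet> b))))"
      unfolding chr_def by (subst euclidean_inner) (simp add: sum_distrib_left exp_sum)
    moreover have "indicator (cbox a (a + T)) w = (\<Prod>b\<in>Basis. indicator {a\<bullet>b..a\<bullet>b+T\<bullet>b} (w \<bullet> b) :: real)"
    proof (cases "w \<in> cbox a (a + T)")
      case True then show ?thesis by (auto simp: mem_box inner_add_left intro!: prod.neutral[symmetric])
    next
      case False
      then obtain b where "b \<in> Basis" "w \<bullet> b \<notin> {a\<bullet>b..a\<bullet>b+T\<bullet>b}" by (auto simp: mem_box inner_add_left)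
      then have "(\<Prod>b\<in>Basis. indicator {a\<bullet>b..a\<bullet>b+T\<bullet>b} (w \<bullet> b) :: real) = 0"
        by (intro prod_zero) (auto intro!: bexI[of _ b])
      then show ?thesis using False by simp
    qed
    ultimately show ?thesis by (simp add: F_def scaleR_conv_of_real prod.distrib)
  qed
  have int: "integrable lborel (F b)" for b
    unfolding F_def by (rule borel_integrable_compact) (auto intro!: continuous_intros)
  obtain b where b: "b \<in> Basis" "x \<bullet> b \<noteq> 0" using x(2) euclidean_all_zero_iff by blast
  have "(\<integral>t. F b t \<partial>lborel) = 0"
    unfolding F_def using T[OF b(1)] b x(1) by (intro integral_exp_period_eq_0) (auto simp: glat_def)
  then have "(\<Prod>b\<in>Basis. (\<integral>t. F b t \<partial>lborel)) = 0"
    using b(1) by (intro prod_zero) auto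
  then show ?thesis by (simp add: eq lborel_integral_prod(2)[OF int])
qed

text \<open>An inductive closure instead of explicit finite sums: closure under products, needed for
  polynomials on the torus, becomes a nested induction, and \<open>trig_explicit\<close> recovers
  the coefficients.\<close>

inductive trig :: "'a::euclidean_space \<Rightarrow> ('a \<Rightarrow> complex) \<Rightarrow> bool" for T where
  base: "x \<in> glat T \<Longrightarrow> trig T (\<lambda>w. c * chr x w)"
| add: "trig T p \<Longrightarrow> trig T q \<Longrightarrow> trig T (\<lambda>w. p w + q w)"

lemma trig_const: "trig T (\<lambda>w. c)"
  using trig.base[of 0 T c] by simp

lemma trig_sum: "finite I \<Longrightarrow> (\<And>i. i \<in> I \<Longrightarrow> trig T (p i)) \<Longrightarrow> trig T (\<lambda>w. \<Sum>i\<in>I. p i w)"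
  by (induction I rule: finite_induct) (auto intro: trig_const trig.add)

lemma trig_mult:
  assumes "trig T p" "trig T q" shows "trig T (\<lambda>w. p w * q w)"
  using assms(1)
proof induction
  case (base x c)
  show ?case using assms(2)
  proof induction
    case (base y d)
    have "trig T (\<lambda>w. (c * d) * chr (x + y) w)" by (intro trig.base glat_add) fact+
    then show ?case by (simp add: chr_add_left mult_ac)
  next
    case (add p q) then show ?case by (simp add: distrib_left trig.add)
  qed
next
  case (add p q) then show ?case by (simp add: distrib_right trig.add)
qed

lemma trig_explicit:
  assumes "trig T p"
  obtains F c where "finite F" "F \<subseteq> glat T" "p = (\<lambda>w. \<Sum>x\<in>F. c x * cnj (chr x w))"
proof -
  have "\<exists>F c. finite F \<and> F \<subseteq> glat T \<and> p = (\<lambda>w. \<Sum>x\<in>F. c x * cnj (chr x w))"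
    using assms
  proof induction
    case (base x c)
    \<comment> \<open>Characters are written conjugated, with \<open>- x\<close> for
      \<open>x\<close>, so that the coefficient at \<open>x\<close> is the one to be compared with
      \<open>fc g x\<close>.\<close>
    then show ?case by (intro exI[of _ "{- x}"] exI[of _ "\<lambda>_. c"]) (auto simp: cnj_chr glat_minus)
  next
    case (add p q)
    then obtain F c G d where F: "finite F" "F \<subseteq> glat T" "p = (\<lambda>w. \<Sum>x\<in>F. c x * cnj (chr x w))"
      and G: "finite G" "G \<subseteq> glat T" "q = (\<lambda>w. \<Sum>x\<in>G. d x * cnj (chr x w))" by blast
    define e where "e x = (if x \<in> F then c x else 0) + (if x \<in> G then d x else 0)" for x
    have "p w + q w = (\<Sum>x\<in>F \<union> G. e x * cnj (chr x w))" for w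
    proof -
      have "p w = (\<Sum>x\<in>F \<union> G. (if x \<in> F then c x else 0) * cnj (chr x w))"
        unfolding F(3) using F(1) G(1) by (intro sum.mono_neutral_cong_left) auto
      moreover have "q w = (\<Sum>x\<in>F \<union> G. (if x \<in> G then d x else 0) * cnj (chr x w))"
        unfolding G(3) using F(1) G(1) by (intro sum.mono_neutral_cong_left) auto
      ultimately show ?thesis by (simp add: e_def distrib_right sum.distrib)
    qed
    then show ?case using F G by (intro exI[of _ "F \<union> G"] exI[of _ e]) auto
  qed
  then show ?thesis using that by blast
qed

lemma continuous_on_trig: "trig T p \<Longrightarrow> continuous_on A p"
  by (induction rule: trig.induct) (auto intro!: continuous_intros)

text \<open>The quotient by \<open>plat T\<close> is realised as a compact subset of \<open>'a \<times> 'a\<close>, so that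
  Stone--Weierstrass yields density of trigonometric polynomials.\<close>

definition torus :: "'a::euclidean_space \<Rightarrow> 'a \<Rightarrow> 'a \<times> 'a" where
  "torus T w = ((\<Sum>b\<in>Basis. cos (2 * pi * (w \<bullet> b) / (T \<bullet> b)) *\<^sub>R b), (\<Sum>b\<in>Basis. sin (2 * pi * (w \<bullet> b) / (T \<bullet> b)) *\<^sub>R b))"

text \<open>Linear functionals of \<open>torus T w\<close> are combinations of cosines and sines of
  \<open>2 * pi * (w \<bullet> b) / (T \<bullet> b)\<close>, and by Euler's formulas these are
  combinations of the characters of \<open>b /\<^sub>R (T \<bullet> b)\<close> and its negative.
  Products are covered by \<open>trig_mult\<close>.\<close>

lemma trig_polynomial_torus:
  assumes T: "\<And>b. b \<in> Basis \<Longrightarrow> T \<bullet> b > 0" and "real_polynomial_function q"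
  shows "trig T (\<lambda>w. complex_of_real (q (torus T w)))"
  using assms(2)
proof induction
  case (linear L)
  have g: "b /\<^sub>R (T \<bullet> b) \<in> glat T" if "b \<in> Basis" for b
    using T[OF that] that by (auto simp: glat_def inner_Basis)
  have cos: "trig T (\<lambda>w. complex_of_real (r * cos (2 * pi * (w \<bullet> b) / (T \<bullet> b))))" if "b \<in> Basis" for b r
  proof -
    have "complex_of_real (r * cos (2 * pi * (w \<bullet> b) / (T \<bullet> b)))
        = (r/2) * chr (b /\<^sub>R (T \<bullet> b)) w + (r/2) * chr (- (b /\<^sub>R (T \<bullet> b))) w" for w
      by (simp add: chr_def cos_exp_eq cos_of_real[symmetric] field_simps del: cos_of_real)
    moreover have "trig T (\<lambda>w. (r/2) * chr (b /\<^sub>R (T \<bullet> b)) w + (r/2) * chr (- (b /\<^sub>R (T \<bullet> b))) w)"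
      using g[OF that] by (intro trig.intros glat_minus) auto
    ultimately show ?thesis by presburger
  qed
  have sin: "trig T (\<lambda>w. complex_of_real (r * sin (2 * pi * (w \<bullet> b) / (T \<bullet> b))))" if "b \<in> Basis" for b r
  proof -
    have "complex_of_real (r * sin (2 * pi * (w \<bullet> b) / (T \<bullet> b)))
        = (- \<i> * r/2) * chr (b /\<^sub>R (T \<bullet> b)) w + (\<i> * r/2) * chr (- (b /\<^sub>R (T \<bullet> b))) w" for w
      by (simp add: chr_def sin_exp_eq sin_of_real[symmetric] field_simps del: sin_of_real)
    moreover have "trig T (\<lambda>w. (- \<i> * r/2) * chr (b /\<^sub>R (T \<bullet> b)) w + (\<i> * r/2) * chr (- (b /\<^sub>R (T \<bullet> b))) w)"
      using g[OF that] by (intro trig.intros glat_minus) auto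
    ultimately show ?thesis by presburger
  qed
  interpret L: bounded_linear L by fact
  have "L (torus T w) = (\<Sum>b\<in>Basis. L (b, 0) * cos (2 * pi * (w \<bullet> b) / (T \<bullet> b)))
       + (\<Sum>b\<in>Basis. L (0, b) * sin (2 * pi * (w \<bullet> b) / (T \<bullet> b)))" for w
  proof -
    have "torus T w = (\<Sum>b\<in>Basis. cos (2 * pi * (w \<bullet> b) / (T \<bullet> b)) *\<^sub>R (b, 0)) + (\<Sum>b\<in>Basis. sin (2 * pi * (w \<bullet> b) / (T \<bullet> b)) *\<^sub>R (0, b))"
      by (simp add: torus_def prod_eq_iff fst_sum snd_sum)
    then show ?thesis by (simp only: L.add L.sum L.scaleR real_scaleR_def mult.commute)
  qed
  moreover have "trig T (\<lambda>w. (\<Sum>b\<in>Basis. complex_of_real (L (b, 0) * cos (2 * pi * (w \<bullet> b) / (T \<bullet> b))))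
       + (\<Sum>b\<in>Basis. complex_of_real (L (0, b) * sin (2 * pi * (w \<bullet> b) / (T \<bullet> b)))))"
    by (intro trig.add trig_sum cos sin) auto
  ultimately show ?case by simp
next
  case (const c) then show ?case by (rule trig_const)
next
  case (add f g) then show ?case by (simp add: trig.add)
next
  case (mult f g) then show ?case by (simp add: trig_mult)
qed

text \<open>Opposite faces of the closed box have the same image, so one of the two points is
  required to be interior.\<close>

lemma torus_eq_imp:
  assumes T: "\<And>b. b \<in> Basis \<Longrightarrow> T \<bullet> b > 0" and v: "v \<in> cbox a (a + T)" and w: "w \<in> cbox a (a + T)"
    and eq: "torus T v = torus T w" and "v \<in> box a (a + T)"
  shows "v = w"
proof (rule euclidean_eqI)
  fix b :: 'a assume b: "b \<in> Basis"
  have proj: "(\<Sum>c\<in>Basis. r c *\<^sub>R c) \<bullet> b = r b" for r :: "'a \<Rightarrow> real"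
    using b by simp
  have "cos (2 * pi * (v \<bullet> b) / (T \<bullet> b)) = cos (2 * pi * (w \<bullet> b) / (T \<bullet> b))"
     "sin (2 * pi * (v \<bullet> b) / (T \<bullet> b)) = sin (2 * pi * (w \<bullet> b) / (T \<bullet> b))"
    using arg_cong[OF eq, of "\<lambda>z. fst z \<bullet> b"] arg_cong[OF eq, of "\<lambda>z. snd z \<bullet> b"]
    by (simp_all only: torus_def fst_conv snd_conv proj)
  then obtain n :: int where n: "2 * pi * (v \<bullet> b) / (T \<bullet> b) = 2 * pi * (w \<bullet> b) / (T \<bullet> b) + 2 * pi * n"
    using sin_cos_eq_iff by metis
  then have "2 * pi * (v \<bullet> b) = 2 * pi * (w \<bullet> b + n * (T \<bullet> b))"
    using T[OF b] by (simp add: field_simps)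
  then have "v \<bullet> b = w \<bullet> b + n * (T \<bullet> b)"
    by simp
  moreover have "\<bar>v \<bullet> b - w \<bullet> b\<bar> < T \<bullet> b"
    using assms(5) w b by (auto simp: mem_box inner_add_left abs_less_iff)
     (smt (verit, del_insts))+
  ultimately have "\<bar>n * (T \<bullet> b)\<bar> < T \<bullet> b" by simp
  then have "\<bar>real_of_int n\<bar> < 1" using T[OF b] by (simp add: abs_mult)
  then have "n = 0" by linarith
  then show "v \<bullet> b = w \<bullet> b" using \<open>v \<bullet> b = w \<bullet> b + n * (T \<bullet> b)\<close> by simp
qed

text \<open>A function that vanishes off the open box takes equal values at points with the same
  image, hence descends to the compact image of the closed box, where Stone-Weierstrass
  applies.\<close>

lemma trig_uniform_approx:
  fixes u :: "'a::euclidean_space \<Rightarrow> real"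
  assumes T: "\<And>b. b \<in> Basis \<Longrightarrow> T \<bullet> b > 0" and u: "continuous_on UNIV u"
    and z: "\<And>w. w \<notin> box a (a + T) \<Longrightarrow> u w = 0" and e: "e > 0"
  obtains p where "trig T p" "\<And>w. w \<in> cbox a (a + T) \<Longrightarrow> norm (complex_of_real (u w) - p w) < e"
proof -
  let ?D = "cbox a (a + T)"
  have cont: "continuous_on A (torus T)" for A
    unfolding torus_def by (intro continuous_intros) (use T in force)+
  define v where "v z = u (inv_into ?D (torus T) z)" for z
  have v: "v (torus T w) = u w" if w: "w \<in> ?D" for w
  proof -
    let ?w = "inv_into ?D (torus T) (torus T w)"
    have 1: "?w \<in> ?D" "torus T ?w = torus T w" using w by (auto intro: inv_into_into f_inv_into_f)
    show ?thesis
    proof (cases "w \<in> box a (a + T) \<or> ?w \<in> box a (a + T)")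
      case True
      then have "?w = w" using torus_eq_imp[OF T w 1(1)] torus_eq_imp[OF T 1(1) w] 1(2) by metis
      then show ?thesis by (simp add: v_def)
    next
      case False then show ?thesis using z by (simp add: v_def)
    qed
  qed
  have "continuous_on (torus T ` ?D) v"
  proof (subst continuous_on_closed_vimage, intro compact_imp_closed compact_continuous_image cont compact_cbox, intro allI impI)
    fix C :: "real set" assume C: "closed C"
    \<comment> \<open>Continuity of the descended function: \<open>torus T\<close> maps compact sets
      to compact sets, so the preimage of a closed set is the image of a compact one.\<close>
    have "v -` C \<inter> torus T ` ?D = torus T ` (?D \<inter> u -` C)" using v by auto
    moreover have "compact (?D \<inter> u -` C)"
      using C u by (intro compact_Int_closed compact_cbox) (simp add: closed_vimage)
    ultimately show "closed (v -` C \<inter> torus T ` ?D)"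
      using cont compact_continuous_image compact_imp_closed by metis
  qed
  then obtain q where q: "real_polynomial_function q" "\<And>x. x \<in> torus T ` ?D \<Longrightarrow> \<bar>v x - q x\<bar> < e"
    using Stone_Weierstrass_real_polynomial_function[OF compact_continuous_image[OF cont compact_cbox] _ e] by metis
  show ?thesis
  proof
    show "trig T (\<lambda>w. complex_of_real (q (torus T w)))" by (rule trig_polynomial_torus[OF T q(1)])
    fix w assume w: "w \<in> ?D"
    then have "\<bar>u w - q (torus T w)\<bar> < e" using q(2)[of "torus T w"] v by auto
    then show "norm (complex_of_real (u w) - complex_of_real (q (torus T w))) < e"
      by (simp flip: of_real_diff)
  qed
qed

section \<open>Square-integrable functions and mean-square approximation on a period box\<close>

definition sqint :: "'b measure \<Rightarrow> ('b \<Rightarrow> complex) \<Rightarrow> bool" where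
  "sqint M f \<longleftrightarrow> f \<in> borel_measurable M \<and> integrable M (\<lambda>x. (cmod (f x))\<^sup>2)"

lemma cmod_add_sq_le: "(cmod (a + b))\<^sup>2 \<le> 2 * (cmod a)\<^sup>2 + 2 * (cmod b)\<^sup>2"
proof -
  have "(cmod (a + b))\<^sup>2 \<le> (cmod a + cmod b)\<^sup>2" by (intro power_mono norm_triangle_ineq) auto
  also have "\<dots> \<le> 2 * (cmod a)\<^sup>2 + 2 * (cmod b)\<^sup>2"
    using zero_le_power2[of "cmod a - cmod b"] by (simp add: power2_eq_square algebra_simps)
  finally show ?thesis .
qed

lemma sqint_bound:
  assumes "g \<in> borel_measurable M" "sqint M f" "\<And>x. x \<in> space M \<Longrightarrow> cmod (g x) \<le> C * cmod (f x)"
  shows "sqint M g"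
proof -
  have "integrable M (\<lambda>x. (cmod (g x))\<^sup>2)"
  proof (rule Bochner_Integration.integrable_bound)
    show "integrable M (\<lambda>x. C\<^sup>2 * (cmod (f x))\<^sup>2)" using assms(2) by (auto simp: sqint_def)
    show "(\<lambda>x. (cmod (g x))\<^sup>2) \<in> borel_measurable M" using assms(1) by measurable
    show "AE x in M. norm ((cmod (g x))\<^sup>2) \<le> norm (C\<^sup>2 * (cmod (f x))\<^sup>2)"
    proof (rule AE_I2)
      fix x assume "x \<in> space M"
      then have "(cmod (g x))\<^sup>2 \<le> (C * cmod (f x))\<^sup>2" using assms(3) by (intro power_mono) auto
      then show "norm ((cmod (g x))\<^sup>2) \<le> norm (C\<^sup>2 * (cmod (f x))\<^sup>2)" by (simp add: power_mult_distrib)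
    qed
  qed
  then show ?thesis using assms(1) by (simp add: sqint_def)
qed

lemma sqint_mult_unimodular:
  assumes "sqint M f" "g \<in> borel_measurable M" "\<And>x. cmod (g x) = 1"
  shows "sqint M (\<lambda>x. f x * g x)"
  using assms by (auto simp: sqint_def norm_mult)

lemma sqint_cmult: "sqint M f \<Longrightarrow> sqint M (\<lambda>x. c * f x)"
  by (auto simp: sqint_def norm_mult power_mult_distrib)

lemma sqint_add:
  assumes "sqint M f" "sqint M g"
  shows "sqint M (\<lambda>x. f x + g x)"
    and "(\<integral>x. (cmod (f x + g x))\<^sup>2 \<partial>M) \<le> 2 * (\<integral>x. (cmod (f x))\<^sup>2 \<partial>M) + 2 * (\<integral>x. (cmod (g x))\<^sup>2 \<partial>M)"
proof -
  have m: "f \<in> borel_measurable M" "g \<in> borel_measurable M" using assms by (auto simp: sqint_def)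
  have i: "integrable M (\<lambda>x. 2 * (cmod (f x))\<^sup>2 + 2 * (cmod (g x))\<^sup>2)"
    using assms by (auto simp: sqint_def)
  have i2: "integrable M (\<lambda>x. (cmod (f x + g x))\<^sup>2)"
    by (rule Bochner_Integration.integrable_bound[OF i]) (use m in \<open>auto simp: cmod_add_sq_le\<close>)
  show "sqint M (\<lambda>x. f x + g x)" using i2 m by (auto simp: sqint_def)
  have "(\<integral>x. (cmod (f x + g x))\<^sup>2 \<partial>M) \<le> (\<integral>x. 2 * (cmod (f x))\<^sup>2 + 2 * (cmod (g x))\<^sup>2 \<partial>M)"
    by (intro integral_mono i i2 cmod_add_sq_le)
  also have "\<dots> = 2 * (\<integral>x. (cmod (f x))\<^sup>2 \<partial>M) + 2 * (\<integral>x. (cmod (g x))\<^sup>2 \<partial>M)"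
    using assms by (simp add: sqint_def)
  finally show "(\<integral>x. (cmod (f x + g x))\<^sup>2 \<partial>M) \<le> 2 * (\<integral>x. (cmod (f x))\<^sup>2 \<partial>M) + 2 * (\<integral>x. (cmod (g x))\<^sup>2 \<partial>M)" .
qed

lemma sqint_minus: "sqint M f \<Longrightarrow> sqint M (\<lambda>x. - f x)"
  by (auto simp: sqint_def)

lemma sqint_diff: "sqint M f \<Longrightarrow> sqint M g \<Longrightarrow> sqint M (\<lambda>x. f x - g x)"
  using sqint_add(1)[of M f "\<lambda>x. - g x"] sqint_minus[of M g] by simp

lemma sqint_zero: "sqint M (\<lambda>x. 0)"
  by (simp add: sqint_def)

lemma sqint_sum: "finite I \<Longrightarrow> (\<And>i. i \<in> I \<Longrightarrow> sqint M (f i)) \<Longrightarrow> sqint M (\<lambda>x. \<Sum>i\<in>I. f i x)"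
  by (induction I rule: finite_induct) (auto intro: sqint_zero sqint_add)

lemma sqint_mult_cnj_integrable:
  assumes "sqint M f" "sqint M g"
  shows "integrable M (\<lambda>x. f x * cnj (g x))"
proof (rule Bochner_Integration.integrable_bound)
  show "integrable M (\<lambda>x. (cmod (f x))\<^sup>2 + (cmod (g x))\<^sup>2)" using assms by (auto simp: sqint_def)
  show "(\<lambda>x. f x * cnj (g x)) \<in> borel_measurable M"
    using assms by (auto simp: sqint_def intro!: borel_measurable_times borel_measurable_continuous_on[of cnj] continuous_intros)
  have "cmod a * cmod b \<le> (cmod a)\<^sup>2 + (cmod b)\<^sup>2" for a b
  proof -
    have "2 * (cmod a * cmod b) \<le> (cmod a)\<^sup>2 + (cmod b)\<^sup>2"
      using sum_squares_bound[of "cmod a" "cmod b"] by (simp add: mult.assoc)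
    moreover have "0 \<le> cmod a * cmod b" by simp
    ultimately show ?thesis by linarith
  qed
  then show "AE x in M. norm (f x * cnj (g x)) \<le> norm ((cmod (f x))\<^sup>2 + (cmod (g x))\<^sup>2)"
    by (auto simp: norm_mult)
qed

lemma sqint_bounded:
  assumes "finite_measure M" "f \<in> borel_measurable M" "\<And>x. x \<in> space M \<Longrightarrow> cmod (f x) \<le> C"
  shows "sqint M f"
proof -
  interpret finite_measure M by fact
  show ?thesis
    by (rule sqint_bound[where f="\<lambda>_. 1" and C=C]) (use assms in \<open>auto simp: sqint_def\<close>)
qed

locale period_box =
  fixes T a :: "'a::euclidean_space"
  assumes T: "\<And>b. b \<in> Basis \<Longrightarrow> T \<bullet> b > 0"
begin

abbreviation "D \<equiv> cbox a (a + T)"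
abbreviation "M \<equiv> lebesgue_on D"
definition "V = (\<Prod>b\<in>Basis. T \<bullet> b)"

lemma V_pos: "V > 0" unfolding V_def using T by (intro prod_pos) auto

lemma measure_D: "measure lebesgue D = V"
proof -
  have "D \<noteq> {}" using T by (auto simp: box_ne_empty inner_add_left intro: less_imp_le)
  then show ?thesis using T by (simp add: V_def content_cbox_if inner_add_left)
qed

lemma finite_M: "finite_measure M"
  by (rule finite_measure_lebesgue_on) auto

lemma continuous_sqint: "continuous_on D f \<Longrightarrow> sqint M f"
proof -
  assume f: "continuous_on D f"
  then have "bounded (f ` D)" by (intro compact_imp_bounded compact_continuous_image) auto
  then obtain C where "\<And>x. x \<in> D \<Longrightarrow> cmod (f x) \<le> C" by (auto simp: bounded_iff)
  moreover have "f \<in> borel_measurable M" using f by (intro continuous_imp_measurable_on_sets_lebesgue) auto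
  ultimately show ?thesis by (intro sqint_bounded[OF finite_M]) auto
qed

lemma chr_orthogonal:
  assumes "x \<in> glat T" "y \<in> glat T"
  shows "(\<integral>w. chr x w * cnj (chr y w) \<partial>M) = (if x = y then complex_of_real V else 0)"
proof -
  have "(\<integral>w. chr x w * cnj (chr y w) \<partial>M) = (\<integral>w. chr (x - y) w \<partial>M)"
    by (simp add: cnj_chr chr_add_left[symmetric])
  also have "\<dots> = (\<integral>w. indicator D w *\<^sub>R chr (x - y) w \<partial>lborel)"
    by (subst integral_restrict_space) (auto intro!: integral_completion borel_measurable_scaleR)
  also have "\<dots> = (if x = y then complex_of_real V else 0)"
  proof (cases "x = y")
    case True
    have "(\<integral>w. indicator D w *\<^sub>R (1::complex) \<partial>lborel) = complex_of_real (measure lborel D)"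
      by (subst integral_scaleR_left) (auto simp: scaleR_conv_of_real emeasure_lborel_cbox_eq)
    moreover have "measure lborel D = V" using measure_D by (simp add: measure_completion)
    ultimately show ?thesis using True by simp
  next
    case False
    then show ?thesis using integral_chr_cbox_eq_0[OF T glat_diff[OF assms]] by simp
  qed
  finally show ?thesis .
qed

lemma sqint_trig: "trig T p \<Longrightarrow> sqint M p"
  by (intro continuous_sqint continuous_on_trig)

lemma sqint_chr: "sqint M (chr x)"
  by (intro continuous_sqint continuous_intros)

lemma sqint_cnj_chr: "sqint M (\<lambda>w. cnj (chr x w))"
  by (intro continuous_sqint continuous_intros)

text \<open>Fourier coefficient without the factor \<open>1 / V\<close>; the coefficient of the best
  approximation at \<open>x\<close> is \<open>fc g x / V\<close>.\<close>

definition fc :: "('a \<Rightarrow> complex) \<Rightarrow> 'a \<Rightarrow> complex" where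
  "fc g x = (\<integral>w. g w * chr x w \<partial>M)"

text \<open>Orthogonality and completing the square. The choice \<open>c x = fc g x / V\<close>
  gives Bessel's inequality, and dropping the nonnegative last term bounds the distance to any
  trigonometric polynomial from below; Parseval follows from these two facts and density.\<close>

lemma trig_sum_distance:
  assumes g: "sqint M g" and F: "finite F" "F \<subseteq> glat T"
  shows "(\<integral>w. (cmod (g w - (\<Sum>x\<in>F. c x * cnj (chr x w))))\<^sup>2 \<partial>M)
     = (\<integral>w. (cmod (g w))\<^sup>2 \<partial>M) - (\<Sum>x\<in>F. (cmod (fc g x))\<^sup>2) / V + V * (\<Sum>x\<in>F. (cmod (c x - fc g x / V))\<^sup>2)"
proof -
  define p where "p w = (\<Sum>x\<in>F. c x * cnj (chr x w))" for w
  have p: "sqint M p" unfolding p_def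
    by (intro sqint_sum F sqint_cmult sqint_cnj_chr)
  have gcp: "(\<integral>w. g w * cnj (p w) \<partial>M) = (\<Sum>x\<in>F. cnj (c x) * fc g x)"
  proof -
    have "(\<integral>w. g w * cnj (p w) \<partial>M) = (\<integral>w. (\<Sum>x\<in>F. cnj (c x) * (g w * chr x w)) \<partial>M)"
      by (simp add: p_def sum_distrib_left mult_ac)
    also have "\<dots> = (\<Sum>x\<in>F. \<integral>w. cnj (c x) * (g w * chr x w) \<partial>M)"
      using sqint_mult_cnj_integrable[OF g sqint_cnj_chr] by (intro Bochner_Integration.integral_sum) auto
    also have "\<dots> = (\<Sum>x\<in>F. cnj (c x) * fc g x)" by (simp add: fc_def)
    finally show ?thesis .
  qed
  have pp: "(\<integral>w. p w * cnj (p w) \<partial>M) = V * (\<Sum>x\<in>F. c x * cnj (c x))"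
  proof -
    have "(\<integral>w. p w * cnj (p w) \<partial>M) = (\<integral>w. (\<Sum>x\<in>F. \<Sum>y\<in>F. (c x * cnj (c y)) * (chr y w * cnj (chr x w))) \<partial>M)"
      by (simp add: p_def sum_product mult_ac)
    also have "\<dots> = (\<Sum>x\<in>F. \<Sum>y\<in>F. \<integral>w. (c x * cnj (c y)) * (chr y w * cnj (chr x w)) \<partial>M)"
      using sqint_mult_cnj_integrable[OF sqint_chr sqint_chr]
      by (subst Bochner_Integration.integral_sum, force intro: Bochner_Integration.integrable_sum)
        (intro sum.cong refl Bochner_Integration.integral_sum, auto)
    also have "\<dots> = (\<Sum>x\<in>F. \<Sum>y\<in>F. if y = x then c x * cnj (c y) * V else 0)"
      using F by (intro sum.cong refl) (auto simp: chr_orthogonal subset_iff)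
    also have "\<dots> = V * (\<Sum>x\<in>F. c x * cnj (c x))"
      using F by (simp add: sum.delta sum_distrib_left mult_ac)
    finally show ?thesis .
  qed
  have sq: "(cmod (g w - p w))\<^sup>2 = (cmod (g w))\<^sup>2 - 2 * Re (g w * cnj (p w)) + Re (p w * cnj (p w))" for w
    unfolding cmod_power2 by (simp add: power2_eq_square algebra_simps)
  have ire: "integrable M (\<lambda>w. Re (u w * cnj (v w)))" if "sqint M u" "sqint M v" for u v
    using sqint_mult_cnj_integrable[OF that] by (rule integrable_Re)
  have "(\<integral>w. (cmod (g w - p w))\<^sup>2 \<partial>M) = (\<integral>w. (cmod (g w))\<^sup>2 \<partial>M) - 2 * (\<integral>w. Re (g w * cnj (p w)) \<partial>M) + (\<integral>w. Re (p w * cnj (p w)) \<partial>M)"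
  proof -
    have gen: "(\<integral>w. C w - 2 * A w + B w \<partial>M) = (\<integral>w. C w \<partial>M) - 2 * (\<integral>w. A w \<partial>M) + (\<integral>w. B w \<partial>M)"
      if "integrable M A" "integrable M B" "integrable M C" for A B C :: "'a \<Rightarrow> real"
      using that by simp
    show ?thesis unfolding sq using g by (intro gen ire[OF g p] ire[OF p p]) (simp add: sqint_def)
  qed
  also have "(\<integral>w. Re (g w * cnj (p w)) \<partial>M) = Re (\<Sum>x\<in>F. cnj (c x) * fc g x)"
    using integral_Re[OF sqint_mult_cnj_integrable[OF g p]] gcp by simp
  also have "(\<integral>w. Re (p w * cnj (p w)) \<partial>M) = Re (V * (\<Sum>x\<in>F. c x * cnj (c x)))"
    using integral_Re[OF sqint_mult_cnj_integrable[OF p p]] pp by simp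
  also have "\<dots> = V * (\<Sum>x\<in>F. (cmod (c x))\<^sup>2)"
    unfolding cmod_power2 by (simp add: power2_eq_square)
  also have "(\<integral>w. (cmod (g w))\<^sup>2 \<partial>M) - 2 * Re (\<Sum>x\<in>F. cnj (c x) * fc g x) + V * (\<Sum>x\<in>F. (cmod (c x))\<^sup>2)
     = (\<integral>w. (cmod (g w))\<^sup>2 \<partial>M) - (\<Sum>x\<in>F. (cmod (fc g x))\<^sup>2) / V + V * (\<Sum>x\<in>F. (cmod (c x - fc g x / V))\<^sup>2)"
  proof -
    have "V * (cmod (c x - fc g x / V))\<^sup>2 = V * (cmod (c x))\<^sup>2 - 2 * Re (cnj (c x) * fc g x) + (cmod (fc g x))\<^sup>2 / V" for x
    proof -
      have "Re (fc g x / V) = Re (fc g x) / V" "Im (fc g x / V) = Im (fc g x) / V" by simp_all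
      then show ?thesis using V_pos unfolding cmod_power2 minus_complex.simps
        by (simp add: power2_eq_square field_simps)
    qed
    then have "V * (\<Sum>x\<in>F. (cmod (c x - fc g x / V))\<^sup>2)
      = V * (\<Sum>x\<in>F. (cmod (c x))\<^sup>2) - 2 * Re (\<Sum>x\<in>F. cnj (c x) * fc g x) + (\<Sum>x\<in>F. (cmod (fc g x))\<^sup>2) / V"
      by (simp only: sum_distrib_left sum.distrib sum_subtractf Re_sum sum_divide_distrib)
    then show ?thesis by simp
  qed
  finally show ?thesis by (simp add: p_def)
qed

text \<open>Membership in the mean-square closure of the trigonometric polynomials. The class is
  enlarged from continuous functions vanishing off the open box to indicators, simple functions and
  finally all square-integrable functions.\<close>

definition apx :: "('a \<Rightarrow> complex) \<Rightarrow> bool" where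
  "apx g \<longleftrightarrow> sqint M g \<and> (\<forall>e>0. \<exists>p. trig T p \<and> (\<integral>w. (cmod (g w - p w))\<^sup>2 \<partial>M) < e)"

lemma apx_add: assumes "apx f" "apx g" shows "apx (\<lambda>w. f w + g w)"
  unfolding apx_def
proof (intro conjI allI impI)
  show "sqint M (\<lambda>w. f w + g w)" using assms sqint_add(1) by (auto simp: apx_def)
  fix e :: real assume "e > 0"
  then have "e / 4 > 0" by simp
  then obtain p q where p: "trig T p" "(\<integral>w. (cmod (f w - p w))\<^sup>2 \<partial>M) < e/4" and q: "trig T q" "(\<integral>w. (cmod (g w - q w))\<^sup>2 \<partial>M) < e/4"
    using assms unfolding apx_def by meson
  have "(\<integral>w. (cmod ((f w - p w) + (g w - q w)))\<^sup>2 \<partial>M) \<le> 2 * (\<integral>w. (cmod (f w - p w))\<^sup>2 \<partial>M) + 2 * (\<integral>w. (cmod (g w - q w))\<^sup>2 \<partial>M)"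
    using assms sqint_trig[OF p(1)] sqint_trig[OF q(1)] by (intro sqint_add(2) sqint_diff) (auto simp: apx_def)
  also have "\<dots> < e" using p q by simp
  finally show "\<exists>p. trig T p \<and> (\<integral>w. (cmod (f w + g w - p w))\<^sup>2 \<partial>M) < e"
    using trig.add[OF p(1) q(1)] by (intro exI[of _ "\<lambda>w. p w + q w"]) (simp add: algebra_simps)
qed

lemma apx_zero: "apx (\<lambda>w. 0)"
  using trig_const[of T 0] by (auto simp: apx_def sqint_zero intro!: exI[of _ "\<lambda>w. 0"])

lemma apx_sum: "finite I \<Longrightarrow> (\<And>i. i \<in> I \<Longrightarrow> apx (f i)) \<Longrightarrow> apx (\<lambda>w. \<Sum>i\<in>I. f i w)"
  by (induction I rule: finite_induct) (auto intro: apx_zero apx_add)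

lemma apx_cmult: assumes "apx f" shows "apx (\<lambda>w. c * f w)"
  unfolding apx_def
proof (intro conjI allI impI)
  show "sqint M (\<lambda>w. c * f w)" using assms sqint_cmult by (auto simp: apx_def)
  fix e :: real assume "e > 0"
  then have "e / ((cmod c)\<^sup>2 + 1) > 0" by (intro divide_pos_pos) (auto simp: add_nonneg_pos)
  then obtain p where p: "trig T p" "(\<integral>w. (cmod (f w - p w))\<^sup>2 \<partial>M) < e / ((cmod c)\<^sup>2 + 1)"
    using assms unfolding apx_def by meson
  have "c * f w - c * p w = c * (f w - p w)" for w by (simp add: algebra_simps)
  then have "(\<integral>w. (cmod (c * f w - c * p w))\<^sup>2 \<partial>M) = (cmod c)\<^sup>2 * (\<integral>w. (cmod (f w - p w))\<^sup>2 \<partial>M)"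
    by (simp add: norm_mult power_mult_distrib)
  also have "\<dots> \<le> ((cmod c)\<^sup>2 + 1) * (\<integral>w. (cmod (f w - p w))\<^sup>2 \<partial>M)"
    by (intro mult_right_mono) auto
  also have "\<dots> < e" using p(2) by (simp add: pos_less_divide_eq add_nonneg_pos mult.commute)
  finally show "\<exists>p. trig T p \<and> (\<integral>w. (cmod (c * f w - p w))\<^sup>2 \<partial>M) < e"
    using trig_mult[OF trig_const p(1)] by (intro exI[of _ "\<lambda>w. c * p w"]) auto
qed

lemma apx_closed:
  assumes "sqint M g" "\<And>e. e > 0 \<Longrightarrow> \<exists>f. apx f \<and> (\<integral>w. (cmod (g w - f w))\<^sup>2 \<partial>M) < e"
  shows "apx g"
  unfolding apx_def
proof (intro conjI allI impI)
  fix e :: real assume "e > 0"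
  then have e: "e / 4 > 0" by simp
  then obtain f where f: "apx f" "(\<integral>w. (cmod (g w - f w))\<^sup>2 \<partial>M) < e/4" using assms by blast
  then obtain p where p: "trig T p" "(\<integral>w. (cmod (f w - p w))\<^sup>2 \<partial>M) < e/4"
    using e unfolding apx_def by meson
  have "(\<integral>w. (cmod ((g w - f w) + (f w - p w)))\<^sup>2 \<partial>M) \<le> 2 * (\<integral>w. (cmod (g w - f w))\<^sup>2 \<partial>M) + 2 * (\<integral>w. (cmod (f w - p w))\<^sup>2 \<partial>M)"
    using assms(1) f(1) sqint_trig[OF p(1)] by (intro sqint_add(2) sqint_diff) (auto simp: apx_def)
  also have "\<dots> < e" using f p by simp
  finally show "\<exists>p. trig T p \<and> (\<integral>w. (cmod (g w - p w))\<^sup>2 \<partial>M) < e" using p(1) by auto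
qed (fact assms(1))

lemma apx_continuous:
  fixes u :: "'a \<Rightarrow> real"
  assumes u: "continuous_on UNIV u" and z: "\<And>w. w \<notin> box a (a + T) \<Longrightarrow> u w = 0"
  shows "apx (\<lambda>w. complex_of_real (u w))"
  unfolding apx_def
proof (intro conjI allI impI)
  have cu: "continuous_on D (\<lambda>w. complex_of_real (u w))"
    using u by (intro continuous_intros) (auto intro: continuous_on_subset)
  then show s: "sqint M (\<lambda>w. complex_of_real (u w))" by (rule continuous_sqint)
  fix e :: real assume e: "e > 0"
  define d where "d = sqrt (e / (2 * V))"
  have d: "d > 0" "d\<^sup>2 = e / (2 * V)" using e V_pos by (auto simp: d_def)
  obtain p where p: "trig T p" "\<And>w. w \<in> D \<Longrightarrow> norm (complex_of_real (u w) - p w) < d"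
    using trig_uniform_approx[OF T u z d(1)] by metis
  interpret finite_measure M by (rule finite_M)
  have "(\<integral>w. (cmod (complex_of_real (u w) - p w))\<^sup>2 \<partial>M) \<le> (\<integral>w. d\<^sup>2 \<partial>M)"
  proof (rule integral_mono)
    show "integrable M (\<lambda>w. (cmod (complex_of_real (u w) - p w))\<^sup>2)"
      using sqint_diff[OF s sqint_trig[OF p(1)]] by (simp add: sqint_def)
    fix w assume "w \<in> space M"
    then show "(cmod (complex_of_real (u w) - p w))\<^sup>2 \<le> d\<^sup>2"
      using p(2)[of w] by (intro power_mono) auto
  qed auto
  also have "\<dots> = d\<^sup>2 * V" using measure_D by (simp add: measure_restrict_space)
  also have "\<dots> < e" using d V_pos e by simp
  finally show "\<exists>p. trig T p \<and> (\<integral>w. (cmod (complex_of_real (u w) - p w))\<^sup>2 \<partial>M) < e" using p(1) by blast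
qed

end

section \<open>Lattice sums as integrals for counting measure, tilings and periodization\<close>

lemma nn_integral_count_space_eq_infsum:
  fixes f :: "'b \<Rightarrow> ennreal"
  assumes A: "countable A"
  shows "(\<integral>\<^sup>+x. f x \<partial>count_space A) = (\<Sum>\<^sub>\<infinity>x\<in>A. f x)"
proof -
  have inf: "(\<Sum>\<^sub>\<infinity>x\<in>A. f x) = (SUP F\<in>{F. finite F \<and> F \<subseteq> A}. sum f F)"
    by (rule nonneg_infsum_complete) auto
  show ?thesis
  proof (cases "finite A")
    case True then show ?thesis by (simp add: nn_integral_count_space_finite)
  next
    case False
    have bij: "bij_betw (from_nat_into A) UNIV A" using A False by (rule bij_betw_from_nat_into)
    have "(\<integral>\<^sup>+x. f x \<partial>count_space A) = (\<integral>\<^sup>+n. f (from_nat_into A n) \<partial>count_space UNIV)"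
      by (rule nn_integral_bij_count_space[OF bij, symmetric])
    also have "\<dots> = (\<Sum>n. f (from_nat_into A n))" by (rule nn_integral_count_space_nat)
    also have "\<dots> = (SUP n. \<Sum>i<n. f (from_nat_into A i))" by (rule suminf_eq_SUP)
    also have "\<dots> \<le> (\<Sum>\<^sub>\<infinity>x\<in>A. f x)" unfolding inf
    proof (rule SUP_least)
      fix n
      have "(\<Sum>i<n. f (from_nat_into A i)) = sum f (from_nat_into A ` {..<n})"
        using bij by (subst sum.reindex) (auto simp: bij_betw_def intro: inj_on_subset)
      moreover have "from_nat_into A ` {..<n} \<subseteq> A" using bij by (auto simp: bij_betw_def)
      ultimately show "(\<Sum>i<n. f (from_nat_into A i)) \<le> (SUP F\<in>{F. finite F \<and> F \<subseteq> A}. sum f F)"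
        by (auto intro!: SUP_upper2[of "from_nat_into A ` {..<n}"])
    qed
    finally have le: "(\<integral>\<^sup>+x. f x \<partial>count_space A) \<le> (\<Sum>\<^sub>\<infinity>x\<in>A. f x)" .
    have "(\<Sum>\<^sub>\<infinity>x\<in>A. f x) \<le> (\<integral>\<^sup>+x. f x \<partial>count_space A)" unfolding inf
    proof (rule SUP_least)
      fix F assume F: "F \<in> {F. finite F \<and> F \<subseteq> A}"
      have "sum f F = (\<integral>\<^sup>+x. f x * indicator F x \<partial>count_space A)"
        using F by (subst nn_integral_count_space'[of F]) (auto intro!: sum.cong)
      also have "\<dots> \<le> (\<integral>\<^sup>+x. f x \<partial>count_space A)"
        by (intro nn_integral_mono) (auto simp: indicator_def)
      finally show "sum f F \<le> (\<integral>\<^sup>+x. f x \<partial>count_space A)" .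
    qed
    with le show ?thesis by simp
  qed
qed

lemma has_sum_imp_infsum_ennreal:
  assumes "(f has_sum (s::real)) A" "\<And>x. x \<in> A \<Longrightarrow> f x \<ge> 0"
  shows "(\<Sum>\<^sub>\<infinity>x\<in>A. ennreal (f x)) = ennreal s"
proof -
  have "ennreal s = ennreal (infsum f A)" using assms(1) by (simp add: infsumI)
  also have "\<dots> = (SUP F\<in>{F. finite F \<and> F \<subseteq> A}. ennreal (sum f F))"
    using assms by (intro infsum_nonneg_is_SUPREMUM_ennreal) (auto simp: has_sum_imp_summable)
  also have "\<dots> = (SUP F\<in>{F. finite F \<and> F \<subseteq> A}. \<Sum>x\<in>F. ennreal (f x))"
    using assms(2) by (intro SUP_cong) (auto intro!: sum_ennreal[symmetric])
  also have "\<dots> = (\<Sum>\<^sub>\<infinity>x\<in>A. ennreal (f x))"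
    by (rule nonneg_infsum_complete[symmetric]) auto
  finally show ?thesis by simp
qed

text \<open>Half-open, so that the translates by \<open>plat L\<close> tile the space exactly; the
  closed box of \<open>period_box\<close> shares faces with its translates.\<close>

definition hbox :: "'a::euclidean_space \<Rightarrow> 'a set" where
  "hbox L = {w. \<forall>b\<in>Basis. 0 \<le> w \<bullet> b \<and> w \<bullet> b < L \<bullet> b}"

text \<open>Coordinatewise rounding down to the lattice: the label of the tile that contains
  \<open>x\<close>.\<close>

definition lfl :: "'a::euclidean_space \<Rightarrow> 'a \<Rightarrow> 'a" where
  "lfl L x = (\<Sum>b\<in>Basis. (of_int \<lfloor>(x \<bullet> b) / (L \<bullet> b)\<rfloor> * (L \<bullet> b)) *\<^sub>R b)"

lemma lfl_inner: "b \<in> Basis \<Longrightarrow> lfl L x \<bullet> b = of_int \<lfloor>(x \<bullet> b) / (L \<bullet> b)\<rfloor> * (L \<bullet> b)"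
  by (simp add: lfl_def)

lemma lfl_plat: "lfl L x \<in> plat L"
  unfolding plat_def by (auto simp: lfl_inner)

lemma diff_lfl_hbox:
  assumes "\<And>b. b \<in> Basis \<Longrightarrow> L \<bullet> b > 0"
  shows "x - lfl L x \<in> hbox L"
  unfolding hbox_def
proof (intro CollectI ballI)
  fix b :: 'a assume b: "b \<in> Basis"
  show "0 \<le> (x - lfl L x) \<bullet> b \<and> (x - lfl L x) \<bullet> b < L \<bullet> b"
    using floor_divide_lower[OF assms[OF b], of "x \<bullet> b"] floor_divide_upper[OF assms[OF b], of "x \<bullet> b"] b
    by (simp add: inner_diff_left lfl_inner distrib_right)
qed

lemma lfl_unique:
  assumes L: "\<And>b. b \<in> Basis \<Longrightarrow> L \<bullet> b > 0" and m: "m \<in> plat L" "x - m \<in> hbox L"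
  shows "m = lfl L x"
proof (rule euclidean_eqI)
  fix b :: 'a assume b: "b \<in> Basis"
  have "\<exists>k::int. m \<bullet> b = of_int k * (L \<bullet> b)" using m(1) b by (simp add: plat_def)
  then obtain k :: int where k: "m \<bullet> b = of_int k * (L \<bullet> b)" ..
  have "0 \<le> x \<bullet> b - of_int k * (L \<bullet> b)" "x \<bullet> b - of_int k * (L \<bullet> b) < L \<bullet> b"
    using m(2) b k by (auto simp: hbox_def inner_diff_left)
  then have "of_int k \<le> (x \<bullet> b) / (L \<bullet> b)" "(x \<bullet> b) / (L \<bullet> b) < of_int k + 1"
    using L[OF b] by (auto simp: field_simps)
  then have "\<lfloor>(x \<bullet> b) / (L \<bullet> b)\<rfloor> = k" by linarith
  then show "m \<bullet> b = lfl L x \<bullet> b" using k b by (simp add: lfl_inner)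
qed

lemma hbox_borel [measurable]: "hbox L \<in> sets borel"
proof -
  have "hbox L = (\<Inter>b\<in>Basis. {w. 0 \<le> w \<bullet> b} \<inter> {w. w \<bullet> b < L \<bullet> b})" by (auto simp: hbox_def)
  also have "\<dots> \<in> sets borel"
    by (intro sets.finite_INT sets.Int) (auto intro!: borel_open borel_closed open_halfspace_component_lt closed_halfspace_component_ge)
  finally show ?thesis .
qed

lemma emeasure_hbox:
  assumes L: "\<And>b. b \<in> Basis \<Longrightarrow> L \<bullet> b > 0"
  shows "emeasure lborel (hbox L) = ennreal (\<Prod>b\<in>Basis. L \<bullet> b)"
proof (rule antisym)
  have "emeasure lborel (hbox L) \<le> emeasure lborel (cbox 0 L)"
    by (intro emeasure_mono) (fastforce simp: hbox_def mem_box)+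
  then show "emeasure lborel (hbox L) \<le> ennreal (\<Prod>b\<in>Basis. L \<bullet> b)"
    using L by (simp add: emeasure_lborel_cbox_eq less_imp_le)
  have "emeasure lborel (box 0 L) \<le> emeasure lborel (hbox L)"
    by (intro emeasure_mono) (auto simp: hbox_def mem_box intro: less_imp_le)
  then show "ennreal (\<Prod>b\<in>Basis. L \<bullet> b) \<le> emeasure lborel (hbox L)"
    using L by (simp add: emeasure_lborel_box_eq less_imp_le)
qed

lemma nn_integral_lborel_shift:
  fixes F :: "'a::euclidean_space \<Rightarrow> ennreal"
  assumes [measurable]: "F \<in> borel_measurable borel"
  shows "(\<integral>\<^sup>+w. F (w + m) \<partial>lborel) = (\<integral>\<^sup>+w. F w \<partial>lborel)"
proof -
  have "(\<integral>\<^sup>+w. F w \<partial>lborel) = (\<integral>\<^sup>+w. F w \<partial>distr lborel borel ((+) m))"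
    by (simp add: lborel_distr_plus)
  also have "\<dots> = (\<integral>\<^sup>+w. F (m + w) \<partial>lborel)" by (rule nn_integral_distr) auto
  finally show ?thesis by (simp add: add.commute)
qed

text \<open>Every point lies in exactly one tile, so the constant 1 is inserted as a sum of tile
  indicators. Tonelli with counting measure on \<open>plat L\<close>, and a shift in each term,
  bring everything back to the base tile.\<close>

lemma nn_integral_periodize:
  fixes F :: "'a::euclidean_space \<Rightarrow> ennreal"
  assumes L: "\<And>b. b \<in> Basis \<Longrightarrow> L \<bullet> b > 0" and F[measurable]: "F \<in> borel_measurable borel"
  shows "(\<integral>\<^sup>+w. F w \<partial>lborel) = (\<integral>\<^sup>+w. (\<Sum>\<^sub>\<infinity>m\<in>plat L. F (w + m)) * indicator (hbox L) w \<partial>lborel)"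
proof -
  have one: "(\<integral>\<^sup>+m. F w * indicator (hbox L) (w - m) \<partial>count_space (plat L)) = F w" for w
  proof -
    have "(\<integral>\<^sup>+m. F w * indicator (hbox L) (w - m) \<partial>count_space (plat L)) = (\<Sum>m\<in>{lfl L w}. F w * indicator (hbox L) (w - m))"
      using lfl_unique[OF L] lfl_plat by (intro nn_integral_count_space') (auto simp: indicator_def)
    also have "\<dots> = F w" using diff_lfl_hbox[OF L] by simp
    finally show ?thesis .
  qed
  have "(\<integral>\<^sup>+w. F w \<partial>lborel) = (\<integral>\<^sup>+w. \<integral>\<^sup>+m. F w * indicator (hbox L) (w - m) \<partial>count_space (plat L) \<partial>lborel)"
    by (simp only: one)
  also have "\<dots> = (\<integral>\<^sup>+m. \<integral>\<^sup>+w. F w * indicator (hbox L) (w - m) \<partial>lborel \<partial>count_space (plat L))"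
    by (intro nn_integral_count_space_nn_integral countable_plat) measurable
  also have "\<dots> = (\<integral>\<^sup>+m. \<integral>\<^sup>+w. F (w + m) * indicator (hbox L) w \<partial>lborel \<partial>count_space (plat L))"
  proof (rule nn_integral_cong)
    fix m
    have "(\<integral>\<^sup>+w. F w * indicator (hbox L) (w - m) \<partial>lborel) = (\<integral>\<^sup>+w. F (w + m) * indicator (hbox L) (w + m - m) \<partial>lborel)"
      by (rule nn_integral_lborel_shift[symmetric]) measurable
    then show "(\<integral>\<^sup>+w. F w * indicator (hbox L) (w - m) \<partial>lborel) = (\<integral>\<^sup>+w. F (w + m) * indicator (hbox L) w \<partial>lborel)"
      by simp
  qed
  also have "\<dots> = (\<integral>\<^sup>+w. \<integral>\<^sup>+m. F (w + m) * indicator (hbox L) w \<partial>count_space (plat L) \<partial>lborel)"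
    by (intro nn_integral_count_space_nn_integral[symmetric] countable_plat) measurable
  also have "\<dots> = (\<integral>\<^sup>+w. (\<Sum>\<^sub>\<infinity>m\<in>plat L. F (w + m)) * indicator (hbox L) w \<partial>lborel)"
    by (intro nn_integral_cong) (simp add: nn_integral_multc flip: nn_integral_count_space_eq_infsum[OF countable_plat])
  finally show ?thesis .
qed

section \<open>Completeness of the characters and Parseval's identity\<close>

context period_box begin

lemma apx_cong: "apx f \<Longrightarrow> (\<And>w. w \<in> D \<Longrightarrow> f w = g w) \<Longrightarrow> apx g"
proof -
  assume f: "apx f" and eq: "\<And>w. w \<in> D \<Longrightarrow> f w = g w"
  have "f \<in> borel_measurable M \<longleftrightarrow> g \<in> borel_measurable M" by (intro measurable_cong) (auto simp: eq)
  moreover have "integrable M (\<lambda>w. (cmod (f w))\<^sup>2) \<longleftrightarrow> integrable M (\<lambda>w. (cmod (g w))\<^sup>2)"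
    by (intro Bochner_Integration.integrable_cong) (auto simp: eq)
  moreover have "(\<integral>w. (cmod (f w - p w))\<^sup>2 \<partial>M) = (\<integral>w. (cmod (g w - p w))\<^sup>2 \<partial>M)" for p
    by (intro Bochner_Integration.integral_cong) (auto simp: eq)
  ultimately show "apx g" using f by (simp add: apx_def sqint_def)
qed

text \<open>A Urysohn function equal to 1 on a closed \<open>K\<close> inside \<open>A\<close> and
  to 0 off an open \<open>U\<close> around \<open>K\<close> differs from the indicator only on
  \<open>A' - K\<close>, on \<open>U0 - K\<close> and on the faces of the box. Intersecting
  \<open>U0\<close> with the open box makes it vanish where \<open>apx_continuous\<close> requires
  it.\<close>

lemma apx_indicator:
  assumes A: "A \<in> sets M"
  shows "apx (indicator A)"
proof (rule apx_closed)
  have AD: "A \<subseteq> D" "A \<in> sets lebesgue" using A by (auto simp: sets_restrict_space)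
  show s: "sqint M (indicator A)"
    using A by (intro sqint_bounded[OF finite_M, where C=1]) (auto simp: indicator_def)
  fix e :: real assume e: "e > 0"
  define A' where "A' = A \<inter> box a (a + T)"
  have A': "A' \<in> sets lebesgue" using AD by (auto simp: A'_def)
  have e2: "e / 2 > 0" using e by simp
  obtain K where K: "closed K" "K \<subseteq> A'" "A' - K \<in> lmeasurable" "emeasure lebesgue (A' - K) < ennreal (e/2)"
    using sets_lebesgue_inner_closed[OF A' e2] by metis
  have Kl: "K \<in> sets lebesgue" using K(1) by (simp add: borel_closed)
  obtain U0 where U0: "open U0" "K \<subseteq> U0" "U0 - K \<in> lmeasurable" "emeasure lebesgue (U0 - K) < ennreal (e/2)"
    using sets_lebesgue_outer_open[OF Kl e2] by metis
  define U where "U = U0 \<inter> box a (a + T)"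
  have U: "open U" "K \<subseteq> U" "U - K \<subseteq> U0 - K" using U0 K by (auto simp: U_def A'_def open_Int)
  obtain u :: "'a \<Rightarrow> real" where u: "continuous_on UNIV u" "\<And>x. u x \<in> closed_segment 1 0"
      "\<And>x. x \<in> K \<Longrightarrow> u x = 1" "\<And>x. x \<in> - U \<Longrightarrow> u x = 0"
    using Urysohn[of K "- U" "1::real" 0] K U by auto
  have u01: "0 \<le> u x" "u x \<le> 1" for x using u(2)[of x] by (auto simp: closed_segment_eq_real_ivl)
  have ap: "apx (\<lambda>w. complex_of_real (u w))"
    by (rule apx_continuous[OF u(1)]) (auto intro!: u(4) simp: U_def)
  let ?N = "D - box a (a + T)"
  have Nn: "?N \<in> null_sets lebesgue"
    using negligible_frontier_interval[of a "a + T"] by (simp add: negligible_iff_null_sets)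
  have "(\<integral>w. (cmod (indicator A w - complex_of_real (u w)))\<^sup>2 \<partial>M) \<le> (\<integral>w. indicator ((A' - K) \<union> (U0 - K) \<union> ?N) w \<partial>M)"
  proof (rule integral_mono)
    show "integrable M (\<lambda>w. (cmod (indicator A w - complex_of_real (u w)))\<^sup>2)"
      using sqint_diff[OF s, of "\<lambda>w. complex_of_real (u w)"] ap by (simp add: apx_def sqint_def)
    show "integrable M (indicator ((A' - K) \<union> (U0 - K) \<union> ?N) :: 'a \<Rightarrow> real)"
    proof -
      interpret finite_measure M by (rule finite_M)
      have "(A' - K) \<union> (U0 - K) \<union> ?N \<in> sets lebesgue" using K(3) U0(3) Nn by auto
      then have "((A' - K) \<union> (U0 - K) \<union> ?N) \<inter> D \<in> sets M" by (auto simp: sets_restrict_space)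
      then have "integrable M (indicator (((A' - K) \<union> (U0 - K) \<union> ?N) \<inter> D) :: 'a \<Rightarrow> real)"
        by (intro integrable_real_indicator) (auto simp: less_top[symmetric] emeasure_finite)
      then show ?thesis by (rule Bochner_Integration.integrable_cong[THEN iffD1, rotated 2]) (auto simp: indicator_def)
    qed
    fix w assume "w \<in> space M"
    then have w: "w \<in> D" by simp
    show "(cmod (indicator A w - complex_of_real (u w)))\<^sup>2 \<le> indicator ((A' - K) \<union> (U0 - K) \<union> ?N) w"
    proof (cases "w \<in> (A' - K) \<union> (U0 - K) \<union> ?N")
      case True
      have "cmod (indicator A w - complex_of_real (u w)) = \<bar>indicator A w - u w\<bar>"
        by (simp add: indicator_def flip: of_real_diff) (metis norm_of_real of_real_1 of_real_diff)
      also have "\<dots> \<le> 1" using u01[of w] by (auto simp: indicator_def)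
      finally have "(cmod (indicator A w - complex_of_real (u w)))\<^sup>2 \<le> 1\<^sup>2" by (intro power_mono) auto
      then show ?thesis using True by simp
    next
      case False
      then have "w \<in> K \<or> (w \<notin> A \<and> w \<notin> U)" using w by (auto simp: A'_def U_def)
      then have "indicator A w = complex_of_real (u w)"
        using u(3,4)[of w] K(2) by (auto simp: A'_def)
      then show ?thesis by simp
    qed
  qed
  also have "\<dots> = measure M (((A' - K) \<union> (U0 - K) \<union> ?N) \<inter> space M)" by simp
  also have "\<dots> \<le> measure lebesgue ((A' - K) \<union> (U0 - K) \<union> ?N)"
  proof -
    have l: "(A' - K) \<union> (U0 - K) \<union> ?N \<in> lmeasurable" using K(3) U0(3) Nn by (auto intro: null_setsD1 fmeasurable.Un)
    have "measure M (((A' - K) \<union> (U0 - K) \<union> ?N) \<inter> space M) = measure lebesgue (((A' - K) \<union> (U0 - K) \<union> ?N) \<inter> D)"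
      by (subst measure_restrict_space) auto
    also have "\<dots> \<le> measure lebesgue ((A' - K) \<union> (U0 - K) \<union> ?N)"
      using l by (intro measure_mono_fmeasurable) auto
    finally show ?thesis .
  qed
  also have "\<dots> \<le> measure lebesgue (A' - K) + measure lebesgue (U0 - K) + measure lebesgue ?N"
    using K(3) U0(3) Nn
    by (intro order_trans[OF measure_Un_le] add_mono measure_Un_le) auto
  also have "measure lebesgue ?N = 0" using Nn by (simp add: measure_eq_0_null_sets)
  also have "measure lebesgue (A' - K) + measure lebesgue (U0 - K) + 0 < e"
  proof -
    have "measure lebesgue (A' - K) < e/2" "measure lebesgue (U0 - K) < e/2"
      using K(3,4) U0(3,4) e by (auto simp: emeasure_eq_measure2 ennreal_less_iff)
    then show ?thesis by simp
  qed
  finally show "\<exists>f. apx f \<and> (\<integral>w. (cmod (indicator A w - f w))\<^sup>2 \<partial>M) < e" using ap by blast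
qed

lemma apx_simple:
  assumes s: "simple_function M s"
  shows "apx s"
proof -
  have "apx (\<lambda>w. \<Sum>y\<in>s ` space M. y * indicator (s -` {y} \<inter> space M) w)"
    using simple_functionD[OF s] by (intro apx_sum apx_cmult apx_indicator) auto
  then show ?thesis
  proof (rule apx_cong)
    fix w assume w: "w \<in> D"
    have "(\<Sum>y\<in>s ` space M. y * indicator (s -` {y} \<inter> space M) w) = (\<Sum>y\<in>{s w}. y * indicator (s -` {y} \<inter> space M) w)"
      using w simple_functionD[OF s] by (intro sum.mono_neutral_right) auto
    then show "(\<Sum>y\<in>s ` space M. y * indicator (s -` {y} \<inter> space M) w) = s w" using w by simp
  qed
qed

lemma apx_sqint:
  assumes g: "sqint M g"
  shows "apx g"
proof (rule apx_closed[OF g])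
  have gm: "g \<in> borel_measurable M" and gi: "integrable M (\<lambda>w. (cmod (g w))\<^sup>2)" using g by (auto simp: sqint_def)
  obtain s where s: "\<And>i. simple_function M (s i)" "\<And>x. x \<in> space M \<Longrightarrow> (\<lambda>i. s i x) \<longlonglongrightarrow> g x"
    "\<And>i x. x \<in> space M \<Longrightarrow> dist (s i x) 0 \<le> 2 * dist (g x) 0"
    using borel_measurable_implies_sequence_metric[OF gm, of 0] by metis
  have sm: "s i \<in> borel_measurable M" for i using s(1) by (rule borel_measurable_simple_function)
  have "(\<lambda>i. \<integral>w. (cmod (g w - s i w))\<^sup>2 \<partial>M) \<longlonglongrightarrow> (\<integral>w. 0 \<partial>M)"
  \<comment> \<open>The approximating simple functions are at most twice \<open>g\<close> in
    modulus, so the error is at most three times \<open>g\<close>, whence the factor 9 in the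
    majorant.\<close>
  proof (rule integral_dominated_convergence[where w="\<lambda>w. 9 * (cmod (g w))\<^sup>2"])
    show "AE w in M. (\<lambda>i. (cmod (g w - s i w))\<^sup>2) \<longlonglongrightarrow> 0"
    proof (rule AE_I2)
      fix w assume "w \<in> space M"
      then have "(\<lambda>i. (cmod (g w - s i w))\<^sup>2) \<longlonglongrightarrow> (cmod (g w - g w))\<^sup>2"
        by (intro tendsto_intros s(2))
      then show "(\<lambda>i. (cmod (g w - s i w))\<^sup>2) \<longlonglongrightarrow> 0" by simp
    qed
    show "AE w in M. norm ((cmod (g w - s i w))\<^sup>2) \<le> 9 * (cmod (g w))\<^sup>2" for i
    proof (rule AE_I2)
      fix w assume "w \<in> space M"
      then have "cmod (g w - s i w) \<le> 3 * cmod (g w)"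
        using s(3)[of w i] norm_triangle_ineq4[of "g w" "s i w"] by simp
      then have "(cmod (g w - s i w))\<^sup>2 \<le> (3 * cmod (g w))\<^sup>2" by (intro power_mono) auto
      then show "norm ((cmod (g w - s i w))\<^sup>2) \<le> 9 * (cmod (g w))\<^sup>2" by (simp add: power_mult_distrib)
    qed
  qed (use gm gi sm in auto)
  then have lim: "(\<lambda>i. \<integral>w. (cmod (g w - s i w))\<^sup>2 \<partial>M) \<longlonglongrightarrow> 0" by simp
  fix e :: real assume "e > 0"
  then have "eventually (\<lambda>i. (\<integral>w. (cmod (g w - s i w))\<^sup>2 \<partial>M) < e) sequentially"
    using lim order_tendstoD(2) by blast
  then obtain i where "(\<integral>w. (cmod (g w - s i w))\<^sup>2 \<partial>M) < e" by (auto simp: eventually_sequentially)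
  then show "\<exists>f. apx f \<and> (\<integral>w. (cmod (g w - f w))\<^sup>2 \<partial>M) < e" using apx_simple[OF s(1)] by blast
qed

text \<open>Bessel gives one inequality by inserting the optimal coefficients. For the other, a
  trigonometric polynomial close to \<open>g\<close> has its frequencies in a finite set
  \<open>F\<close>, and the coefficients of \<open>g\<close> on \<open>F\<close> then carry almost
  the whole norm.\<close>

lemma Parseval_box:
  assumes g: "sqint M g"
  shows "((\<lambda>x. (cmod (fc g x))\<^sup>2) has_sum (V * (\<integral>w. (cmod (g w))\<^sup>2 \<partial>M))) (glat T)"
proof -
  let ?I = "\<integral>w. (cmod (g w))\<^sup>2 \<partial>M"
  let ?f = "\<lambda>x. (cmod (fc g x))\<^sup>2"
  have bessel: "sum ?f F \<le> V * ?I" if F: "finite F" "F \<subseteq> glat T" for F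
  proof -
    have "0 \<le> (\<integral>w. (cmod (g w - (\<Sum>x\<in>F. (fc g x / V) * cnj (chr x w))))\<^sup>2 \<partial>M)" by simp
    then have "0 \<le> ?I - sum ?f F / V"
      by (subst (asm) trig_sum_distance[OF g F]) simp
    then show ?thesis using V_pos by (simp add: field_simps)
  qed
  have bdd: "bdd_above (sum ?f ` {F. F \<subseteq> glat T \<and> finite F})"
    using bessel by (intro bdd_aboveI[where M="V * ?I"]) auto
  have bdd': "bdd_above (sum ?f ` {F. finite F \<and> F \<subseteq> glat T})"
    using bessel by (intro bdd_aboveI[where M="V * ?I"]) auto
  have hs: "(?f has_sum (SUP F\<in>{F. finite F \<and> F \<subseteq> glat T}. sum ?f F)) (glat T)"
    by (rule nonneg_bdd_above_has_sum) (use bdd in auto)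
  have "(SUP F\<in>{F. finite F \<and> F \<subseteq> glat T}. sum ?f F) = V * ?I"
  proof (rule antisym)
    show "(SUP F\<in>{F. finite F \<and> F \<subseteq> glat T}. sum ?f F) \<le> V * ?I"
      by (rule cSUP_least) (use bessel in auto)
    show "V * ?I \<le> (SUP F\<in>{F. finite F \<and> F \<subseteq> glat T}. sum ?f F)"
    proof (rule field_le_epsilon)
      fix e :: real assume "e > 0"
      then have "e / V > 0" using V_pos by simp
      then obtain p where p: "trig T p" "(\<integral>w. (cmod (g w - p w))\<^sup>2 \<partial>M) < e / V"
        using apx_sqint[OF g] unfolding apx_def by meson
      obtain F c where F: "finite F" "F \<subseteq> glat T" "p = (\<lambda>w. \<Sum>x\<in>F. c x * cnj (chr x w))"
        by (rule trig_explicit[OF p(1)])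
      have "?I - sum ?f F / V + V * (\<Sum>x\<in>F. (cmod (c x - fc g x / V))\<^sup>2) < e / V"
        using p(2) unfolding F(3) by (subst (asm) trig_sum_distance[OF g F(1,2)])
      moreover have "0 \<le> V * (\<Sum>x\<in>F. (cmod (c x - fc g x / V))\<^sup>2)"
        using V_pos by (intro mult_nonneg_nonneg sum_nonneg) auto
      ultimately have "?I - sum ?f F / V < e / V" by linarith
      then have "?I < (sum ?f F + e) / V" by (simp add: add_divide_distrib)
      then have "V * ?I \<le> sum ?f F + e" using V_pos by (simp add: pos_less_divide_eq mult.commute)
      also have "sum ?f F \<le> (SUP F\<in>{F. finite F \<and> F \<subseteq> glat T}. sum ?f F)"
        using F bdd' by (intro cSUP_upper) auto
      finally show "V * ?I \<le> (SUP F\<in>{F. finite F \<and> F \<subseteq> glat T}. sum ?f F) + e" by simp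
    qed
  qed
  with hs show ?thesis by simp
qed

lemma integral_M_eq_lborel:
  fixes g :: "'a \<Rightarrow> 'b::{banach, second_countable_topology}"
  assumes "g \<in> borel_measurable borel" "\<And>w. w \<notin> D \<Longrightarrow> g w = 0"
  shows "(\<integral>w. g w \<partial>M) = (\<integral>w. g w \<partial>lborel)" "integrable M g \<longleftrightarrow> integrable lborel g"
proof -
  have eq: "(\<lambda>w. indicator D w *\<^sub>R g w) = g" using assms(2) by (force simp: indicator_def)
  have gl: "g \<in> borel_measurable lborel" using assms(1) by simp
  show "(\<integral>w. g w \<partial>M) = (\<integral>w. g w \<partial>lborel)"
    using integral_completion[OF gl] by (subst integral_restrict_space) (auto simp: eq)
  show "integrable M g \<longleftrightarrow> integrable lborel g"
    using integrable_completion[OF gl] by (subst integrable_restrict_space) (auto simp: eq)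
qed

lemma Parseval_lborel:
  assumes g: "sqint lborel g" "\<And>w. w \<notin> D \<Longrightarrow> g w = 0"
  shows "((\<lambda>x. (cmod (\<integral>w. g w * chr x w \<partial>lborel))\<^sup>2) has_sum (V * (\<integral>w. (cmod (g w))\<^sup>2 \<partial>lborel))) (glat T)"
proof -
  have gm: "g \<in> borel_measurable borel" using g by (simp add: sqint_def)
  then have "g \<in> borel_measurable M"
    by (intro measurable_restrict_space1 measurable_completion) simp
  moreover have "integrable M (\<lambda>w. (cmod (g w))\<^sup>2)"
    using g by (subst integral_M_eq_lborel) (auto simp: sqint_def)
  ultimately have s: "sqint M g" by (simp add: sqint_def)
  have "fc g x = (\<integral>w. g w * chr x w \<partial>lborel)" for x
    unfolding fc_def using g gm by (intro integral_M_eq_lborel) auto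
  moreover have "(\<integral>w. (cmod (g w))\<^sup>2 \<partial>M) = (\<integral>w. (cmod (g w))\<^sup>2 \<partial>lborel)"
    using g gm by (intro integral_M_eq_lborel) auto
  ultimately show ?thesis using Parseval_box[OF s] by simp
qed

end

section \<open>The transform of spectra with bounded support, and the Paley-Wiener space\<close>

definition fourier :: "('a::euclidean_space \<Rightarrow> complex) \<Rightarrow> 'a \<Rightarrow> complex" where
  "fourier g x = (\<integral>w. g w * chr x w \<partial>lborel)"

lemma sqint_bounded_support_integrable:
  assumes g: "sqint lborel g" and S: "\<And>w. w \<notin> S \<Longrightarrow> g w = 0" "bounded S"
  shows "integrable lborel g"
proof -
  obtain a where a: "S \<subseteq> cbox (-a) a" using S(2) bounded_subset_cbox_symmetric by metis
  show ?thesis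
  proof (rule Bochner_Integration.integrable_bound)
    show "integrable lborel (\<lambda>w. indicator (cbox (-a) a) w + (cmod (g w))\<^sup>2)"
      using g emeasure_lborel_cbox_finite[of "- a" a]
      by (intro Bochner_Integration.integrable_add integrable_real_indicator) (auto simp: sqint_def)
    show "g \<in> borel_measurable lborel" using g by (simp add: sqint_def)
    have "x \<le> 1 + x\<^sup>2" for x :: real
    proof -
      have "2 * x \<le> 1 + x\<^sup>2" using zero_le_power2[of "x - 1"] by (simp add: power2_diff)
      then show ?thesis using zero_le_power2[of x] by linarith
    qed
    then have "cmod (g w) \<le> indicator (cbox (-a) a) w + (cmod (g w))\<^sup>2" for w
      using S(1)[of w] a by (cases "w \<in> S") (auto simp: indicator_def)
    then show "AE w in lborel. norm (g w) \<le> norm (indicator (cbox (-a) a) w + (cmod (g w))\<^sup>2 :: real)"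
      by (intro AE_I2) (auto intro: order_trans)
  qed
qed

text \<open>Dominated convergence with majorant \<open>norm (g w)\<close>. Continuity is used for
  the measurability of the transform in \<open>Plancherel\<close>.\<close>

lemma continuous_on_fourier:
  assumes g: "integrable lborel g"
  shows "continuous_on UNIV (fourier g)"
proof -
  have "(\<lambda>n. fourier g (X n)) \<longlonglongrightarrow> fourier g x" if X: "X \<longlonglongrightarrow> x" for X :: "nat \<Rightarrow> 'a" and x
    unfolding fourier_def
  proof (rule integral_dominated_convergence[where w="\<lambda>w. norm (g w)"])
    show "AE w in lborel. (\<lambda>n. g w * chr (X n) w) \<longlonglongrightarrow> g w * chr x w"
      unfolding chr_def by (intro AE_I2 tendsto_intros X)
  qed (use g in \<open>auto simp: norm_mult\<close>)
  then show ?thesis by (simp add: continuous_on_sequentially comp_def)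
qed

text \<open>Enclose the support in a box. Parseval for \<open>g\<close> times the character at
  \<open>x\<close> says that the squared moduli of the transform over \<open>x + m\<close>, with
  \<open>m\<close> in \<open>glat T\<close>, add up to the same number \<open>V * ?I\<close> for
  every \<open>x\<close>. Integrating over one tile of that lattice, of volume \<open>1 / V\<close>,
  gives the norm.\<close>

lemma Plancherel:
  assumes g: "sqint lborel g" and S: "\<And>w. w \<notin> S \<Longrightarrow> g w = 0" "bounded S"
  shows "L2_norm_sq (fourier g) = (\<integral>w. (cmod (g w))\<^sup>2 \<partial>lborel)"
proof -
  obtain a0 where a0: "S \<subseteq> cbox (-a0) a0" using S(2) bounded_subset_cbox_symmetric by metis
  define c where "c = norm a0 + 1"
  define a where "a = - c *\<^sub>R (One::'a)"
  define T where "T = (2 * c) *\<^sub>R (One::'a)"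
  have c: "c > 0" by (simp add: c_def add_nonneg_pos)
  have Tb: "T \<bullet> b = 2 * c" if "b \<in> Basis" for b using that by (simp add: T_def)
  interpret period_box T a using c Tb by unfold_locales auto
  have SD: "S \<subseteq> D"
  proof
    fix w assume "w \<in> S"
    then have "w \<in> cbox (-a0) a0" using a0 by auto
    then have "\<bar>w \<bullet> b\<bar> \<le> c" if "b \<in> Basis" for b
      using that Basis_le_norm[OF that, of a0] unfolding mem_box c_def by force
    moreover have "a \<bullet> b = - c" "(a + T) \<bullet> b = c" if "b \<in> Basis" for b
      using that by (auto simp: a_def T_def inner_add_left inner_diff_left)
    ultimately show "w \<in> D" by (auto simp: mem_box abs_le_iff minus_le_iff)
  qed
  define L where "L = (\<Sum>b\<in>Basis. (1 / (T \<bullet> b)) *\<^sub>R b)"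
  have L: "L \<bullet> b = 1 / (T \<bullet> b)" if "b \<in> Basis" for b using that by (simp add: L_def)
  have Lp: "L \<bullet> b > 0" if "b \<in> Basis" for b using L T that by simp
  have glat: "glat T = plat L" unfolding L_def by (rule glat_eq_plat[OF T])
  let ?I = "\<integral>w. (cmod (g w))\<^sup>2 \<partial>lborel"
  have gi: "integrable lborel g" by (rule sqint_bounded_support_integrable[OF g S])
  have cont: "continuous_on UNIV (fourier g)" by (rule continuous_on_fourier[OF gi])
  then have [measurable]: "fourier g \<in> borel_measurable borel" by (rule borel_measurable_continuous_onI)
  have per: "(\<Sum>\<^sub>\<infinity>m\<in>plat L. ennreal ((cmod (fourier g (x + m)))\<^sup>2)) = ennreal (V * ?I)" for x
  proof (rule has_sum_imp_infsum_ennreal)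
    have s: "sqint lborel (\<lambda>w. g w * chr x w)" by (rule sqint_mult_unimodular[OF g]) auto
    have z: "w \<notin> D \<Longrightarrow> g w * chr x w = 0" for w using S(1) SD by auto
    have "((\<lambda>y. (cmod (\<integral>w. g w * chr x w * chr y w \<partial>lborel))\<^sup>2) has_sum (V * (\<integral>w. (cmod (g w * chr x w))\<^sup>2 \<partial>lborel))) (glat T)"
      by (rule Parseval_lborel[OF s z])
    then show "((\<lambda>m. (cmod (fourier g (x + m)))\<^sup>2) has_sum V * ?I) (plat L)"
      by (simp add: fourier_def chr_add_left norm_mult glat mult.assoc)
  qed auto
  have "(\<integral>\<^sup>+x. ennreal ((cmod (fourier g x))\<^sup>2) \<partial>lborel)
      = (\<integral>\<^sup>+x. (\<Sum>\<^sub>\<infinity>m\<in>plat L. ennreal ((cmod (fourier g (x + m)))\<^sup>2)) * indicator (hbox L) x \<partial>lborel)"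
    by (rule nn_integral_periodize[OF Lp]) measurable
  also have "\<dots> = ennreal (V * ?I) * emeasure lborel (hbox L)"
    unfolding per by (rule nn_integral_cmult_indicator) simp
  also have "\<dots> = ennreal (V * ?I) * ennreal (1 / V)"
    using L by (simp add: emeasure_hbox[OF Lp] V_def prod_dividef)
  also have "\<dots> = ennreal ?I"
    using V_pos by (simp add: ennreal_mult[symmetric])
  finally have nn: "(\<integral>\<^sup>+x. ennreal ((cmod (fourier g x))\<^sup>2) \<partial>lborel) = ennreal ?I" .
  have "L2_norm_sq (fourier g) = (\<integral>x. (cmod (fourier g x))\<^sup>2 \<partial>lborel)"
    unfolding L2_norm_sq_def by (rule integral_completion) measurable
  also have "\<dots> = enn2real (\<integral>\<^sup>+x. ennreal ((cmod (fourier g x))\<^sup>2) \<partial>lborel)"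
    by (rule integral_eq_nn_integral) auto
  also have "\<dots> = ?I" by (simp add: nn)
  finally show ?thesis .
qed

text \<open>Normal form for the rest of the proof: a Lebesgue-measurable spectrum is replaced by a
  Borel one that vanishes off \<open>S\<close> and agrees with it almost everywhere on
  \<open>S\<close>, so the integral at every point is unchanged.\<close>

lemma PW_space_eq:
  assumes S: "compact S"
  shows "PW_space S = {f. \<exists>g. sqint lborel g \<and> (\<forall>w. w \<notin> S \<longrightarrow> g w = 0) \<and> f = fourier g}"
proof (intro equalityI subsetI)
  have Sb: "S \<in> sets borel" using S by (rule borel_compact)
  {
    fix f assume "f \<in> PW_space S"
    then obtain g where g: "g \<in> borel_measurable lebesgue" "set_integrable lebesgue S (\<lambda>w. (cmod (g w))\<^sup>2)"
      and f: "\<And>x. f x = set_lebesgue_integral lebesgue S (\<lambda>w. g w * exp (2 * pi * \<i> * complex_of_real (w \<bullet> x)))"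
      by (auto simp: PW_space_def)
    define g0 where "g0 w = indicator S w *\<^sub>R g w" for w
    have g0: "g0 \<in> borel_measurable lebesgue"
      unfolding g0_def using g(1) Sb by (intro borel_measurable_scaleR borel_measurable_indicator) auto
    obtain g1 where g1: "g1 \<in> borel_measurable lborel" "AE w in lborel. g0 w = g1 w"
      using completion_ex_borel_measurable_real[of "\<lambda>w. Re (g0 w)" lborel] completion_ex_borel_measurable_real[of "\<lambda>w. Im (g0 w)" lborel]
    proof -
      have "(\<lambda>w. Re (g0 w)) \<in> borel_measurable lebesgue" "(\<lambda>w. Im (g0 w)) \<in> borel_measurable lebesgue"
        using g0 by measurable
      then obtain r i where ri: "r \<in> borel_measurable lborel" "AE w in lborel. Re (g0 w) = r w"
          "i \<in> borel_measurable lborel" "AE w in lborel. Im (g0 w) = i w"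
        using completion_ex_borel_measurable_real by metis
      show ?thesis
      proof (rule that[of "\<lambda>w. Complex (r w) (i w)"])
        have "(\<lambda>w. complex_of_real (r w) + \<i> * complex_of_real (i w)) \<in> borel_measurable lborel"
          using ri by measurable
        then show "(\<lambda>w. Complex (r w) (i w)) \<in> borel_measurable lborel" by (simp add: Complex_eq)
        show "AE w in lborel. g0 w = Complex (r w) (i w)"
          using ri(2,4) by eventually_elim (simp add: complex_eq_iff)
      qed
    qed
    define h where "h w = indicator S w *\<^sub>R g1 w" for w
    have h: "h \<in> borel_measurable lborel"
      unfolding h_def using g1(1) Sb by (intro borel_measurable_scaleR borel_measurable_indicator) auto
    have ae: "AE w in lebesgue. g0 w = h w"
      using AE_completion[OF g1(2)] by eventually_elim (auto simp: h_def g0_def indicator_def)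
    have "integrable lebesgue (\<lambda>w. (cmod (g0 w))\<^sup>2)"
      using g(2) unfolding set_integrable_def
      by (rule Bochner_Integration.integrable_cong[THEN iffD1, rotated 2]) (auto simp: g0_def indicator_def)
    then have "integrable lebesgue (\<lambda>w. (cmod (h w))\<^sup>2)"
    proof (rule integrable_cong_AE[THEN iffD1, rotated 3])
      show "(\<lambda>w. (cmod (g0 w))\<^sup>2) \<in> borel_measurable lebesgue" using g0 by measurable
      show "(\<lambda>w. (cmod (h w))\<^sup>2) \<in> borel_measurable lebesgue" using measurable_completion[OF h] by measurable
      show "AE w in lebesgue. (cmod (g0 w))\<^sup>2 = (cmod (h w))\<^sup>2" using ae by eventually_elim simp
    qed
    then have "integrable lborel (\<lambda>w. (cmod (h w))\<^sup>2)"
      using h by (subst (asm) integrable_completion) auto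
    then have 1: "sqint lborel h" using h by (simp add: sqint_def)
    have "f = fourier h"
    proof
      fix x
      have "f x = (\<integral>w. g0 w * chr x w \<partial>lebesgue)"
        unfolding f set_lebesgue_integral_def chr_def g0_def by simp
      also have "\<dots> = (\<integral>w. h w * chr x w \<partial>lebesgue)"
      proof (rule integral_cong_AE)
        show "(\<lambda>w. g0 w * chr x w) \<in> borel_measurable lebesgue" using g0 by measurable
        show "(\<lambda>w. h w * chr x w) \<in> borel_measurable lebesgue" using measurable_completion[OF h] by measurable
        show "AE w in lebesgue. g0 w * chr x w = h w * chr x w" using ae by eventually_elim simp
      qed
      also have "\<dots> = fourier h x"
        unfolding fourier_def using h by (intro integral_completion) auto
      finally show "f x = fourier h x" .
    qed
    then show "f \<in> {f. \<exists>g. sqint lborel g \<and> (\<forall>w. w \<notin> S \<longrightarrow> g w = 0) \<and> f = fourier g}"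
      using 1 by (auto simp: h_def intro!: exI[of _ h])
  next
    fix f assume "f \<in> {f. \<exists>g. sqint lborel g \<and> (\<forall>w. w \<notin> S \<longrightarrow> g w = 0) \<and> f = fourier g}"
    then obtain g where g: "sqint lborel g" "\<And>w. w \<notin> S \<Longrightarrow> g w = 0" "f = fourier g" by blast
    have gm: "g \<in> borel_measurable lborel" using g by (simp add: sqint_def)
    have "integrable lebesgue (\<lambda>w. (cmod (g w))\<^sup>2)"
      using g(1) by (subst integrable_completion) (auto simp: sqint_def)
    then have "set_integrable lebesgue S (\<lambda>w. (cmod (g w))\<^sup>2)"
      unfolding set_integrable_def
      by (rule Bochner_Integration.integrable_cong[THEN iffD1, rotated 2]) (auto simp: indicator_def g(2))
    moreover have "f x = set_lebesgue_integral lebesgue S (\<lambda>w. g w * exp (2 * pi * \<i> * complex_of_real (w \<bullet> x)))" for x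
    proof -
      have "f x = (\<integral>w. g w * chr x w \<partial>lebesgue)"
        unfolding g(3) fourier_def using gm by (intro integral_completion[symmetric]) auto
      also have "\<dots> = set_lebesgue_integral lebesgue S (\<lambda>w. g w * exp (2 * pi * \<i> * complex_of_real (w \<bullet> x)))"
        unfolding set_lebesgue_integral_def chr_def
        by (rule Bochner_Integration.integral_cong) (auto simp: indicator_def g(2))
      finally show ?thesis .
    qed
    ultimately show "f \<in> PW_space S" using measurable_completion[OF gm] by (auto simp: PW_space_def)
  }
qed

subsection \<open>Cell decompositions and path densities\<close>

definition perp :: "'a::euclidean_space \<Rightarrow> 'a \<Rightarrow> 'a" where
  "perp b0 x = x - (x \<bullet> b0) *\<^sub>R b0"

lemma perp_inner: "b0 \<in> Basis \<Longrightarrow> b \<in> Basis \<Longrightarrow> perp b0 x \<bullet> b = (if b = b0 then 0 else x \<bullet> b)"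
  by (auto simp: perp_def inner_diff_left inner_Basis)

lemma perp_inner_self: "norm b0 = 1 \<Longrightarrow> perp b0 x \<bullet> b0 = 0"
  by (simp add: perp_def inner_diff_left norm_eq_1)

text \<open>Side vector of a box whose edge along \<open>b0\<close> may differ from the
  others.\<close>

definition colvec :: "'a::euclidean_space \<Rightarrow> real \<Rightarrow> real \<Rightarrow> 'a" where
  "colvec b0 R t = (\<Sum>b\<in>Basis. (if b = b0 then t else R) *\<^sub>R b)"

lemma colvec_inner: "b \<in> Basis \<Longrightarrow> colvec b0 R t \<bullet> b = (if b = b0 then t else R)"
  by (simp add: colvec_def)

lemma colvec_pos: "R > 0 \<Longrightarrow> t > 0 \<Longrightarrow> b \<in> Basis \<Longrightarrow> colvec b0 R t \<bullet> b > 0"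
  by (simp add: colvec_inner)

lemma prod_colvec:
  "b0 \<in> Basis \<Longrightarrow> (\<Prod>b\<in>(Basis::'a::euclidean_space set). colvec b0 R t \<bullet> b) = t * R ^ (DIM('a) - 1)"
  by (simp add: colvec_inner prod.remove[of Basis b0] card_Diff_singleton)

text \<open>The cubic lattice of step \<open>R\<close> in the hyperplane orthogonal to
  \<open>b0\<close>, kept inside a full-dimensional \<open>plat\<close> so that \<open>lfl\<close>
  and its uniqueness apply.\<close>

definition plat0 :: "'a::euclidean_space \<Rightarrow> real \<Rightarrow> 'a set" where
  "plat0 b0 R = {m \<in> plat (colvec b0 R 1). m \<bullet> b0 = 0}"

lemma countable_plat0: "countable (plat0 b0 R)"
  unfolding plat0_def by (rule countable_subset[OF _ countable_plat]) auto

text \<open>An unbounded column over a cubic cell: the coordinate along \<open>b0\<close> is free,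
  so membership is shared by all points of a line parallel to \<open>b0\<close>.\<close>

definition cell0 :: "'a::euclidean_space \<Rightarrow> real \<Rightarrow> 'a \<Rightarrow> 'a set" where
  "cell0 b0 R m = {z. \<forall>b\<in>Basis - {b0}. m \<bullet> b \<le> z \<bullet> b \<and> z \<bullet> b < m \<bullet> b + R}"

definition lfl0 :: "'a::euclidean_space \<Rightarrow> real \<Rightarrow> 'a \<Rightarrow> 'a" where
  "lfl0 b0 R z = lfl (colvec b0 R 1) (perp b0 z)"

lemma lfl0_plat0: "b0 \<in> Basis \<Longrightarrow> lfl0 b0 R z \<in> plat0 b0 R"
  unfolding plat0_def lfl0_def by (simp add: lfl_plat lfl_inner perp_inner)

text \<open>The columns partition the space: the column of a point is found by rounding its
  projection along \<open>b0\<close> to the lattice.\<close>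

lemma cell0_iff:
  assumes "b0 \<in> Basis" "R > 0" "m \<in> plat0 b0 R"
  shows "z \<in> cell0 b0 R m \<longleftrightarrow> m = lfl0 b0 R z"
proof -
  have L: "\<And>b. b \<in> Basis \<Longrightarrow> colvec b0 R 1 \<bullet> b > 0" using assms by (simp add: colvec_pos)
  have "z \<in> cell0 b0 R m \<longleftrightarrow> perp b0 z - m \<in> hbox (colvec b0 R 1)"
    using assms by (auto simp: cell0_def hbox_def inner_diff_left perp_inner colvec_inner plat0_def split: if_splits)
      (smt (verit, best) DiffI singletonD)+
  also have "\<dots> \<longleftrightarrow> m = lfl0 b0 R z"
    using assms lfl_unique[OF L, of m "perp b0 z"] diff_lfl_hbox[OF L, of "perp b0 z"] by (auto simp: lfl0_def plat0_def)
  finally show ?thesis .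
qed

lemma cell0_close:
  fixes b0 u v :: "'a::euclidean_space"
  assumes b0: "b0 \<in> Basis" and R: "R > 0" and "u \<in> cell0 b0 R m" "v \<in> cell0 b0 R m"
  shows "norm (perp b0 u - perp b0 v) \<le> real (DIM('a)) * R"
proof -
  have "norm (perp b0 u - perp b0 v) \<le> (\<Sum>b\<in>Basis. \<bar>(perp b0 u - perp b0 v) \<bullet> b\<bar>)" by (rule norm_le_l1)
  also have "\<dots> \<le> (\<Sum>b\<in>(Basis::'a set). R)"
  proof (rule sum_mono)
    fix b :: 'a assume b: "b \<in> Basis"
    show "\<bar>(perp b0 u - perp b0 v) \<bullet> b\<bar> \<le> R"
    proof (cases "b = b0")
      case True then show ?thesis using b0 R by (simp add: inner_diff_left perp_inner)
    next
      case False
      then have "m \<bullet> b \<le> u \<bullet> b" "u \<bullet> b < m \<bullet> b + R" "m \<bullet> b \<le> v \<bullet> b" "v \<bullet> b < m \<bullet> b + R"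
        using assms b by (auto simp: cell0_def)
      then show ?thesis using b0 b False by (simp add: inner_diff_left perp_inner abs_le_iff)
    qed
  qed
  finally show ?thesis by simp
qed

text \<open>Half the length of the chord cut from the ball by the line through \<open>p\<close> in
  the unit direction \<open>b0\<close>; the clamp at 0 covers lines that miss the ball.\<close>

definition chord :: "'a::euclidean_space \<Rightarrow> 'a \<Rightarrow> 'a \<Rightarrow> real \<Rightarrow> real" where
  "chord b0 p x a = sqrt (max 0 (a\<^sup>2 - (norm (perp b0 p - perp b0 x))\<^sup>2))"

lemma norm_perp_split:
  assumes "norm b0 = 1"
  shows "(norm z)\<^sup>2 = (norm (perp b0 z))\<^sup>2 + (z \<bullet> b0)\<^sup>2"
proof -
  have "b0 \<bullet> b0 = 1" using assms by (simp add: norm_eq_1)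
  then show ?thesis
    unfolding perp_def power2_norm_eq_inner
    by (simp add: inner_diff_left inner_diff_right inner_commute power2_eq_square)
qed

lemma perp_diff: "perp b0 (x - y) = perp b0 x - perp b0 y"
  by (simp add: perp_def inner_diff_left algebra_simps)

lemma mem_cball_column:
  assumes "norm b0 = 1" "a \<ge> 0"
  shows "z \<in> cball x a \<longleftrightarrow> (norm (perp b0 z - perp b0 x))\<^sup>2 + (z \<bullet> b0 - x \<bullet> b0)\<^sup>2 \<le> a\<^sup>2"
proof -
  have "z \<in> cball x a \<longleftrightarrow> norm (z - x) \<le> a" by (simp add: dist_norm norm_minus_commute)
  also have "\<dots> \<longleftrightarrow> (norm (z - x))\<^sup>2 \<le> a\<^sup>2" using assms(2) by (simp add: abs_le_square_iff[symmetric])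
  finally show ?thesis
    using norm_perp_split[OF assms(1), of "z - x"] by (simp add: perp_diff inner_diff_left)
qed

lemma line_through_perp:
  "line_through p b0 = {perp b0 p + s *\<^sub>R b0 | s. True}"
proof -
  have "p + t *\<^sub>R b0 = perp b0 p + (t + p \<bullet> b0) *\<^sub>R b0" for t by (simp add: perp_def algebra_simps)
  moreover have "perp b0 p + s *\<^sub>R b0 = p + (s - p \<bullet> b0) *\<^sub>R b0" for s by (simp add: perp_def algebra_simps)
  ultimately show ?thesis unfolding line_through_def by (simp only: image_def) blast
qed

lemma line_Int_cball:
  assumes b0: "norm b0 = 1" and a: "a \<ge> 0"
  shows "line_through p b0 \<inter> cball x a =
    (if norm (perp b0 p - perp b0 x) \<le> a
     then (\<lambda>s. perp b0 p + s *\<^sub>R b0) ` {x \<bullet> b0 - chord b0 p x a .. x \<bullet> b0 + chord b0 p x a} else {})"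
proof -
  let ?r = "norm (perp b0 p - perp b0 x)"
  have in_ball: "perp b0 p + s *\<^sub>R b0 \<in> cball x a \<longleftrightarrow> ?r\<^sup>2 + (s - x \<bullet> b0)\<^sup>2 \<le> a\<^sup>2" for s
  proof -
    have bb: "b0 \<bullet> b0 = 1" using b0 by (simp add: norm_eq_1)
    have "perp b0 (perp b0 p + s *\<^sub>R b0) = perp b0 p" "(perp b0 p + s *\<^sub>R b0) \<bullet> b0 = s"
      by (simp_all add: perp_def inner_diff_left inner_add_left bb)
    then show ?thesis by (simp only: mem_cball_column[OF b0 a])
  qed
  show ?thesis
  proof (cases "?r \<le> a")
    case True
    then have "?r\<^sup>2 \<le> a\<^sup>2" by (intro power_mono) auto
    then have c: "(chord b0 p x a)\<^sup>2 = a\<^sup>2 - ?r\<^sup>2" by (simp add: chord_def)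
    have c0: "chord b0 p x a \<ge> 0" by (simp add: chord_def)
    have "?r\<^sup>2 + (s - x \<bullet> b0)\<^sup>2 \<le> a\<^sup>2 \<longleftrightarrow> s \<in> {x \<bullet> b0 - chord b0 p x a .. x \<bullet> b0 + chord b0 p x a}" for s
    proof -
      have "?r\<^sup>2 + (s - x \<bullet> b0)\<^sup>2 \<le> a\<^sup>2 \<longleftrightarrow> (s - x \<bullet> b0)\<^sup>2 \<le> (chord b0 p x a)\<^sup>2" using c by auto
      also have "\<dots> \<longleftrightarrow> \<bar>s - x \<bullet> b0\<bar> \<le> chord b0 p x a" using c0 by (simp add: abs_le_square_iff[symmetric])
      finally show ?thesis by auto
    qed
    then have "perp b0 p + s *\<^sub>R b0 \<in> cball x a \<longleftrightarrow> s \<in> {x \<bullet> b0 - chord b0 p x a .. x \<bullet> b0 + chord b0 p x a}" for s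
      by (simp only: in_ball)
    then show ?thesis using True unfolding line_through_perp[of p b0] by (simp only: if_True) blast
  next
    case False
    then have "?r\<^sup>2 > a\<^sup>2" using a by (intro power_strict_mono) auto
    then have "\<not> (?r\<^sup>2 + (s - x \<bullet> b0)\<^sup>2 \<le> a\<^sup>2)" for s
      using zero_le_power2[of "s - x \<bullet> b0"] by linarith
    then have "perp b0 p + s *\<^sub>R b0 \<notin> cball x a" for s by (simp only: in_ball not_False_eq_True)
    then show ?thesis using False unfolding line_through_perp[of p b0] by (simp only: if_False) blast
  qed
qed

lemma diameter_line_Int_cball:
  assumes b0: "norm b0 = 1" and a: "a \<ge> 0"
  shows "diameter (line_through p b0 \<inter> cball x a) = 2 * chord b0 p x a"
proof (cases "norm (perp b0 p - perp b0 x) \<le> a")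
  case True
  let ?c = "chord b0 p x a"
  have c0: "?c \<ge> 0" by (simp add: chord_def)
  let ?f = "\<lambda>s. perp b0 p + s *\<^sub>R b0"
  have d: "dist (?f s) (?f t) = \<bar>s - t\<bar>" for s t
    using b0 by (simp add: dist_norm scaleR_diff_left[symmetric])
  have eq: "line_through p b0 \<inter> cball x a = ?f ` {x \<bullet> b0 - ?c .. x \<bullet> b0 + ?c}"
    using line_Int_cball[OF b0 a] True by simp
  show ?thesis
  proof (rule antisym)
    show "diameter (line_through p b0 \<inter> cball x a) \<le> 2 * ?c"
      unfolding eq
    proof (rule diameter_le)
      fix u v assume "u \<in> ?f ` {x \<bullet> b0 - ?c .. x \<bullet> b0 + ?c}" "v \<in> ?f ` {x \<bullet> b0 - ?c .. x \<bullet> b0 + ?c}"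
      then obtain s t where "u = ?f s" "v = ?f t" "s \<in> {x \<bullet> b0 - ?c .. x \<bullet> b0 + ?c}" "t \<in> {x \<bullet> b0 - ?c .. x \<bullet> b0 + ?c}" by blast
      then show "norm (u - v) \<le> 2 * ?c" using d[of s t] by (simp add: dist_norm abs_le_iff)
    qed (use c0 in simp)
    have "dist (?f (x \<bullet> b0 - ?c)) (?f (x \<bullet> b0 + ?c)) \<le> diameter (line_through p b0 \<inter> cball x a)"
    proof (rule diameter_bounded_bound)
      show "bounded (line_through p b0 \<inter> cball x a)" by (simp add: bounded_Int)
      show "?f (x \<bullet> b0 - ?c) \<in> line_through p b0 \<inter> cball x a" "?f (x \<bullet> b0 + ?c) \<in> line_through p b0 \<inter> cball x a"
        unfolding eq using c0 by (auto intro!: imageI)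
    qed
    then show "2 * ?c \<le> diameter (line_through p b0 \<inter> cball x a)" unfolding d using c0 by simp
  qed
next
  case False
  then have "a\<^sup>2 < (norm (perp b0 p - perp b0 x))\<^sup>2" using a by (intro power_strict_mono) auto
  then show ?thesis using line_Int_cball[OF b0 a] False by (simp add: chord_def)
qed

text \<open>One line per column. Thickening each chord to the full cross-section of its column, of
  volume \<open>R ^ (DIM('a) - 1)\<close>, gives disjoint pieces \<open>E m\<close> whose volumes
  are the weighted chord lengths. A point of a column is within \<open>c\<close> of the line point
  at the same height, so the union of the pieces lies between the balls of radii
  \<open>a - c\<close> and \<open>a + c\<close>.\<close>

lemma cell_sum_sandwich:
  fixes y :: "'a::euclidean_space \<Rightarrow> 'a"
  assumes b0: "b0 \<in> Basis" and R: "R > 0" and a: "a \<ge> 0"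
    and y: "\<And>m. m \<in> plat0 b0 R \<Longrightarrow> y m \<in> cell0 b0 R m"
  defines "c \<equiv> real (DIM('a)) * R"
  shows "ennreal (R ^ (DIM('a) - 1)) * (\<Sum>\<^sub>\<infinity>m\<in>plat0 b0 R. ennreal (diameter (line_through (y m) b0 \<inter> cball x a))) \<le> emeasure lborel (cball x (a + c))"
    and "emeasure lborel (cball x (a - c)) \<le> ennreal (R ^ (DIM('a) - 1)) * (\<Sum>\<^sub>\<infinity>m\<in>plat0 b0 R. ennreal (diameter (line_through (y m) b0 \<inter> cball x a)))"
proof -
  have nb: "norm b0 = 1" using b0 by simp
  have bb: "b0 \<bullet> b0 = 1" using b0 by simp
  define J where "J m = {s. perp b0 (y m) + s *\<^sub>R b0 \<in> cball x a}" for m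
  have Jeq: "J m = (if norm (perp b0 (y m) - perp b0 x) \<le> a then {x \<bullet> b0 - chord b0 (y m) x a .. x \<bullet> b0 + chord b0 (y m) x a} else {})" for m
  proof -
    have "s \<in> J m \<longleftrightarrow> perp b0 (y m) + s *\<^sub>R b0 \<in> line_through (y m) b0 \<inter> cball x a" for s
      unfolding J_def line_through_perp[of "y m" b0] by auto
    moreover have im: "perp b0 (y m) + s *\<^sub>R b0 \<in> (\<lambda>s. perp b0 (y m) + s *\<^sub>R b0) ` I \<longleftrightarrow> s \<in> I" for s I
    proof -
      have "inj (\<lambda>s. perp b0 (y m) + s *\<^sub>R b0)" using nb by (auto simp: inj_def)
      from inj_image_mem_iff[OF this, of s I] show ?thesis .
    qed
    ultimately have "s \<in> J m \<longleftrightarrow> s \<in> (if norm (perp b0 (y m) - perp b0 x) \<le> a then {x \<bullet> b0 - chord b0 (y m) x a .. x \<bullet> b0 + chord b0 (y m) x a} else {})" for s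
      unfolding line_Int_cball[OF nb a] by (cases "norm (perp b0 (y m) - perp b0 x) \<le> a") (simp_all only: im if_True if_False empty_iff)
    then show ?thesis by blast
  qed
  have Jm: "J m \<in> sets borel" for m unfolding Jeq by simp
  have Jlen: "emeasure lborel (J m) = ennreal (diameter (line_through (y m) b0 \<inter> cball x a))" for m
  proof (cases "norm (perp b0 (y m) - perp b0 x) \<le> a")
    case True
    have "chord b0 (y m) x a \<ge> 0" by (simp add: chord_def)
    then show ?thesis using True by (simp add: Jeq diameter_line_Int_cball[OF nb a])
  next
    case False
    then show ?thesis by (simp add: Jeq line_Int_cball[OF nb a])
  qed
  define E where "E m = {z \<in> cell0 b0 R m. z \<bullet> b0 \<in> J m}" for m
  have ind: "indicator (E m) z = (\<Prod>b\<in>Basis. indicator (if b = b0 then J m else {m \<bullet> b ..< m \<bullet> b + R}) (z \<bullet> b) :: ennreal)" for m z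
  proof (cases "z \<in> E m")
    case True
    then show ?thesis by (auto simp: E_def cell0_def intro!: prod.neutral[symmetric])
  next
    case False
    then have "\<exists>b\<in>Basis. indicator (if b = b0 then J m else {m \<bullet> b ..< m \<bullet> b + R}) (z \<bullet> b) = (0::ennreal)"
      using b0 by (auto simp: E_def cell0_def indicator_def)
    then show ?thesis using False by (simp add: prod_zero)
  qed
  have Em: "E m \<in> sets borel" for m
  proof -
    have "(\<lambda>z::'a. (\<Prod>b\<in>Basis. indicator (if b = b0 then J m else {m \<bullet> b ..< m \<bullet> b + R}) (z \<bullet> b) :: ennreal)) \<in> borel_measurable borel"
      using Jm by (intro borel_measurable_prod_ennreal) (auto intro!: measurable_compose[OF _ borel_measurable_indicator])
    then have "(indicator (E m) :: 'a \<Rightarrow> ennreal) \<in> borel_measurable borel" unfolding ind[abs_def, symmetric] by simp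
    then show ?thesis by (simp add: borel_measurable_indicator_iff)
  qed
  have Ev: "emeasure lborel (E m) = ennreal (R ^ (DIM('a) - 1)) * ennreal (diameter (line_through (y m) b0 \<inter> cball x a))" for m
  proof -
    have "emeasure lborel (E m) = (\<integral>\<^sup>+z. indicator (E m) z \<partial>lborel)" using Em by simp
    also have "\<dots> = (\<Prod>b\<in>(Basis::'a set). (\<integral>\<^sup>+t. indicator (if b = b0 then J m else {m \<bullet> b ..< m \<bullet> b + R}) t \<partial>lborel))"
      unfolding ind using Jm by (subst nn_integral_lborel_prod) auto
    also have "\<dots> = (\<Prod>b\<in>(Basis::'a set). if b = b0 then emeasure lborel (J m) else ennreal R)"
      using Jm R by (intro prod.cong) auto
    also have "\<dots> = emeasure lborel (J m) * ennreal R ^ (DIM('a) - 1)"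
      using b0 by (simp add: prod.remove[of Basis b0] card_Diff_singleton)
    finally show ?thesis using R by (simp add: Jlen ennreal_power mult.commute)
  qed
  define U where "U = (\<Union>m\<in>plat0 b0 R. E m)"
  have disj: "disjoint_family_on E (plat0 b0 R)"
    unfolding disjoint_family_on_def using cell0_iff[OF b0 R] by (auto simp: E_def)
  have "emeasure lborel U = (\<integral>\<^sup>+m. emeasure lborel (E m) \<partial>count_space (plat0 b0 R))"
    unfolding U_def by (rule emeasure_UN_countable) (use Em disj countable_plat0 in auto)
  also have "\<dots> = (\<integral>\<^sup>+m. ennreal (R ^ (DIM('a) - 1)) * ennreal (diameter (line_through (y m) b0 \<inter> cball x a)) \<partial>count_space (plat0 b0 R))"
    unfolding Ev ..
  also have "\<dots> = ennreal (R ^ (DIM('a) - 1)) * (\<integral>\<^sup>+m. ennreal (diameter (line_through (y m) b0 \<inter> cball x a)) \<partial>count_space (plat0 b0 R))"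
    by (rule nn_integral_cmult) simp
  also have "\<dots> = ennreal (R ^ (DIM('a) - 1)) * (\<Sum>\<^sub>\<infinity>m\<in>plat0 b0 R. ennreal (diameter (line_through (y m) b0 \<inter> cball x a)))"
    by (simp add: nn_integral_count_space_eq_infsum[OF countable_plat0])
  finally have U: "emeasure lborel U = ennreal (R ^ (DIM('a) - 1)) * (\<Sum>\<^sub>\<infinity>m\<in>plat0 b0 R. ennreal (diameter (line_through (y m) b0 \<inter> cball x a)))" .
  have Ub: "U \<in> sets borel" unfolding U_def using Em countable_plat0 by (intro sets.countable_UN') auto
  have near: "dist z (perp b0 (y m) + (z \<bullet> b0) *\<^sub>R b0) \<le> c" if "m \<in> plat0 b0 R" "z \<in> cell0 b0 R m" for z m
  proof -
    have "z - (perp b0 (y m) + (z \<bullet> b0) *\<^sub>R b0) = perp b0 z - perp b0 (y m)" by (simp add: perp_def)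
    then show ?thesis using cell0_close[OF b0 R that(2) y[OF that(1)]] by (simp only: dist_norm c_def)
  qed
  have "U \<subseteq> cball x (a + c)"
  proof
    fix z assume "z \<in> U"
    then obtain m where m: "m \<in> plat0 b0 R" "z \<in> cell0 b0 R m" "perp b0 (y m) + (z \<bullet> b0) *\<^sub>R b0 \<in> cball x a"
      by (auto simp: U_def E_def J_def)
    have "dist x z \<le> dist x (perp b0 (y m) + (z \<bullet> b0) *\<^sub>R b0) + dist z (perp b0 (y m) + (z \<bullet> b0) *\<^sub>R b0)"
      by (rule dist_triangle2)
    then show "z \<in> cball x (a + c)" using near[OF m(1,2)] m(3) by simp
  qed
  then have "emeasure lborel U \<le> emeasure lborel (cball x (a + c))" by (intro emeasure_mono) auto
  then show "ennreal (R ^ (DIM('a) - 1)) * (\<Sum>\<^sub>\<infinity>m\<in>plat0 b0 R. ennreal (diameter (line_through (y m) b0 \<inter> cball x a))) \<le> emeasure lborel (cball x (a + c))"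
    by (simp only: U)
  have "cball x (a - c) \<subseteq> U"
  proof
    fix z assume z: "z \<in> cball x (a - c)"
    let ?m = "lfl0 b0 R z"
    have m: "?m \<in> plat0 b0 R" "z \<in> cell0 b0 R ?m" using cell0_iff[OF b0 R lfl0_plat0[OF b0]] lfl0_plat0[OF b0] by auto
    have "dist x (perp b0 (y ?m) + (z \<bullet> b0) *\<^sub>R b0) \<le> dist x z + dist z (perp b0 (y ?m) + (z \<bullet> b0) *\<^sub>R b0)"
      by (rule dist_triangle)
    then have "perp b0 (y ?m) + (z \<bullet> b0) *\<^sub>R b0 \<in> cball x a" using near[OF m] z by simp
    then show "z \<in> U" using m by (auto simp: U_def E_def J_def)
  qed
  then have "emeasure lborel (cball x (a - c)) \<le> emeasure lborel U" using Ub by (intro emeasure_mono) auto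
  then show "emeasure lborel (cball x (a - c)) \<le> ennreal (R ^ (DIM('a) - 1)) * (\<Sum>\<^sub>\<infinity>m\<in>plat0 b0 R. ennreal (diameter (line_through (y m) b0 \<inter> cball x a)))"
    by (simp only: U)
qed

section \<open>Path density of finitely many families with one line per column\<close>

lemma arc_mass_mono: "P \<subseteq> Q \<Longrightarrow> arc_mass P a x \<le> arc_mass Q a x"
  unfolding arc_mass_def by (intro infsum_mono_neutral nonneg_summable_on_complete) auto

lemma has_sum_finite_families:
  fixes F :: "'c \<Rightarrow> 'b::{topological_comm_monoid_add, t2_space}"
  assumes "finite J" and "inj_on (\<lambda>(j, m). l j m) (J \<times> A)"
    and "\<And>j. j \<in> J \<Longrightarrow> ((\<lambda>m. F (l j m)) has_sum s j) A"
  shows "(F has_sum (\<Sum>j\<in>J. s j)) ((\<lambda>(j, m). l j m) ` (J \<times> A))"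
  using assms
proof (induction J rule: finite_induct)
  case empty then show ?case by simp
next
  case (insert i J)
  have sub: "inj_on (\<lambda>(j, m). l j m) (J \<times> A)"
    using insert.prems(1) by (rule inj_on_subset) auto
  have inji: "inj_on (l i) A"
  proof (rule inj_onI)
    fix u v assume "u \<in> A" "v \<in> A" "l i u = l i v"
    then show "u = v" using inj_onD[OF insert.prems(1), of "(i, u)" "(i, v)"] by auto
  qed
  have "(F has_sum s i) (l i ` A)"
    using insert.prems(2)[of i] by (subst has_sum_reindex[OF inji]) (simp add: comp_def)
  moreover have "(F has_sum (\<Sum>j\<in>J. s j)) ((\<lambda>(j, m). l j m) ` (J \<times> A))"
    using insert.IH[OF sub] insert.prems(2) by simp
  moreover have "l i ` A \<inter> (\<lambda>(j, m). l j m) ` (J \<times> A) = {}"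
  proof (rule equals0I)
    fix z assume "z \<in> l i ` A \<inter> (\<lambda>(j, m). l j m) ` (J \<times> A)"
    then have z: "z \<in> l i ` A" "z \<in> (\<lambda>(j, m). l j m) ` (J \<times> A)" by simp_all
    obtain u where u: "z = l i u" "u \<in> A" using z(1) by blast
    obtain j v where "z = l j v" "j \<in> J" "v \<in> A" using z(2) by (force simp: image_iff)
    with u show False using inj_onD[OF insert.prems(1), of "(i, u)" "(j, v)"] insert.hyps by auto
  qed
  ultimately have "(F has_sum (s i + (\<Sum>j\<in>J. s j))) (l i ` A \<union> (\<lambda>(j, m). l j m) ` (J \<times> A))"
    by (rule has_sum_Un_disjoint)
  moreover have "l i ` A \<union> (\<lambda>(j, m). l j m) ` (J \<times> A) = (\<lambda>(j, m). l j m) ` (insert i J \<times> A)" by auto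
  ultimately show ?case using insert.hyps by simp
qed

lemma arc_mass_families:
  assumes fin: "finite J" and inj: "inj_on (\<lambda>(j, m). l j m) (J \<times> A)"
  shows "arc_mass ((\<lambda>(j, m). l j m) ` (J \<times> A)) a x = (\<Sum>j\<in>J. \<Sum>\<^sub>\<infinity>m\<in>A. ennreal (diameter (l j m \<inter> cball x a)))"
  unfolding arc_mass_def
  by (intro infsumI has_sum_finite_families[OF fin inj] has_sum_infsum nonneg_summable_on_complete) auto

lemma emeasure_cball_ratio:
  fixes x :: "'a::euclidean_space"
  assumes "r \<ge> 0" "a > 0"
  shows "emeasure lborel (cball x r) / ennreal (measure lebesgue (cball (0::'a) a)) = ennreal ((r / a) ^ DIM('a))"
proof -
  have "emeasure lborel (cball x r) = ennreal (measure lebesgue (cball x r))"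
    using emeasure_lborel_cball_finite[of x r] by (simp add: emeasure_eq_ennreal_measure)
  moreover have "unit_ball_vol (real DIM('a)) \<noteq> 0"
    using unit_ball_vol_pos[OF of_nat_0_le_iff[of "DIM('a)"]] by (metis less_irrefl)
  ultimately show ?thesis using assms
    by (simp add: content_cball divide_ennreal power_divide)
qed

lemma tendsto_shifted_ratio: "((\<lambda>a. ((a + c) / a) ^ n) \<longlongrightarrow> 1) (at_top::real filter)"
proof -
  have "((\<lambda>a. c / a) \<longlongrightarrow> 0) (at_top::real filter)"
    by (rule real_tendsto_divide_at_top[OF tendsto_const filterlim_ident])
  then have "((\<lambda>a. (1 + c / a) ^ n) \<longlongrightarrow> (1 + 0) ^ n) (at_top::real filter)"
    by (intro tendsto_intros)
  moreover have "\<forall>\<^sub>F a in (at_top::real filter). (1 + c / a) ^ n = ((a + c) / a) ^ n"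
    using eventually_gt_at_top[of 0] by eventually_elim (simp add: field_simps)
  ultimately show ?thesis using tendsto_cong[of "\<lambda>a. (1 + c / a) ^ n" "\<lambda>a. ((a + c) / a) ^ n" at_top 1] by simp
qed

text \<open>Each of the \<open>N\<close> families contributes \<open>1 / R ^ (DIM('a) - 1)\<close>
  in the limit, since changing the radius by \<open>c\<close> is negligible. The lower bound is
  stated for all supersets \<open>Q\<close> because in an arbitrary set of lines only a selected
  part will be arranged in this way.\<close>

lemma family_density:
  fixes y :: "nat \<Rightarrow> 'a::euclidean_space \<Rightarrow> 'a"
  assumes b0: "b0 \<in> Basis" and R: "R > 0"
    and y: "\<And>j m. j < N \<Longrightarrow> m \<in> plat0 b0 R \<Longrightarrow> y j m \<in> cell0 b0 R m"
    and inj: "inj_on (\<lambda>(j, m). line_through (y j m) b0) ({..<N} \<times> plat0 b0 R)"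
  defines "P \<equiv> (\<lambda>(j, m). line_through (y j m) b0) ` ({..<N} \<times> plat0 b0 R)"
  shows "\<And>Q. P \<subseteq> Q \<Longrightarrow> ennreal (real N / R ^ (DIM('a) - 1)) \<le> lower_path_density Q"
    and "upper_path_density P \<le> ennreal (real N / R ^ (DIM('a) - 1))"
proof -
  let ?n = "DIM('a) - 1" and ?d = "DIM('a)"
  define c where "c = real ?d * R"
  have c0: "c > 0" using R by (simp add: c_def)
  have Rn: "R ^ ?n > 0" using R by simp
  let ?A = "\<lambda>j a x. \<Sum>\<^sub>\<infinity>m\<in>plat0 b0 R. ennreal (diameter (line_through (y j m) b0 \<inter> cball x a))"
  have am: "arc_mass P a x = (\<Sum>j<N. ?A j a x)" for a x
    unfolding P_def by (rule arc_mass_families[OF _ inj]) simp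
  have Reck: "ennreal (1 / R ^ ?n) * (ennreal (R ^ ?n) * u) = u" for u
    using Rn R by (simp add: mult.assoc[symmetric] ennreal_mult[symmetric])
  have up: "arc_mass P a x \<le> ennreal (real N / R ^ ?n) * emeasure lborel (cball x (a + c))" if "a \<ge> 0" for a x
  proof -
    have "?A j a x \<le> ennreal (1 / R ^ ?n) * emeasure lborel (cball x (a + c))" if "j < N" for j
    proof -
      have "ennreal (R ^ ?n) * ?A j a x \<le> emeasure lborel (cball x (a + c))"
        unfolding c_def using y[OF that] by (intro cell_sum_sandwich(1)[OF b0 R \<open>a \<ge> 0\<close>])
      from mult_left_mono[OF this, of "ennreal (1 / R ^ ?n)"] show ?thesis by (simp only: Reck) simp
    qed
    then have "arc_mass P a x \<le> (\<Sum>j<N. ennreal (1 / R ^ ?n) * emeasure lborel (cball x (a + c)))"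
      unfolding am by (intro sum_mono) auto
    also have "\<dots> = ennreal (real N / R ^ ?n) * emeasure lborel (cball x (a + c))"
      using Rn by (simp add: ennreal_of_nat_eq_real_of_nat ennreal_mult[symmetric] mult.assoc[symmetric])
    finally show ?thesis .
  qed
  have lo: "ennreal (real N / R ^ ?n) * emeasure lborel (cball x (a - c)) \<le> arc_mass P a x" if "a \<ge> 0" for a x
  proof -
    have "ennreal (1 / R ^ ?n) * emeasure lborel (cball x (a - c)) \<le> ?A j a x" if "j < N" for j
    proof -
      have "emeasure lborel (cball x (a - c)) \<le> ennreal (R ^ ?n) * ?A j a x"
        unfolding c_def using y[OF that] by (intro cell_sum_sandwich(2)[OF b0 R \<open>a \<ge> 0\<close>])
      from mult_left_mono[OF this, of "ennreal (1 / R ^ ?n)"] show ?thesis by (simp only: Reck) simp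
    qed
    then have "(\<Sum>j<N. ennreal (1 / R ^ ?n) * emeasure lborel (cball x (a - c))) \<le> arc_mass P a x"
      unfolding am by (intro sum_mono) auto
    moreover have "(\<Sum>j<N. ennreal (1 / R ^ ?n) * emeasure lborel (cball x (a - c))) = ennreal (real N / R ^ ?n) * emeasure lborel (cball x (a - c))"
      using Rn by (simp add: ennreal_of_nat_eq_real_of_nat ennreal_mult[symmetric] mult.assoc[symmetric])
    ultimately show ?thesis by simp
  qed
  have lim: "((\<lambda>a. ennreal (real N / R ^ ?n) * ennreal (((a + e) / a) ^ ?d)) \<longlongrightarrow> ennreal (real N / R ^ ?n) * ennreal 1) at_top" for e
    by (intro ennreal_tendsto_cmult tendsto_ennrealI tendsto_shifted_ratio) simp
  show "upper_path_density P \<le> ennreal (real N / R ^ ?n)"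
  proof -
    have "upper_path_density P \<le> Limsup at_top (\<lambda>a. ennreal (real N / R ^ ?n) * ennreal (((a + c) / a) ^ ?d))"
      unfolding upper_path_density_def
    proof (rule Limsup_mono, rule eventually_mono[OF eventually_gt_at_top[of 0]], rule SUP_least)
      fix a :: real and x :: 'a assume a: "a > 0"
      have "arc_mass P a x / ennreal (measure lebesgue (cball (0::'a) a))
          \<le> ennreal (real N / R ^ ?n) * emeasure lborel (cball x (a + c)) / ennreal (measure lebesgue (cball (0::'a) a))"
        using up[of a x] a by (intro divide_right_mono_ennreal) auto
      also have "\<dots> = ennreal (real N / R ^ ?n) * (emeasure lborel (cball x (a + c)) / ennreal (measure lebesgue (cball (0::'a) a)))"
        by (simp add: divide_ennreal_def mult.assoc)
      also have "\<dots> = ennreal (real N / R ^ ?n) * ennreal (((a + c) / a) ^ ?d)"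
        using a c0 by (subst emeasure_cball_ratio) auto
      finally show "arc_mass P a x / ennreal (measure lebesgue (cball (0::'a) a)) \<le> ennreal (real N / R ^ ?n) * ennreal (((a + c) / a) ^ ?d)" .
    qed
    also have "\<dots> = ennreal (real N / R ^ ?n) * ennreal 1"
      by (rule lim_imp_Limsup[OF _ lim]) simp
    finally show ?thesis by simp
  qed
  fix Q assume Q: "P \<subseteq> Q"
  have "ennreal (real N / R ^ ?n) * ennreal 1 = Liminf at_top (\<lambda>a. ennreal (real N / R ^ ?n) * ennreal (((a + - c) / a) ^ ?d))"
    by (rule lim_imp_Liminf[OF _ lim, symmetric]) simp
  also have "\<dots> \<le> lower_path_density Q"
    unfolding lower_path_density_def
  proof (rule Liminf_mono, rule eventually_mono[OF eventually_gt_at_top[of c]], rule INF_greatest)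
    fix a :: real and x :: 'a assume a: "a > c"
    have "ennreal (real N / R ^ ?n) * ennreal (((a + - c) / a) ^ ?d)
       = ennreal (real N / R ^ ?n) * (emeasure lborel (cball x (a - c)) / ennreal (measure lebesgue (cball (0::'a) a)))"
      using a c0 by (subst emeasure_cball_ratio) auto
    also have "\<dots> = ennreal (real N / R ^ ?n) * emeasure lborel (cball x (a - c)) / ennreal (measure lebesgue (cball (0::'a) a))"
      by (simp add: divide_ennreal_def mult.assoc)
    also have "\<dots> \<le> arc_mass Q a x / ennreal (measure lebesgue (cball (0::'a) a))"
      using order_trans[OF lo[of a x] arc_mass_mono[OF Q, of a x]] a c0 by (intro divide_right_mono_ennreal) auto
    finally show "ennreal (real N / R ^ ?n) * ennreal (((a + - c) / a) ^ ?d) \<le> arc_mass Q a x / ennreal (measure lebesgue (cball (0::'a) a))" .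
  qed
  finally show "ennreal (real N / R ^ ?n) \<le> lower_path_density Q" by simp
qed

subsection \<open>Slices of symmetric convex bodies\<close>

text \<open>The slice of \<open>K\<close> at height \<open>\<tau>\<close>, moved to height 0 and
  thickened to unit height as in \<open>section_vol\<close>; thus all slices are compared through
  full-dimensional measure.\<close>

definition cyl :: "'a::euclidean_space \<Rightarrow> 'a set \<Rightarrow> real \<Rightarrow> 'a set" where
  "cyl b0 K \<tau> = {z. perp b0 z + \<tau> *\<^sub>R b0 \<in> K \<and> z \<bullet> b0 \<in> {0..1}}"

lemma section_vol_cyl:
  assumes "norm b0 = 1"
  shows "section_vol S b0 = measure lebesgue (cyl b0 S 0)"
proof -
  have bb: "b0 \<bullet> b0 = 1" using assms by (simp add: norm_eq_1)
  have "{y + t *\<^sub>R (b0 /\<^sub>R norm b0) | y t. y \<in> S \<and> y \<bullet> b0 = 0 \<and> t \<in> {0..1}} = cyl b0 S 0"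
  proof (intro equalityI subsetI)
    fix z assume "z \<in> {y + t *\<^sub>R (b0 /\<^sub>R norm b0) | y t. y \<in> S \<and> y \<bullet> b0 = 0 \<and> t \<in> {0..1}}"
    then obtain y t where yt: "z = y + t *\<^sub>R (b0 /\<^sub>R norm b0)" "y \<in> S" "y \<bullet> b0 = 0" "t \<in> {0..1}" by blast
    then have "perp b0 z = y" "z \<bullet> b0 = t" using assms bb by (simp_all add: perp_def inner_add_left)
    then show "z \<in> cyl b0 S 0" using yt by (simp add: cyl_def)
  next
    fix z assume z: "z \<in> cyl b0 S 0"
    have "z = perp b0 z + (z \<bullet> b0) *\<^sub>R (b0 /\<^sub>R norm b0)" using assms by (simp add: perp_def)
    then show "z \<in> {y + t *\<^sub>R (b0 /\<^sub>R norm b0) | y t. y \<in> S \<and> y \<bullet> b0 = 0 \<and> t \<in> {0..1}}"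
      using z perp_inner_self[OF assms, of z] by (auto simp: cyl_def)
  qed
  then show ?thesis by (simp add: section_vol_def)
qed

lemma continuous_on_perp [continuous_intros]: "continuous_on A f \<Longrightarrow> continuous_on A (\<lambda>x. perp b0 (f x))"
  unfolding perp_def by (intro continuous_intros)

lemma compact_cyl:
  assumes "compact K"
  shows "compact (cyl b0 K \<tau>)"
proof -
  have "closed ((\<lambda>z. perp b0 z + \<tau> *\<^sub>R b0) -` K \<inter> (\<lambda>z. z \<bullet> b0) -` {0..1})"
    using assms by (intro closed_Int closed_vimage compact_imp_closed continuous_intros) auto
  moreover have "(\<lambda>z. perp b0 z + \<tau> *\<^sub>R b0) -` K \<inter> (\<lambda>z. z \<bullet> b0) -` {0..1} = cyl b0 K \<tau>"
    by (auto simp: cyl_def)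
  moreover obtain B where B: "\<And>x. x \<in> K \<Longrightarrow> norm x \<le> B" using compact_imp_bounded[OF assms] by (auto simp: bounded_iff)
  have "norm z \<le> B + \<bar>\<tau>\<bar> * norm b0 + norm b0" if "z \<in> cyl b0 K \<tau>" for z
  proof -
    have "z = (perp b0 z + \<tau> *\<^sub>R b0) + (- \<tau> *\<^sub>R b0) + (z \<bullet> b0) *\<^sub>R b0" by (simp add: perp_def)
    then have "norm z \<le> norm (perp b0 z + \<tau> *\<^sub>R b0) + norm (- \<tau> *\<^sub>R b0) + norm ((z \<bullet> b0) *\<^sub>R b0)"
      by (metis norm_triangle_ineq norm_triangle_mono order_refl)
    also have "\<dots> \<le> B + \<bar>\<tau>\<bar> * norm b0 + 1 * norm b0"
      using that B by (intro add_mono) (auto simp: cyl_def mult_left_le_one_le)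
    finally show ?thesis by simp
  qed
  then have "bounded (cyl b0 K \<tau>)" by (auto simp: bounded_iff)
  ultimately show ?thesis by (simp add: compact_eq_bounded_closed)
qed

text \<open>By symmetry of \<open>K\<close> the map from \<open>z\<close> to \<open>b0 - z\<close>
  carries the cylinder at height \<open>\<tau>\<close> to the one at \<open>- \<tau>\<close>, and by
  convexity midpoints of the two lie over the central slice. The multiplicative Brunn-Minkowski
  inequality then compares two equal measures with the central one.\<close>

lemma measure_cyl_le_central:
  assumes K: "compact K" "convex K" "uminus ` K = K" and b0: "norm b0 = 1"
  shows "measure lebesgue (cyl b0 K \<tau>) \<le> measure lebesgue (cyl b0 K 0)"
proof -
  have bb: "b0 \<bullet> b0 = 1" using b0 by (simp add: norm_eq_1)
  have neg: "- x \<in> K" if "x \<in> K" for x using that K(3) by blast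
  have refl: "cyl b0 K (- \<tau>) = (\<lambda>z. (-1) *\<^sub>R z + b0) ` cyl b0 K \<tau>"
  proof -
    have *: "(-1) *\<^sub>R z + b0 \<in> cyl b0 K (- \<sigma>)" if "z \<in> cyl b0 K \<sigma>" for z \<sigma>
    proof -
      have "perp b0 ((-1) *\<^sub>R z + b0) + (- \<sigma>) *\<^sub>R b0 = - (perp b0 z + \<sigma> *\<^sub>R b0)"
        using bb by (simp add: perp_def inner_add_left inner_diff_left algebra_simps)
      then have "perp b0 ((-1) *\<^sub>R z + b0) + (- \<sigma>) *\<^sub>R b0 \<in> K"
        using that neg by (simp only: cyl_def mem_Collect_eq)
      then show ?thesis using that bb by (simp add: cyl_def inner_add_left inner_diff_left)
    qed
    show ?thesis
    proof (intro equalityI subsetI)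
      fix z assume "z \<in> cyl b0 K (- \<tau>)"
      from *[OF this] have "(-1) *\<^sub>R z + b0 \<in> cyl b0 K \<tau>" by simp
      then show "z \<in> (\<lambda>z. (-1) *\<^sub>R z + b0) ` cyl b0 K \<tau>"
        by (intro image_eqI[where x="(-1) *\<^sub>R z + b0"]) auto
    qed (use * in blast)
  qed
  have eq: "measure lebesgue (cyl b0 K (- \<tau>)) = measure lebesgue (cyl b0 K \<tau>)"
    unfolding refl by (subst measure_lebesgue_affine) simp
  have "measure lebesgue (cyl b0 K \<tau>) * measure lebesgue (cyl b0 K (- \<tau>)) \<le> (measure lebesgue (cyl b0 K 0))\<^sup>2"
  proof (rule measure_midpoint_set)
    fix x y assume x: "x \<in> cyl b0 K \<tau>" and y: "y \<in> cyl b0 K (- \<tau>)"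
    have "perp b0 ((x + y) /\<^sub>R 2) + 0 *\<^sub>R b0 = (1/2) *\<^sub>R (perp b0 x + \<tau> *\<^sub>R b0) + (1/2) *\<^sub>R (perp b0 y + (- \<tau>) *\<^sub>R b0)"
      by (simp add: perp_def inner_add_left algebra_simps)
    also have "\<dots> \<in> K" using x y K(2) by (intro convexD) (auto simp: cyl_def)
    finally show "(x + y) /\<^sub>R 2 \<in> cyl b0 K 0" using x y by (auto simp: cyl_def inner_add_left)
  qed (intro compact_cyl K)+
  then have "(measure lebesgue (cyl b0 K \<tau>))\<^sup>2 \<le> (measure lebesgue (cyl b0 K 0))\<^sup>2"
    by (simp add: eq power2_eq_square)
  then show ?thesis by (rule power2_le_imp_le) simp
qed

text \<open>The dilation also stretches the unit height, hence the exponent \<open>DIM('a)\<close>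
  rather than the dimension of the slice. The loss disappears as \<open>s\<close> tends to
  1.\<close>

lemma measure_cyl_scaled:
  assumes K: "compact K" and s: "s \<ge> 1"
  shows "measure lebesgue (cyl b0 ((*\<^sub>R) s ` K) 0) \<le> s ^ DIM('a) * measure lebesgue (cyl b0 (K::'a::euclidean_space set) 0)"
proof -
  have sub: "cyl b0 ((*\<^sub>R) s ` K) 0 \<subseteq> (\<lambda>z. s *\<^sub>R z + 0) ` cyl b0 K 0"
  proof
    fix z assume z: "z \<in> cyl b0 ((*\<^sub>R) s ` K) 0"
    then obtain k where k: "k \<in> K" "perp b0 z = s *\<^sub>R k" by (auto simp: cyl_def)
    have "perp b0 (z /\<^sub>R s) = (perp b0 z) /\<^sub>R s" by (simp add: perp_def algebra_simps)
    then have "perp b0 (z /\<^sub>R s) = k" using k s by simp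
    moreover have "(z /\<^sub>R s) \<bullet> b0 \<in> {0..1}"
      using z s by (auto simp: cyl_def field_simps)
    ultimately have "z /\<^sub>R s \<in> cyl b0 K 0" using k by (simp add: cyl_def)
    then show "z \<in> (\<lambda>z. s *\<^sub>R z + 0) ` cyl b0 K 0" using s by (intro image_eqI[where x="z /\<^sub>R s"]) auto
  qed
  have c: "compact ((\<lambda>z. s *\<^sub>R z + 0) ` cyl b0 K 0)"
    by (intro compact_continuous_image compact_cyl K continuous_intros)
  have "measure lebesgue (cyl b0 ((*\<^sub>R) s ` K) 0) \<le> measure lebesgue ((\<lambda>z. s *\<^sub>R z + 0) ` cyl b0 K 0)"
    by (rule measure_mono_fmeasurable[OF sub fmeasurableD[OF lmeasurable_compact[OF compact_cyl[OF compact_scaling[OF K]]]] lmeasurable_compact[OF c]])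
  also have "\<dots> = s ^ DIM('a) * measure lebesgue (cyl b0 K 0)"
    using s by (subst measure_lebesgue_affine) simp
  finally show ?thesis .
qed

lemma convex_scaled_sum:
  assumes "convex K" "x \<in> K" "y \<in> K" "s \<ge> 0"
  shows "x + s *\<^sub>R y \<in> (*\<^sub>R) (1 + s) ` K"
proof -
  have "(1 / (1 + s)) *\<^sub>R x + (s / (1 + s)) *\<^sub>R y \<in> K"
    using assms by (intro convexD) (auto simp: field_simps)
  moreover have "x + s *\<^sub>R y = (1 + s) *\<^sub>R ((1 / (1 + s)) *\<^sub>R x + (s / (1 + s)) *\<^sub>R y)"
    using assms(4) by (simp add: scaleR_add_right)
  ultimately show ?thesis by blast
qed

text \<open>Over each counted lattice point stands a box with cross-section of side \<open>h\<close>
  and height 1. These boxes are disjoint, and since horizontal displacements in a box are at most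
  \<open>s * r\<close>, they fit into the cylinder over a slice of the body dilated by
  \<open>1 + s\<close>, which is at most the central one.\<close>

lemma slice_lattice_count:
  fixes K :: "'a::euclidean_space set"
  assumes K: "compact K" "convex K" "uminus ` K = K" and b0: "b0 \<in> Basis"
    and r: "r > 0" "cball 0 r \<subseteq> K" and s: "s > 0" and h: "h > 0" "real DIM('a) * h \<le> s * r"
    and W: "finite W" "W \<subseteq> {m \<in> plat0 b0 h. w + m \<in> K}"
  shows "real (card W) * h ^ (DIM('a) - 1) \<le> (1 + s) ^ DIM('a) * section_vol K b0"
proof -
  have nb: "norm b0 = 1" and bb: "b0 \<bullet> b0 = 1" using b0 by auto
  \<comment> \<open>The side 1 along \<open>b0\<close> matches the unit height of
    \<open>cyl\<close>.\<close>
  define L where "L = colvec b0 h 1"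
  have L: "\<And>b. b \<in> Basis \<Longrightarrow> L \<bullet> b > 0" using h by (simp add: L_def colvec_pos)
  define Q where "Q m = (+) (perp b0 w + m) ` hbox L" for m
  have hb: "emeasure lborel (hbox L) = ennreal (h ^ (DIM('a) - 1))"
    using emeasure_hbox[OF L] prod_colvec[OF b0, of h 1] by (simp add: L_def)
  have Ql: "Q m \<in> lmeasurable" and Qm: "measure lebesgue (Q m) = h ^ (DIM('a) - 1)" for m
  proof -
    have "hbox L \<in> lmeasurable" using hb by (intro fmeasurableI) (auto simp: emeasure_completion)
    then show "Q m \<in> lmeasurable" unfolding Q_def by (rule measurable_translation)
    have "measure lebesgue (hbox L) = h ^ (DIM('a) - 1)"
      using hb h by (simp add: measure_def)
    then show "measure lebesgue (Q m) = h ^ (DIM('a) - 1)" unfolding Q_def by (simp add: measure_translation)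
  qed
  have disj: "pairwise (\<lambda>m m'. disjnt (Q m) (Q m')) W"
  proof (clarsimp simp: pairwise_def disjnt_def)
    fix m m' assume m: "m \<in> W" "m' \<in> W" "m \<noteq> m'"
    show "Q m \<inter> Q m' = {}"
    proof (rule equals0I)
      fix z assume "z \<in> Q m \<inter> Q m'"
      moreover have "(z - perp b0 w) - k \<in> hbox L" if "z \<in> Q k" for k using that by (auto simp: Q_def algebra_simps)
      ultimately have "(z - perp b0 w) - m \<in> hbox L" "(z - perp b0 w) - m' \<in> hbox L" by blast+
      moreover have "m \<in> plat L" "m' \<in> plat L" using m W by (auto simp: plat0_def L_def)
      ultimately show False using m(3) lfl_unique[OF L] by metis
    qed
  qed
  let ?K = "(*\<^sub>R) (1 + s) ` K"
  have sub: "Q m \<subseteq> cyl b0 ?K (w \<bullet> b0)" if m: "m \<in> W" for m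
  proof
    fix z assume "z \<in> Q m"
    then obtain u where u: "u \<in> hbox L" "z = perp b0 w + m + u" by (auto simp: Q_def)
    have m0: "m \<bullet> b0 = 0" "w + m \<in> K" using m W by (auto simp: plat0_def)
    have zb: "z \<bullet> b0 = u \<bullet> b0" using u m0 perp_inner_self[OF nb, of w] by (simp add: inner_add_left)
    have "u \<bullet> b0 \<in> {0..1}" using u(1) b0 by (auto simp: hbox_def L_def colvec_inner less_imp_le)
    moreover have "perp b0 z + (w \<bullet> b0) *\<^sub>R b0 \<in> ?K"
    proof -
      have "perp b0 z + (w \<bullet> b0) *\<^sub>R b0 = (w + m) + perp b0 u"
        using m0 bb by (simp add: perp_def u(2) inner_add_left inner_diff_left algebra_simps)
      moreover have "norm (perp b0 u) \<le> s * r"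
      proof -
        have "norm (perp b0 u) \<le> (\<Sum>b\<in>Basis. \<bar>perp b0 u \<bullet> b\<bar>)" by (rule norm_le_l1)
        also have "\<dots> \<le> (\<Sum>b\<in>(Basis::'a set). h)"
          using u(1) b0 h by (intro sum_mono) (auto simp: perp_inner hbox_def L_def colvec_inner less_imp_le)
        finally show ?thesis using h by simp
      qed
      then have "norm (perp b0 u /\<^sub>R s) \<le> r" using s by (simp add: field_simps)
      then have "perp b0 u /\<^sub>R s \<in> K" using r(2) by auto
      from convex_scaled_sum[OF K(2) m0(2) this, of s] s have "(w + m) + perp b0 u \<in> ?K" by simp
      ultimately show ?thesis by simp
    qed
    ultimately show "z \<in> cyl b0 ?K (w \<bullet> b0)" using zb by (simp add: cyl_def)
  qed
  have cK: "compact ?K" "convex ?K" "uminus ` ?K = ?K"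
  proof -
    show "compact ?K" by (rule compact_scaling[OF K(1)])
    show "convex ?K" by (rule convex_scaling[OF K(2)])
    have "uminus ` ?K = (*\<^sub>R) (1 + s) ` (uminus ` K)" by (auto simp: image_iff)
    then show "uminus ` ?K = ?K" by (simp add: K(3))
  qed
  have "real (card W) * h ^ (DIM('a) - 1) = (\<Sum>m\<in>W. measure lebesgue (Q m))" by (simp add: Qm)
  also have "\<dots> = measure lebesgue (\<Union>m\<in>W. Q m)"
    using W(1) Ql disj by (intro measure_UNION'[symmetric]) auto
  also have "\<dots> \<le> measure lebesgue (cyl b0 ?K (w \<bullet> b0))"
  proof (rule measure_mono_fmeasurable)
    show "(\<Union>m\<in>W. Q m) \<subseteq> cyl b0 ?K (w \<bullet> b0)" using sub by auto
    show "(\<Union>m\<in>W. Q m) \<in> sets lebesgue" using W(1) Ql by (intro sets.finite_UN) auto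
    show "cyl b0 ?K (w \<bullet> b0) \<in> lmeasurable" by (intro lmeasurable_compact compact_cyl cK)
  qed
  also have "\<dots> \<le> measure lebesgue (cyl b0 ?K 0)" by (rule measure_cyl_le_central[OF cK nb])
  also have "\<dots> \<le> (1 + s) ^ DIM('a) * measure lebesgue (cyl b0 K 0)"
    using s by (intro measure_cyl_scaled K) auto
  finally show ?thesis by (simp add: section_vol_cyl[OF nb])
qed

subsection \<open>Sampling on unions of lattice translates\<close>

lemma finite_plat_bounded:
  assumes L: "\<And>b. b \<in> Basis \<Longrightarrow> L \<bullet> b > 0" and "bounded B"
  shows "finite (plat L \<inter> B)"
proof -
  obtain \<rho> where \<rho>: "\<And>x. x \<in> B \<Longrightarrow> norm x \<le> \<rho>" using assms(2) by (auto simp: bounded_iff)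
  let ?I = "\<lambda>b. {- \<lceil>\<rho> / (L \<bullet> b)\<rceil> .. \<lceil>\<rho> / (L \<bullet> b)\<rceil>}"
  have "plat L \<inter> B \<subseteq> (\<lambda>k. \<Sum>b\<in>Basis. (of_int (k b) * (L \<bullet> b)) *\<^sub>R b) ` (PiE Basis ?I)"
  proof
    fix x assume x: "x \<in> plat L \<inter> B"
    then obtain k :: "'a \<Rightarrow> int" where k: "\<And>b. b \<in> Basis \<Longrightarrow> x \<bullet> b = of_int (k b) * (L \<bullet> b)"
      unfolding plat_def by (auto dest!: bchoice)
    have "x = (\<Sum>b\<in>Basis. (of_int (restrict k Basis b) * (L \<bullet> b)) *\<^sub>R b)"
      by (subst euclidean_representation[symmetric, of x]) (auto intro!: sum.cong simp: k)
    moreover have "k b \<in> ?I b" if b: "b \<in> Basis" for b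
    proof -
      have "\<bar>of_int (k b) * (L \<bullet> b)\<bar> \<le> \<rho>" using k[OF b] Basis_le_norm[OF b, of x] \<rho>[of x] x by simp
      then have "\<bar>real_of_int (k b)\<bar> \<le> \<rho> / (L \<bullet> b)" using L[OF b] by (simp add: abs_mult pos_le_divide_eq)
      then show ?thesis by (auto simp: abs_le_iff) linarith+
    qed
    ultimately show "x \<in> (\<lambda>k. \<Sum>b\<in>Basis. (of_int (k b) * (L \<bullet> b)) *\<^sub>R b) ` (PiE Basis ?I)"
      by (intro image_eqI[where x="restrict k Basis"]) auto
  qed
  moreover have "finite (PiE Basis ?I)" by (intro finite_PiE) auto
  ultimately show ?thesis by (meson finite_imageI finite_subset)
qed

text \<open>Lagrange interpolation: the polynomial vanishing at all nodes except \<open>z m\<close>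
  has degree below \<open>N\<close>, so pairing its coefficients with the \<open>N\<close> given
  sums isolates \<open>c m * p m\<close>; Cauchy-Schwarz turns this into a bound.\<close>

lemma Vandermonde_lower_bound:
  fixes z :: "'b \<Rightarrow> complex"
  assumes W: "finite W" "inj_on z W" "card W \<le> N"
  shows "\<exists>C\<ge>0. \<forall>c. (\<Sum>m\<in>W. (cmod (c m))\<^sup>2) \<le> C * (\<Sum>j<N. (cmod (\<Sum>m\<in>W. c m * z m ^ j))\<^sup>2)"
proof -
  define l where "l m = (\<Prod>k\<in>W - {m}. [:- z k, 1:])" for m
  have lm: "poly (l m) (z k) = (if k = m then \<Prod>k\<in>W - {m}. z m - z k else 0)" if "k \<in> W" "m \<in> W" for k m
  proof (cases "k = m")
    case True then show ?thesis by (simp add: l_def poly_prod)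
  next
    case False
    then have "k \<in> W - {m}" using that by auto
    then have "(\<Prod>i\<in>W - {m}. z k - z i) = 0" using W(1) by (intro prod_zero) auto
    then show ?thesis using False by (simp add: l_def poly_prod)
  qed
  define p where "p m = (\<Prod>k\<in>W - {m}. z m - z k)" for m
  have p: "p m \<noteq> 0" if "m \<in> W" for m
    unfolding p_def using W that by (auto simp: inj_on_def)
  have deg: "degree (l m) < N" if "m \<in> W" for m
  proof -
    have "degree (l m) = (\<Sum>k\<in>W - {m}. degree [:- z k, 1:])"
      unfolding l_def by (rule degree_prod_sum_eq) auto
    also have "\<dots> = card W - 1" using that W(1) by simp
    finally show ?thesis using W that card_gt_0_iff[of W] by auto
  qed
  have rec: "c m * p m = (\<Sum>j<N. coeff (l m) j * (\<Sum>k\<in>W. c k * z k ^ j))" if m: "m \<in> W" for c m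
  proof -
    have ev: "poly (l m) x = (\<Sum>j<N. coeff (l m) j * x ^ j)" for x
      unfolding poly_altdef using deg[OF m] by (intro sum.mono_neutral_left) (auto simp: coeff_eq_0)
    have "(\<Sum>j<N. coeff (l m) j * (\<Sum>k\<in>W. c k * z k ^ j)) = (\<Sum>j<N. \<Sum>k\<in>W. c k * (coeff (l m) j * z k ^ j))"
      by (simp add: sum_distrib_left mult_ac)
    also have "\<dots> = (\<Sum>k\<in>W. \<Sum>j<N. c k * (coeff (l m) j * z k ^ j))" by (rule sum.swap)
    also have "\<dots> = (\<Sum>k\<in>W. c k * poly (l m) (z k))" by (simp add: ev sum_distrib_left)
    also have "\<dots> = (\<Sum>k\<in>W. if k = m then c m * p m else 0)"
      using m by (intro sum.cong) (auto simp: lm p_def)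
    also have "\<dots> = c m * p m" using W(1) m by simp
    finally show ?thesis by simp
  qed
  define C where "C = (\<Sum>m\<in>W. (\<Sum>j<N. (cmod (coeff (l m) j))\<^sup>2) / (cmod (p m))\<^sup>2)"
  have "(\<Sum>m\<in>W. (cmod (c m))\<^sup>2) \<le> C * (\<Sum>j<N. (cmod (\<Sum>m\<in>W. c m * z m ^ j))\<^sup>2)" for c
  proof -
    let ?E = "\<Sum>j<N. (cmod (\<Sum>m\<in>W. c m * z m ^ j))\<^sup>2"
    have "(cmod (c m))\<^sup>2 \<le> (\<Sum>j<N. (cmod (coeff (l m) j))\<^sup>2) / (cmod (p m))\<^sup>2 * ?E" if m: "m \<in> W" for m
    proof -
      have "cmod (c m) * cmod (p m) \<le> (\<Sum>j<N. cmod (coeff (l m) j) * cmod (\<Sum>k\<in>W. c k * z k ^ j))"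
        using rec[OF m, of c] norm_sum[of "\<lambda>j. coeff (l m) j * (\<Sum>k\<in>W. c k * z k ^ j)" "{..<N}"]
        by (simp add: norm_mult[symmetric])
      then have "(cmod (c m) * cmod (p m))\<^sup>2 \<le> (\<Sum>j<N. cmod (coeff (l m) j) * cmod (\<Sum>k\<in>W. c k * z k ^ j))\<^sup>2"
        by (intro power_mono) auto
      also have "\<dots> \<le> (\<Sum>j<N. (cmod (coeff (l m) j))\<^sup>2) * ?E"
        by (rule Cauchy_Schwarz_ineq_sum)
      finally show ?thesis using p[OF m] by (simp add: power_mult_distrib field_simps)
    qed
    then show ?thesis unfolding C_def sum_distrib_right by (rule sum_mono)
  qed
  moreover have "C \<ge> 0" unfolding C_def by (intro sum_nonneg divide_nonneg_nonneg) auto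
  ultimately show ?thesis by blast
qed

text \<open>There are only finitely many node sets \<open>W\<close>, so one constant serves them
  all. This is what allows the fibres of the periodized spectrum to be integrated with a common
  bound.\<close>

lemma Vandermonde_uniform:
  fixes z :: "'b \<Rightarrow> complex"
  assumes M: "finite M" "inj_on z M"
  shows "\<exists>C>0. \<forall>W c. W \<subseteq> M \<and> card W \<le> N \<longrightarrow>
     (\<Sum>m\<in>W. (cmod (c m))\<^sup>2) \<le> C * (\<Sum>j<N. (cmod (\<Sum>m\<in>W. c m * z m ^ j))\<^sup>2)"
proof -
  have "\<forall>W\<in>{W. W \<subseteq> M \<and> card W \<le> N}. \<exists>C\<ge>0. \<forall>c. (\<Sum>m\<in>W. (cmod (c m))\<^sup>2) \<le> C * (\<Sum>j<N. (cmod (\<Sum>m\<in>W. c m * z m ^ j))\<^sup>2)"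
    using M by (auto intro!: Vandermonde_lower_bound intro: finite_subset inj_on_subset)
  then obtain C where C: "\<And>W. W \<subseteq> M \<Longrightarrow> card W \<le> N \<Longrightarrow> C W \<ge> 0"
    "\<And>W c. W \<subseteq> M \<Longrightarrow> card W \<le> N \<Longrightarrow> (\<Sum>m\<in>W. (cmod (c m))\<^sup>2) \<le> C W * (\<Sum>j<N. (cmod (\<Sum>m\<in>W. c m * z m ^ j))\<^sup>2)"
    unfolding bchoice_iff by blast
  let ?F = "{W. W \<subseteq> M \<and> card W \<le> N}"
  have fin: "finite ?F" using M(1) by (intro finite_subset[of ?F "Pow M"]) auto
  define B where "B = 1 + sum C ?F"
  have le: "C W \<le> B" if "W \<subseteq> M" "card W \<le> N" for W
    unfolding B_def using member_le_sum[of W ?F C] that C(1) fin by (auto intro: order_trans[of _ "sum C ?F"])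
  have "(\<Sum>m\<in>W. (cmod (c m))\<^sup>2) \<le> B * (\<Sum>j<N. (cmod (\<Sum>m\<in>W. c m * z m ^ j))\<^sup>2)" if "W \<subseteq> M" "card W \<le> N" for W c
    by (rule order_trans[OF C(2)[OF that]]) (intro mult_right_mono le that sum_nonneg, auto)
  moreover have "B > 0" unfolding B_def using C(1) by (intro add_pos_nonneg sum_nonneg) auto
  ultimately show ?thesis by blast
qed

text \<open>The vectors to be avoided lie on countably many hyperplanes, hence in a null set. Such
  an \<open>x0\<close> makes the values \<open>chr x0 m\<close> distinct at distinct lattice points;
  these values are the Vandermonde nodes.\<close>

lemma generic_direction:
  fixes b0 :: "'a::euclidean_space"
  assumes b0: "b0 \<in> Basis"
  obtains x0 where "x0 \<bullet> b0 = 0" "\<And>m. m \<in> plat0 b0 h \<Longrightarrow> m \<noteq> 0 \<Longrightarrow> m \<bullet> x0 \<notin> \<int>"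
proof -
  let ?F = "(\<lambda>(m, k::int). {x. m \<bullet> x = of_int k}) ` ((plat0 b0 h - {0}) \<times> UNIV)"
  have "negligible (\<Union>?F)"
  proof (rule negligible_countable_Union)
    show "countable ?F" using countable_plat0 by (intro countable_image countable_SIGMA) auto
    show "negligible X" if "X \<in> ?F" for X
      using that by (auto intro!: negligible_hyperplane)
  qed
  then have "\<Union>?F \<noteq> UNIV" using non_negligible_UNIV by auto
  then obtain x where x: "x \<notin> \<Union>?F" by blast
  show ?thesis
  proof (rule that[of "perp b0 x"])
    show "perp b0 x \<bullet> b0 = 0" using b0 by (simp add: perp_inner)
    fix m assume m: "m \<in> plat0 b0 h" "m \<noteq> 0"
    have "m \<bullet> perp b0 x = m \<bullet> x" using m by (simp add: perp_def inner_diff_right plat0_def)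
    then show "m \<bullet> perp b0 x \<notin> \<int>" using x m by (auto simp: Ints_def)
  qed
qed

lemma lborel_integral_shift:
  fixes F :: "'a::euclidean_space \<Rightarrow> 'b::{banach, second_countable_topology}"
  assumes F: "F \<in> borel_measurable borel"
  shows "(\<integral>w. F (w + m) \<partial>lborel) = (\<integral>w. F w \<partial>lborel)" "integrable lborel (\<lambda>w. F (w + m)) \<longleftrightarrow> integrable lborel F"
proof -
  have m: "(\<lambda>w. m + w) \<in> measurable lborel borel" by simp
  have d: "distr lborel borel (\<lambda>w. m + w) = lborel" using lborel_distr_plus[of m] by simp
  show "(\<integral>w. F (w + m) \<partial>lborel) = (\<integral>w. F w \<partial>lborel)"
    using integral_distr[OF m F] unfolding d by (simp add: add.commute)
  show "integrable lborel (\<lambda>w. F (w + m)) \<longleftrightarrow> integrable lborel F"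
    using integrable_distr_eq[OF m F] unfolding d by (simp add: add.commute)
qed

lemma sqint_shift: "sqint lborel g \<Longrightarrow> sqint lborel (\<lambda>w. g (w + m))"
proof -
  assume g: "sqint lborel g"
  then have [measurable]: "g \<in> borel_measurable borel" by (simp add: sqint_def)
  have "integrable lborel (\<lambda>w. (cmod (g (w + m)))\<^sup>2)"
    using g by (subst lborel_integral_shift(2)[of "\<lambda>w. (cmod (g w))\<^sup>2"]) (auto simp: sqint_def)
  then show ?thesis by (simp add: sqint_def)
qed

text \<open>Counterpart of \<open>nn_integral_periodize\<close> for vector-valued integrands:
  \<open>M\<close> contains all shifts that lead from the tile at \<open>a\<close> into
  \<open>S\<close>, so only finite sums occur.\<close>

lemma integral_periodize_finite:
  fixes u :: "'a::euclidean_space \<Rightarrow> 'b::{banach, second_countable_topology}"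
  assumes T: "\<And>b. b \<in> Basis \<Longrightarrow> T \<bullet> b > 0" and u: "integrable lborel u" "\<And>w. w \<notin> S \<Longrightarrow> u w = 0"
    and M: "finite M" "M \<subseteq> plat T" "\<And>m w. m \<in> plat T \<Longrightarrow> w - a \<in> hbox T \<Longrightarrow> w + m \<in> S \<Longrightarrow> m \<in> M"
  shows "(\<integral>w. u w \<partial>lborel) = (\<integral>w. indicator ((+) a ` hbox T) w *\<^sub>R (\<Sum>m\<in>M. u (w + m)) \<partial>lborel)"
proof -
  let ?H = "(+) a ` hbox T"
  have mem: "w \<in> ?H \<longleftrightarrow> w - a \<in> hbox T" for w by (auto simp: image_iff algebra_simps) (metis add_diff_cancel_left' diff_add_cancel add.commute)
  have um: "u \<in> borel_measurable borel" using u(1) by (auto dest: borel_measurable_integrable)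
  have Hm: "?H \<in> sets borel"
  proof -
    have "?H = (\<lambda>w. w - a) -` hbox T \<inter> space borel" using mem by auto
    also have "\<dots> \<in> sets borel" by (rule measurable_sets[OF _ hbox_borel]) measurable
    finally show ?thesis .
  qed
  have one: "u w = (\<Sum>m\<in>M. indicator ?H (w - m) *\<^sub>R u w)" for w
  proof (cases "w \<in> S")
    case True
    define m where "m = lfl T (w - a)"
    have m: "m \<in> plat T" "(w - m) - a \<in> hbox T" using lfl_plat diff_lfl_hbox[OF T, of "w - a"] by (auto simp: m_def algebra_simps)
    then have mM: "m \<in> M" using M(3)[of m "w - m"] True by simp
    have "(\<Sum>k\<in>M. indicator ?H (w - k) *\<^sub>R u w) = (\<Sum>k\<in>{m}. indicator ?H (w - k) *\<^sub>R u w)"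
    proof (rule sum.mono_neutral_right)
      show "\<forall>k\<in>M - {m}. indicator ?H (w - k) *\<^sub>R u w = 0"
      proof
        fix k assume k: "k \<in> M - {m}"
        have "w - k \<notin> ?H"
        proof
          assume "w - k \<in> ?H"
          then have "(w - a) - k \<in> hbox T" unfolding mem by (simp add: algebra_simps)
          then have "k = m" using lfl_unique[OF T, of k "w - a"] k M(2) by (auto simp: m_def)
          then show False using k by simp
        qed
        then show "indicator ?H (w - k) *\<^sub>R u w = 0" by simp
      qed
    qed (use M(1) mM in auto)
    also have "\<dots> = u w" using m(2) mem by simp
    finally show ?thesis by simp
  next
    case False then show ?thesis using u(2) by simp
  qed
  have int: "integrable lborel (\<lambda>w. indicator ?H (w - m) *\<^sub>R u w)" for m
  proof -
    have "(\<lambda>w. w - m) -` ?H \<inter> space borel \<in> sets borel" by (rule measurable_sets[OF _ Hm]) measurable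
    then have "integrable lborel (\<lambda>w. indicator ((\<lambda>w. w - m) -` ?H) w *\<^sub>R u w)"
      using u(1) by (intro integrable_mult_indicator) auto
    then show ?thesis by (simp add: indicator_def)
  qed
  have int2: "integrable lborel (\<lambda>w. indicator ?H w *\<^sub>R u (w + m))" for m
    using u(1) um Hm by (intro integrable_mult_indicator) (auto simp: lborel_integral_shift(2))
  have "(\<integral>w. u w \<partial>lborel) = (\<integral>w. (\<Sum>m\<in>M. indicator ?H (w - m) *\<^sub>R u w) \<partial>lborel)"
    using one by simp
  also have "\<dots> = (\<Sum>m\<in>M. \<integral>w. indicator ?H (w - m) *\<^sub>R u w \<partial>lborel)"
    by (intro Bochner_Integration.integral_sum int)
  also have "\<dots> = (\<Sum>m\<in>M. \<integral>w. indicator ?H w *\<^sub>R u (w + m) \<partial>lborel)"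
  proof (rule sum.cong[OF refl])
    fix m
    have "(\<lambda>w. indicator ?H (w - m) *\<^sub>R u w) \<in> borel_measurable borel" using borel_measurable_integrable[OF int[of m]] by simp
    from lborel_integral_shift(1)[OF this, of m]
    show "(\<integral>w. indicator ?H (w - m) *\<^sub>R u w \<partial>lborel) = (\<integral>w. indicator ?H w *\<^sub>R u (w + m) \<partial>lborel)" by simp
  qed
  also have "\<dots> = (\<integral>w. (\<Sum>m\<in>M. indicator ?H w *\<^sub>R u (w + m)) \<partial>lborel)"
    by (intro Bochner_Integration.integral_sum[symmetric] int2)
  finally show ?thesis by (simp add: scaleR_sum_right)
qed

text \<open>Characters of \<open>glat T\<close> are constant along \<open>plat T\<close>, so the
  samples at \<open>x + \<gamma>\<close> are the Fourier coefficients, on the tile at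
  \<open>a\<close>, of the folded spectrum of \<open>g\<close> times \<open>chr x\<close>. Parseval
  gives their energy.\<close>

lemma periodized_Parseval:
  fixes g :: "'a::euclidean_space \<Rightarrow> complex"
  assumes T: "\<And>b. b \<in> Basis \<Longrightarrow> T \<bullet> b > 0" and g: "sqint lborel g" "\<And>w. w \<notin> S \<Longrightarrow> g w = 0" "bounded S"
    and M: "finite M" "M \<subseteq> plat T" "\<And>m w. m \<in> plat T \<Longrightarrow> w - a \<in> hbox T \<Longrightarrow> w + m \<in> S \<Longrightarrow> m \<in> M"
  shows "((\<lambda>\<gamma>. (cmod (fourier g (x + \<gamma>)))\<^sup>2) has_sum
     ((\<Prod>b\<in>Basis. T \<bullet> b) * (\<integral>w. indicator ((+) a ` hbox T) w * (cmod (\<Sum>m\<in>M. g (w + m) * chr x (w + m)))\<^sup>2 \<partial>lborel))) (glat T)"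
    and "integrable lborel (\<lambda>w. indicator ((+) a ` hbox T) w * (cmod (\<Sum>m\<in>M. g (w + m) * chr x (w + m)))\<^sup>2)"
proof -
  interpret period_box T a using T by unfold_locales
  let ?H = "(+) a ` hbox T"
  define G where "G w = indicator ?H w *\<^sub>R (\<Sum>m\<in>M. g (w + m) * chr x (w + m))" for w
  have HD: "?H \<subseteq> D" by (fastforce simp: hbox_def mem_box inner_add_left)
  have gx: "sqint lborel (\<lambda>w. g w * chr x w)" by (rule sqint_mult_unimodular[OF g(1)]) auto
  have Hm: "?H \<in> sets borel"
  proof -
    have "?H = (\<lambda>w. w - a) -` hbox T \<inter> space borel" by (force simp: image_iff algebra_simps)
    also have "\<dots> \<in> sets borel" by (rule measurable_sets[OF _ hbox_borel]) measurable
    finally show ?thesis .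
  qed
  have s0: "sqint lborel (\<lambda>w. \<Sum>m\<in>M. g (w + m) * chr x (w + m))"
    using sqint_shift[OF gx] by (intro sqint_sum M(1)) auto
  have Gs: "sqint lborel G"
  proof (rule sqint_bound[OF _ s0, where C=1])
    show "G \<in> borel_measurable lborel" unfolding G_def using s0 Hm by (auto simp: sqint_def intro!: borel_measurable_scaleR)
    show "cmod (G w) \<le> 1 * cmod (\<Sum>m\<in>M. g (w + m) * chr x (w + m))" for w by (auto simp: G_def indicator_def)
  qed
  have sqG: "(cmod (G w))\<^sup>2 = indicator ?H w * (cmod (\<Sum>m\<in>M. g (w + m) * chr x (w + m)))\<^sup>2" for w
    by (simp add: G_def indicator_def)
  show "integrable lborel (\<lambda>w. indicator ?H w * (cmod (\<Sum>m\<in>M. g (w + m) * chr x (w + m)))\<^sup>2)"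
    using Gs by (simp add: sqint_def sqG)
  have "(\<integral>w. G w * chr \<gamma> w \<partial>lborel) = fourier g (x + \<gamma>)" if \<gamma>: "\<gamma> \<in> glat T" for \<gamma>
  proof -
    have i: "integrable lborel (\<lambda>w. g w * chr (x + \<gamma>) w)"
      by (rule sqint_bounded_support_integrable[of _ S]) (use g in \<open>auto intro!: sqint_mult_unimodular\<close>)
    have "fourier g (x + \<gamma>) = (\<integral>w. indicator ?H w *\<^sub>R (\<Sum>m\<in>M. g (w + m) * chr (x + \<gamma>) (w + m)) \<partial>lborel)"
      unfolding fourier_def using g(2) by (intro integral_periodize_finite[OF T i _ M]) auto
    also have "\<dots> = (\<integral>w. G w * chr \<gamma> w \<partial>lborel)"
    proof (rule Bochner_Integration.integral_cong[OF refl])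
      fix w
      have "(\<Sum>m\<in>M. g (w + m) * chr (x + \<gamma>) (w + m)) = (\<Sum>m\<in>M. g (w + m) * chr x (w + m)) * chr \<gamma> w"
        unfolding sum_distrib_right
      proof (rule sum.cong[OF refl])
        fix m assume "m \<in> M"
        then have "chr \<gamma> m = 1" using chr_glat_plat[OF \<gamma>] M(2) by blast
        then show "g (w + m) * chr (x + \<gamma>) (w + m) = g (w + m) * chr x (w + m) * chr \<gamma> w"
          by (simp add: chr_add_left chr_add_right[of \<gamma>] mult_ac)
      qed
      then show "indicator ?H w *\<^sub>R (\<Sum>m\<in>M. g (w + m) * chr (x + \<gamma>) (w + m)) = G w * chr \<gamma> w"
        by (simp add: G_def)
    qed
    finally show ?thesis by simp
  qed
  moreover have "((\<lambda>\<gamma>. (cmod (\<integral>w. G w * chr \<gamma> w \<partial>lborel))\<^sup>2) has_sum (V * (\<integral>w. (cmod (G w))\<^sup>2 \<partial>lborel))) (glat T)"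
    by (rule Parseval_lborel[OF Gs]) (use HD in \<open>auto simp: G_def indicator_def\<close>)
  ultimately have "((\<lambda>\<gamma>. (cmod (fourier g (x + \<gamma>)))\<^sup>2) has_sum (V * (\<integral>w. (cmod (G w))\<^sup>2 \<partial>lborel))) (glat T)"
    by (simp cong: has_sum_cong)
  then show "((\<lambda>\<gamma>. (cmod (fourier g (x + \<gamma>)))\<^sup>2) has_sum
     ((\<Prod>b\<in>Basis. T \<bullet> b) * (\<integral>w. indicator ?H w * (cmod (\<Sum>m\<in>M. g (w + m) * chr x (w + m)))\<^sup>2 \<partial>lborel))) (glat T)"
    unfolding sqG V_def .
qed

text \<open>Each coset contributes the energy of one folded spectrum. At a point \<open>w\<close> of
  the tile at most \<open>N\<close> of the values \<open>g (w + m)\<close> are nonzero, and the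
  \<open>N\<close> cosets supply their Vandermonde sums with nodes \<open>z m\<close>. These control
  the values with a constant independent of \<open>w\<close>, and integration over the tile gives
  both sampling bounds.\<close>

lemma multicoset_stable_sampling:
  fixes S :: "'a::euclidean_space set" and \<xi> :: "nat \<Rightarrow> 'a"
  assumes T: "\<And>b. b \<in> Basis \<Longrightarrow> T \<bullet> b > 0" and S: "compact S"
    and M: "finite M" "M \<subseteq> plat T" "\<And>m w. m \<in> plat T \<Longrightarrow> w - a \<in> hbox T \<Longrightarrow> w + m \<in> S \<Longrightarrow> m \<in> M"
    and N: "\<And>w. card {m \<in> M. w + m \<in> S} \<le> N"
    and z: "inj_on z M" "\<And>j m. j < N \<Longrightarrow> m \<in> M \<Longrightarrow> chr (\<xi> j) m = z m ^ j"
    and inj: "inj_on (\<lambda>(j, \<gamma>). \<xi> j + \<gamma>) ({..<N} \<times> glat T)"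
  shows "stable_sampling S ((\<lambda>(j, \<gamma>). \<xi> j + \<gamma>) ` ({..<N} \<times> glat T))"
proof -
  let ?Lam = "(\<lambda>(j, \<gamma>). \<xi> j + \<gamma>) ` ({..<N} \<times> glat T)"
  let ?H = "(+) a ` hbox T"
  define V where "V = (\<Prod>b\<in>Basis. T \<bullet> b)"
  have Vp: "V > 0" unfolding V_def using T by (intro prod_pos) auto
  obtain C where C: "C > 0" "\<And>W c. W \<subseteq> M \<Longrightarrow> card W \<le> N \<Longrightarrow>
     (\<Sum>m\<in>W. (cmod (c m))\<^sup>2) \<le> C * (\<Sum>j<N. (cmod (\<Sum>m\<in>W. c m * z m ^ j))\<^sup>2)"
    using Vandermonde_uniform[OF M(1) z(1), of N] by blast
  define A where "A = V / C"
  \<comment> \<open>The maximum secures \<open>A \<le> B\<close>, which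
    \<open>stable_sampling\<close> demands.\<close>
  define B where "B = max A (V * (real N * real (card M)))"
  have Ap: "A > 0" using Vp C by (simp add: A_def)
  have main: "(\<lambda>l. (cmod (f l))\<^sup>2) summable_on ?Lam \<and> A * L2_norm_sq f \<le> (\<Sum>\<^sub>\<infinity>l\<in>?Lam. (cmod (f l))\<^sup>2) \<and>
        (\<Sum>\<^sub>\<infinity>l\<in>?Lam. (cmod (f l))\<^sup>2) \<le> B * L2_norm_sq f" if "f \<in> PW_space S" for f
  proof -
    obtain g where g: "sqint lborel g" "\<And>w. w \<notin> S \<Longrightarrow> g w = 0" and f: "f = fourier g"
      using \<open>f \<in> PW_space S\<close> unfolding PW_space_eq[OF S] by blast
    have bS: "bounded S" using S by (rule compact_imp_bounded)
    let ?E = "\<lambda>j w. indicator ?H w * (cmod (\<Sum>m\<in>M. g (w + m) * chr (\<xi> j) (w + m)))\<^sup>2"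
    let ?Q = "\<lambda>w. indicator ?H w * (\<Sum>m\<in>M. (cmod (g (w + m)))\<^sup>2)"
    have hs: "((\<lambda>l. (cmod (f l))\<^sup>2) has_sum (\<Sum>j<N. V * (\<integral>w. ?E j w \<partial>lborel))) ?Lam"
      unfolding f V_def
      by (rule has_sum_finite_families[OF _ inj]) (use periodized_Parseval(1)[OF T g bS M] in auto)
    have Ei: "integrable lborel (?E j)" for j by (rule periodized_Parseval(2)[OF T g bS M])
    have tot: "(\<Sum>j<N. V * (\<integral>w. ?E j w \<partial>lborel)) = V * (\<integral>w. (\<Sum>j<N. ?E j w) \<partial>lborel)"
      using Bochner_Integration.integral_sum[of "{..<N}" lborel ?E, OF Ei] by (simp only: sum_distrib_left)
    have g2: "integrable lborel (\<lambda>w. (cmod (g w))\<^sup>2)" using g(1) by (simp add: sqint_def)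
    have nrm: "L2_norm_sq f = (\<integral>w. ?Q w \<partial>lborel)"
    proof -
      have "(\<integral>w. (cmod (g w))\<^sup>2 \<partial>lborel) = (\<integral>w. indicator ?H w *\<^sub>R (\<Sum>m\<in>M. (cmod (g (w + m)))\<^sup>2) \<partial>lborel)"
        by (rule integral_periodize_finite[OF T g2 _ M]) (use g(2) in auto)
      then show ?thesis unfolding f using Plancherel[OF g(1) g(2) bS] by simp
    qed
    have Qi: "integrable lborel ?Q"
    proof -
      have "integrable lborel (\<lambda>w. \<Sum>m\<in>M. (cmod (g (w + m)))\<^sup>2)"
        using sqint_shift[OF g(1)] by (intro Bochner_Integration.integrable_sum) (simp add: sqint_def)
      moreover have "?H \<in> sets borel"
      proof -
        have "?H = (\<lambda>w. w - a) -` hbox T \<inter> space borel" by (force simp: image_iff algebra_simps)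
        also have "\<dots> \<in> sets borel" by (rule measurable_sets[OF _ hbox_borel]) measurable
        finally show ?thesis .
      qed
      ultimately show ?thesis using integrable_mult_indicator[of ?H lborel "\<lambda>w. \<Sum>m\<in>M. (cmod (g (w + m)))\<^sup>2"] by simp
    qed
    \<comment> \<open>The factor \<open>chr (\<xi> j) w\<close> is unimodular and common to all
      terms; without it the sums are exactly those of \<open>Vandermonde_uniform\<close>.\<close>
    have red: "cmod (\<Sum>m\<in>M. g (w + m) * chr (\<xi> j) (w + m)) = cmod (\<Sum>m\<in>{m \<in> M. w + m \<in> S}. g (w + m) * z m ^ j)" if "j < N" for j w
    proof -
      have "(\<Sum>m\<in>M. g (w + m) * chr (\<xi> j) (w + m)) = (\<Sum>m\<in>{m \<in> M. w + m \<in> S}. g (w + m) * chr (\<xi> j) (w + m))"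
        using M(1) g(2) by (intro sum.mono_neutral_right) auto
      also have "\<dots> = chr (\<xi> j) w * (\<Sum>m\<in>{m \<in> M. w + m \<in> S}. g (w + m) * z m ^ j)"
        unfolding sum_distrib_left using z(2)[OF that] by (intro sum.cong) (auto simp: chr_add_right)
      finally show ?thesis by (simp add: norm_mult)
    qed
    have sumW: "(\<Sum>m\<in>M. (cmod (g (w + m)))\<^sup>2) = (\<Sum>m\<in>{m \<in> M. w + m \<in> S}. (cmod (g (w + m)))\<^sup>2)" for w
      using M(1) g(2) by (intro sum.mono_neutral_right) auto
    have lo: "?Q w \<le> C * (\<Sum>j<N. ?E j w)" for w
    proof (cases "w \<in> ?H")
      case True
      have "(\<Sum>m\<in>M. (cmod (g (w + m)))\<^sup>2) \<le> C * (\<Sum>j<N. (cmod (\<Sum>m\<in>{m \<in> M. w + m \<in> S}. g (w + m) * z m ^ j))\<^sup>2)"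
        unfolding sumW by (rule C(2)) (use N in auto)
      then show ?thesis using True by (simp add: red)
    qed simp
    have up: "(\<Sum>j<N. ?E j w) \<le> (real N * real (card M)) * ?Q w" for w
    proof (cases "w \<in> ?H")
      case True
      have "(cmod (\<Sum>m\<in>M. g (w + m) * chr (\<xi> j) (w + m)))\<^sup>2 \<le> real (card M) * (\<Sum>m\<in>M. (cmod (g (w + m)))\<^sup>2)" for j
      proof -
        have "cmod (\<Sum>m\<in>M. g (w + m) * chr (\<xi> j) (w + m)) \<le> (\<Sum>m\<in>M. 1 * cmod (g (w + m)))"
          by (rule order_trans[OF norm_sum]) (simp add: norm_mult)
        then have "(cmod (\<Sum>m\<in>M. g (w + m) * chr (\<xi> j) (w + m)))\<^sup>2 \<le> (\<Sum>m\<in>M. 1 * cmod (g (w + m)))\<^sup>2"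
          by (intro power_mono) auto
        also have "\<dots> \<le> (\<Sum>m\<in>M. 1\<^sup>2) * (\<Sum>m\<in>M. (cmod (g (w + m)))\<^sup>2)" by (rule Cauchy_Schwarz_ineq_sum)
        finally show ?thesis by simp
      qed
      then have "(\<Sum>j<N. (cmod (\<Sum>m\<in>M. g (w + m) * chr (\<xi> j) (w + m)))\<^sup>2) \<le> (\<Sum>j<N. real (card M) * (\<Sum>m\<in>M. (cmod (g (w + m)))\<^sup>2))"
        by (intro sum_mono)
      then show ?thesis using True by (simp add: mult.assoc)
    qed simp
    have Esi: "integrable lborel (\<lambda>w. \<Sum>j<N. ?E j w)" using Ei by (intro Bochner_Integration.integrable_sum)
    have "(\<integral>w. ?Q w \<partial>lborel) \<le> (\<integral>w. C * (\<Sum>j<N. ?E j w) \<partial>lborel)"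
      by (intro integral_mono Qi integrable_mult_right Esi lo)
    then have 1: "L2_norm_sq f \<le> C * (\<integral>w. (\<Sum>j<N. ?E j w) \<partial>lborel)" unfolding nrm by simp
    have "(\<integral>w. (\<Sum>j<N. ?E j w) \<partial>lborel) \<le> (\<integral>w. (real N * real (card M)) * ?Q w \<partial>lborel)"
      by (intro integral_mono integrable_mult_right Qi Esi up)
    then have 2: "(\<integral>w. (\<Sum>j<N. ?E j w) \<partial>lborel) \<le> (real N * real (card M)) * L2_norm_sq f" unfolding nrm by simp
    have nn: "L2_norm_sq f \<ge> 0" unfolding L2_norm_sq_def by simp
    have inf: "(\<Sum>\<^sub>\<infinity>l\<in>?Lam. (cmod (f l))\<^sup>2) = V * (\<integral>w. (\<Sum>j<N. ?E j w) \<partial>lborel)"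
      using infsumI[OF hs] tot by simp
    have "A * L2_norm_sq f \<le> A * (C * (\<integral>w. (\<Sum>j<N. ?E j w) \<partial>lborel))" using 1 Ap by (intro mult_left_mono) auto
    also have "\<dots> = V * (\<integral>w. (\<Sum>j<N. ?E j w) \<partial>lborel)" using C(1) by (simp add: A_def)
    finally have 3: "A * L2_norm_sq f \<le> (\<Sum>\<^sub>\<infinity>l\<in>?Lam. (cmod (f l))\<^sup>2)" by (simp only: inf)
    have "V * (\<integral>w. (\<Sum>j<N. ?E j w) \<partial>lborel) \<le> V * ((real N * real (card M)) * L2_norm_sq f)"
      using 2 Vp by (intro mult_left_mono) auto
    also have "\<dots> \<le> B * L2_norm_sq f"
      unfolding mult.assoc[symmetric] B_def using nn by (intro mult_right_mono) (auto simp: mult.assoc)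
    finally have 4: "(\<Sum>\<^sub>\<infinity>l\<in>?Lam. (cmod (f l))\<^sup>2) \<le> B * L2_norm_sq f" by (simp only: inf)
    show ?thesis using has_sum_imp_summable[OF hs] 3 4 by blast
  qed
  have "A \<le> B" by (simp add: B_def)
  then show ?thesis unfolding stable_sampling_def using Ap main by blast
qed

subsection \<open>Short curves covering families of lines\<close>

lemma poly_lengths_linepath: "poly_lengths (linepath p q) = {dist p q}"
  for p q :: "'a::real_normed_vector"
proof -
  have d: "dist (linepath p q s) (linepath p q t) = \<bar>s - t\<bar> * dist p q" for s t
  proof -
    have "linepath p q s - linepath p q t = (s - t) *\<^sub>R (q - p)" by (simp add: linepath_def algebra_simps)
    then show ?thesis by (simp add: dist_norm norm_minus_commute)
  qed
  have "(\<Sum>i<n. dist (linepath p q (t (Suc i))) (linepath p q (t i))) = dist p q"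
    if "t 0 = 0" "t n = 1" "\<forall>i<n. t i \<le> t (Suc i)" for n :: nat and t :: "nat \<Rightarrow> real"
  proof -
    have "(\<Sum>i<n. dist (linepath p q (t (Suc i))) (linepath p q (t i))) = (\<Sum>i<n. (t (Suc i) - t i)) * dist p q"
      unfolding sum_distrib_right using that(3) by (intro sum.cong) (auto simp: d)
    also have "(\<Sum>i<n. (t (Suc i) - t i)) = t n - t 0" by (rule sum_lessThan_telescope)
    finally show ?thesis using that by simp
  qed
  moreover have "dist p q \<in> poly_lengths (linepath p q)"
    unfolding poly_lengths_def
    by (intro CollectI exI[of _ "1::nat"] exI[of _ "\<lambda>i. if i = 0 then 0 else 1"]) (simp add: linepath_def dist_commute)
  ultimately show ?thesis unfolding poly_lengths_def by blast
qed

lemma rectifiable_linepath: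
  fixes p q :: "'a::real_normed_vector"
  shows "rectifiable_curve (linepath p q)" "curve_length (linepath p q) = dist p q"
  by (auto simp: rectifiable_curve_def curve_length_def poly_lengths_linepath)

lemma poly_lengths_nonempty: "poly_lengths \<alpha> \<noteq> {}"
proof -
  have "(\<Sum>i<1. dist (\<alpha> ((\<lambda>i::nat. if i = 0 then 0 else 1) (Suc i))) (\<alpha> ((\<lambda>i::nat. if i = 0 then 0 else 1) i))) \<in> poly_lengths \<alpha>"
    unfolding poly_lengths_def by (intro CollectI exI[of _ "1::nat"] exI[of _ "\<lambda>i. if i = 0 then 0 else 1"]) simp
  then show ?thesis by blast
qed

text \<open>Additivity of the supremum over partitions: clamping the parameters splits a partition
  of the join into one for each half, and two partitions concatenate to one of the join.\<close>

lemma rectifiable_join: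
  fixes g1 g2 :: "real \<Rightarrow> 'a::euclidean_space"
  assumes g1: "rectifiable_curve g1" and g2: "rectifiable_curve g2" and eq: "g1 1 = g2 0"
  shows "rectifiable_curve (g1 +++ g2)" "curve_length (g1 +++ g2) = curve_length g1 + curve_length g2"
proof -
  let ?G = "g1 +++ g2"
  have bd: "bdd_above (poly_lengths g1)" "bdd_above (poly_lengths g2)" using g1 g2 by (auto simp: rectifiable_curve_def)
  have G1: "?G s = g1 (min (2 * s) 1)" "g2 (max (2 * s - 1) 0) = g1 1" if "s \<le> 1/2" for s
    using that eq by (auto simp: joinpaths_def)
  have G2: "?G s = g2 (max (2 * s - 1) 0)" "g1 (min (2 * s) 1) = g1 1" if "s \<ge> 1/2" for s
  proof -
    show "g1 (min (2 * s) 1) = g1 1" using that by simp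
    show "?G s = g2 (max (2 * s - 1) 0)"
    proof (cases "s = 1/2")
      case True show ?thesis unfolding True using eq by (simp add: joinpaths_def)
    next
      case False then show ?thesis using that by (simp add: joinpaths_def)
    qed
  qed
  have up: "\<exists>u\<in>poly_lengths g1. \<exists>v\<in>poly_lengths g2. s \<le> u + v" if "s \<in> poly_lengths ?G" for s
  proof -
    from that obtain n t where s: "s = (\<Sum>i<n. dist (?G (t (Suc i))) (?G (t i)))"
      and t: "t 0 = 0" "t n = 1" "\<forall>i<n. t i \<le> t (Suc i)" unfolding poly_lengths_def by blast
    \<comment> \<open>Clamped parameters: each half stands still while the join runs through the
      other, so the partition need not contain \<open>1/2\<close>. The step that crosses
      \<open>1/2\<close> is handled by the triangle inequality.\<close>
    define t1 where "t1 i = min (2 * t i) 1" for i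
    define t2 where "t2 i = max (2 * t i - 1) 0" for i
    have le: "dist (?G (t (Suc i))) (?G (t i)) \<le> dist (g1 (t1 (Suc i))) (g1 (t1 i)) + dist (g2 (t2 (Suc i))) (g2 (t2 i))" if i: "i < n" for i
    proof -
      have m: "t i \<le> t (Suc i)" using t i by blast
      consider "t (Suc i) \<le> 1/2" | "t i \<ge> 1/2" | "t i \<le> 1/2" "t (Suc i) \<ge> 1/2" by linarith
      then show ?thesis
      proof cases
        case 1
        then show ?thesis using G1[of "t i"] G1[of "t (Suc i)"] m by (simp add: t1_def t2_def)
      next
        case 2
        then show ?thesis using G2[of "t i"] G2[of "t (Suc i)"] m by (simp add: t1_def t2_def)
      next
        case 3
        have "dist (?G (t (Suc i))) (?G (t i)) \<le> dist (?G (t (Suc i))) (g1 1) + dist (g1 1) (?G (t i))" by (rule dist_triangle)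
        then show ?thesis using G1[OF 3(1)] G2[OF 3(2)] by (simp add: t1_def t2_def)
      qed
    qed
    have "(\<Sum>i<n. dist (g1 (t1 (Suc i))) (g1 (t1 i))) \<in> poly_lengths g1"
      unfolding poly_lengths_def using t
      by (intro CollectI exI[of _ n] exI[of _ t1]) (auto simp: t1_def intro!: min.mono)
    moreover have "(\<Sum>i<n. dist (g2 (t2 (Suc i))) (g2 (t2 i))) \<in> poly_lengths g2"
      unfolding poly_lengths_def using t
      by (intro CollectI exI[of _ n] exI[of _ t2]) (auto simp: t2_def intro!: max.mono)
    moreover have "s \<le> (\<Sum>i<n. dist (g1 (t1 (Suc i))) (g1 (t1 i))) + (\<Sum>i<n. dist (g2 (t2 (Suc i))) (g2 (t2 i)))"
      unfolding s sum.distrib[symmetric] using le by (intro sum_mono) auto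
    ultimately show ?thesis by blast
  qed
  have down: "u + v \<in> poly_lengths ?G" if "u \<in> poly_lengths g1" "v \<in> poly_lengths g2" for u v
  proof -
    from that(1) obtain n1 t1 where u: "u = (\<Sum>i<n1. dist (g1 (t1 (Suc i))) (g1 (t1 i)))"
      and t1: "t1 0 = 0" "t1 n1 = 1" "\<forall>i<n1. t1 i \<le> t1 (Suc i)" unfolding poly_lengths_def by blast
    from that(2) obtain n2 t2 where v: "v = (\<Sum>i<n2. dist (g2 (t2 (Suc i))) (g2 (t2 i)))"
      and t2: "t2 0 = 0" "t2 n2 = 1" "\<forall>i<n2. t2 i \<le> t2 (Suc i)" unfolding poly_lengths_def by blast
    have mono: "s 0 \<le> s i \<and> s i \<le> s n" if "\<forall>i<n. s i \<le> s (Suc i)" "i \<le> n" for s :: "nat \<Rightarrow> real" and n i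
    proof
      show "s 0 \<le> s i" using that by (induction i) (auto intro: order_trans)
      show "s i \<le> s n" using that(2,1) by (induction rule: inc_induct) (auto intro: order_trans)
    qed
    define t where "t i = (if i \<le> n1 then t1 i / 2 else (1 + t2 (i - n1)) / 2)" for i
    have Gt1: "?G (t i) = g1 (t1 i)" if "i \<le> n1" for i
      using mono[OF t1(3) that] t1 that G1(1)[of "t i"] by (simp add: t_def)
    have Gt2: "?G (t (n1 + i)) = g2 (t2 i)" if "i \<le> n2" for i
    proof (cases "i = 0")
      case True then show ?thesis using Gt1[of n1] t1 t2 eq by simp
    next
      case False
      then have "max (2 * t (n1 + i) - 1) 0 = t2 i" "t (n1 + i) \<ge> 1/2"
        using mono[OF t2(3) that] t2 by (simp_all add: t_def add_divide_distrib)
      then show ?thesis using G2(1)[of "t (n1 + i)"] by simp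
    qed
    have "(\<Sum>i<n1 + n2. dist (?G (t (Suc i))) (?G (t i))) = (\<Sum>i<n1. dist (?G (t (Suc i))) (?G (t i))) + (\<Sum>i<n2. dist (?G (t (Suc (n1 + i)))) (?G (t (n1 + i))))"
      by (induction n2) auto
    also have "(\<Sum>i<n1. dist (?G (t (Suc i))) (?G (t i))) = u"
      unfolding u by (intro sum.cong) (auto simp: Gt1)
    also have "(\<Sum>i<n2. dist (?G (t (Suc (n1 + i)))) (?G (t (n1 + i)))) = v"
      unfolding v using Gt2 by (intro sum.cong refl) (metis add_Suc_right lessThan_iff less_imp_le Suc_leI)
    finally have "u + v = (\<Sum>i<n1 + n2. dist (?G (t (Suc i))) (?G (t i)))" by simp
    moreover have "t 0 = 0" using t1 by (simp add: t_def)
    moreover have "t (n1 + n2) = 1" using t1 t2 by (cases "n2 = 0") (auto simp: t_def)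
    moreover have "\<forall>i<n1 + n2. t i \<le> t (Suc i)"
    proof (intro allI impI)
      fix i assume i: "i < n1 + n2"
      consider "Suc i \<le> n1" | "i = n1" | "i > n1" by linarith
      then show "t i \<le> t (Suc i)"
      proof cases
        case 1 then show ?thesis using t1 by (simp add: t_def)
      next
        case 2
        then have "t2 0 \<le> t2 1" using t2 i by (metis One_nat_def add_less_cancel_left add.right_neutral)
        then show ?thesis using 2 t1 t2 by (simp add: t_def)
      next
        case 3
        then have "t2 (i - n1) \<le> t2 (Suc (i - n1))" using t2 i by (metis less_diff_conv2 less_imp_le add.commute)
        then show ?thesis using 3 by (simp add: t_def Suc_diff_le)
      qed
    qed
    ultimately show ?thesis unfolding poly_lengths_def by blast
  qed
  have le: "s \<le> curve_length g1 + curve_length g2" if "s \<in> poly_lengths ?G" for s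
    using up[OF that] bd unfolding curve_length_def by (meson add_mono cSup_upper order_trans)
  then have bG: "bdd_above (poly_lengths ?G)" by (auto simp: bdd_above_def)
  have "continuous_on {0..1} ?G"
  proof -
    have "path ?G" using g1 g2 eq by (subst path_join) (auto simp: path_def rectifiable_curve_def pathfinish_def pathstart_def)
    then show ?thesis by (simp add: path_def)
  qed
  then show "rectifiable_curve ?G" using bG by (simp add: rectifiable_curve_def)
  show "curve_length ?G = curve_length g1 + curve_length g2"
  proof (rule antisym)
    show "curve_length ?G \<le> curve_length g1 + curve_length g2"
      unfolding curve_length_def[of ?G] by (rule cSup_least[OF poly_lengths_nonempty]) (rule le)
    have "u \<le> curve_length ?G - curve_length g2" if u: "u \<in> poly_lengths g1" for u
    proof -
      have "v \<le> curve_length ?G - u" if v: "v \<in> poly_lengths g2" for v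
        using cSup_upper[OF down[OF u v] bG] unfolding curve_length_def by simp
      then have "curve_length g2 \<le> curve_length ?G - u"
        unfolding curve_length_def[of g2] by (intro cSup_least poly_lengths_nonempty)
      then show ?thesis by simp
    qed
    then have "curve_length g1 \<le> curve_length ?G - curve_length g2"
      unfolding curve_length_def[of g1] by (intro cSup_least poly_lengths_nonempty)
    then show "curve_length g1 + curve_length g2 \<le> curve_length ?G" by simp
  qed
qed

text \<open>The endpoints are recorded so that coverings can be chained, and the length is only
  bounded; \<open>cov_exact\<close> turns the bound into an equality at the end.\<close>

definition cov :: "'a::euclidean_space set \<Rightarrow> 'a \<Rightarrow> 'a \<Rightarrow> real \<Rightarrow> bool" where
  "cov E p q l \<longleftrightarrow> (\<exists>\<alpha>. rectifiable_curve \<alpha> \<and> \<alpha> 0 = p \<and> \<alpha> 1 = q \<and> E \<subseteq> \<alpha> ` {0..1} \<and> curve_length \<alpha> \<le> l)"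

lemma cov_segment: "cov (closed_segment p q) p q (dist p q)"
  unfolding cov_def using rectifiable_linepath[of p q]
  by (intro exI[of _ "linepath p q"]) (simp add: linepath_image_01 linepath_0' linepath_1')

lemma cov_mono: "cov E p q l \<Longrightarrow> F \<subseteq> E \<Longrightarrow> l \<le> l' \<Longrightarrow> cov F p q l'"
  unfolding cov_def by (elim exE conjE, intro exI conjI) (assumption | rule order_trans | simp)+

lemma cov_join:
  assumes "cov E p q l" "cov F q r l'"
  shows "cov (E \<union> F) p r (l + l')"
proof -
  obtain g1 where g1: "rectifiable_curve g1" "g1 0 = p" "g1 1 = q" "E \<subseteq> g1 ` {0..1}" "curve_length g1 \<le> l"
    using assms(1) unfolding cov_def by blast
  obtain g2 where g2: "rectifiable_curve g2" "g2 0 = q" "g2 1 = r" "F \<subseteq> g2 ` {0..1}" "curve_length g2 \<le> l'"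
    using assms(2) unfolding cov_def by blast
  have eq: "g1 1 = g2 0" using g1 g2 by simp
  have "(g1 +++ g2) ` {0..1} = g1 ` {0..1} \<union> g2 ` {0..1}"
    using path_image_join[of g1 g2] eq by (simp add: path_image_def pathfinish_def pathstart_def)
  then show ?thesis unfolding cov_def
    using rectifiable_join[OF g1(1) g2(1) eq] g1 g2
    by (intro exI[of _ "g1 +++ g2"]) (auto simp: joinpaths_def)
qed

text \<open>\<open>condition_C2\<close> prescribes the length exactly, so the missing amount is
  spent on an additional final segment.\<close>

lemma cov_exact:
  fixes E :: "'a::euclidean_space set"
  assumes "cov E p q l"
  obtains \<alpha> where "rectifiable_curve \<alpha>" "E \<subseteq> \<alpha> ` {0..1}" "curve_length \<alpha> = l"
proof -
  obtain g where g: "rectifiable_curve g" "g 0 = p" "g 1 = q" "E \<subseteq> g ` {0..1}" "curve_length g \<le> l"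
    using assms unfolding cov_def by blast
  obtain b :: 'a where b: "b \<in> Basis" using nonempty_Basis by blast
  let ?h = "linepath q (q + (l - curve_length g) *\<^sub>R b)"
  have h: "rectifiable_curve ?h" "curve_length ?h = l - curve_length g"
    using rectifiable_linepath[of q "q + (l - curve_length g) *\<^sub>R b"] g(5) b by (auto simp: dist_norm)
  have eq: "g 1 = ?h 0" using g by (simp add: linepath_def)
  have "(g +++ ?h) ` {0..1} = g ` {0..1} \<union> ?h ` {0..1}"
    using path_image_join[of g ?h] eq by (simp add: path_image_def pathfinish_def pathstart_def)
  then show ?thesis using rectifiable_join[OF g(1) h(1) eq] h g by (intro that[of "g +++ ?h"]) auto
qed

text \<open>Back-and-forth traversal: from a \<open>u\<close>-end the curve steps to the
  \<open>u\<close>-end of the next segment and runs to its \<open>v\<close>-end, and conversely.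
  Each step between segments costs at most \<open>\<kappa>\<close>.\<close>

lemma cov_group:
  fixes u v :: "'i \<Rightarrow> 'a::euclidean_space"
  assumes "finite I" "I \<noteq> {}" and \<kappa>: "\<And>i j. i \<in> I \<Longrightarrow> j \<in> I \<Longrightarrow> dist (u i) (u j) \<le> \<kappa>" "\<And>i j. i \<in> I \<Longrightarrow> j \<in> I \<Longrightarrow> dist (v i) (v j) \<le> \<kappa>"
  shows "\<exists>p\<in>u ` I \<union> v ` I. \<exists>q\<in>u ` I \<union> v ` I. cov (\<Union>i\<in>I. closed_segment (u i) (v i)) p q ((\<Sum>i\<in>I. dist (u i) (v i)) + real (card I) * \<kappa>)"
  using assms
proof (induction I rule: finite_ne_induct)
  case (singleton i)
  then have "\<kappa> \<ge> 0" by (metis dist_self singletonI)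
  then show ?case using cov_mono[OF cov_segment[of "u i" "v i"] order_refl, of "dist (u i) (v i) + \<kappa>"] by auto
next
  case (insert i I)
  obtain p q where p: "p \<in> u ` I \<union> v ` I" and q: "q \<in> u ` I \<union> v ` I"
    and c: "cov (\<Union>i\<in>I. closed_segment (u i) (v i)) p q ((\<Sum>i\<in>I. dist (u i) (v i)) + real (card I) * \<kappa>)"
  proof -
    have "\<exists>p\<in>u ` I \<union> v ` I. \<exists>q\<in>u ` I \<union> v ` I. cov (\<Union>i\<in>I. closed_segment (u i) (v i)) p q ((\<Sum>i\<in>I. dist (u i) (v i)) + real (card I) * \<kappa>)"
      by (rule insert.IH; rule insert.prems) simp_all
    then show ?thesis using that by blast
  qed
  have next_seg: "\<exists>r\<in>{u i, v i}. cov (closed_segment (u i) (v i)) q r (\<kappa> + dist (u i) (v i))"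
  proof -
    consider j where "j \<in> I" "q = u j" | j where "j \<in> I" "q = v j" using q by blast
    then show ?thesis
    proof cases
      case 1
      have "cov (closed_segment q (u i) \<union> closed_segment (u i) (v i)) q (v i) (dist q (u i) + dist (u i) (v i))"
        by (rule cov_join[OF cov_segment cov_segment])
      moreover have "dist q (u i) \<le> \<kappa>" using insert.prems(1)[of j i] 1 by simp
      ultimately have "cov (closed_segment (u i) (v i)) q (v i) (\<kappa> + dist (u i) (v i))" by (elim cov_mono) auto
      then show ?thesis by blast
    next
      case 2
      have "cov (closed_segment q (v i) \<union> closed_segment (v i) (u i)) q (u i) (dist q (v i) + dist (v i) (u i))"
        by (rule cov_join[OF cov_segment cov_segment])
      moreover have "dist q (v i) \<le> \<kappa>" using insert.prems(2)[of j i] 2 by simp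
      ultimately have "cov (closed_segment (u i) (v i)) q (u i) (\<kappa> + dist (u i) (v i))"
        by (elim cov_mono) (auto simp: closed_segment_commute dist_commute)
      then show ?thesis by blast
    qed
  qed
  then obtain r where r: "r \<in> {u i, v i}" "cov (closed_segment (u i) (v i)) q r (\<kappa> + dist (u i) (v i))" by blast
  have "cov (\<Union>i\<in>insert i I. closed_segment (u i) (v i)) p r ((\<Sum>i\<in>insert i I. dist (u i) (v i)) + real (card (insert i I)) * \<kappa>)"
    by (rule cov_mono[OF cov_join[OF c r(2)]]) (use insert.hyps in \<open>auto simp: algebra_simps\<close>)
  moreover have "p \<in> u ` insert i I \<union> v ` insert i I" "r \<in> u ` insert i I \<union> v ` insert i I" using p r(1) by auto
  ultimately show ?case by blast
qed

text \<open>Inside a group the steps are short; a change of group joins two points of the ball and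
  costs at most its diameter \<open>2 * a\<close>.\<close>

lemma cov_groups:
  fixes u v :: "'i \<Rightarrow> 'a::euclidean_space"
  assumes "finite G" and "\<And>k. k \<in> G \<Longrightarrow> finite (I k)" "\<And>k. k \<in> G \<Longrightarrow> I k \<noteq> {}"
    and "\<And>k i j. k \<in> G \<Longrightarrow> i \<in> I k \<Longrightarrow> j \<in> I k \<Longrightarrow> dist (u i) (u j) \<le> \<kappa>"
    and "\<And>k i j. k \<in> G \<Longrightarrow> i \<in> I k \<Longrightarrow> j \<in> I k \<Longrightarrow> dist (v i) (v j) \<le> \<kappa>"
    and "\<And>k i. k \<in> G \<Longrightarrow> i \<in> I k \<Longrightarrow> u i \<in> cball x a \<and> v i \<in> cball x a" and a: "a \<ge> 0"
  shows "\<exists>p\<in>cball x a. \<exists>q\<in>cball x a. cov (\<Union>k\<in>G. \<Union>i\<in>I k. closed_segment (u i) (v i)) p q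
     ((\<Sum>k\<in>G. \<Sum>i\<in>I k. dist (u i) (v i)) + (\<Sum>k\<in>G. real (card (I k))) * \<kappa> + real (card G) * (2 * a))"
  using assms(1-6)
proof (induction G rule: finite_induct)
  case empty
  have "cov {} x x 0" using cov_segment[of x x] by (rule cov_mono) auto
  then show ?case using a by (intro bexI[of _ x]) auto
next
  case (insert k G)
  obtain p q where p: "p \<in> cball x a" and q: "q \<in> cball x a"
    and c: "cov (\<Union>k\<in>G. \<Union>i\<in>I k. closed_segment (u i) (v i)) p q
     ((\<Sum>k\<in>G. \<Sum>i\<in>I k. dist (u i) (v i)) + (\<Sum>k\<in>G. real (card (I k))) * \<kappa> + real (card G) * (2 * a))"
  proof -
    have "\<exists>p\<in>cball x a. \<exists>q\<in>cball x a. cov (\<Union>k\<in>G. \<Union>i\<in>I k. closed_segment (u i) (v i)) p q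
     ((\<Sum>k\<in>G. \<Sum>i\<in>I k. dist (u i) (v i)) + (\<Sum>k\<in>G. real (card (I k))) * \<kappa> + real (card G) * (2 * a))"
    proof (rule insert.IH)
      show "finite (I k')" "I k' \<noteq> {}" if "k' \<in> G" for k' using insert.prems(1,2)[of k'] that by simp_all
      show "dist (u i) (u j) \<le> \<kappa>" "dist (v i) (v j) \<le> \<kappa>" if "k' \<in> G" "i \<in> I k'" "j \<in> I k'" for k' i j
        using insert.prems(3,4)[of k' i j] that by simp_all
      show "u i \<in> cball x a \<and> v i \<in> cball x a" if "k' \<in> G" "i \<in> I k'" for k' i
        using insert.prems(5)[of k' i] that by simp
    qed
    then show ?thesis using that by blast
  qed
  obtain p' q' where p': "p' \<in> u ` I k \<union> v ` I k" and q': "q' \<in> u ` I k \<union> v ` I k"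
    and c': "cov (\<Union>i\<in>I k. closed_segment (u i) (v i)) p' q' ((\<Sum>i\<in>I k. dist (u i) (v i)) + real (card (I k)) * \<kappa>)"
  proof -
    have "\<exists>p\<in>u ` I k \<union> v ` I k. \<exists>q\<in>u ` I k \<union> v ` I k. cov (\<Union>i\<in>I k. closed_segment (u i) (v i)) p q ((\<Sum>i\<in>I k. dist (u i) (v i)) + real (card (I k)) * \<kappa>)"
    proof (rule cov_group)
      show "finite (I k)" "I k \<noteq> {}" using insert.prems(1,2)[of k] by simp_all
      show "dist (u i) (u j) \<le> \<kappa>" "dist (v i) (v j) \<le> \<kappa>" if "i \<in> I k" "j \<in> I k" for i j
        using insert.prems(3,4)[of k i j] that by simp_all
    qed
    then show ?thesis using that by blast
  qed
  have b: "p' \<in> cball x a" "q' \<in> cball x a" using p' q' insert.prems(5)[of k] by auto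
  have "dist q p' \<le> dist x q + dist x p'" by (rule dist_triangle3)
  then have d: "dist q p' \<le> 2 * a" using q b by simp
  have "cov ((\<Union>k\<in>G. \<Union>i\<in>I k. closed_segment (u i) (v i)) \<union> closed_segment q p' \<union> (\<Union>i\<in>I k. closed_segment (u i) (v i))) p q'
     (((\<Sum>k\<in>G. \<Sum>i\<in>I k. dist (u i) (v i)) + (\<Sum>k\<in>G. real (card (I k))) * \<kappa> + real (card G) * (2 * a)) + dist q p' + ((\<Sum>i\<in>I k. dist (u i) (v i)) + real (card (I k)) * \<kappa>))"
    by (rule cov_join[OF cov_join[OF c cov_segment] c'])
  then have "cov (\<Union>k\<in>insert k G. \<Union>i\<in>I k. closed_segment (u i) (v i)) p q'
     ((\<Sum>k\<in>insert k G. \<Sum>i\<in>I k. dist (u i) (v i)) + (\<Sum>k\<in>insert k G. real (card (I k))) * \<kappa> + real (card (insert k G)) * (2 * a))"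
    by (rule cov_mono) (use insert.hyps d in \<open>auto simp: algebra_simps\<close>)
  then show ?case using p b by blast
qed

text \<open>A line meeting the ball of radius \<open>a\<close> cuts a chord of length at least
  \<open>2 * a\<close> from the concentric ball of radius \<open>2 * a\<close>. The volume bound on
  the sum of chord lengths therefore bounds the number of lines.\<close>

lemma line_count:
  fixes y :: "'a::euclidean_space \<Rightarrow> 'a" and x :: 'a
  assumes b0: "b0 \<in> Basis" and R: "R > 0" and a: "a > 0"
    and y: "\<And>m. m \<in> plat0 b0 R \<Longrightarrow> y m \<in> cell0 b0 R m"
  defines "I \<equiv> {m \<in> plat0 b0 R. norm (perp b0 (y m) - perp b0 x) \<le> a}"
  shows "finite I" "real (card I) * (2 * a * R ^ (DIM('a) - 1)) \<le> unit_ball_vol (real DIM('a)) * (2 * a + real DIM('a) * R) ^ DIM('a)"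
proof -
  let ?n = "DIM('a) - 1"
  define K where "K = unit_ball_vol (real DIM('a)) * (2 * a + real DIM('a) * R) ^ DIM('a)"
  have nb: "norm b0 = 1" using b0 by simp
  have Rn: "R ^ ?n > 0" using R by simp
  have bound: "real (card F) * (2 * a * R ^ ?n) \<le> K" if F: "finite F" "F \<subseteq> I" for F
  proof -
    have big: "2 * a \<le> diameter (line_through (y m) b0 \<inter> cball x (2 * a))" if "m \<in> F" for m
    proof -
      have "norm (perp b0 (y m) - perp b0 x) \<le> a" using that F by (auto simp: I_def)
      then have "(norm (perp b0 (y m) - perp b0 x))\<^sup>2 \<le> a\<^sup>2" by (intro power_mono) auto
      then have "a\<^sup>2 \<le> max 0 ((2 * a)\<^sup>2 - (norm (perp b0 (y m) - perp b0 x))\<^sup>2)" by (simp add: power_mult_distrib)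
      then have "a \<le> chord b0 (y m) x (2 * a)" unfolding chord_def by (rule real_le_rsqrt)
      then show ?thesis using a by (simp add: diameter_line_Int_cball[OF nb])
    qed
    have "ennreal (real (card F) * (2 * a)) = (\<Sum>m\<in>F. ennreal (2 * a))"
      using a by (simp add: ennreal_of_nat_eq_real_of_nat ennreal_mult)
    also have "\<dots> \<le> (\<Sum>m\<in>F. ennreal (diameter (line_through (y m) b0 \<inter> cball x (2 * a))))"
      using big by (intro sum_mono ennreal_leI)
    also have "\<dots> \<le> (\<Sum>\<^sub>\<infinity>m\<in>plat0 b0 R. ennreal (diameter (line_through (y m) b0 \<inter> cball x (2 * a))))"
      using F by (subst nonneg_infsum_complete) (auto intro!: SUP_upper simp: I_def)
    finally have "ennreal (R ^ ?n) * ennreal (real (card F) * (2 * a)) \<le> ennreal (R ^ ?n) * (\<Sum>\<^sub>\<infinity>m\<in>plat0 b0 R. ennreal (diameter (line_through (y m) b0 \<inter> cball x (2 * a))))"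
      by (rule mult_left_mono) simp
    also have "\<dots> \<le> emeasure lborel (cball x (2 * a + real DIM('a) * R))"
      using a by (intro cell_sum_sandwich(1)[OF b0 R _ y]) auto
    also have "\<dots> = ennreal (measure lebesgue (cball x (2 * a + real DIM('a) * R)))"
      using emeasure_lborel_cball_finite[of x "2 * a + real DIM('a) * R"] by (simp add: emeasure_eq_ennreal_measure)
    also have "\<dots> = ennreal K"
      using a R by (simp add: content_cball K_def)
    finally have "ennreal (R ^ ?n * (real (card F) * (2 * a))) \<le> ennreal K"
      using Rn a by (simp add: ennreal_mult)
    moreover have "K \<ge> 0" unfolding K_def using a R by (intro mult_nonneg_nonneg) auto
    ultimately show ?thesis by (simp add: ennreal_le_iff mult_ac)
  qed
  have "card F \<le> nat \<lfloor>K / (2 * a * R ^ ?n)\<rfloor>" if "F \<subseteq> I" "finite F" for F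
  proof -
    have "real (card F) \<le> K / (2 * a * R ^ ?n)" using bound[OF that(2,1)] a Rn by (simp add: pos_le_divide_eq)
    then show ?thesis by linarith
  qed
  then show fin: "finite I" using finite_if_finite_subsets_card_bdd[of I] by blast
  show "real (card I) * (2 * a * R ^ (DIM('a) - 1)) \<le> unit_ball_vol (real DIM('a)) * (2 * a + real DIM('a) * R) ^ DIM('a)"
    using bound[OF fin order_refl] by (simp only: K_def)
qed

text \<open>For nonnegative numbers the square of a difference is at most the difference of the
  squares in modulus. Near the rim of the ball chords are not Lipschitz in the position of the line,
  but this square-root modulus holds up to the rim.\<close>

lemma chord_close:
  fixes p p' :: "'a::euclidean_space"
  assumes a: "a \<ge> 0" and p: "norm (perp b0 p - perp b0 x) \<le> a" "norm (perp b0 p' - perp b0 x) \<le> a"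
    and D: "norm (perp b0 p - perp b0 p') \<le> D"
  shows "\<bar>chord b0 p x a - chord b0 p' x a\<bar> \<le> sqrt (2 * a * D)"
proof -
  let ?r = "norm (perp b0 p - perp b0 x)" and ?r' = "norm (perp b0 p' - perp b0 x)"
  let ?c = "chord b0 p x a" and ?c' = "chord b0 p' x a"
  have c0: "?c \<ge> 0" "?c' \<ge> 0" by (auto simp: chord_def)
  have "?r\<^sup>2 \<le> a\<^sup>2" "?r'\<^sup>2 \<le> a\<^sup>2" using p by (auto intro!: power_mono)
  then have c2: "?c\<^sup>2 = a\<^sup>2 - ?r\<^sup>2" "?c'\<^sup>2 = a\<^sup>2 - ?r'\<^sup>2" by (auto simp: chord_def)
  have "\<bar>?r - ?r'\<bar> \<le> norm ((perp b0 p - perp b0 x) - (perp b0 p' - perp b0 x))" by (rule norm_triangle_ineq3)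
  then have rr: "\<bar>?r - ?r'\<bar> \<le> D" using D by simp
  have "\<bar>?c - ?c'\<bar>\<^sup>2 \<le> \<bar>?c - ?c'\<bar> * (?c + ?c')"
    unfolding power2_eq_square using c0 by (intro mult_left_mono) auto
  also have "\<dots> = \<bar>(?c - ?c') * (?c + ?c')\<bar>" using c0 by (simp add: abs_mult)
  also have "(?c - ?c') * (?c + ?c') = ?c\<^sup>2 - ?c'\<^sup>2" by (simp add: power2_eq_square algebra_simps)
  also have "\<dots> = (?r' - ?r) * (?r' + ?r)" using c2 by (simp add: power2_eq_square algebra_simps)
  also have "\<bar>(?r' - ?r) * (?r' + ?r)\<bar> = \<bar>?r - ?r'\<bar> * (?r' + ?r)" by (simp add: abs_mult abs_minus_commute)
  also have "\<dots> \<le> D * (2 * a)" using rr p by (intro mult_mono) auto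
  finally show ?thesis by (intro real_le_rsqrt) (simp add: mult_ac)
qed

lemma line_Int_cball_subset_segment:
  fixes b0 p x :: "'a::euclidean_space"
  assumes "norm b0 = 1" "a \<ge> 0"
  shows "line_through p b0 \<inter> cball x a \<subseteq> closed_segment (perp b0 p + (x \<bullet> b0 - chord b0 p x a) *\<^sub>R b0) (perp b0 p + (x \<bullet> b0 + chord b0 p x a) *\<^sub>R b0)"
proof
  fix z assume "z \<in> line_through p b0 \<inter> cball x a"
  from this obtain s where s: "z = perp b0 p + s *\<^sub>R b0" "x \<bullet> b0 - chord b0 p x a \<le> s" "s \<le> x \<bullet> b0 + chord b0 p x a"
  proof -
    assume "z \<in> line_through p b0 \<inter> cball x a"
    then have "z \<in> (\<lambda>s. perp b0 p + s *\<^sub>R b0) ` {x \<bullet> b0 - chord b0 p x a .. x \<bullet> b0 + chord b0 p x a}"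
      unfolding line_Int_cball[OF assms] by (simp split: if_splits)
    then obtain s where "z = perp b0 p + s *\<^sub>R b0" "s \<in> {x \<bullet> b0 - chord b0 p x a .. x \<bullet> b0 + chord b0 p x a}" by (rule imageE)
    then show ?thesis by (intro that[of s]) (simp_all only: atLeastAtMost_iff)
  qed
  let ?c = "chord b0 p x a"
  show "z \<in> closed_segment (perp b0 p + (x \<bullet> b0 - ?c) *\<^sub>R b0) (perp b0 p + (x \<bullet> b0 + ?c) *\<^sub>R b0)"
  proof (cases "?c = 0")
    case True then show ?thesis using s by simp
  next
    case False
    moreover have "?c \<ge> 0" unfolding chord_def by simp
    ultimately have c: "?c > 0" by linarith
    have gen: "(1 - t) *\<^sub>R (p + \<alpha> *\<^sub>R b) + t *\<^sub>R (p + \<beta> *\<^sub>R b) = p + ((1 - t) * \<alpha> + t * \<beta>) *\<^sub>R b"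
      for p b :: 'a and \<alpha> \<beta> t :: real by (simp add: algebra_simps)
    define t where "t = (s - (x \<bullet> b0 - ?c)) / (2 * ?c)"
    have t: "0 \<le> t" "t \<le> 1" using s c by (auto simp: t_def field_simps)
    have "t * (2 * ?c) = s - (x \<bullet> b0 - ?c)" using c by (simp add: t_def)
    then have "(1 - t) * (x \<bullet> b0 - ?c) + t * (x \<bullet> b0 + ?c) = s" by (simp add: algebra_simps)
    then have "z = (1 - t) *\<^sub>R (perp b0 p + (x \<bullet> b0 - ?c) *\<^sub>R b0) + t *\<^sub>R (perp b0 p + (x \<bullet> b0 + ?c) *\<^sub>R b0)"
      unfolding gen using s(1) by simp
    then show ?thesis using t by (auto simp: closed_segment_def)
  qed
qed

text \<open>Lines are traversed in bundles over cells of side \<open>\<rho> = sqrt a\<close>. Up to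
  constants and with \<open>d\<close> the dimension, there are \<open>a ^ (d - 1)\<close> lines with
  a cost \<open>\<kappa>\<close> of order \<open>a\<close> to the power 3/4 each, and
  \<open>(a / \<rho>) ^ (d - 1)\<close> bundles with a cost \<open>2 * a\<close> each. For
  \<open>d \<ge> 2\<close> both totals are at most of order \<open>a ^ d\<close> divided by the
  fourth root of \<open>a\<close>.\<close>

lemma condition_C2_family:
  fixes y :: "nat \<Rightarrow> 'a::euclidean_space \<Rightarrow> 'a"
  assumes b0: "b0 \<in> Basis" and R: "R > 0"
    and y: "\<And>j m. j < N \<Longrightarrow> m \<in> plat0 b0 R \<Longrightarrow> y j m \<in> cell0 b0 R m"
    and inj: "inj_on (\<lambda>(j, m). line_through (y j m) b0) ({..<N} \<times> plat0 b0 R)"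
  defines "P \<equiv> (\<lambda>(j, m). line_through (y j m) b0) ` ({..<N} \<times> plat0 b0 R)"
  shows "condition_C2 P"
proof -
  let ?d = "DIM('a)" and ?n = "DIM('a) - 1"
  have nb: "norm b0 = 1" using b0 by simp
  define \<omega> where "\<omega> = unit_ball_vol (real ?d)"
  have \<omega>: "\<omega> \<ge> 0" unfolding \<omega>_def by simp
  \<comment> \<open>\<open>C1\<close> accounts for the steps inside bundles, \<open>C2\<close> for
    the changes of bundle. The factor 3 in \<open>C1\<close> comes from enlarging
    \<open>2 * a + d * R\<close> to \<open>3 * a\<close>.\<close>
  define C1 where "C1 = real N * \<omega> * 3 ^ ?d * (3 * real ?d) / (2 * R ^ ?n)"
  define C2 where "C2 = \<omega> * (2 + real ?d) ^ ?d"
  have C: "C1 \<ge> 0" "C2 \<ge> 0" using \<omega> R by (auto simp: C1_def C2_def)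
  define \<delta> where "\<delta> a = (C1 + C2) * a ^ ?d / sqrt (sqrt a)" for a
  have \<delta>0: "\<delta> a \<ge> 0" if "a > 0" for a using that C by (simp add: \<delta>_def)
  have \<delta>o: "\<delta> \<in> o(\<lambda>a. a ^ ?d)"
  proof (rule smalloI_tendsto)
    have "filterlim (\<lambda>a. sqrt (sqrt a)) at_top at_top"
      by (rule filterlim_compose[OF sqrt_at_top sqrt_at_top])
    then have "((\<lambda>a. (C1 + C2) / sqrt (sqrt a)) \<longlongrightarrow> 0) at_top"
      by (rule real_tendsto_divide_at_top[OF tendsto_const])
    moreover have "\<forall>\<^sub>F a in at_top. (C1 + C2) / sqrt (sqrt a) = \<delta> a / a ^ ?d"
      using eventually_gt_at_top[of 0] by eventually_elim (simp add: \<delta>_def)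
    ultimately show "((\<lambda>a. \<delta> a / a ^ ?d) \<longlongrightarrow> 0) at_top" by (rule Lim_transform_eventually)
    show "\<forall>\<^sub>F a in at_top. (a::real) ^ ?d \<noteq> 0" using eventually_gt_at_top[of 0] by eventually_elim simp
  qed
  have main: "\<exists>p q M. M \<ge> 0 \<and> arc_mass P a x = ennreal M \<and> cov (\<Union>P \<inter> cball x a) p q (M + \<delta> a)"
    if a: "a \<ge> 1" "a \<ge> real ?d * R" for a and x :: 'a
  proof -
    have a0: "a \<ge> 0" "a > 0" using a by auto
    define Y where "Y i = y (fst i) (snd i)" for i
    define IS where "IS = {i \<in> {..<N} \<times> plat0 b0 R. norm (perp b0 (Y i) - perp b0 x) \<le> a}"
    let ?c = "\<lambda>i. chord b0 (Y i) x a"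
    have c0: "?c i \<ge> 0" for i by (simp add: chord_def)
    define u where "u i = perp b0 (Y i) + (x \<bullet> b0 - ?c i) *\<^sub>R b0" for i
    define v where "v i = perp b0 (Y i) + (x \<bullet> b0 + ?c i) *\<^sub>R b0" for i
    have ISj: "IS = (\<Union>j<N. Pair j ` {m \<in> plat0 b0 R. norm (perp b0 (y j m) - perp b0 x) \<le> a})"
      by (auto simp: IS_def Y_def)
    have fin: "finite IS" unfolding ISj using line_count(1)[OF b0 R a0(2)] y by (intro finite_UN_I) auto
    have cardIS: "real (card IS) \<le> real N * (\<omega> * (3 * a) ^ ?d / (2 * a * R ^ ?n))"
    proof -
      have one: "real (card {m \<in> plat0 b0 R. norm (perp b0 (y j m) - perp b0 x) \<le> a}) \<le> \<omega> * (3 * a) ^ ?d / (2 * a * R ^ ?n)" if "j < N" for j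
      proof -
        have "real (card {m \<in> plat0 b0 R. norm (perp b0 (y j m) - perp b0 x) \<le> a}) * (2 * a * R ^ ?n) \<le> \<omega> * (2 * a + real ?d * R) ^ ?d"
          unfolding \<omega>_def using y[OF that] by (intro line_count(2)[OF b0 R a0(2)])
        also have "\<dots> \<le> \<omega> * (3 * a) ^ ?d" using a R \<omega> a0 by (intro mult_left_mono power_mono) auto
        finally show ?thesis using a0 R by (simp add: pos_le_divide_eq)
      qed
      have "real (card IS) \<le> real (\<Sum>j<N. card (Pair j ` {m \<in> plat0 b0 R. norm (perp b0 (y j m) - perp b0 x) \<le> a}))"
        unfolding ISj of_nat_le_iff by (rule card_UN_le) simp
      also have "\<dots> = (\<Sum>j<N. real (card {m \<in> plat0 b0 R. norm (perp b0 (y j m) - perp b0 x) \<le> a}))"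
        by (simp add: card_image inj_on_def)
      also have "\<dots> \<le> (\<Sum>j<N. \<omega> * (3 * a) ^ ?d / (2 * a * R ^ ?n))" using one by (intro sum_mono) auto
      finally show ?thesis by simp
    qed
    have uv: "dist (u i) (v i) = 2 * ?c i" for i
      using nb c0[of i] by (simp add: u_def v_def dist_norm scaleR_diff_left[symmetric])
    define M where "M = (\<Sum>i\<in>IS. 2 * ?c i)"
    have M0: "M \<ge> 0" unfolding M_def using c0 by (intro sum_nonneg) auto
    have am: "arc_mass P a x = ennreal M"
    proof -
      have "arc_mass P a x = (\<Sum>\<^sub>\<infinity>i\<in>{..<N} \<times> plat0 b0 R. ennreal (diameter (line_through (Y i) b0 \<inter> cball x a)))"
        unfolding arc_mass_def P_def by (subst infsum_reindex[OF inj]) (simp add: comp_def case_prod_unfold Y_def)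
      also have "\<dots> = (\<Sum>\<^sub>\<infinity>i\<in>IS. ennreal (2 * ?c i))"
        by (rule infsum_cong_neutral) (auto simp: IS_def diameter_line_Int_cball[OF nb a0(1)] line_Int_cball[OF nb a0(1)] simp flip: diameter_line_Int_cball[OF nb a0(1)])
      also have "\<dots> = ennreal M" using fin c0 by (simp add: M_def sum_ennreal)
      finally show ?thesis .
    qed
    have cover: "\<Union>P \<inter> cball x a \<subseteq> (\<Union>i\<in>IS. closed_segment (u i) (v i))"
    proof
      fix z assume "z \<in> \<Union>P \<inter> cball x a"
      then obtain i where i: "i \<in> {..<N} \<times> plat0 b0 R" "z \<in> line_through (Y i) b0 \<inter> cball x a" by (auto simp: P_def Y_def)
      then have "i \<in> IS" unfolding IS_def using line_Int_cball[OF nb a0(1), of "Y i" x] by (auto split: if_splits)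
      moreover have "z \<in> closed_segment (u i) (v i)"
        using line_Int_cball_subset_segment[OF nb a0(1), of "Y i" x] i unfolding u_def v_def by blast
      ultimately show "z \<in> (\<Union>i\<in>IS. closed_segment (u i) (v i))" by blast
    qed
    have ends: "u i \<in> cball x a" "v i \<in> cball x a" if "i \<in> IS" for i
    proof -
      have "norm (perp b0 (Y i) - perp b0 x) \<le> a" using that by (simp add: IS_def)
      then have "line_through (Y i) b0 \<inter> cball x a = (\<lambda>s. perp b0 (Y i) + s *\<^sub>R b0) ` {x \<bullet> b0 - ?c i .. x \<bullet> b0 + ?c i}"
        using line_Int_cball[OF nb a0(1), of "Y i" x] by simp
      moreover have "u i \<in> (\<lambda>s. perp b0 (Y i) + s *\<^sub>R b0) ` {x \<bullet> b0 - ?c i .. x \<bullet> b0 + ?c i}"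
        "v i \<in> (\<lambda>s. perp b0 (Y i) + s *\<^sub>R b0) ` {x \<bullet> b0 - ?c i .. x \<bullet> b0 + ?c i}"
        using c0[of i] by (auto simp: u_def v_def)
      ultimately show "u i \<in> cball x a" "v i \<in> cball x a" by blast+
    qed
    show ?thesis
    proof (cases "card IS \<le> 1")
      case True
      have "\<exists>p q. cov (\<Union>i\<in>IS. closed_segment (u i) (v i)) p q M"
      proof (cases "IS = {}")
        case True
        have "cov {} x x 0" using cov_segment[of x x] by (rule cov_mono) auto
        then show ?thesis using True by (auto simp: M_def)
      next
        case False
        then obtain i where i: "IS = {i}" using True fin by (metis card_1_singletonE card_gt_0_iff le_antisym Suc_leI One_nat_def)
        show ?thesis using cov_segment[of "u i" "v i"] unfolding i M_def by (auto simp: uv i)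
      qed
      then obtain p q where "cov (\<Union>i\<in>IS. closed_segment (u i) (v i)) p q M" by blast
      then have "cov (\<Union>P \<inter> cball x a) p q (M + \<delta> a)" by (rule cov_mono[OF _ cover]) (use \<delta>0[OF a0(2)] in simp)
      then show ?thesis using M0 am by blast
    next
      case False
      \<comment> \<open>Two different lines can only occur in dimension at least 2; below this makes
        \<open>\<rho> ^ ?n\<close> dominate the fourth root \<open>t\<close>.\<close>
      have d2: "?n \<ge> 1"
      proof (rule ccontr)
        assume "\<not> ?n \<ge> 1"
        then have "DIM('a) = 1" using DIM_positive[where 'a='a] by linarith
        then have B: "Basis = {b0}" using b0 by (metis card_1_singletonE singletonD)
        have pz: "perp b0 z = 0" for z
        proof (rule euclidean_eqI)
          fix b :: 'a assume "b \<in> Basis" then show "perp b0 z \<bullet> b = 0 \<bullet> b" using B b0 perp_inner[of b0 b z] by auto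
        qed
        have "line_through p b0 = line_through p' b0" for p p' unfolding line_through_perp[of p b0] line_through_perp[of p' b0] by (simp add: pz)
        then have "i = i'" if "i \<in> IS" "i' \<in> IS" for i i' 
          using inj_onD[OF inj, of i i'] that by (auto simp: IS_def case_prod_unfold)
        then have "card IS \<le> 1" using fin by (metis card_le_Suc0_iff_eq One_nat_def)
        then show False using False by simp
      qed
      define t where "t = sqrt (sqrt a)"
      have t1: "t \<ge> 1" using a by (simp add: t_def)
      have t2: "t\<^sup>2 = sqrt a" and t4: "t ^ 4 = a"
      proof -
        show "t\<^sup>2 = sqrt a" using a0 by (simp add: t_def)
        have "t ^ 4 = (t\<^sup>2)\<^sup>2" by (simp add: power_mult[symmetric])
        then show "t ^ 4 = a" using a0 by (simp add: \<open>t\<^sup>2 = sqrt a\<close>)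
      qed
      define \<rho> where "\<rho> = sqrt a"
      have \<rho>: "\<rho> \<ge> 1" "\<rho> > 0" "\<rho> \<le> a" using a t1 unfolding \<rho>_def
        by (auto intro: real_le_lsqrt simp: power2_eq_square)
      define D where "D = real ?d * \<rho>"
      define \<kappa> where "\<kappa> = D + sqrt (2 * a * D)"
      define k where "k i = lfl0 b0 \<rho> (Y i)" for i
      define Ik where "Ik g = {i \<in> IS. k i = g}" for g
      define G where "G = k ` IS"
      have kc: "Y i \<in> cell0 b0 \<rho> (k i)" "k i \<in> plat0 b0 \<rho>" for i
        using cell0_iff[OF b0 \<rho>(2) lfl0_plat0[OF b0]] lfl0_plat0[OF b0] unfolding k_def by auto
      have near: "norm (perp b0 (Y i) - perp b0 (Y j)) \<le> D \<and> \<bar>?c i - ?c j\<bar> \<le> sqrt (2 * a * D)" if "i \<in> Ik g" "j \<in> Ik g" for i j g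
      proof -
        have ij: "norm (perp b0 (Y i) - perp b0 x) \<le> a" "norm (perp b0 (Y j) - perp b0 x) \<le> a" "k i = k j"
          using that by (auto simp: Ik_def IS_def)
        have D: "norm (perp b0 (Y i) - perp b0 (Y j)) \<le> D"
          unfolding D_def using kc(1)[of i] kc(1)[of j] ij(3) by (intro cell0_close[OF b0 \<rho>(2), of _ "k i"]) auto
        then show ?thesis using chord_close[OF a0(1) ij(1,2) D] by blast
      qed
      have dk: "dist (u i) (u j) \<le> \<kappa>" "dist (v i) (v j) \<le> \<kappa>" if "i \<in> Ik g" "j \<in> Ik g" for i j g
      proof -
        have e: "u i - u j = (perp b0 (Y i) - perp b0 (Y j)) + (?c j - ?c i) *\<^sub>R b0"
          "v i - v j = (perp b0 (Y i) - perp b0 (Y j)) + (?c i - ?c j) *\<^sub>R b0"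
          by (simp_all add: u_def v_def algebra_simps)
        show "dist (u i) (u j) \<le> \<kappa>" "dist (v i) (v j) \<le> \<kappa>"
          unfolding dist_norm e \<kappa>_def using near[OF that] nb
          by (auto intro!: order_trans[OF norm_triangle_ineq] add_mono simp: abs_minus_commute)
      qed
      have finI: "finite (Ik g)" for g using fin by (simp add: Ik_def)
      have "\<exists>p\<in>cball x a. \<exists>q\<in>cball x a. cov (\<Union>g\<in>G. \<Union>i\<in>Ik g. closed_segment (u i) (v i)) p q
         ((\<Sum>g\<in>G. \<Sum>i\<in>Ik g. dist (u i) (v i)) + (\<Sum>g\<in>G. real (card (Ik g))) * \<kappa> + real (card G) * (2 * a))"
      proof (rule cov_groups)
        show "finite G" using fin by (simp add: G_def)
        show "Ik g \<noteq> {}" if "g \<in> G" for g using that by (auto simp: G_def Ik_def)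
        show "u i \<in> cball x a \<and> v i \<in> cball x a" if "i \<in> Ik g" for i g using ends[of i] that by (auto simp: Ik_def)
      qed (use finI dk a0 in blast)+
      then obtain p q where c: "cov (\<Union>g\<in>G. \<Union>i\<in>Ik g. closed_segment (u i) (v i)) p q
         ((\<Sum>g\<in>G. \<Sum>i\<in>Ik g. dist (u i) (v i)) + (\<Sum>g\<in>G. real (card (Ik g))) * \<kappa> + real (card G) * (2 * a))" by blast
      have regroup: "(\<Sum>g\<in>G. \<Sum>i\<in>Ik g. F i) = (\<Sum>i\<in>IS. F i)" for F :: "nat \<times> 'a \<Rightarrow> real"
        unfolding G_def Ik_def using sum.image_gen[OF fin, of F k] by simp
      have s1: "(\<Sum>g\<in>G. \<Sum>i\<in>Ik g. dist (u i) (v i)) = M" unfolding regroup M_def by (simp add: uv)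
      have s2: "(\<Sum>g\<in>G. real (card (Ik g))) = real (card IS)" using regroup[of "\<lambda>_. 1"] by simp
      have cardG: "real (card G) * (2 * a * \<rho> ^ ?n) \<le> \<omega> * (2 * a + real ?d * \<rho>) ^ ?d"
      proof -
        \<comment> \<open>\<open>line_count\<close> expects one line in every cell: an occupied cell
          is represented by one of its lines, any other by its own lattice point.\<close>
        define y' where "y' m = (if m \<in> G then Y (SOME i. i \<in> IS \<and> k i = m) else m)" for m
        have sel: "(SOME i. i \<in> IS \<and> k i = m) \<in> IS \<and> k (SOME i. i \<in> IS \<and> k i = m) = m" if "m \<in> G" for m
          by (rule someI_ex) (use that in \<open>auto simp: G_def\<close>)
        have y'c: "y' m \<in> cell0 b0 \<rho> m" if "m \<in> plat0 b0 \<rho>" for m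
        proof (cases "m \<in> G")
          case True then show ?thesis using sel[OF True] kc(1)[of "SOME i. i \<in> IS \<and> k i = m"] by (simp add: y'_def)
        next
          case False then show ?thesis using \<rho> by (simp add: y'_def cell0_def)
        qed
        let ?I = "{m \<in> plat0 b0 \<rho>. norm (perp b0 (y' m) - perp b0 x) \<le> a}"
        have sub: "G \<subseteq> ?I"
        proof
          fix m assume m: "m \<in> G"
          then have "m \<in> plat0 b0 \<rho>" using kc(2) by (auto simp: G_def)
          moreover have "norm (perp b0 (y' m) - perp b0 x) \<le> a" using sel[OF m] m by (auto simp: y'_def IS_def)
          ultimately show "m \<in> ?I" by simp
        qed
        have "real (card G) * (2 * a * \<rho> ^ ?n) \<le> real (card ?I) * (2 * a * \<rho> ^ ?n)"
          using card_mono[OF line_count(1)[OF b0 \<rho>(2) a0(2) y'c] sub] a0 \<rho> by (intro mult_right_mono) auto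
        also have "\<dots> \<le> \<omega> * (2 * a + real ?d * \<rho>) ^ ?d"
          unfolding \<omega>_def by (rule line_count(2)[OF b0 \<rho>(2) a0(2) y'c])
        finally show ?thesis .
      qed
      have B2: "real (card G) * (2 * a) \<le> C2 * a ^ ?d / t"
      proof -
        have "2 * a + real ?d * \<rho> \<le> (2 + real ?d) * a"
        proof -
          have "real ?d * \<rho> \<le> real ?d * a" using \<rho> by (intro mult_left_mono) auto
          then show ?thesis by (simp add: distrib_right)
        qed
        then have "(2 * a + real ?d * \<rho>) ^ ?d \<le> ((2 + real ?d) * a) ^ ?d" using a0 \<rho> by (intro power_mono) auto
        then have "real (card G) * (2 * a * \<rho> ^ ?n) \<le> C2 * a ^ ?d"
          using cardG mult_left_mono[OF _ \<omega>] by (fastforce simp: C2_def power_mult_distrib mult.assoc)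
        then have "real (card G) * (2 * a) \<le> C2 * a ^ ?d / \<rho> ^ ?n" using \<rho> by (simp add: pos_le_divide_eq mult_ac)
        also have "\<dots> \<le> C2 * a ^ ?d / t"
        proof (rule divide_left_mono)
          have "t \<le> t\<^sup>2" using t1 by (simp add: power2_eq_square)
          also have "t\<^sup>2 = \<rho>" by (simp only: t2 \<rho>_def)
          also have "\<dots> \<le> \<rho> ^ ?n" using power_increasing[OF d2 \<rho>(1)] by (simp only: power_one_right)
          finally show "t \<le> \<rho> ^ ?n" .
        qed (use C a0 t1 \<rho> in auto)
        finally show ?thesis .
      qed
      have K: "\<kappa> \<le> 3 * real ?d * t ^ 3"
      proof -
        have d1: "real ?d \<ge> 1" by (simp add: Suc_leI)
        have "D = real ?d * t\<^sup>2" by (simp add: D_def \<rho>_def t2)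
        also have "\<dots> \<le> real ?d * t ^ 3" using t1 by (intro mult_left_mono power_increasing) auto
        finally have 1: "D \<le> real ?d * t ^ 3" .
        have "2 * a * D = 2 * real ?d * (t ^ 3)\<^sup>2"
        proof -
          have "2 * a * D = 2 * t ^ 4 * (real ?d * t\<^sup>2)" by (simp add: D_def \<rho>_def t2 t4)
          also have "\<dots> = 2 * real ?d * (t ^ 3)\<^sup>2" by (simp add: power2_eq_square eval_nat_numeral)
          finally show ?thesis .
        qed
        also have "\<dots> \<le> (2 * real ?d)\<^sup>2 * (t ^ 3)\<^sup>2"
        proof (rule mult_right_mono)
          have "2 * real ?d * 1 \<le> 2 * real ?d * (2 * real ?d)" using d1 by (intro mult_left_mono) linarith+
          then show "2 * real ?d \<le> (2 * real ?d)\<^sup>2" by (simp add: power2_eq_square)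
        qed simp
        finally have "sqrt (2 * a * D) \<le> 2 * real ?d * t ^ 3"
          using t1 by (intro real_le_lsqrt) (auto simp: power_mult_distrib)
        with 1 show ?thesis by (simp add: \<kappa>_def)
      qed
      have B1: "real (card IS) * \<kappa> \<le> C1 * a ^ ?d / t"
      proof -
        have \<kappa>0: "\<kappa> \<ge> 0" unfolding \<kappa>_def D_def using a0 \<rho> by simp
        have "real (card IS) * \<kappa> \<le> (real N * (\<omega> * (3 * a) ^ ?d / (2 * a * R ^ ?n))) * (3 * real ?d * t ^ 3)"
          using cardIS K \<kappa>0 \<omega> a0 R by (intro mult_mono) auto
        also have "\<dots> = C1 * a ^ ?d * (t ^ 3 / a)" using a0 R by (simp add: C1_def power_mult_distrib field_simps)
        also have "t ^ 3 / a = 1 / t"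
        proof -
          have "a = t ^ 3 * t" using t4 power_add[of t 3 1] by simp
          then show ?thesis using t1 by (simp only: divide_divide_eq_left[symmetric]) simp
        qed
        finally show ?thesis by simp
      qed
      have "cov (\<Union>P \<inter> cball x a) p q (M + \<delta> a)"
      proof (rule cov_mono[OF c])
        show "\<Union>P \<inter> cball x a \<subseteq> (\<Union>g\<in>G. \<Union>i\<in>Ik g. closed_segment (u i) (v i))"
        proof -
          have "(\<Union>g\<in>G. \<Union>i\<in>Ik g. closed_segment (u i) (v i)) = (\<Union>i\<in>IS. closed_segment (u i) (v i))"
            unfolding G_def Ik_def by blast
          then show ?thesis using cover by (simp only:)
        qed
        have "\<delta> a = C1 * a ^ ?d / t + C2 * a ^ ?d / t" by (simp add: \<delta>_def t_def add_divide_distrib distrib_right)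
        then show "(\<Sum>g\<in>G. \<Sum>i\<in>Ik g. dist (u i) (v i)) + (\<Sum>g\<in>G. real (card (Ik g))) * \<kappa> + real (card G) * (2 * a) \<le> M + \<delta> a"
          unfolding s1 s2 using B1 B2 by linarith
      qed
      then show ?thesis using M0 am by blast
    qed
  qed
  show ?thesis unfolding condition_C2_def
  proof (intro exI[of _ \<delta>] conjI allI impI)
    fix x :: 'a
    have "\<forall>\<^sub>F a in at_top. a \<ge> 1 \<and> a \<ge> real ?d * R"
      by (intro eventually_conj eventually_ge_at_top)
    then show "\<forall>\<^sub>F a in at_top. \<exists>\<alpha>. rectifiable_curve \<alpha> \<and> ennreal (curve_length \<alpha>) = arc_mass P a x + ennreal (\<delta> a) \<and> \<Union>P \<inter> cball x a \<subseteq> \<alpha> ` {0..1}"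
    proof (rule eventually_mono)
      fix a assume "a \<ge> 1 \<and> a \<ge> real ?d * R"
      then have a: "a \<ge> 1" "a \<ge> real ?d * R" by simp_all
      from main[OF a, of x] obtain p q M where M: "M \<ge> 0" "arc_mass P a x = ennreal M" "cov (\<Union>P \<inter> cball x a) p q (M + \<delta> a)"
        by (elim exE conjE)
      obtain \<alpha> where \<alpha>: "rectifiable_curve \<alpha>" "\<Union>P \<inter> cball x a \<subseteq> \<alpha> ` {0..1}" "curve_length \<alpha> = M + \<delta> a"
        by (rule cov_exact[OF M(3)])
      have "\<delta> a \<ge> 0" using \<delta>0[of a] a(1) by linarith
      then have "ennreal (curve_length \<alpha>) = arc_mass P a x + ennreal (\<delta> a)" unfolding \<alpha>(3) M(2) using M(1) by (simp only: ennreal_plus)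
      with \<alpha>(1,2) show "\<exists>\<alpha>. rectifiable_curve \<alpha> \<and> ennreal (curve_length \<alpha>) = arc_mass P a x + ennreal (\<delta> a) \<and> \<Union>P \<inter> cball x a \<subseteq> \<alpha> ` {0..1}"
        by (intro exI[of _ \<alpha>] conjI)
    qed
  next
    show "\<delta> a \<ge> 0" if "a > 0" for a using \<delta>0[OF that] .
    show "\<delta> \<in> o(\<lambda>a. a ^ ?d)" by (rule \<delta>o)
  qed
qed

subsection \<open>The upper bound\<close>

lemma chr_scaleR_nat: "chr (real j *\<^sub>R x) w = chr x w ^ j"
  by (simp add: chr_def exp_of_nat_mult[symmetric] mult_ac)

text \<open>Columns of side \<open>1 / h\<close> fit the sampling lattice dual to the period
  \<open>h\<close>, so rounding a point to its column changes it by a lattice vector.\<close>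

lemma plat0_subset_glat:
  assumes "b0 \<in> Basis" "h > 0"
  shows "plat0 b0 (1 / h) \<subseteq> glat (colvec b0 h \<tau>)"
proof
  fix m assume m: "m \<in> plat0 b0 (1 / h)"
  show "m \<in> glat (colvec b0 h \<tau>)" unfolding glat_def
  proof (intro CollectI ballI)
    fix b :: 'a assume b: "b \<in> Basis"
    have "\<exists>k::int. m \<bullet> b = of_int k * (colvec b0 (1 / h) 1 \<bullet> b)" using m b by (simp add: plat0_def plat_def)
    then obtain k :: int where k: "m \<bullet> b = of_int k * (colvec b0 (1 / h) 1 \<bullet> b)" ..
    show "(m \<bullet> b) * (colvec b0 h \<tau> \<bullet> b) \<in> \<int>"
    proof (cases "b = b0")
      case True then show ?thesis using m by (simp add: plat0_def)
    next
      case False then show ?thesis using k b assms by (simp add: colvec_inner)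
    qed
  qed
qed

text \<open>The sampling lattice lies on lines parallel to \<open>b0\<close> through a lattice of
  the hyperplane; this puts the sample points on the constructed lines.\<close>

lemma perp_glat_plat0:
  assumes "b0 \<in> Basis" "h > 0" "\<gamma> \<in> glat (colvec b0 h \<tau>)"
  shows "perp b0 \<gamma> \<in> plat0 b0 (1 / h)"
  unfolding plat0_def plat_def
proof (intro CollectI conjI ballI)
  fix b :: 'a assume b: "b \<in> Basis"
  show "\<exists>k::int. perp b0 \<gamma> \<bullet> b = of_int k * (colvec b0 (1 / h) 1 \<bullet> b)"
  proof (cases "b = b0")
    case True then show ?thesis using assms by (intro exI[of _ 0]) (simp add: perp_inner)
  next
    case False
    have "(\<gamma> \<bullet> b) * h \<in> \<int>" using assms(3) b False by (auto simp: glat_def colvec_inner)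
    then obtain k :: int where "(\<gamma> \<bullet> b) * h = of_int k" by (auto simp: Ints_def)
    then show ?thesis using False b assms by (intro exI[of _ k]) (simp add: perp_inner colvec_inner field_simps)
  qed
next
  show "perp b0 \<gamma> \<bullet> b0 = 0" using assms by (simp add: perp_inner)
qed

text \<open>The cosets come from multiples of one generic vector \<open>x0\<close>, so that
  \<open>chr (\<xi> j) m\<close> is a power of \<open>chr x0 m\<close>, as the Vandermonde argument
  requires. The resulting lines have density exactly \<open>N * h ^ (DIM('a) - 1)\<close>, which
  \<open>slice_lattice_count\<close> bounds.\<close>

lemma upper_construction:
  fixes S :: "'a::euclidean_space set"
  assumes S: "compact S" "convex S" "0 \<in> interior S" "uminus ` S = S" and b0: "b0 \<in> Basis" and s: "s > 0"
  shows "\<exists>P\<in>Hom S b0. path_density P \<le> ennreal ((1 + s) ^ DIM('a) * section_vol S b0)"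
proof -
  let ?n = "DIM('a) - 1"
  have nb: "norm b0 = 1" and bb: "b0 \<bullet> b0 = 1" using b0 by auto
  obtain r where r: "r > 0" "cball 0 r \<subseteq> S" using S(3) mem_interior_cball by blast
  \<comment> \<open>Fine enough that displacements within a cell of side \<open>h\<close> are at
    most \<open>s * r\<close>, so that dilating \<open>S\<close> by \<open>1 + s\<close> absorbs
    them.\<close>
  define h where "h = s * r / real DIM('a)"
  have h: "h > 0" "real DIM('a) * h \<le> s * r" using s r by (auto simp: h_def)
  obtain \<rho> where \<rho>: "\<And>x. x \<in> S \<Longrightarrow> norm x \<le> \<rho>" using compact_imp_bounded[OF S(1)] by (auto simp: bounded_iff)
  \<comment> \<open>The period along \<open>b0\<close> exceeds the extent of \<open>S\<close> in
    that direction, and the tile at \<open>a\<close> is centred along \<open>b0\<close>. Shifts from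
    this tile into \<open>S\<close> then cannot move along \<open>b0\<close>, so that
    \<open>M\<close> consists of points of \<open>plat0 b0 h\<close>.\<close>
  define \<tau> where "\<tau> = 2 * \<rho> + 2"
  have \<rho>0: "\<rho> \<ge> 0" using \<rho>[of 0] S(3) interior_subset[of S] by auto
  have \<tau>: "\<tau> > 0" using \<rho>0 by (simp add: \<tau>_def)
  define T where "T = colvec b0 h \<tau>"
  have T: "T \<bullet> b > 0" if "b \<in> Basis" for b using h \<tau> that by (simp add: T_def colvec_pos)
  define a where "a = (- (\<tau> / 2)) *\<^sub>R b0"
  define M where "M = {m \<in> plat T. \<exists>w. w - a \<in> hbox T \<and> w + m \<in> S}"
  have M0: "m \<bullet> b0 = 0" "m \<in> plat0 b0 h" if m: "m \<in> M" for m
  proof -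
    obtain w where w: "w - a \<in> hbox T" "w + m \<in> S" using m by (auto simp: M_def)
    have 1: "- (\<tau> / 2) \<le> w \<bullet> b0" "w \<bullet> b0 < \<tau> / 2"
    proof -
      have "0 \<le> (w - a) \<bullet> b0 \<and> (w - a) \<bullet> b0 < T \<bullet> b0" using w(1) b0 unfolding hbox_def by blast
      then show "- (\<tau> / 2) \<le> w \<bullet> b0" "w \<bullet> b0 < \<tau> / 2"
        using b0 bb by (auto simp: a_def T_def colvec_inner inner_add_left)
    qed
    have 2: "\<bar>(w + m) \<bullet> b0\<bar> < \<tau> / 2" using \<rho>[OF w(2)] Basis_le_norm[OF b0, of "w + m"] by (simp add: \<tau>_def)
    have mp: "m \<in> plat T" using m by (simp add: M_def)
    then have "\<exists>k::int. m \<bullet> b0 = of_int k * \<tau>" using b0 by (auto simp: plat_def T_def colvec_inner)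
    then obtain k :: int where k: "m \<bullet> b0 = of_int k * \<tau>" ..
    have "(w + m) \<bullet> b0 < \<tau> / 2" "- ((w + m) \<bullet> b0) < \<tau> / 2" using 2 by (simp_all only: abs_less_iff)
    then have "\<bar>m \<bullet> b0\<bar> < \<tau>" unfolding inner_add_left abs_less_iff using 1 by linarith
    then have "\<bar>real_of_int k\<bar> < 1" using \<tau> k by (simp add: abs_mult)
    then have "k = 0" by linarith
    then show m0: "m \<bullet> b0 = 0" using k by simp
    show "m \<in> plat0 b0 h" unfolding plat0_def plat_def
    proof (intro CollectI conjI ballI m0)
      fix b :: 'a assume b: "b \<in> Basis"
      show "\<exists>k::int. m \<bullet> b = of_int k * (colvec b0 h 1 \<bullet> b)"
      proof (cases "b = b0")
        case True then show ?thesis using m0 by (intro exI[of _ 0]) simp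
      next
        case False
        then show ?thesis using mp b by (auto simp: plat_def T_def colvec_inner dest!: bspec[of _ _ b])
      qed
    qed
  qed
  have finM: "finite M"
  proof -
    have "bounded ((+) a ` cbox 0 T)" by (intro bounded_translation bounded_cbox)
    then obtain K where K: "\<And>w. w \<in> (+) a ` cbox 0 T \<Longrightarrow> norm w \<le> K" unfolding bounded_iff by blast
    have "finite (plat T \<inter> cball 0 (\<rho> + K))" by (intro finite_plat_bounded T bounded_cball)
    moreover have "M \<subseteq> plat T \<inter> cball 0 (\<rho> + K)"
    proof
      fix m assume m: "m \<in> M"
      then obtain w where w: "w - a \<in> hbox T" "w + m \<in> S" by (auto simp: M_def)
      then have "w - a \<in> cbox 0 T" by (fastforce simp: hbox_def mem_box)
      then have "w \<in> (+) a ` cbox 0 T" by (intro image_eqI[where x="w - a"]) auto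
      then have "norm ((w + m) - w) \<le> \<rho> + K" using norm_triangle_ineq4[of "w + m" w] \<rho>[OF w(2)] K by fastforce
      then show "m \<in> plat T \<inter> cball 0 (\<rho> + K)" using m by (simp add: M_def)
    qed
    ultimately show ?thesis by (rule finite_subset[rotated])
  qed
  let ?W = "\<lambda>w. {m \<in> M. w + m \<in> S}"
  have rangefin: "finite (range (\<lambda>w. card (?W w)))"
    by (rule finite_subset[of _ "{..card M}"]) (use finM in \<open>auto intro: card_mono\<close>)
  define N where "N = Max (range (\<lambda>w. card (?W w)))"
  have N: "card (?W w) \<le> N" for w unfolding N_def using rangefin by (intro Max_ge) auto
  obtain w1 where w1: "card (?W w1) = N"
  proof -
    have "N \<in> range (\<lambda>w. card (?W w))" unfolding N_def using rangefin by (intro Max_in) auto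
    then obtain w where "N = card (?W w)" by blast
    then show ?thesis using that[of w] by simp
  qed
  have Nbound: "real N * h ^ ?n \<le> (1 + s) ^ DIM('a) * section_vol S b0"
  proof -
    have "real (card (?W w1)) * h ^ ?n \<le> (1 + s) ^ DIM('a) * section_vol S b0"
      by (rule slice_lattice_count[OF S(1,2,4) b0 r s h]) (use finM M0 in auto)
    then show ?thesis by (simp only: w1)
  qed
  obtain x0 where x0: "x0 \<bullet> b0 = 0" "\<And>m. m \<in> plat0 b0 h \<Longrightarrow> m \<noteq> 0 \<Longrightarrow> m \<bullet> x0 \<notin> \<int>"
    by (rule generic_direction[OF b0, of h]) (use that in blast)
  define R where "R = 1 / h"
  have R: "R > 0" using h by (simp add: R_def)
  \<comment> \<open>Subtracting a lattice vector changes neither the coset nor the character values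
    on \<open>plat T\<close>, but moves \<open>\<xi> j\<close> into the base column, which gives
    each family one line per column.\<close>
  define \<xi> where "\<xi> j = real j *\<^sub>R x0 - lfl0 b0 R (real j *\<^sub>R x0)" for j
  have lf: "lfl0 b0 R x \<in> plat0 b0 R" for x by (rule lfl0_plat0[OF b0])
  have lfg: "lfl0 b0 R x \<in> glat T" for x using lf plat0_subset_glat[OF b0 h(1), of \<tau>] by (auto simp: R_def T_def)
  have \<xi>0: "\<xi> j \<bullet> b0 = 0" for j using x0(1) lf by (simp add: \<xi>_def inner_diff_left plat0_def)
  have \<xi>chr: "chr (\<xi> j) m = chr x0 m ^ j" if "m \<in> plat T" for j m
  proof -
    have "chr (real j *\<^sub>R x0) m = chr (\<xi> j) m * chr (lfl0 b0 R (real j *\<^sub>R x0)) m"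
      unfolding chr_add_left[symmetric] by (simp add: \<xi>_def)
    then show ?thesis using chr_glat_plat[OF lfg that] by (simp add: chr_scaleR_nat)
  qed
  have sep: "j = j'" if jj: "j < N" "j' < N" and g: "\<xi> j - \<xi> j' \<in> glat T" for j j'
  proof (rule ccontr)
    assume ne: "j \<noteq> j'"
    \<comment> \<open>With two different indices some fibre contains two lattice points of the
      hyperplane. So there is a basis direction \<open>b\<close> other than \<open>b0\<close>, in
      which a lattice difference of the cosets contradicts the genericity of
      \<open>x0\<close>.\<close>
    have "N \<ge> 2" using jj ne by linarith
    then have "\<not> (\<forall>u\<in>?W w1. \<forall>v\<in>?W w1. u = v)"
      using w1 card_le_Suc0_iff_eq[of "?W w1"] finM by auto
    then obtain u v where uv: "u \<in> M" "v \<in> M" "u \<noteq> v" by blast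
    have "\<exists>b\<in>Basis. b \<noteq> b0"
    proof (rule ccontr)
      assume no: "\<not> (\<exists>b\<in>Basis. b \<noteq> b0)"
      have "u = v" by (rule euclidean_eqI) (use no M0(1)[OF uv(1)] M0(1)[OF uv(2)] in auto)
      then show False using uv by simp
    qed
    then obtain b where b: "b \<in> Basis" "b \<noteq> b0" by blast
    define \<Delta> where "\<Delta> = real j - real j'"
    have \<Delta>: "\<Delta> \<noteq> 0" using ne by (simp add: \<Delta>_def)
    have "\<Delta> *\<^sub>R x0 = (\<xi> j - \<xi> j') + (lfl0 b0 R (real j *\<^sub>R x0) - lfl0 b0 R (real j' *\<^sub>R x0))"
      by (simp add: \<xi>_def \<Delta>_def algebra_simps)
    then have "\<Delta> *\<^sub>R x0 \<in> glat T" using glat_add[OF g glat_diff[OF lfg lfg]] by simp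
    then have "(\<Delta> * (x0 \<bullet> b)) * h \<in> \<int>" using b by (auto simp: glat_def T_def colvec_inner dest!: bspec[of _ _ b])
    moreover have "((\<Delta> * h) *\<^sub>R b) \<bullet> x0 = (\<Delta> * (x0 \<bullet> b)) * h" by (simp add: inner_commute mult_ac)
    moreover have "(\<Delta> * h) *\<^sub>R b \<noteq> 0" using \<Delta> h b by auto
    moreover have "(\<Delta> * h) *\<^sub>R b \<in> plat0 b0 h" unfolding plat0_def plat_def
    proof (intro CollectI conjI ballI)
      fix c :: 'a assume c: "c \<in> Basis"
      show "\<exists>k::int. ((\<Delta> * h) *\<^sub>R b) \<bullet> c = of_int k * (colvec b0 h 1 \<bullet> c)"
      proof (cases "c = b")
        case True
        then show ?thesis using b c by (intro exI[of _ "int j - int j'"]) (simp add: colvec_inner \<Delta>_def)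
      next
        case False then show ?thesis using b c by (intro exI[of _ 0]) (simp add: inner_Basis)
      qed
    qed (use b b0 in \<open>simp add: inner_Basis\<close>)
    ultimately show False using x0(2) by metis
  qed
  define y where "y j m = m + \<xi> j" for j :: nat and m
  have ycell: "y j m \<in> cell0 b0 R m" if m: "m \<in> plat0 b0 R" for j m
  proof -
    have "real j *\<^sub>R x0 \<in> cell0 b0 R (lfl0 b0 R (real j *\<^sub>R x0))" using cell0_iff[OF b0 R lf] by simp
    then show ?thesis by (auto simp: cell0_def y_def \<xi>_def inner_add_left inner_diff_left) (smt (verit) DiffI singletonD)+
  qed
  have p0g: "m \<in> glat T" if "m \<in> plat0 b0 R" for m using that plat0_subset_glat[OF b0 h(1), of \<tau>] by (auto simp: R_def T_def)
  have injl: "inj_on (\<lambda>(j, m). line_through (y j m) b0) ({..<N} \<times> plat0 b0 R)"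
  proof (rule inj_onI, clarsimp)
    fix j m j' m' assume jm: "j < N" "m \<in> plat0 b0 R" "j' < N" "m' \<in> plat0 b0 R"
      and eq: "line_through (y j m) b0 = line_through (y j' m') b0"
    have "y j m \<in> line_through (y j' m') b0" unfolding eq[symmetric] by (auto simp: line_through_def intro!: image_eqI[where x=0])
    then obtain t where t: "y j m = y j' m' + t *\<^sub>R b0" by (auto simp: line_through_def)
    have "y j m \<bullet> b0 = 0" "y j' m' \<bullet> b0 = 0" using jm \<xi>0 by (auto simp: y_def inner_add_left plat0_def)
    then have "t = 0" using t bb by (simp add: inner_add_left)
    then have e: "m + \<xi> j = m' + \<xi> j'" using t by (simp add: y_def)
    then have "\<xi> j - \<xi> j' = m' - m" by (simp add: algebra_simps)
    then have "\<xi> j - \<xi> j' \<in> glat T" using glat_diff[OF p0g[OF jm(4)] p0g[OF jm(2)]] by simp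
    then have "j = j'" using sep jm by blast
    then show "j = j' \<and> m = m'" using e by simp
  qed
  define P where "P = (\<lambda>(j, m). line_through (y j m) b0) ` ({..<N} \<times> plat0 b0 R)"
  have injL: "inj_on (\<lambda>(j, \<gamma>). \<xi> j + \<gamma>) ({..<N} \<times> glat T)"
  proof (rule inj_onI, clarsimp)
    fix j \<gamma> j' \<gamma>' assume j: "j < N" "\<gamma> \<in> glat T" "j' < N" "\<gamma>' \<in> glat T" and eq: "\<xi> j + \<gamma> = \<xi> j' + \<gamma>'"
    have "\<xi> j - \<xi> j' = \<gamma>' - \<gamma>" using eq by (simp add: algebra_simps)
    then have "\<xi> j - \<xi> j' \<in> glat T" using glat_diff[OF j(4,2)] by simp
    then have "j = j'" using sep j by blast
    then show "j = j' \<and> \<gamma> = \<gamma>'" using eq by simp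
  qed
  define Lam where "Lam = (\<lambda>(j, \<gamma>). \<xi> j + \<gamma>) ` ({..<N} \<times> glat T)"
  have stable: "stable_sampling S Lam"
    unfolding Lam_def
  proof (rule multicoset_stable_sampling[OF T S(1) finM _ _ N])
    show "M \<subseteq> plat T" by (auto simp: M_def)
    show "m \<in> M" if "m \<in> plat T" "w - a \<in> hbox T" "w + m \<in> S" for m w using that by (auto simp: M_def)
    show "inj_on (chr x0) M"
    proof (rule inj_onI)
      fix u v assume uv: "u \<in> M" "v \<in> M" "chr x0 u = chr x0 v"
      have "chr x0 (u - v) * chr x0 v = chr x0 u" by (simp add: chr_add_right[symmetric])
      moreover have "chr x0 v \<noteq> 0" using norm_chr[of x0 v] by (metis norm_zero zero_neq_one)
      ultimately have "chr x0 (u - v) = 1" using uv(3) by simp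
      then have "(u - v) \<bullet> x0 \<in> \<int>" by (simp add: chr_eq_1_iff)
      moreover have "u - v \<in> plat0 b0 h"
        using M0(2)[OF uv(1)] M0(2)[OF uv(2)] plat_diff[of u _ v] by (auto simp: plat0_def inner_diff_left)
      ultimately show "u = v" using x0(2)[of "u - v"] by auto
    qed
    show "chr (\<xi> j) m = chr x0 m ^ j" if "m \<in> M" for j m using \<xi>chr that by (auto simp: M_def)
  qed (assumption | rule injL)+
  have LamP: "Lam \<subseteq> \<Union>P"
  proof
    fix l assume "l \<in> Lam"
    then obtain j \<gamma> where j: "j < N" "\<gamma> \<in> glat T" "l = \<xi> j + \<gamma>" by (auto simp: Lam_def)
    have pp: "perp b0 \<gamma> \<in> plat0 b0 R" using perp_glat_plat0[OF b0 h(1)] j(2) by (simp add: T_def R_def)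
    have "l = y j (perp b0 \<gamma>) + (\<gamma> \<bullet> b0) *\<^sub>R b0" by (simp add: j(3) y_def perp_def)
    then have "l \<in> line_through (y j (perp b0 \<gamma>)) b0" by (auto simp: line_through_def)
    moreover have "line_through (y j (perp b0 \<gamma>)) b0 \<in> P"
      unfolding P_def using j(1) pp by (intro image_eqI[where x="(j, perp b0 \<gamma>)"]) auto
    ultimately show "l \<in> \<Union>P" by blast
  qed
  have ud: "uniformly_discrete Lam"
  proof -
    \<comment> \<open>Differences of sample points have the form
      \<open>\<xi> j - \<xi> j' + \<gamma>\<close>, and only finitely many of them have norm at most
      1. The element 1 inserted in \<open>E\<close> below serves the pairs at larger distance and
      keeps \<open>E\<close> nonempty.\<close>
    let ?Df = "\<lambda>j j'. {\<gamma> \<in> glat T. norm (\<xi> j - \<xi> j' + \<gamma>) \<le> 1}"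
    have finD: "finite (?Df j j')" for j j'
    proof -
      define L where "L = (\<Sum>b\<in>Basis. (1 / (T \<bullet> b)) *\<^sub>R b)"
      have Lp: "L \<bullet> b > 0" if "b \<in> Basis" for b using T that by (simp add: L_def)
      have "glat T = plat L" unfolding L_def by (rule glat_eq_plat) (rule T)
      then have "?Df j j' = plat L \<inter> {\<gamma>. norm (\<xi> j - \<xi> j' + \<gamma>) \<le> 1}" by auto
      moreover have "bounded {\<gamma>. norm (\<xi> j - \<xi> j' + \<gamma>) \<le> 1}"
      proof (rule boundedI)
        fix \<gamma> assume "\<gamma> \<in> {\<gamma>. norm (\<xi> j - \<xi> j' + \<gamma>) \<le> 1}"
        then show "norm \<gamma> \<le> 1 + norm (\<xi> j - \<xi> j')"
          using norm_triangle_ineq4[of "\<xi> j - \<xi> j' + \<gamma>" "\<xi> j - \<xi> j'"] by simp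
      qed
      ultimately show ?thesis using finite_plat_bounded[OF Lp] by simp
    qed
    define E where "E = insert 1 ((\<Union>j<N. \<Union>j'<N. (\<lambda>\<gamma>. norm (\<xi> j - \<xi> j' + \<gamma>)) ` ?Df j j') - {0})"
    have finE: "finite E" unfolding E_def using finD by (intro finite.insertI finite_Diff finite_UN_I finite_imageI) auto
    have Epos: "e > 0" if "e \<in> E" for e using that by (auto simp: E_def)
    have "Min E > 0" using finE Epos by (subst Min_gr_iff) (auto simp: E_def)
    moreover have "Min E \<le> dist l l'" if l: "l \<in> Lam" "l' \<in> Lam" "l \<noteq> l'" for l l'
    proof (cases "dist l l' \<le> 1")
      case True
      obtain j \<gamma> j' \<gamma>' where j: "j < N" "\<gamma> \<in> glat T" "l = \<xi> j + \<gamma>" "j' < N" "\<gamma>' \<in> glat T" "l' = \<xi> j' + \<gamma>'"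
        using l by (auto simp: Lam_def)
      have d: "dist l l' = norm (\<xi> j - \<xi> j' + (\<gamma> - \<gamma>'))" by (simp add: dist_norm j algebra_simps)
      moreover have "\<gamma> - \<gamma>' \<in> ?Df j j'" using True glat_diff[OF j(2,5)] by (simp add: d)
      ultimately have "dist l l' \<in> E" unfolding E_def using j l(3) by auto
      then show ?thesis using finE by (rule Min_le[rotated])
    next
      case False
      have "Min E \<le> 1" using finE by (rule Min_le) (simp add: E_def)
      then show ?thesis using False by simp
    qed
    ultimately show ?thesis unfolding uniformly_discrete_def by blast
  qed
  have "condition_C2 P" unfolding P_def by (rule condition_C2_family[OF b0 R ycell injl])
  then have nyq: "stable_nyquist S P" unfolding stable_nyquist_def using LamP ud stable by blast
  have "parallel_lines b0 P"
    unfolding parallel_lines_def P_def using countable_plat0 by (auto intro!: countable_image countable_SIGMA)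
  then have Par: "P \<in> Par S b0" using nyq by (simp add: Par_def)
  have lo: "ennreal (real N / R ^ ?n) \<le> lower_path_density P"
    unfolding P_def by (rule family_density(1)[OF b0 R ycell injl]) auto
  have up: "upper_path_density P \<le> ennreal (real N / R ^ ?n)"
    unfolding P_def by (rule family_density(2)[OF b0 R ycell injl])
  have lu: "lower_path_density P \<le> upper_path_density P"
  proof -
    have "lower_path_density P \<le> Liminf at_top (\<lambda>a. SUP x. arc_mass P a x / ennreal (measure lebesgue (cball (0::'a) a)))"
      unfolding lower_path_density_def
      by (intro Liminf_mono always_eventually allI order_trans[OF INF_lower[of 0] SUP_upper[of 0]]) auto
    also have "\<dots> \<le> upper_path_density P"
      unfolding upper_path_density_def by (rule Liminf_le_Limsup) simp
    finally show ?thesis .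
  qed
  have "homogeneous P" unfolding homogeneous_def using lo up lu by (meson antisym order_trans)
  then have "P \<in> Hom S b0" using Par by (simp add: Hom_def)
  moreover have "path_density P \<le> ennreal ((1 + s) ^ DIM('a) * section_vol S b0)"
  proof -
    have "real N / R ^ ?n = real N * h ^ ?n" using h by (simp add: R_def power_divide)
    then have "ennreal (real N / R ^ ?n) \<le> ennreal ((1 + s) ^ DIM('a) * section_vol S b0)"
      using Nbound by (intro ennreal_leI) simp
    then show ?thesis unfolding path_density_def using lu up by (meson order_trans)
  qed
  ultimately show ?thesis by blast
qed

subsection \<open>Localised windows and the lower bound\<close>

text \<open>Transform of \<open>t ^ i * (1 - t) ^ j\<close> on the unit interval. Two exponents are
  kept because integration by parts lowers only one of them in each resulting term.\<close>

definition win :: "nat \<Rightarrow> nat \<Rightarrow> real \<Rightarrow> complex" where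
  "win i j u = (\<integral>t. indicator {0..1} t *\<^sub>R (complex_of_real (t ^ i * (1 - t) ^ j) * exp (2 * pi * \<i> * complex_of_real (t * u))) \<partial>lborel)"

lemma win_integrable:
  "integrable lborel (\<lambda>t. indicator {0..1} t *\<^sub>R (complex_of_real (t ^ i * (1 - t) ^ j) * exp (2 * pi * \<i> * complex_of_real (t * u))))"
  by (rule borel_integrable_compact) (auto intro!: continuous_intros)

lemma norm_win_le_1: "cmod (win i j u) \<le> 1"
proof -
  let ?f = "\<lambda>t. indicator {0..1} t *\<^sub>R (complex_of_real (t ^ i * (1 - t) ^ j) * exp (2 * pi * \<i> * complex_of_real (t * u)))"
  have "cmod (win i j u) \<le> (\<integral>(t::real). cmod (?f t) \<partial>lborel)"
    unfolding win_def by (rule integral_norm_bound)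
  also have "\<dots> \<le> (\<integral>(t::real). indicator {0..1} t \<partial>lborel)"
  proof (rule integral_mono)
    show "integrable lborel (\<lambda>t. cmod (?f t))" by (intro integrable_norm win_integrable)
    show "integrable lborel (indicator {0..1} :: real \<Rightarrow> real)" by (rule integrable_real_indicator) auto
    fix t :: real
    have "\<bar>t ^ i * (1 - t) ^ j\<bar> \<le> 1" if "0 \<le> t" "t \<le> 1"
      using that by (simp add: abs_mult) (intro mult_le_one power_le_one, auto)
    moreover have "cmod (exp (2 * pi * \<i> * complex_of_real (t * u))) = 1" by (simp add: norm_exp_eq_Re)
    ultimately show "cmod (?f t) \<le> indicator {0..1} t"
      unfolding norm_scaleR norm_mult norm_of_real by (simp add: indicator_def)
  qed
  also have "\<dots> = 1" by (simp add: content_real)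
  finally show ?thesis .
qed

text \<open>Both boundary terms vanish because both exponents are positive.\<close>

lemma win_by_parts:
  assumes u: "u \<noteq> 0"
  shows "2 * pi * \<i> * complex_of_real u * win (Suc i) (Suc j) u = of_nat (Suc j) * win (Suc i) j u - of_nat (Suc i) * win i (Suc j) u"
proof -
  let ?e = "\<lambda>t::real. exp (2 * pi * \<i> * complex_of_real (t * u))"
  let ?F = "\<lambda>t::real. complex_of_real (t ^ Suc i * (1 - t) ^ Suc j) * ?e t"
  let ?d = "\<lambda>t::real. of_nat (Suc i) * (complex_of_real (t ^ i * (1 - t) ^ Suc j) * ?e t) - of_nat (Suc j) * (complex_of_real (t ^ Suc i * (1 - t) ^ j) * ?e t)
      + 2 * pi * \<i> * complex_of_real u * (complex_of_real (t ^ Suc i * (1 - t) ^ Suc j) * ?e t)"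
  have "(\<integral>t. indicator {0..1} t *\<^sub>R ?d t \<partial>lborel) = ?F 1 - ?F 0"
  proof (rule integral_FTC_Icc)
    fix t :: real
    have "((\<lambda>z. z ^ Suc i * (1 - z) ^ Suc j * exp (2 * pi * \<i> * (z * u))) has_field_derivative
        of_nat (Suc i) * (complex_of_real t ^ i * (1 - complex_of_real t) ^ Suc j * exp (2 * pi * \<i> * (complex_of_real t * u)))
        - of_nat (Suc j) * (complex_of_real t ^ Suc i * (1 - complex_of_real t) ^ j * exp (2 * pi * \<i> * (complex_of_real t * u)))
        + 2 * pi * \<i> * complex_of_real u * (complex_of_real t ^ Suc i * (1 - complex_of_real t) ^ Suc j * exp (2 * pi * \<i> * (complex_of_real t * u)))) (at (complex_of_real t))"
      by (rule derivative_eq_intros refl)+ (simp add: algebra_simps)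
    from has_vector_derivative_real_field[OF this]
    show "(?F has_vector_derivative ?d t) (at t within {0..1})"
      by (auto intro: has_vector_derivative_at_within)
  qed (auto intro!: continuous_intros)
  also have "\<dots> = 0" by simp
  also have "(\<integral>t. indicator {0..1} t *\<^sub>R ?d t \<partial>lborel) = of_nat (Suc i) * win i (Suc j) u - of_nat (Suc j) * win (Suc i) j u
      + 2 * pi * \<i> * complex_of_real u * win (Suc i) (Suc j) u"
  proof -
    let ?w = "\<lambda>i j t. indicator {0..1} t *\<^sub>R (complex_of_real (t ^ i * (1 - t) ^ j) * ?e t)"
    have eq: "indicator {0..1} t *\<^sub>R ?d t = of_nat (Suc i) * ?w i (Suc j) t - of_nat (Suc j) * ?w (Suc i) j t + 2 * pi * \<i> * complex_of_real u * ?w (Suc i) (Suc j) t" for t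
      by (simp only: scaleR_conv_of_real) (simp add: algebra_simps)
    have gen: "(\<integral>t. a * A t - b * B t + c * C t \<partial>lborel) = a * (\<integral>t. A t \<partial>lborel) - b * (\<integral>t. B t \<partial>lborel) + c * (\<integral>t. C t \<partial>lborel)"
      if "integrable lborel A" "integrable lborel B" "integrable lborel C" for a b c :: complex and A B C :: "real \<Rightarrow> complex"
      using that by simp
    show ?thesis unfolding eq win_def by (rule gen[OF win_integrable win_integrable win_integrable])
  qed
  finally show ?thesis by (simp add: algebra_simps)
qed

text \<open>Integration by parts is repeated \<open>p\<close> times; each round divides by
  \<open>2 * pi * \<bar>u\<bar>\<close> and yields two terms of total weight at most the original
  \<open>i + j\<close>.\<close>

lemma norm_win_le:
  assumes u: "u \<noteq> 0" and p: "p \<le> i" "p \<le> j"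
  shows "cmod (win i j u) \<le> (real (i + j) / (2 * pi * \<bar>u\<bar>)) ^ p"
  using p
proof (induction p arbitrary: i j)
  case 0 then show ?case by (simp add: norm_win_le_1)
next
  case (Suc p)
  then obtain i' j' where ij: "i = Suc i'" "j = Suc j'" by (meson Suc_le_D)
  let ?U = "2 * pi * \<bar>u\<bar>"
  have U: "?U > 0" using u by simp
  have le: "cmod (win a b u) \<le> (real (i + j) / ?U) ^ p" if "p \<le> a" "p \<le> b" "a + b \<le> i + j" for a b
  proof -
    have "cmod (win a b u) \<le> (real (a + b) / ?U) ^ p" by (rule Suc.IH[OF that(1,2)])
    also have "\<dots> \<le> (real (i + j) / ?U) ^ p" using that(3) U by (intro power_mono divide_right_mono) auto
    finally show ?thesis .
  qed
  have "?U * cmod (win i j u) = cmod (2 * pi * \<i> * complex_of_real u * win (Suc i') (Suc j') u)"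
    by (simp add: norm_mult ij)
  also have "\<dots> = cmod (of_nat (Suc j') * win (Suc i') j' u - of_nat (Suc i') * win i' (Suc j') u)"
    by (simp only: win_by_parts[OF u])
  also have "\<dots> \<le> real j * cmod (win (Suc i') j' u) + real i * cmod (win i' (Suc j') u)"
    by (rule order_trans[OF norm_triangle_ineq4]) (simp add: norm_mult ij del: of_nat_Suc)
  also have "\<dots> \<le> real j * (real (i + j) / ?U) ^ p + real i * (real (i + j) / ?U) ^ p"
    using Suc.prems ij by (intro add_mono mult_left_mono le) auto
  also have "\<dots> = real (i + j) * (real (i + j) / ?U) ^ p" by (simp add: algebra_simps)
  finally have "cmod (win i j u) \<le> real (i + j) * (real (i + j) / ?U) ^ p / ?U" using U by (simp add: pos_le_divide_eq mult.commute)
  then show ?case by simp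
qed

text \<open>One bound for all \<open>u\<close>: when \<open>\<bar>u\<bar> < 1\<close> the base on
  the right is at least 1 and the trivial bound suffices. The form \<open>1 + \<bar>u\<bar>\<close>
  is what can be multiplied over the coordinates.\<close>

lemma norm_win_decay: "cmod (win p p u) \<le> ((2 + 2 * real p) / (1 + \<bar>u\<bar>)) ^ p"
proof (cases "\<bar>u\<bar> \<ge> 1")
  case True
  then have u: "u \<noteq> 0" by auto
  have "real (p + p) / (2 * pi * \<bar>u\<bar>) \<le> (2 + 2 * real p) / (1 + \<bar>u\<bar>)"
  proof -
    have "real (p + p) / (2 * pi * \<bar>u\<bar>) = real p / (pi * \<bar>u\<bar>)" by simp
    also have "\<dots> \<le> real p / (1 * \<bar>u\<bar>)" using True pi_gt3 by (intro divide_left_mono mult_right_mono) auto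
    also have "\<dots> = 2 * real p / (2 * \<bar>u\<bar>)" by simp
    also have "\<dots> \<le> (2 + 2 * real p) / (1 + \<bar>u\<bar>)" using True by (intro frac_le) auto
    finally show ?thesis .
  qed
  then have "(real (p + p) / (2 * pi * \<bar>u\<bar>)) ^ p \<le> ((2 + 2 * real p) / (1 + \<bar>u\<bar>)) ^ p" by (intro power_mono) auto
  then show ?thesis using norm_win_le[OF u order_refl order_refl, of p] by linarith
next
  case False
  have "1 \<le> (2 + 2 * real p) / (1 + \<bar>u\<bar>)" using False by (simp add: pos_le_divide_eq)
  then have "1 \<le> ((2 + 2 * real p) / (1 + \<bar>u\<bar>)) ^ p" by (rule one_le_power)
  then show ?thesis using norm_win_le_1[of p p u] by linarith
qed

definition bump :: "nat \<Rightarrow> real \<Rightarrow> real" where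
  "bump p t = indicator {0..1} t * (t ^ p * (1 - t) ^ p)"

lemma bump_measurable [measurable]: "bump p \<in> borel_measurable borel"
  unfolding bump_def by measurable

lemma bump_bounds: "0 \<le> bump p t" "bump p t \<le> 1"
proof -
  have "0 \<le> t ^ p * (1 - t) ^ p \<and> t ^ p * (1 - t) ^ p \<le> 1" if "t \<in> {0..1}"
    using that by (intro conjI mult_nonneg_nonneg zero_le_power mult_le_one power_le_one) simp_all
  then show "0 \<le> bump p t" "bump p t \<le> 1"
    by (cases "t \<in> {0..1}"; simp add: bump_def)+
qed

lemma bump_nonzero: "p > 0 \<Longrightarrow> bump p t \<noteq> 0 \<Longrightarrow> 0 < t \<and> t < 1"
proof -
  assume p: "p > 0" and b: "bump p t \<noteq> 0"
  have "t \<in> {0..1}" using b by (cases "t \<in> {0..1}") (simp_all add: bump_def)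
  moreover have "t \<noteq> 0" "t \<noteq> 1" using p b by (auto simp: bump_def)
  ultimately show ?thesis by simp
qed

lemma bump_lower: "0 \<le> \<theta> \<Longrightarrow> \<theta> \<le> t \<Longrightarrow> t \<le> 1 - \<theta> \<Longrightarrow> \<theta> ^ (2 * p) \<le> bump p t"
proof -
  assume t: "0 \<le> \<theta>" "\<theta> \<le> t" "t \<le> 1 - \<theta>"
  have "\<theta> ^ p * \<theta> ^ p \<le> t ^ p * (1 - t) ^ p" using t by (intro mult_mono power_mono) auto
  then show ?thesis using t by (simp add: bump_def mult_2 power_add)
qed

text \<open>The zeros of order \<open>p\<close> at the faces make the transform of a window decay with order \<open>p\<close>.\<close>

definition cellwin :: "nat \<Rightarrow> real \<Rightarrow> 'a::euclidean_space \<Rightarrow> 'a \<Rightarrow> complex" where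
  "cellwin p h c w = complex_of_real (\<Prod>b\<in>Basis. bump p ((w \<bullet> b - c \<bullet> b) / h))"

lemma cellwin_measurable [measurable]: "cellwin p h c \<in> borel_measurable borel"
  unfolding cellwin_def by measurable

lemma norm_cellwin_le_1: "cmod (cellwin p h c w) \<le> 1"
  unfolding cellwin_def norm_of_real abs_prod using bump_bounds by (intro prod_le_1) (auto simp: abs_of_nonneg)

lemma cellwin_nonzero:
  assumes "p > 0" "h > 0" "cellwin p h c w \<noteq> 0" "b \<in> Basis"
  shows "c \<bullet> b < w \<bullet> b \<and> w \<bullet> b < c \<bullet> b + h"
proof -
  have "bump p ((w \<bullet> b - c \<bullet> b) / h) \<noteq> 0" using assms(3,4) by (auto simp: cellwin_def)
  from bump_nonzero[OF assms(1) this] show ?thesis using assms(2) by (auto simp: field_simps)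
qed

text \<open>Affine substitution in each coordinate: the corner \<open>c\<close> of the cell becomes
  a phase, and the side \<open>h\<close> rescales the argument of \<open>win\<close>.\<close>

lemma fourier_cellwin:
  assumes h: "h > 0"
  shows "(\<integral>w. cellwin p h c w * chr x w \<partial>lborel) =
    (\<Prod>b\<in>Basis. h * exp (2 * pi * \<i> * complex_of_real ((c \<bullet> b) * (x \<bullet> b))) * win p p (h * (x \<bullet> b)))"
proof -
  define B where "B b t = complex_of_real (bump p ((t - c \<bullet> b) / h)) * exp (2 * pi * \<i> * complex_of_real (t * (x \<bullet> b)))" for b t
  have Bt: "B b (c \<bullet> b + h * s) = exp (2 * pi * \<i> * complex_of_real ((c \<bullet> b) * (x \<bullet> b))) *
      (indicator {0..1} s *\<^sub>R (complex_of_real (s ^ p * (1 - s) ^ p) * exp (2 * pi * \<i> * complex_of_real (s * (h * (x \<bullet> b))))))" for b s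
  proof -
    have "exp (2 * pi * \<i> * complex_of_real ((c \<bullet> b + h * s) * (x \<bullet> b))) =
      exp (2 * pi * \<i> * complex_of_real ((c \<bullet> b) * (x \<bullet> b))) * exp (2 * pi * \<i> * complex_of_real (s * (h * (x \<bullet> b))))"
      by (simp add: exp_add[symmetric] algebra_simps)
    then show ?thesis using h by (simp add: B_def bump_def scaleR_conv_of_real)
  qed
  have Bi: "integrable lborel (B b)" for b
  proof -
    have "integrable lborel (\<lambda>s. B b (c \<bullet> b + h * s))" unfolding Bt by (intro integrable_mult_right win_integrable)
    then show ?thesis using lborel_integrable_real_affine_iff[of h "B b" "c \<bullet> b"] h by simp
  qed
  have BI: "(\<integral>t. B b t \<partial>lborel) = h * exp (2 * pi * \<i> * complex_of_real ((c \<bullet> b) * (x \<bullet> b))) * win p p (h * (x \<bullet> b))" for b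
  proof -
    have "(\<integral>t. B b t \<partial>lborel) = \<bar>h\<bar> *\<^sub>R (\<integral>s. B b (c \<bullet> b + h * s) \<partial>lborel)"
      using h by (intro lborel_integral_real_affine) auto
    also have "\<dots> = h * (exp (2 * pi * \<i> * complex_of_real ((c \<bullet> b) * (x \<bullet> b))) * win p p (h * (x \<bullet> b)))"
      unfolding Bt win_def using h by (simp add: scaleR_conv_of_real)
    finally show ?thesis by (simp add: mult.assoc)
  qed
  have "cellwin p h c w * chr x w = (\<Prod>b\<in>Basis. B b (w \<bullet> b))" for w
  proof -
    have "chr x w = (\<Prod>b\<in>Basis. exp (2 * pi * \<i> * complex_of_real ((w \<bullet> b) * (x \<bullet> b))))"
      unfolding chr_def by (subst euclidean_inner) (simp add: sum_distrib_left exp_sum)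
    then show ?thesis by (simp add: cellwin_def B_def prod.distrib)
  qed
  then show ?thesis using lborel_integral_prod(2)[of B, OF Bi] by (simp add: BI)
qed

section \<open>Underdetermined linear systems, sums over separated sets, packing the section by
  cells\<close>

lemma homogeneous_system:
  fixes a :: "'e \<Rightarrow> 'i \<Rightarrow> 'f::field"
  assumes "finite E" "finite I" "card E < card I"
  shows "\<exists>c. (\<exists>i\<in>I. c i \<noteq> 0) \<and> (\<forall>e\<in>E. (\<Sum>i\<in>I. c i * a e i) = 0)"
  using assms
proof (induction E arbitrary: I a rule: finite_induct)
  case empty
  then have "I \<noteq> {}" by auto
  then show ?case by (intro exI[of _ "\<lambda>_. 1"]) auto
next
  case (insert e E)
  show ?case
  proof (cases "\<forall>i\<in>I. a e i = 0")
    case True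
    have "card E < card I" using insert.hyps insert.prems by simp
    then obtain c where "\<exists>i\<in>I. c i \<noteq> 0" "\<forall>f\<in>E. (\<Sum>i\<in>I. c i * a f i) = 0" using insert.IH[OF insert.prems(1)] by blast
    then show ?thesis using True by (intro exI[of _ c]) (auto intro!: sum.neutral)
  next
    case False
    then obtain i0 where i0: "i0 \<in> I" "a e i0 \<noteq> 0" by blast
    let ?I = "I - {i0}"
    \<comment> \<open>Eliminating the unknown \<open>i0\<close> by means of equation
      \<open>e\<close> leaves a system with one equation and one unknown less; \<open>d\<close>
      below restores the eliminated unknown.\<close>
    have "card E < card ?I" using insert.hyps insert.prems i0 by simp
    then obtain c where c: "\<exists>i\<in>?I. c i \<noteq> 0" "\<forall>f\<in>E. (\<Sum>i\<in>?I. c i * (a f i - a f i0 * a e i / a e i0)) = 0"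
      using insert.IH[of ?I "\<lambda>f i. a f i - a f i0 * a e i / a e i0"] insert.prems by blast
    define d where "d i = (if i = i0 then - (\<Sum>i\<in>?I. c i * a e i) / a e i0 else c i)" for i
    have split: "(\<Sum>i\<in>I. d i * a f i) = d i0 * a f i0 + (\<Sum>i\<in>?I. c i * a f i)" for f
      using insert.prems i0 by (subst sum.remove[of I i0]) (auto simp: d_def intro!: sum.cong)
    have "(\<Sum>i\<in>I. d i * a f i) = 0" if "f \<in> insert e E" for f
    proof (cases "f = e")
      case True then show ?thesis using i0 unfolding split by (simp add: d_def)
    next
      case False
      then have "(\<Sum>i\<in>?I. c i * (a f i - a f i0 * a e i / a e i0)) = 0" using c(2) that by blast
      moreover have "(\<Sum>i\<in>?I. c i * (a f i - a f i0 * a e i / a e i0)) = (\<Sum>i\<in>?I. c i * a f i) - (\<Sum>i\<in>?I. c i * a e i) * (a f i0 / a e i0)"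
      proof -
        have "(\<Sum>i\<in>?I. c i * (a f i - a f i0 * a e i / a e i0)) = (\<Sum>i\<in>?I. c i * a f i - c i * a e i * (a f i0 / a e i0))"
          by (intro sum.cong) (auto simp: algebra_simps)
        then show ?thesis by (simp only: sum_subtractf sum_distrib_right)
      qed
      ultimately show ?thesis unfolding split by (simp add: d_def)
    qed
    moreover have "\<exists>i\<in>I. d i \<noteq> 0" using c(1) by (auto simp: d_def)
    ultimately show ?thesis by blast
  qed
qed

text \<open>The balls of radius \<open>e / 2\<close> about the points are disjoint and lie in the
  ball of radius \<open>r + e / 2\<close> about \<open>\<kappa>\<close>; their volumes are
  compared.\<close>

lemma separated_card_bound:
  fixes F :: "'a::euclidean_space set"
  assumes e: "e > 0" and sep: "\<And>x y. x \<in> F \<Longrightarrow> y \<in> F \<Longrightarrow> x \<noteq> y \<Longrightarrow> e \<le> dist x y"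
    and F: "finite F" "F \<subseteq> cball \<kappa> r" and r: "r \<ge> 0"
  shows "real (card F) \<le> (1 + 2 * r / e) ^ DIM('a)"
proof -
  let ?v = "unit_ball_vol (real DIM('a))"
  have v: "?v > 0" by (rule unit_ball_vol_pos) simp
  have disj: "pairwise (\<lambda>x y. disjnt (ball x (e/2)) (ball y (e/2))) F"
  proof (clarsimp simp: pairwise_def disjnt_def)
    fix x y assume xy: "x \<in> F" "y \<in> F" "x \<noteq> y"
    show "ball x (e/2) \<inter> ball y (e/2) = {}"
    proof (rule equals0I)
      fix z assume "z \<in> ball x (e/2) \<inter> ball y (e/2)"
      then have "dist x y < e" using dist_triangle2[of x y z] by (simp add: dist_commute)
      then show False using sep[OF xy] by simp
    qed
  qed
  have "real (card F) * (?v * (e/2) ^ DIM('a)) = (\<Sum>x\<in>F. measure lebesgue (ball x (e/2)))"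
    using e by (simp add: content_ball)
  also have "\<dots> = measure lebesgue (\<Union>x\<in>F. ball x (e/2))"
    using F(1) disj by (intro measure_UNION'[symmetric]) auto
  also have "\<dots> \<le> measure lebesgue (cball \<kappa> (r + e/2))"
  proof (rule measure_mono_fmeasurable)
    show "(\<Union>x\<in>F. ball x (e/2)) \<subseteq> cball \<kappa> (r + e/2)"
    proof
      fix z assume "z \<in> (\<Union>x\<in>F. ball x (e/2))"
      then obtain x where "x \<in> F" "dist x z < e/2" by auto
      moreover have "dist \<kappa> x \<le> r" using F(2) \<open>x \<in> F\<close> by auto
      ultimately show "z \<in> cball \<kappa> (r + e/2)" using dist_triangle[of \<kappa> z x] by simp
    qed
    show "(\<Union>x\<in>F. ball x (e/2)) \<in> sets lebesgue" using F(1) by (intro sets.finite_UN) auto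
  qed auto
  also have "\<dots> = ?v * (r + e/2) ^ DIM('a)"
  proof -
    have "0 \<le> r + e/2" using r e by linarith
    then show ?thesis by (simp add: content_cball)
  qed
  finally have "?v * (real (card F) * (e/2) ^ DIM('a)) \<le> ?v * (r + e/2) ^ DIM('a)" by (simp only: mult.left_commute)
  then have "real (card F) * (e/2) ^ DIM('a) \<le> (r + e/2) ^ DIM('a)" using v by (simp only: mult_le_cancel_left_pos)
  then have "real (card F) \<le> (r + e/2) ^ DIM('a) / (e/2) ^ DIM('a)" using e by (simp add: pos_le_divide_eq)
  also have "\<dots> = ((r + e/2) / (e/2)) ^ DIM('a)" by (rule power_divide[symmetric])
  also have "(r + e/2) / (e/2) = 1 + 2 * r / e" using e by (simp add: field_simps)
  finally show ?thesis .
qed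

text \<open>Summation over shells of unit width about \<open>\<kappa>\<close>: with \<open>d\<close>
  the dimension, the shell at distance \<open>j\<close> holds order \<open>(j + 1) ^ d\<close>
  points, each contributing order \<open>1 / (j + 1) ^ (d + 2)\<close>, which leaves a convergent
  series. The bound must be uniform in the centre, as windows are placed anywhere.\<close>

lemma separated_decay_sum:
  fixes Lam :: "'a::euclidean_space set"
  assumes e: "e > 0" and sep: "\<And>x y. x \<in> Lam \<Longrightarrow> y \<in> Lam \<Longrightarrow> x \<noteq> y \<Longrightarrow> e \<le> dist x y" and h: "h > 0"
  shows "\<exists>C\<ge>0. \<forall>\<kappa> F. finite F \<longrightarrow> F \<subseteq> Lam \<longrightarrow> (\<Sum>l\<in>F. (1 / (1 + h * norm (l - \<kappa>))) ^ (DIM('a) + 2)) \<le> C"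
proof -
  let ?d = "DIM('a)"
  \<comment> \<open>Gives \<open>m * (j + 1) \<le> 1 + h * j\<close> for small and large
    \<open>h\<close> alike.\<close>
  define m where "m = min 1 h"
  have m: "m > 0" "m \<le> 1" "m \<le> h" using h by (auto simp: m_def)
  define K where "K = (1 + 2 / e) ^ ?d * (1 / m) ^ (?d + 2)"
  have K: "K \<ge> 0" using e m by (simp add: K_def)
  have sm: "summable (\<lambda>j. K * (1 / real (Suc j) ^ 2))"
  proof (rule summable_mult)
    have "summable (\<lambda>n. inverse (real n ^ 2))" by (rule inverse_power_summable) simp
    then have "summable (\<lambda>n. inverse (real (Suc n) ^ 2))" by (subst summable_Suc_iff[of "\<lambda>n. inverse (real n ^ 2)"])
    then show "summable (\<lambda>j. 1 / real (Suc j) ^ 2)" by (simp only: inverse_eq_divide)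
  qed
  define C where "C = (\<Sum>j. K * (1 / real (Suc j) ^ 2))"
  have C0: "C \<ge> 0" unfolding C_def using K by (intro suminf_nonneg sm) simp
  have "(\<Sum>l\<in>F. (1 / (1 + h * norm (l - \<kappa>))) ^ (?d + 2)) \<le> C" if F: "finite F" "F \<subseteq> Lam" for \<kappa> F
  proof -
    define k where "k l = nat \<lfloor>norm (l - \<kappa>)\<rfloor>" for l
    have kb: "real (k l) \<le> norm (l - \<kappa>)" "norm (l - \<kappa>) < real (k l) + 1" for l
      by (simp_all add: k_def)
    have shell: "(\<Sum>l\<in>{l\<in>F. k l = j}. (1 / (1 + h * norm (l - \<kappa>))) ^ (?d + 2)) \<le> K * (1 / real (Suc j) ^ 2)" for j
    proof -
      let ?Fj = "{l\<in>F. k l = j}"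
      have cd: "real (card ?Fj) \<le> (1 + 2 * real (Suc j) / e) ^ ?d"
      proof (rule separated_card_bound[OF e])
        show "?Fj \<subseteq> cball \<kappa> (real (Suc j))"
        proof
          fix l assume "l \<in> ?Fj"
          then show "l \<in> cball \<kappa> (real (Suc j))" using kb(2)[of l] by (simp add: dist_norm norm_minus_commute)
        qed
      qed (use F sep in auto)
      have trm: "(1 / (1 + h * norm (l - \<kappa>))) ^ (?d + 2) \<le> (1 / (m * real (Suc j))) ^ (?d + 2)" if "l \<in> ?Fj" for l
      proof (intro power_mono divide_left_mono)
        have "m * real (Suc j) = m + m * real j" by (simp add: algebra_simps)
        also have "\<dots> \<le> 1 + h * norm (l - \<kappa>)"
        proof -
          have "real j \<le> norm (l - \<kappa>)" using kb(1)[of l] that by simp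
          then show ?thesis using m h by (intro add_mono mult_mono) auto
        qed
        finally show "m * real (Suc j) \<le> 1 + h * norm (l - \<kappa>)" .
      qed (use m h in \<open>auto intro!: mult_pos_pos add_pos_nonneg\<close>)
      have "(\<Sum>l\<in>?Fj. (1 / (1 + h * norm (l - \<kappa>))) ^ (?d + 2)) \<le> real (card ?Fj) * (1 / (m * real (Suc j))) ^ (?d + 2)"
        by (rule sum_bounded_above) (rule trm)
      also have "\<dots> \<le> (1 + 2 * real (Suc j) / e) ^ ?d * (1 / (m * real (Suc j))) ^ (?d + 2)"
        using cd m by (intro mult_right_mono) auto
      also have "\<dots> \<le> ((1 + 2 / e) * real (Suc j)) ^ ?d * (1 / (m * real (Suc j))) ^ (?d + 2)"
      proof (intro mult_right_mono power_mono)
        show "1 + 2 * real (Suc j) / e \<le> (1 + 2 / e) * real (Suc j)" by (simp add: algebra_simps)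
      qed (use e m in auto)
      also have "\<dots> = K * (1 / real (Suc j) ^ 2)"
      proof -
        let ?S = "real (Suc j)"
        have S0: "?S > 0" by simp
        have "1 / (m * ?S) = (1 / m) * (1 / ?S)" by simp
        then have "((1 + 2 / e) * ?S) ^ ?d * (1 / (m * ?S)) ^ (?d + 2) = K * (?S ^ ?d * (1 / ?S) ^ (?d + 2))"
          by (simp only: K_def power_mult_distrib mult_ac)
        also have "?S ^ ?d * (1 / ?S) ^ (?d + 2) = 1 / ?S ^ 2"
          using S0 by (simp add: power_divide power_add power2_eq_square del: of_nat_Suc)
        finally show ?thesis .
      qed
      finally show ?thesis .
    qed
    have "(\<Sum>l\<in>F. (1 / (1 + h * norm (l - \<kappa>))) ^ (?d + 2)) = (\<Sum>j\<in>k ` F. \<Sum>l\<in>{l\<in>F. k l = j}. (1 / (1 + h * norm (l - \<kappa>))) ^ (?d + 2))"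
      using sum.image_gen[OF F(1), of "\<lambda>l. (1 / (1 + h * norm (l - \<kappa>))) ^ (?d + 2)" k] by simp
    also have "\<dots> \<le> (\<Sum>j\<in>k ` F. K * (1 / real (Suc j) ^ 2))" by (intro sum_mono shell)
    also have "\<dots> \<le> C" unfolding C_def using F(1) K by (intro sum_le_suminf sm) auto
    finally show ?thesis .
  qed
  then show ?thesis using C0 by blast
qed

lemma prod_one_plus_ge:
  fixes x :: "'b \<Rightarrow> real"
  assumes "finite B" "\<And>b. b \<in> B \<Longrightarrow> x b \<ge> 0"
  shows "1 + (\<Sum>b\<in>B. x b) \<le> (\<Prod>b\<in>B. 1 + x b)"
  using assms
proof (induction B rule: finite_induct)
  case (insert a B)
  have nn: "(\<Sum>b\<in>B. x b) \<ge> 0" "x a \<ge> 0" using insert.prems by (auto intro: sum_nonneg)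
  have "1 + (\<Sum>b\<in>insert a B. x b) \<le> (1 + x a) * (1 + (\<Sum>b\<in>B. x b))"
    using insert.hyps nn by (simp add: algebra_simps)
  also have "\<dots> \<le> (1 + x a) * (\<Prod>b\<in>B. 1 + x b)" using insert nn by (intro mult_left_mono) auto
  finally show ?case using insert.hyps by simp
qed simp

lemma line_through_eq_perp:
  assumes "line_through p b0 = line_through p' b0" "norm b0 = 1"
  shows "perp b0 p = perp b0 p'"
proof -
  have bb: "b0 \<bullet> b0 = 1" using assms(2) by (simp add: norm_eq_1)
  have "p \<in> line_through p' b0" unfolding assms(1)[symmetric] by (auto simp: line_through_def intro!: image_eqI[where x=0])
  then obtain t where "p = p' + t *\<^sub>R b0" by (auto simp: line_through_def)
  then show ?thesis using bb by (simp add: perp_def inner_add_left algebra_simps)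
qed

lemma cell0_perp_cong:
  assumes "b0 \<in> Basis" "perp b0 p = perp b0 p'"
  shows "p \<in> cell0 b0 R m \<longleftrightarrow> p' \<in> cell0 b0 R m"
proof -
  have "p \<bullet> b = p' \<bullet> b" if "b \<in> Basis - {b0}" for b
    using arg_cong[OF assms(2), of "\<lambda>z. z \<bullet> b"] perp_inner[OF assms(1), of b] that by auto
  then show ?thesis by (simp add: cell0_def)
qed

text \<open>The section shrunk by \<open>1 - s\<close> leaves room \<open>s * r\<close> inside
  \<open>S\<close>. A cube of side \<open>h\<close> that stands on the hyperplane and whose base
  meets the shrunken section therefore lies in \<open>S\<close> by convexity, so these bases, all
  indexed by \<open>M\<close>, cover the shrunken section; volumes are compared after
  thickening.\<close>

lemma cell_packing:
  fixes S :: "'a::euclidean_space set"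
  assumes S: "compact S" "convex S" and r: "r > 0" "cball 0 r \<subseteq> S" and b0: "b0 \<in> Basis"
    and s: "0 < s" "s < 1" and h: "h > 0" "real DIM('a) * h \<le> s * r"
  defines "M \<equiv> {m \<in> plat0 b0 h. \<forall>v. (\<forall>b\<in>Basis. m \<bullet> b \<le> v \<bullet> b \<and> v \<bullet> b \<le> m \<bullet> b + h) \<longrightarrow> v \<in> S}"
  shows "finite M" "(1 - s) ^ DIM('a) * section_vol S b0 \<le> real (card M) * h ^ (DIM('a) - 1)"
proof -
  have nb: "norm b0 = 1" and bb: "b0 \<bullet> b0 = 1" using b0 by auto
  define L where "L = colvec b0 h 1"
  have L: "\<And>b. b \<in> Basis \<Longrightarrow> L \<bullet> b > 0" using h by (simp add: L_def colvec_pos)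
  have "M \<subseteq> plat L \<inter> S" using h by (auto simp: M_def plat0_def L_def)
  moreover have "finite (plat L \<inter> S)" by (intro finite_plat_bounded L compact_imp_bounded S(1))
  ultimately show fin: "finite M" by (rule finite_subset)
  have hb: "emeasure lborel (hbox L) = ennreal (h ^ (DIM('a) - 1))"
    using emeasure_hbox[OF L] prod_colvec[OF b0, of h 1] by (simp add: L_def)
  have hbl: "hbox L \<in> lmeasurable" using hb by (intro fmeasurableI) (auto simp: emeasure_completion)
  have hbm: "measure lebesgue (hbox L) = h ^ (DIM('a) - 1)" using hb h by (simp add: measure_def)
  have sub: "(\<lambda>z. (1 - s) *\<^sub>R z + 0) ` cyl b0 S 0 \<subseteq> (\<Union>m\<in>M. (+) m ` hbox L)"
  proof
    fix z' assume "z' \<in> (\<lambda>z. (1 - s) *\<^sub>R z + 0) ` cyl b0 S 0"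
    then obtain z where z: "z \<in> cyl b0 S 0" "z' = (1 - s) *\<^sub>R z" by auto
    have pz: "perp b0 z \<in> S" "0 \<le> z \<bullet> b0" "z \<bullet> b0 \<le> 1" using z(1) by (auto simp: cyl_def)
    have pz': "perp b0 z' = (1 - s) *\<^sub>R perp b0 z" by (simp add: z(2) perp_def algebra_simps)
    define m where "m = lfl0 b0 h z'"
    have m0: "m \<in> plat0 b0 h" "z' \<in> cell0 b0 h m" using cell0_iff[OF b0 h(1) lfl0_plat0[OF b0]] lfl0_plat0[OF b0] by (auto simp: m_def)
    have mb: "m \<bullet> b0 = 0" using m0 by (simp add: plat0_def)
    have "m \<in> M" unfolding M_def
    proof (intro CollectI conjI allI impI m0(1))
      fix v assume v: "\<forall>b\<in>Basis. m \<bullet> b \<le> v \<bullet> b \<and> v \<bullet> b \<le> m \<bullet> b + h"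
      have "norm (v - perp b0 z') \<le> (\<Sum>b\<in>Basis. \<bar>(v - perp b0 z') \<bullet> b\<bar>)" by (rule norm_le_l1)
      also have "\<dots> \<le> (\<Sum>b\<in>(Basis::'a set). h)"
      proof (rule sum_mono)
        fix b :: 'a assume b: "b \<in> Basis"
        have vb: "m \<bullet> b \<le> v \<bullet> b" "v \<bullet> b \<le> m \<bullet> b + h" using v b by auto
        show "\<bar>(v - perp b0 z') \<bullet> b\<bar> \<le> h"
        proof (cases "b = b0")
          case True then show ?thesis using vb mb b0 by (simp add: inner_diff_left perp_inner)
        next
          case False
          then have "m \<bullet> b \<le> z' \<bullet> b" "z' \<bullet> b < m \<bullet> b + h" using m0(2) b by (auto simp: cell0_def)
          then show ?thesis using vb False b b0 by (simp add: inner_diff_left perp_inner abs_le_iff)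
        qed
      qed
      finally have "norm (v - perp b0 z') \<le> s * r" using h by simp
      then have "norm (v - perp b0 z') / s \<le> r" using s by (simp add: pos_divide_le_eq mult.commute)
      then have "norm ((v - perp b0 z') /\<^sub>R s) \<le> r" using s by (simp only: norm_scaleR) (simp add: divide_inverse mult.commute)
      then have "(v - perp b0 z') /\<^sub>R s \<in> S" using r(2) by auto
      then have "(1 - s) *\<^sub>R perp b0 z + s *\<^sub>R ((v - perp b0 z') /\<^sub>R s) \<in> S"
        using pz(1) s by (intro convexD[OF S(2)]) auto
      moreover have "(1 - s) *\<^sub>R perp b0 z + s *\<^sub>R ((v - perp b0 z') /\<^sub>R s) = v" using s by (simp add: pz')
      ultimately show "v \<in> S" by simp
    qed
    moreover have "z' - m \<in> hbox L" unfolding hbox_def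
    proof (intro CollectI ballI)
      fix b :: 'a assume b: "b \<in> Basis"
      show "0 \<le> (z' - m) \<bullet> b \<and> (z' - m) \<bullet> b < L \<bullet> b"
      proof (cases "b = b0")
        case True
        have "(1 - s) * (z \<bullet> b0) \<le> (1 - s) * 1" using pz s by (intro mult_left_mono) auto
        then have "(1 - s) * (z \<bullet> b0) \<le> 1 - s" by (simp only: mult_1_right)
        also have "\<dots> < 1" using s by simp
        finally have "(1 - s) * (z \<bullet> b0) < 1" .
        then show ?thesis using True mb pz s b0 by (simp add: inner_diff_left z(2) L_def colvec_inner)
      next
        case False
        then have "m \<bullet> b \<le> z' \<bullet> b" "z' \<bullet> b < m \<bullet> b + h" using m0(2) b by (auto simp: cell0_def)
        then show ?thesis using False b by (simp add: inner_diff_left L_def colvec_inner)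
      qed
    qed
    then have "z' \<in> (+) m ` hbox L" by (intro image_eqI[where x="z' - m"]) auto
    ultimately show "z' \<in> (\<Union>m\<in>M. (+) m ` hbox L)" by blast
  qed
  have "(1 - s) ^ DIM('a) * section_vol S b0 = measure lebesgue ((\<lambda>z. (1 - s) *\<^sub>R z + 0) ` cyl b0 S 0)"
    using s by (subst measure_lebesgue_affine) (simp add: section_vol_cyl[OF nb])
  also have "\<dots> \<le> measure lebesgue (\<Union>m\<in>M. (+) m ` hbox L)"
  proof (rule measure_mono_fmeasurable[OF sub])
    have "compact ((\<lambda>z. (1 - s) *\<^sub>R z + 0) ` cyl b0 S 0)"
      by (intro compact_continuous_image compact_cyl S continuous_intros)
    then show "(\<lambda>z. (1 - s) *\<^sub>R z + 0) ` cyl b0 S 0 \<in> sets lebesgue" by (intro fmeasurableD lmeasurable_compact)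
    show "(\<Union>m\<in>M. (+) m ` hbox L) \<in> lmeasurable" using fin hbl by (intro fmeasurable.finite_UN) (auto intro: measurable_translation)
  qed
  also have "\<dots> \<le> (\<Sum>m\<in>M. measure lebesgue ((+) m ` hbox L))"
    using fin hbl by (intro measure_UNION_le) (auto intro: fmeasurableD measurable_translation)
  also have "\<dots> = real (card M) * h ^ (DIM('a) - 1)" by (simp add: measure_translation hbm)
  finally show "(1 - s) ^ DIM('a) * section_vol S b0 \<le> real (card M) * h ^ (DIM('a) - 1)" .
qed

text \<open>\<open>trig_sum_distance\<close> with \<open>g = 0\<close>: the distance is then the
  norm of the trigonometric polynomial itself. Injectivity of \<open>k\<close> turns the family into
  a sum over distinct lattice points.\<close>

lemma (in period_box) trig_family_norm:
  assumes \<Phi>: "finite \<Phi>" and k: "inj_on k \<Phi>" "k ` \<Phi> \<subseteq> glat T"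
  shows "(\<integral>w. indicator D w * (cmod (\<Sum>\<phi>\<in>\<Phi>. c \<phi> * cnj (chr (k \<phi>) w)))\<^sup>2 \<partial>lborel) = V * (\<Sum>\<phi>\<in>\<Phi>. (cmod (c \<phi>))\<^sup>2)"
proof -
  define c' where "c' x = c (the_inv_into \<Phi> k x)" for x
  have c': "c' (k \<phi>) = c \<phi>" if "\<phi> \<in> \<Phi>" for \<phi> using that k(1) by (simp add: c'_def the_inv_into_f_f)
  have eq: "(\<Sum>x\<in>k ` \<Phi>. c' x * cnj (chr x w)) = (\<Sum>\<phi>\<in>\<Phi>. c \<phi> * cnj (chr (k \<phi>) w))" for w
    by (subst sum.reindex[OF k(1)]) (auto intro!: sum.cong simp: c')
  have "(\<integral>w. (cmod (0 - (\<Sum>x\<in>k ` \<Phi>. c' x * cnj (chr x w))))\<^sup>2 \<partial>M)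
     = (\<integral>w. (cmod 0)\<^sup>2 \<partial>M) - (\<Sum>x\<in>k ` \<Phi>. (cmod (fc (\<lambda>_. 0) x))\<^sup>2) / V + V * (\<Sum>x\<in>k ` \<Phi>. (cmod (c' x - fc (\<lambda>_. 0) x / V))\<^sup>2)"
    by (rule trig_sum_distance[OF sqint_zero]) (use \<Phi> k in auto)
  then have "(\<integral>w. (cmod (\<Sum>\<phi>\<in>\<Phi>. c \<phi> * cnj (chr (k \<phi>) w)))\<^sup>2 \<partial>M) = V * (\<Sum>x\<in>k ` \<Phi>. (cmod (c' x))\<^sup>2)"
    by (simp add: eq fc_def)
  also have "(\<Sum>x\<in>k ` \<Phi>. (cmod (c' x))\<^sup>2) = (\<Sum>\<phi>\<in>\<Phi>. (cmod (c \<phi>))\<^sup>2)"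
    by (subst sum.reindex[OF k(1)]) (auto intro!: sum.cong simp: c')
  also have "(\<integral>w. (cmod (\<Sum>\<phi>\<in>\<Phi>. c \<phi> * cnj (chr (k \<phi>) w)))\<^sup>2 \<partial>M) = (\<integral>w. indicator D w * (cmod (\<Sum>\<phi>\<in>\<Phi>. c \<phi> * cnj (chr (k \<phi>) w)))\<^sup>2 \<partial>M)"
    by (rule Bochner_Integration.integral_cong) auto
  also have "\<dots> = (\<integral>w. indicator D w * (cmod (\<Sum>\<phi>\<in>\<Phi>. c \<phi> * cnj (chr (k \<phi>) w)))\<^sup>2 \<partial>lborel)"
    by (rule integral_M_eq_lborel) (auto simp: cnj_chr)
  finally show ?thesis .
qed

text \<open>The windows are indexed by a frequency cell \<open>m \<in> M\<close> of side \<open>h\<close> and a position on the grid of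
  step \<open>\<sigma>\<close> inside the cube of side \<open>R = A q \<sigma>\<close> at \<open>\<mu>\<close>, keeping distance \<open>q \<sigma>\<close> from its boundary. The
  step is dual to the concentric subcell of side \<open>l = (1 - 2\<theta>) h\<close>, on which the window is bounded
  below, so Parseval there gives the lower Riesz bound.\<close>

locale cell_windows =
  fixes b0 :: "'a::euclidean_space" and S M :: "'a set" and h \<theta> :: real and A q :: nat and \<mu> :: 'a
  assumes b0: "b0 \<in> Basis" and S: "compact S" and h: "h > 0" and \<theta>: "0 < \<theta>" "\<theta> < 1/2" and A: "A \<ge> 3" and q: "q \<ge> 1"
    and finM: "finite M" and M: "M \<subseteq> plat0 b0 h"
    and cellS: "\<And>m v. m \<in> M \<Longrightarrow> (\<And>b. b \<in> Basis \<Longrightarrow> m \<bullet> b \<le> v \<bullet> b \<and> v \<bullet> b \<le> m \<bullet> b + h) \<Longrightarrow> v \<in> S"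
    and \<mu>: "\<mu> \<bullet> b0 = 0"
begin

text \<open>A squared window tail has order \<open>2 * p\<close>. One half of it, of order
  \<open>DIM('a) + 2\<close>, is summed over the separated sample set by
  \<open>separated_decay_sum\<close>; the other half outweighs the number of windows, which grows
  like \<open>q ^ (DIM('a) - 1)\<close>.\<close>

definition "p = DIM('a) + 2"
definition "l = (1 - 2 * \<theta>) * h"
definition "\<sigma> = 1 / l"
definition "R = real A * real q * \<sigma>"
definition "\<Phi> = (Basis - {b0}) \<rightarrow>\<^sub>E {q..<(A - 1) * q}"
definition pos :: "('a \<Rightarrow> nat) \<Rightarrow> 'a" where "pos \<phi> = (\<Sum>b\<in>Basis - {b0}. (real (\<phi> b) * \<sigma>) *\<^sub>R b)"
definition "I = M \<times> \<Phi>"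
definition gi :: "'a \<times> ('a \<Rightarrow> nat) \<Rightarrow> 'a \<Rightarrow> complex" where
  "gi i w = cellwin p h (fst i) w * cnj (chr (\<mu> + pos (snd i)) w)"
text \<open>The one-dimensional factor, in direction \<open>b\<close>, of the transform of
  \<open>gi i\<close>; the factors are kept apart so that the one along \<open>b0\<close> can be
  split off.\<close>

definition psi :: "'a \<times> ('a \<Rightarrow> nat) \<Rightarrow> 'a \<Rightarrow> 'a \<Rightarrow> complex" where
  "psi i x b = h * exp (2 * pi * \<i> * complex_of_real ((fst i \<bullet> b) * ((x - (\<mu> + pos (snd i))) \<bullet> b))) * win p p (h * ((x - (\<mu> + pos (snd i))) \<bullet> b))"

lemma l_pos: "l > 0" "\<sigma> > 0" "h * \<sigma> \<ge> 1"
proof -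
  show l: "l > 0" using \<theta> h by (simp add: l_def)
  then show "\<sigma> > 0" by (simp add: \<sigma>_def)
  have "l \<le> h" using \<theta> h by (simp add: l_def algebra_simps)
  then show "h * \<sigma> \<ge> 1" using l by (simp add: \<sigma>_def)
qed

lemma p_pos: "p > 0" by (simp add: p_def)

lemma finI: "finite I" unfolding I_def \<Phi>_def using finM by (intro finite_cartesian_product finite_PiE) auto

lemma card_I: "card I = card M * ((A - 2) * q) ^ (DIM('a) - 1)"
proof -
  have "card \<Phi> = (\<Prod>b\<in>Basis - {b0}. card {q..<(A - 1) * q})" unfolding \<Phi>_def by (rule card_PiE) simp
  also have "card {q..<(A - 1) * q} = (A - 2) * q"
    by (simp add: diff_mult_distrib)
  finally show ?thesis using b0 by (simp add: I_def card_cartesian_product card_Diff_singleton)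
qed

lemma pos_inner: "b \<in> Basis \<Longrightarrow> pos \<phi> \<bullet> b = (if b = b0 then 0 else real (\<phi> b) * \<sigma>)"
proof -
  assume b: "b \<in> Basis"
  have "pos \<phi> \<bullet> b = (\<Sum>c\<in>Basis - {b0}. (real (\<phi> c) * \<sigma>) * (c \<bullet> b))" by (simp add: pos_def inner_sum_left)
  also have "\<dots> = (\<Sum>c\<in>Basis - {b0}. if c = b then real (\<phi> c) * \<sigma> else 0)"
    using b by (intro sum.cong) (auto simp: inner_Basis)
  also have "\<dots> = (if b = b0 then 0 else real (\<phi> b) * \<sigma>)" using b by simp
  finally show ?thesis .
qed

lemma inj_pos: "inj_on pos \<Phi>"
proof (rule inj_onI)
  fix \<phi> \<psi> assume \<phi>: "\<phi> \<in> \<Phi>" "\<psi> \<in> \<Phi>" and eq: "pos \<phi> = pos \<psi>"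
  show "\<phi> = \<psi>"
  proof (rule PiE_ext[of \<phi> "Basis - {b0}" "\<lambda>_. {q..<(A - 1) * q}" \<psi>])
    fix b :: 'a assume b: "b \<in> Basis - {b0}"
    have "real (\<phi> b) * \<sigma> = real (\<psi> b) * \<sigma>" using arg_cong[OF eq, of "\<lambda>z. z \<bullet> b"] b by (simp add: pos_inner)
    then show "\<phi> b = \<psi> b" using l_pos by simp
  qed (use \<phi> in \<open>simp_all add: \<Phi>_def\<close>)
qed

definition "Tl = colvec b0 l l"

lemma Tl_pos: "b \<in> Basis \<Longrightarrow> Tl \<bullet> b > 0" using l_pos by (simp add: Tl_def colvec_pos)

text \<open>The step \<open>\<sigma>\<close> is the reciprocal of the side \<open>l\<close>, so the
  modulations belonging to the grid are characters of the period box of side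
  \<open>l\<close>.\<close>

lemma pos_glat: "pos \<phi> \<in> glat Tl"
  unfolding glat_def
proof (intro CollectI ballI)
  fix b :: 'a assume b: "b \<in> Basis"
  show "(pos \<phi> \<bullet> b) * (Tl \<bullet> b) \<in> \<int>"
    using b l_pos by (simp add: pos_inner Tl_def colvec_inner \<sigma>_def)
qed

lemma gi_measurable [measurable]: "gi i \<in> borel_measurable borel"
  unfolding gi_def cnj_chr by measurable

lemma gi_bound: "cmod (gi i w) \<le> 1"
  unfolding gi_def norm_mult using norm_cellwin_le_1[of p h "fst i" w] by simp

lemma gi_support: assumes "i \<in> I" "gi i w \<noteq> 0" shows "w \<in> S"
proof -
  have "cellwin p h (fst i) w \<noteq> 0" using assms(2) by (auto simp: gi_def)
  then have "fst i \<bullet> b \<le> w \<bullet> b \<and> w \<bullet> b \<le> fst i \<bullet> b + h" if "b \<in> Basis" for b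
    using cellwin_nonzero[OF p_pos h _ that, of "fst i" w] by auto
  then show ?thesis using cellS[of "fst i" w] assms(1) by (auto simp: I_def)
qed

lemma sqint_gi: assumes "i \<in> I" shows "sqint lborel (gi i)"
proof -
  obtain a where a: "S \<subseteq> cbox (-a) a" using compact_imp_bounded[OF S] bounded_subset_cbox_symmetric by metis
  have "sqint lborel (\<lambda>w. complex_of_real (indicator (cbox (-a) a) w))"
  proof -
    have "(\<lambda>w. (cmod (complex_of_real (indicator (cbox (-a) a) w)))\<^sup>2) = (indicator (cbox (-a) a) :: 'a \<Rightarrow> real)"
      by (auto simp: indicator_def)
    moreover have "integrable lborel (indicator (cbox (-a) a) :: 'a \<Rightarrow> real)"
      using emeasure_lborel_cbox_finite[of "-a" a] by (intro integrable_real_indicator) auto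
    ultimately show ?thesis by (simp add: sqint_def)
  qed
  then show ?thesis
  proof (rule sqint_bound[rotated])
    show "cmod (gi i w) \<le> 1 * cmod (complex_of_real (indicator (cbox (-a) a) w))" for w
      using gi_bound[of i w] gi_support[OF assms, of w] a by (cases "gi i w = 0") (auto simp: indicator_def)
  qed simp
qed

lemma fourier_gi: "fourier (gi i) x = (\<Prod>b\<in>Basis. psi i x b)"
proof -
  have "gi i w * chr x w = cellwin p h (fst i) w * chr (x - (\<mu> + pos (snd i))) w" for w
  proof -
    define y where "y = \<mu> + pos (snd i)"
    have "chr (x - y) w = chr x w * cnj (chr y w)" using chr_add_left[of x "- y" w] by (simp add: cnj_chr)
    then show ?thesis by (simp add: gi_def y_def[symmetric] mult_ac)
  qed
  then show ?thesis unfolding fourier_def psi_def by (simp add: fourier_cellwin[OF h])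
qed

definition comb :: "('a \<times> ('a \<Rightarrow> nat) \<Rightarrow> complex) \<Rightarrow> 'a \<Rightarrow> complex" where
  "comb c w = (\<Sum>i\<in>I. c i * gi i w)"

lemma sqint_comb: "sqint lborel (comb c)"
  unfolding comb_def[abs_def] by (intro sqint_sum finI sqint_cmult sqint_gi)

lemma comb_support: "w \<notin> S \<Longrightarrow> comb c w = 0"
  unfolding comb_def by (intro sum.neutral) (use gi_support in force)

lemma fourier_comb: "fourier (comb c) x = (\<Sum>i\<in>I. c i * (\<Prod>b\<in>Basis. psi i x b))"
proof -
  have int: "integrable lborel (\<lambda>w. gi i w * chr x w)" if "i \<in> I" for i
    by (rule sqint_bounded_support_integrable[of _ S])
      (use sqint_gi[OF that] gi_support[OF that] compact_imp_bounded[OF S] in \<open>auto intro!: sqint_mult_unimodular\<close>)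
  have "fourier (comb c) x = (\<integral>w. (\<Sum>i\<in>I. c i * (gi i w * chr x w)) \<partial>lborel)"
    unfolding fourier_def comb_def by (simp add: sum_distrib_right mult.assoc)
  also have "\<dots> = (\<Sum>i\<in>I. \<integral>w. c i * (gi i w * chr x w) \<partial>lborel)"
    by (intro Bochner_Integration.integral_sum integrable_mult_right int)
  also have "\<dots> = (\<Sum>i\<in>I. c i * fourier (gi i) x)" by (simp add: fourier_def)
  finally show ?thesis by (simp add: fourier_gi)
qed

lemma comb_in_PW: "fourier (comb c) \<in> PW_space S"
  unfolding PW_space_eq[OF S] using sqint_comb comb_support by blast

text \<open>Square of the lower bound for a window on its subcell, times the volume of the
  subcell.\<close>

definition "c0 = ((\<theta> ^ (2 * p)) ^ DIM('a))\<^sup>2 * l ^ DIM('a)"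

definition corner :: "'a \<Rightarrow> 'a" where "corner m = m + (\<Sum>b\<in>Basis. (\<theta> * h) *\<^sub>R b)"

lemma subbox_iff: "w \<in> cbox (corner m) (corner m + Tl) \<longleftrightarrow> (\<forall>b\<in>Basis. \<theta> \<le> (w \<bullet> b - m \<bullet> b) / h \<and> (w \<bullet> b - m \<bullet> b) / h \<le> 1 - \<theta>)"
proof -
  have "corner m \<bullet> b = m \<bullet> b + \<theta> * h" "(corner m + Tl) \<bullet> b = m \<bullet> b + (1 - \<theta>) * h" if "b \<in> Basis" for b
  proof -
    show 1: "corner m \<bullet> b = m \<bullet> b + \<theta> * h" using that by (simp add: corner_def inner_add_left)
    show "(corner m + Tl) \<bullet> b = m \<bullet> b + (1 - \<theta>) * h"
      unfolding inner_add_left 1 using that by (simp add: Tl_def colvec_inner l_def algebra_simps)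
  qed
  moreover have "(\<theta> \<le> (w \<bullet> b - m \<bullet> b) / h \<and> (w \<bullet> b - m \<bullet> b) / h \<le> 1 - \<theta>) \<longleftrightarrow>
      (m \<bullet> b + \<theta> * h \<le> w \<bullet> b \<and> w \<bullet> b \<le> m \<bullet> b + (1 - \<theta>) * h)" for b
    unfolding pos_le_divide_eq[OF h] pos_divide_le_eq[OF h] by linarith
  ultimately show ?thesis unfolding mem_box by simp
qed

text \<open>If the window of \<open>m'\<close> were nonzero at \<open>w\<close>, both
  \<open>m\<close> and \<open>m'\<close> would label the tile of side \<open>h\<close> containing
  \<open>w\<close>.\<close>

lemma subbox_other_zero:
  assumes m: "m \<in> M" "m' \<in> M" "m' \<noteq> m" and w: "w \<in> cbox (corner m) (corner m + Tl)"
  shows "cellwin p h m' w = 0"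
proof (rule ccontr)
  assume nz: "cellwin p h m' w \<noteq> 0"
  define L where "L = colvec b0 h h"
  have L: "L \<bullet> b > 0" if "b \<in> Basis" for b using h that by (simp add: L_def colvec_pos)
  have Mp: "k \<in> plat L" if "k \<in> M" for k
    unfolding plat_def
  proof (intro CollectI ballI)
    fix b :: 'a assume b: "b \<in> Basis"
    have k: "k \<in> plat0 b0 h" using that M by blast
    show "\<exists>j::int. k \<bullet> b = of_int j * (L \<bullet> b)"
    proof (cases "b = b0")
      case True then show ?thesis using k by (intro exI[of _ 0]) (simp add: plat0_def)
    next
      case False
      have "\<exists>j::int. k \<bullet> b = of_int j * (colvec b0 h 1 \<bullet> b)" using k b by (simp add: plat0_def plat_def)
      then show ?thesis using False b by (simp add: L_def colvec_inner)
    qed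
  qed
  have "w - m' \<in> hbox L" unfolding hbox_def
  proof (intro CollectI ballI)
    fix b :: 'a assume b: "b \<in> Basis"
    have "m' \<bullet> b < w \<bullet> b \<and> w \<bullet> b < m' \<bullet> b + h" by (rule cellwin_nonzero[OF p_pos h nz b])
    then show "0 \<le> (w - m') \<bullet> b \<and> (w - m') \<bullet> b < L \<bullet> b" using b by (simp add: L_def colvec_inner inner_diff_left)
  qed
  moreover have "w - m \<in> hbox L" unfolding hbox_def
  proof (intro CollectI ballI)
    fix b :: 'a assume b: "b \<in> Basis"
    have "\<theta> * h \<le> w \<bullet> b - m \<bullet> b" "w \<bullet> b - m \<bullet> b \<le> (1 - \<theta>) * h"
      using w b h unfolding subbox_iff by (auto simp: field_simps)
    moreover have "0 < \<theta> * h" "(1 - \<theta>) * h < h" using \<theta> h by (auto simp: algebra_simps)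
    ultimately show "0 \<le> (w - m) \<bullet> b \<and> (w - m) \<bullet> b < L \<bullet> b" using b by (simp add: inner_diff_left L_def colvec_inner)
  qed
  ultimately have "m' = m" using lfl_unique[OF L] Mp m by metis
  then show False using m by simp
qed

text \<open>On the subcell of \<open>m\<close> only the windows of that cell live, so
  \<open>comb c\<close> is the window times a unimodular factor times a trigonometric polynomial
  whose frequencies \<open>pos \<phi>\<close> are distinct points of the lattice dual to the
  subcell. Bounding the window below and applying Parseval on each subcell yields the squared
  coefficients; the spectrum elsewhere is discarded.\<close>

lemma comb_norm_lower: "c0 * (\<Sum>i\<in>I. (cmod (c i))\<^sup>2) \<le> L2_norm_sq (fourier (comb c))"
proof -
  let ?B = "\<lambda>m. cbox (corner m) (corner m + Tl)"
  let ?\<eta> = "(\<theta> ^ (2 * p)) ^ DIM('a)"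
  let ?t = "\<lambda>m w. \<Sum>\<phi>\<in>\<Phi>. c (m, \<phi>) * cnj (chr (pos \<phi>) w)"
  have fin\<Phi>: "finite \<Phi>" unfolding \<Phi>_def by (intro finite_PiE) auto
  have lam: "?\<eta> \<le> cmod (cellwin p h m w)" if "w \<in> ?B m" for m w
  proof -
    have "(\<Prod>b\<in>(Basis::'a set). \<theta> ^ (2 * p)) \<le> (\<Prod>b\<in>Basis. bump p ((w \<bullet> b - m \<bullet> b) / h))"
      using that \<theta> unfolding subbox_iff by (intro prod_mono) (auto intro!: bump_lower)
    moreover have "cmod (cellwin p h m w) = (\<Prod>b\<in>Basis. bump p ((w \<bullet> b - m \<bullet> b) / h))"
      unfolding cellwin_def norm_of_real using bump_bounds by (intro abs_of_nonneg prod_nonneg) auto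
    ultimately show ?thesis by simp
  qed
  have cw: "comb c w = cellwin p h m w * (cnj (chr \<mu> w) * ?t m w)" if m: "m \<in> M" and w: "w \<in> ?B m" for m w
  proof -
    have "comb c w = (\<Sum>m'\<in>M. \<Sum>\<phi>\<in>\<Phi>. c (m', \<phi>) * gi (m', \<phi>) w)"
      unfolding comb_def I_def by (simp add: sum.cartesian_product)
    also have "\<dots> = (\<Sum>m'\<in>{m}. \<Sum>\<phi>\<in>\<Phi>. c (m', \<phi>) * gi (m', \<phi>) w)"
    proof (rule sum.mono_neutral_right[OF finM])
      show "\<forall>m'\<in>M - {m}. (\<Sum>\<phi>\<in>\<Phi>. c (m', \<phi>) * gi (m', \<phi>) w) = 0"
        using subbox_other_zero[OF m _ _ w] by (auto simp: gi_def intro!: sum.neutral)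
    qed (use m in auto)
    also have "\<dots> = cellwin p h m w * (cnj (chr \<mu> w) * ?t m w)"
      by (simp add: gi_def chr_add_left sum_distrib_left mult_ac)
    finally show ?thesis .
  qed
  have sqc: "integrable lborel (\<lambda>w. (cmod (comb c w))\<^sup>2)" using sqint_comb by (simp add: sqint_def)
  have tb: "integrable lborel (\<lambda>w. indicator (?B m) w * (cmod (?t m w))\<^sup>2)" for m
  proof -
    have "integrable lborel (\<lambda>w. indicator (?B m) w *\<^sub>R (cmod (?t m w))\<^sup>2)"
      by (rule borel_integrable_compact) (auto intro!: continuous_intros)
    then show ?thesis by simp
  qed
  have each: "(\<integral>w. indicator (?B m) w * (cmod (?t m w))\<^sup>2 \<partial>lborel) = l ^ DIM('a) * (\<Sum>\<phi>\<in>\<Phi>. (cmod (c (m, \<phi>)))\<^sup>2)" for m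
  proof -
    interpret pb: period_box Tl "corner m" by unfold_locales (rule Tl_pos)
    have "pb.V = l ^ DIM('a)"
      unfolding pb.V_def using prod_colvec[OF b0, of l l] by (simp add: Tl_def power_eq_if)
    then show ?thesis using pb.trig_family_norm[OF fin\<Phi> inj_pos, of "\<lambda>\<phi>. c (m, \<phi>)"] pos_glat by auto
  qed
  have pw: "(\<Sum>m\<in>M. ?\<eta>\<^sup>2 * (indicator (?B m) w * (cmod (?t m w))\<^sup>2)) \<le> (cmod (comb c w))\<^sup>2" for w
  proof (cases "\<exists>m\<in>M. w \<in> ?B m")
    case True
    then obtain m where m: "m \<in> M" "w \<in> ?B m" by blast
    have other: "w \<notin> ?B m'" if "m' \<in> M - {m}" for m'
    proof
      assume w': "w \<in> ?B m'"
      have "cellwin p h m w = 0" using subbox_other_zero[OF _ m(1) _ w'] that by auto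
      moreover have "?\<eta> > 0" using \<theta> by simp
      ultimately show False using lam[OF m(2)] by simp
    qed
    have "(\<Sum>m'\<in>M. ?\<eta>\<^sup>2 * (indicator (?B m') w * (cmod (?t m' w))\<^sup>2)) = (\<Sum>m'\<in>{m}. ?\<eta>\<^sup>2 * (indicator (?B m') w * (cmod (?t m' w))\<^sup>2))"
      by (rule sum.mono_neutral_right[OF finM]) (use m other in auto)
    also have "\<dots> = ?\<eta>\<^sup>2 * (cmod (?t m w))\<^sup>2" using m by simp
    also have "\<dots> \<le> (cmod (cellwin p h m w))\<^sup>2 * (cmod (?t m w))\<^sup>2"
      using lam[OF m(2)] \<theta> by (intro mult_right_mono power_mono) auto
    also have "\<dots> = (cmod (comb c w))\<^sup>2" by (simp add: cw[OF m] norm_mult power_mult_distrib)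
    finally show ?thesis .
  next
    case False
    then have ind0: "indicator (?B m) w = (0::real)" if "m \<in> M" for m using that by (simp add: indicator_def del: mem_box)
    have "(\<Sum>m\<in>M. ?\<eta>\<^sup>2 * (indicator (?B m) w * (cmod (?t m w))\<^sup>2)) = 0"
    proof (rule sum.neutral, rule ballI)
      fix m assume m: "m \<in> M"
      show "?\<eta>\<^sup>2 * (indicator (?B m) w * (cmod (?t m w))\<^sup>2) = 0" unfolding ind0[OF m] by (simp only: mult_zero_left mult_zero_right)
    qed
    also have "0 \<le> (cmod (comb c w))\<^sup>2" by (rule zero_le_power2)
    finally show ?thesis .
  qed
  have "c0 * (\<Sum>i\<in>I. (cmod (c i))\<^sup>2) = (\<Sum>m\<in>M. ?\<eta>\<^sup>2 * (l ^ DIM('a) * (\<Sum>\<phi>\<in>\<Phi>. (cmod (c (m, \<phi>)))\<^sup>2)))"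
  proof -
    have "(\<Sum>i\<in>I. (cmod (c i))\<^sup>2) = (\<Sum>m\<in>M. \<Sum>\<phi>\<in>\<Phi>. (cmod (c (m, \<phi>)))\<^sup>2)"
      unfolding sum.cartesian_product I_def by (simp add: split_def)
    then show ?thesis unfolding c0_def by (simp only: sum_distrib_left[symmetric] mult.assoc)
  qed
  also have "\<dots> = (\<Sum>m\<in>M. \<integral>w. ?\<eta>\<^sup>2 * (indicator (?B m) w * (cmod (?t m w))\<^sup>2) \<partial>lborel)"
    by (intro sum.cong refl) (simp only: each[symmetric] integral_mult_right_zero)
  also have "\<dots> = (\<integral>w. (\<Sum>m\<in>M. ?\<eta>\<^sup>2 * (indicator (?B m) w * (cmod (?t m w))\<^sup>2)) \<partial>lborel)"
    by (intro Bochner_Integration.integral_sum[symmetric] integrable_mult_right tb)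
  also have "\<dots> \<le> (\<integral>w. (cmod (comb c w))\<^sup>2 \<partial>lborel)"
    by (intro integral_mono Bochner_Integration.integrable_sum integrable_mult_right tb sqc pw)
  also have "\<dots> = L2_norm_sq (fourier (comb c))"
    by (rule Plancherel[OF sqint_comb _ compact_imp_bounded[OF S], symmetric]) (rule comb_support)
  finally show ?thesis .
qed

definition "K1 = (h ^ DIM('a) * ((2 + 2 * real p) ^ p) ^ DIM('a))\<^sup>2"

text \<open>With \<open>y\<close> the product of the factors
  \<open>1 + h * \<bar>u \<bullet> b\<bar>\<close>, the squared transform is at most
  \<open>K1 / y ^ (2 * p)\<close>. Outside the column some coordinate of \<open>u\<close> other than
  that along \<open>b0\<close> is at least \<open>q * \<sigma>\<close>, and
  \<open>h * \<sigma> \<ge> 1\<close>, so \<open>y \<ge> 1 + q\<close>; moreover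
  \<open>y \<ge> 1 + h * norm u\<close>. Each bound takes half of the exponent.\<close>

lemma psi_tail:
  assumes i: "i \<in> I" and x: "x \<notin> cell0 b0 R \<mu>"
  shows "(cmod (\<Prod>b\<in>Basis. psi i x b))\<^sup>2 \<le> K1 * ((1 / (1 + real q)) ^ p * (1 / (1 + h * norm (x - (\<mu> + pos (snd i))))) ^ p)"
proof -
  define u where "u = x - (\<mu> + pos (snd i))"
  define y where "y = (\<Prod>b\<in>Basis. 1 + h * \<bar>u \<bullet> b\<bar>)"
  have \<phi>: "snd i \<in> \<Phi>" using i by (auto simp: I_def)
  have y1: "1 + h * norm u \<le> y"
  proof -
    have "h * norm u \<le> (\<Sum>b\<in>Basis. h * \<bar>u \<bullet> b\<bar>)"
      unfolding sum_distrib_left[symmetric] using norm_le_l1[of u] h by (intro mult_left_mono) auto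
    moreover have "1 + (\<Sum>b\<in>Basis. h * \<bar>u \<bullet> b\<bar>) \<le> y"
      unfolding y_def using h by (intro prod_one_plus_ge) auto
    ultimately show ?thesis by linarith
  qed
  have y2: "1 + real q \<le> y"
  proof -
    obtain b where b: "b \<in> Basis" "b \<noteq> b0" "x \<bullet> b < \<mu> \<bullet> b \<or> \<mu> \<bullet> b + R \<le> x \<bullet> b"
      using x by (auto simp: cell0_def not_le not_less)
    have \<phi>b: "q \<le> snd i b" "snd i b < (A - 1) * q" using \<phi> b by (auto simp: \<Phi>_def PiE_def Pi_def)
    have "real q * \<sigma> \<le> \<bar>u \<bullet> b\<bar>"
    proof -
      have ub: "u \<bullet> b = x \<bullet> b - \<mu> \<bullet> b - real (snd i b) * \<sigma>" using b by (simp add: u_def inner_diff_left inner_add_left pos_inner)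
      have 1: "real q * \<sigma> \<le> real (snd i b) * \<sigma>" using \<phi>b l_pos by (intro mult_right_mono) auto
      have "real (snd i b) + real q \<le> real A * real q"
      proof -
        have "snd i b + q \<le> (A - 1) * q + q" using \<phi>b by simp
        also have "\<dots> = A * q" using A by (simp add: diff_mult_distrib)
        finally show ?thesis by (metis of_nat_add of_nat_le_iff of_nat_mult)
      qed
      then have "(real (snd i b) + real q) * \<sigma> \<le> R" unfolding R_def using l_pos by (intro mult_right_mono) auto
      then have 2: "real (snd i b) * \<sigma> + real q * \<sigma> \<le> R" by (simp add: distrib_right)
      from b(3) show ?thesis
      proof
        assume "x \<bullet> b < \<mu> \<bullet> b"
        then show ?thesis using ub 1 by (simp add: abs_if)
      next
        assume "\<mu> \<bullet> b + R \<le> x \<bullet> b"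
        then show ?thesis using ub 2 by (simp add: abs_if)
      qed
    qed
    then have "h * (real q * \<sigma>) \<le> h * \<bar>u \<bullet> b\<bar>" using h by (intro mult_left_mono) auto
    moreover have "1 * real q \<le> (h * \<sigma>) * real q" using l_pos by (intro mult_right_mono) auto
    ultimately have "1 + real q \<le> 1 + h * \<bar>u \<bullet> b\<bar>" by (simp add: mult_ac)
    also have "\<dots> \<le> y"
    proof -
      have "(\<Prod>c\<in>{b}. 1 + h * \<bar>u \<bullet> c\<bar>) \<le> y"
        unfolding y_def using b h by (intro prod_mono2) auto
      then show ?thesis by simp
    qed
    finally show ?thesis .
  qed
  have y0: "y > 0" using y2 by linarith
  have "cmod (\<Prod>b\<in>Basis. psi i x b) = (\<Prod>b\<in>Basis. h * cmod (win p p (h * (u \<bullet> b))))"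
    using h by (simp add: prod_norm[symmetric] psi_def u_def norm_mult norm_exp_eq_Re)
  also have "\<dots> \<le> (\<Prod>b\<in>(Basis::'a set). h * ((2 + 2 * real p) / (1 + h * \<bar>u \<bullet> b\<bar>)) ^ p)"
  proof (rule prod_mono)
    fix b :: 'a
    have "cmod (win p p (h * (u \<bullet> b))) \<le> ((2 + 2 * real p) / (1 + h * \<bar>u \<bullet> b\<bar>)) ^ p"
      using norm_win_decay[of p "h * (u \<bullet> b)"] h by (simp add: abs_mult)
    then show "0 \<le> h * cmod (win p p (h * (u \<bullet> b))) \<and> h * cmod (win p p (h * (u \<bullet> b))) \<le> h * ((2 + 2 * real p) / (1 + h * \<bar>u \<bullet> b\<bar>)) ^ p"
      using h by (intro conjI mult_nonneg_nonneg mult_left_mono) auto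
  qed
  also have "\<dots> = h ^ DIM('a) * ((2 + 2 * real p) ^ p) ^ DIM('a) * (1 / y) ^ p"
    by (simp add: prod.distrib power_divide prod_dividef y_def prod_power_distrib power_mult_distrib)
  finally have "(cmod (\<Prod>b\<in>Basis. psi i x b))\<^sup>2 \<le> (h ^ DIM('a) * ((2 + 2 * real p) ^ p) ^ DIM('a) * (1 / y) ^ p)\<^sup>2"
    by (intro power_mono) auto
  also have "\<dots> = K1 * ((1 / y) ^ p * (1 / y) ^ p)" by (simp add: K1_def power_mult_distrib power2_eq_square)
  also have "\<dots> \<le> K1 * ((1 / (1 + real q)) ^ p * (1 / (1 + h * norm u)) ^ p)"
  proof (rule mult_left_mono)
    have hn: "h * norm u \<ge> 0" using h by simp
    have i1: "1 / y \<le> 1 / (1 + real q)" by (rule frac_le[OF _ order_refl _ y2]) simp_all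
    have i2: "1 / y \<le> 1 / (1 + h * norm u)" by (rule frac_le[OF _ order_refl _ y1]) (simp, use hn in linarith)
    have i0: "0 \<le> 1 / y" by (rule divide_nonneg_nonneg[OF zero_le_one less_imp_le[OF y0]])
    show "(1 / y) ^ p * (1 / y) ^ p \<le> (1 / (1 + real q)) ^ p * (1 / (1 + h * norm u)) ^ p"
      by (rule mult_mono[OF power_mono[OF i1 i0] power_mono[OF i2 i0] zero_le_power zero_le_power[OF i0]]) simp
    show "0 \<le> K1" unfolding K1_def by (rule zero_le_power2)
  qed
  finally show ?thesis unfolding u_def .
qed

lemma comb_tail:
  assumes x: "x \<notin> cell0 b0 R \<mu>"
  shows "(cmod (fourier (comb c) x))\<^sup>2 \<le> (\<Sum>i\<in>I. (cmod (c i))\<^sup>2) *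
     (\<Sum>i\<in>I. K1 * ((1 / (1 + real q)) ^ p * (1 / (1 + h * norm (x - (\<mu> + pos (snd i))))) ^ p))"
proof -
  have "cmod (fourier (comb c) x) \<le> (\<Sum>i\<in>I. cmod (c i) * cmod (\<Prod>b\<in>Basis. psi i x b))"
    unfolding fourier_comb by (rule order_trans[OF norm_sum]) (simp add: norm_mult)
  then have "(cmod (fourier (comb c) x))\<^sup>2 \<le> (\<Sum>i\<in>I. cmod (c i) * cmod (\<Prod>b\<in>Basis. psi i x b))\<^sup>2"
    by (intro power_mono) auto
  also have "\<dots> \<le> (\<Sum>i\<in>I. (cmod (c i))\<^sup>2) * (\<Sum>i\<in>I. (cmod (\<Prod>b\<in>Basis. psi i x b))\<^sup>2)"
    by (rule Cauchy_Schwarz_ineq_sum)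
  also have "\<dots> \<le> (\<Sum>i\<in>I. (cmod (c i))\<^sup>2) *
     (\<Sum>i\<in>I. K1 * ((1 / (1 + real q)) ^ p * (1 / (1 + h * norm (x - (\<mu> + pos (snd i))))) ^ p))"
    by (intro mult_left_mono sum_mono psi_tail x sum_nonneg) auto
  finally show ?thesis .
qed

text \<open>Cell corners, grid positions and \<open>\<mu>\<close> all have zero coordinate along
  \<open>b0\<close>, so the factor in that direction is the same for every window, while the
  remaining factors depend only on the line. Hence one linear equation in the coefficients makes a
  combination vanish on a whole line.\<close>

lemma psi_line:
  assumes i: "i \<in> I" and pp: "perp b0 x = perp b0 x'"
  shows "(\<Prod>b\<in>Basis. psi i x b) = (\<Prod>b\<in>Basis - {b0}. psi i x' b) * (h * win p p (h * (x \<bullet> b0)))"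
proof -
  have m0: "fst i \<bullet> b0 = 0" using i M by (auto simp: I_def plat0_def)
  have "psi i x b0 = h * win p p (h * (x \<bullet> b0))"
    using m0 \<mu> b0 by (simp add: psi_def inner_diff_left inner_add_left pos_inner)
  moreover have "psi i x b = psi i x' b" if "b \<in> Basis - {b0}" for b
  proof -
    have "x \<bullet> b = x' \<bullet> b" using arg_cong[OF pp, of "\<lambda>z. z \<bullet> b"] perp_inner[OF b0, of b] that by auto
    then show ?thesis by (simp add: psi_def inner_diff_left)
  qed
  ultimately have "psi i x b0 * (\<Prod>b\<in>Basis - {b0}. psi i x b) = (h * win p p (h * (x \<bullet> b0))) * (\<Prod>b\<in>Basis - {b0}. psi i x' b)"
    by (metis (no_types, lifting) prod.cong)
  then show ?thesis by (subst prod.remove[OF finite_Basis b0]) (simp only: mult.commute)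
qed

lemma comb_vanishes:
  assumes "(\<Sum>i\<in>I. c i * (\<Prod>b\<in>Basis - {b0}. psi i x' b)) = 0" "perp b0 x = perp b0 x'"
  shows "fourier (comb c) x = 0"
proof -
  have "fourier (comb c) x = (\<Sum>i\<in>I. c i * (\<Prod>b\<in>Basis - {b0}. psi i x' b) * (h * win p p (h * (x \<bullet> b0))))"
    unfolding fourier_comb by (intro sum.cong refl) (simp only: psi_line[OF _ assms(2)] mult.assoc)
  also have "\<dots> = (\<Sum>i\<in>I. c i * (\<Prod>b\<in>Basis - {b0}. psi i x' b)) * (h * win p p (h * (x \<bullet> b0)))"
    by (simp only: sum_distrib_right)
  also have "\<dots> = 0" unfolding assms(1) by (rule mult_zero_left)
  finally show ?thesis .
qed

end

text \<open>With fewer lines than windows a nonzero combination vanishes on every line of the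
  column. Its remaining samples lie outside the column, and by \<open>comb_tail\<close>,
  \<open>decay\<close> and \<open>small\<close> they carry less energy than the lower sampling bound
  together with \<open>comb_norm_lower\<close> demands.\<close>

lemma (in cell_windows) cell_line_count:
  fixes P :: "'a set set" and Lam :: "'a set" and \<alpha> C :: real
  assumes P: "parallel_lines b0 P" and Lam: "Lam \<subseteq> \<Union>P" and \<alpha>: "\<alpha> > 0"
    and samp: "\<And>f. f \<in> PW_space S \<Longrightarrow> (\<lambda>l. (cmod (f l))\<^sup>2) summable_on Lam \<and> \<alpha> * L2_norm_sq f \<le> (\<Sum>\<^sub>\<infinity>l\<in>Lam. (cmod (f l))\<^sup>2)"
    and decay: "\<And>\<kappa> F. finite F \<Longrightarrow> F \<subseteq> Lam \<Longrightarrow> (\<Sum>l\<in>F. (1 / (1 + h * norm (l - \<kappa>))) ^ (DIM('a) + 2)) \<le> C"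
    and small: "real (card I) * (K1 * (1 / (1 + real q)) ^ p * C) < \<alpha> * c0"
    and fin: "finite {L \<in> P. \<exists>x. L = line_through x b0 \<and> x \<in> cell0 b0 R \<mu>}" (is "finite ?L")
  shows "card I \<le> card {L \<in> P. \<exists>x. L = line_through x b0 \<and> x \<in> cell0 b0 R \<mu>}"
proof (rule ccontr)
  assume "\<not> card I \<le> card ?L"
  then have lt: "card ?L < card I" by simp
  have nb: "norm b0 = 1" using b0 by simp
  define pt where "pt L = (SOME x. L = line_through x b0)" for L
  have pt: "L = line_through (pt L) b0" if "L \<in> ?L" for L
    unfolding pt_def by (rule someI_ex) (use that in blast)
  obtain c where c: "\<exists>i\<in>I. c i \<noteq> 0" "\<forall>L\<in>?L. (\<Sum>i\<in>I. c i * (\<Prod>b\<in>Basis - {b0}. psi i (pt L) b)) = 0"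
    using homogeneous_system[OF fin finI lt, of "\<lambda>L i. \<Prod>b\<in>Basis - {b0}. psi i (pt L) b"] by (elim exE conjE)
  define f where "f = fourier (comb c)"
  define N where "N = (\<Sum>i\<in>I. (cmod (c i))\<^sup>2)"
  have N: "N > 0"
  proof -
    from c(1) obtain i where "i \<in> I" "c i \<noteq> 0" by blast
    then show ?thesis unfolding N_def by (intro sum_pos2[OF finI, of i]) auto
  qed
  have K1: "K1 \<ge> 0" unfolding K1_def by (rule zero_le_power2)
  define B where "B = K1 * (1 / (1 + real q)) ^ p"
  have B: "B \<ge> 0" using K1 by (simp add: B_def)
  let ?w = "\<lambda>x i. (1 / (1 + h * norm (x - (\<mu> + pos (snd i))))) ^ p"
  have pw: "(cmod (f x))\<^sup>2 \<le> N * (\<Sum>i\<in>I. B * ?w x i)" if x: "x \<in> Lam" for x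
  proof (cases "x \<in> cell0 b0 R \<mu>")
    case True
    obtain L where L1: "L \<in> P" "x \<in> L" using subsetD[OF Lam x] by (rule UnionE)
    then obtain y where L2: "L = line_through y b0" using P unfolding parallel_lines_def by metis
    obtain t where L3: "x = y + t *\<^sub>R b0" using L1(2) unfolding L2 line_through_def by (rule imageE)
    note L = L1(1) L2 L3
    have px: "perp b0 x = perp b0 y" using L(3) nb by (simp add: perp_def inner_add_left algebra_simps norm_eq_1)
    then have "y \<in> cell0 b0 R \<mu>" using True cell0_perp_cong[OF b0] by metis
    then have LL: "L \<in> ?L" using L by blast
    have "perp b0 y = perp b0 (pt L)" by (rule line_through_eq_perp[OF _ nb]) (use pt[OF LL] L in simp)
    then have "f x = 0" unfolding f_def by (intro comb_vanishes[OF bspec[OF c(2) LL]]) (simp only: px)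
    moreover have "0 \<le> N * (\<Sum>i\<in>I. B * ?w x i)"
      using N B h by (intro mult_nonneg_nonneg sum_nonneg zero_le_power) auto
    ultimately show ?thesis by simp
  next
    case False
    show ?thesis using comb_tail[OF False, of c] by (simp only: f_def N_def B_def mult.assoc)
  qed
  have fin_bound: "(\<Sum>x\<in>F. (cmod (f x))\<^sup>2) \<le> N * (real (card I) * (B * C))" if F: "finite F" "F \<subseteq> Lam" for F
  proof -
    have "(\<Sum>x\<in>F. (cmod (f x))\<^sup>2) \<le> (\<Sum>x\<in>F. N * (\<Sum>i\<in>I. B * ?w x i))"
      using F by (intro sum_mono pw) auto
    also have "\<dots> = N * (\<Sum>i\<in>I. B * (\<Sum>x\<in>F. ?w x i))"
      unfolding sum_distrib_left[symmetric] by (subst sum.swap) (simp only: sum_distrib_left)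
    also have "\<dots> \<le> N * (\<Sum>i\<in>I. B * C)"
      using N B decay[OF F] unfolding p_def by (intro mult_left_mono sum_mono) auto
    finally show ?thesis by simp
  qed
  have s: "(\<lambda>l. (cmod (f l))\<^sup>2) summable_on Lam \<and> \<alpha> * L2_norm_sq f \<le> (\<Sum>\<^sub>\<infinity>l\<in>Lam. (cmod (f l))\<^sup>2)"
    unfolding f_def by (rule samp[OF comb_in_PW])
  have "\<alpha> * (c0 * N) \<le> \<alpha> * L2_norm_sq f"
    unfolding f_def N_def using comb_norm_lower[of c] \<alpha> by (intro mult_left_mono) auto
  also have "\<dots> \<le> (\<Sum>\<^sub>\<infinity>l\<in>Lam. (cmod (f l))\<^sup>2)" using s by blast
  also have "\<dots> \<le> N * (real (card I) * (B * C))" by (rule infsum_le_finite_sums[OF _ fin_bound]) (use s in blast)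
  also have "\<dots> < N * (\<alpha> * c0)" using small N unfolding B_def by (intro mult_strict_left_mono)
  finally show False by (simp add: mult_ac)
qed

text \<open>At most \<open>card M * (A * (1 + q)) ^ (DIM('a) - 1)\<close> windows meet a tail factor
  \<open>1 / (1 + q) ^ p\<close>, and \<open>p\<close> exceeds \<open>DIM('a) - 1\<close> by 3, so
  the product decays at least like \<open>1 / (1 + q)\<close>.\<close>

lemma (in cell_windows) small_tail:
  assumes "real (card M) * real A ^ (DIM('a) - 1) * K1 * C < (1 + real q) * (\<alpha> * c0)" "C \<ge> 0"
  shows "real (card I) * (K1 * (1 / (1 + real q)) ^ p * C) < \<alpha> * c0"
proof -
  let ?n = "DIM('a) - 1" and ?x = "1 + real q"
  have K1: "K1 \<ge> 0" unfolding K1_def by (rule zero_le_power2)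
  have "real (card I) \<le> real (card M) * (real A * ?x) ^ ?n"
    unfolding card_I of_nat_mult of_nat_power by (intro mult_left_mono power_mono mult_mono) auto
  then have "real (card I) * (K1 * (1 / ?x) ^ p * C) \<le> real (card M) * (real A * ?x) ^ ?n * (K1 * (1 / ?x) ^ p * C)"
    using K1 assms(2) by (intro mult_right_mono mult_nonneg_nonneg) auto
  also have "\<dots> = (real (card M) * real A ^ ?n * K1 * C) * (?x ^ ?n * (1 / ?x) ^ p)"
    by (simp only: power_mult_distrib mult_ac)
  also have "?x ^ ?n * (1 / ?x) ^ p \<le> 1 / ?x"
  proof -
    have pe: "p = ?n + 1 + 2" using DIM_positive[where 'a='a] by (simp add: p_def)
    have "?x ^ ?n * (1 / ?x) ^ p = (?x * (1 / ?x)) ^ ?n * (1 / ?x) * (1 / ?x)\<^sup>2"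
      unfolding pe power_add power_mult_distrib by (simp only: mult_ac power_one_right)
    also have "\<dots> = (1 / ?x) * (1 / ?x)\<^sup>2" by simp
    also have "\<dots> \<le> (1 / ?x) * 1" by (intro mult_left_mono power_le_one) auto
    finally show ?thesis by simp
  qed
  then have "(real (card M) * real A ^ ?n * K1 * C) * (?x ^ ?n * (1 / ?x) ^ p) \<le> (real (card M) * real A ^ ?n * K1 * C) * (1 / ?x)"
    using K1 assms(2) by (intro mult_left_mono) auto
  also have "\<dots> < \<alpha> * c0"
  proof -
    have x0: "?x > 0" by simp
    have "real (card M) * real A ^ ?n * K1 * C / ?x < \<alpha> * c0"
      unfolding pos_divide_less_eq[OF x0] using assms(1) by (simp only: mult_ac)
    then show ?thesis by (simp only: times_divide_eq_right mult_1_right)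
  qed
  finally show ?thesis .
qed

text \<open>\<open>N\<close> lines are selected in every column and arranged as \<open>N\<close>
  families inside \<open>P\<close>. The count is asked only of columns with finitely many lines
  because \<open>card\<close> of an infinite set is 0; an infinite column offers \<open>N\<close>
  lines in any case.\<close>

lemma density_from_cells:
  fixes P :: "'a::euclidean_space set set"
  assumes b0: "b0 \<in> Basis" and R: "R > 0"
    and cells: "\<And>\<mu>. \<mu> \<in> plat0 b0 R \<Longrightarrow> finite {L \<in> P. \<exists>x. L = line_through x b0 \<and> x \<in> cell0 b0 R \<mu>} \<Longrightarrow>
       N \<le> card {L \<in> P. \<exists>x. L = line_through x b0 \<and> x \<in> cell0 b0 R \<mu>}"
  shows "ennreal (real N / R ^ (DIM('a) - 1)) \<le> lower_path_density P"
proof -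
  let ?L = "\<lambda>\<mu>. {L \<in> P. \<exists>x. L = line_through x b0 \<and> x \<in> cell0 b0 R \<mu>}"
  have nb: "norm b0 = 1" using b0 by simp
  have "\<exists>y. (\<forall>j<N. y j \<in> cell0 b0 R \<mu> \<and> line_through (y j) b0 \<in> P) \<and> inj_on (\<lambda>j. line_through (y j) b0) {..<N}"
    if \<mu>: "\<mu> \<in> plat0 b0 R" for \<mu>
  proof -
    have "\<exists>T\<subseteq>?L \<mu>. finite T \<and> card T = N"
    proof (cases "finite (?L \<mu>)")
      case True
      obtain T where "T \<subseteq> ?L \<mu>" "card T = N" "finite T" by (rule obtain_subset_with_card_n[OF cells[OF \<mu> True]])
      then show ?thesis by (intro exI[of _ T] conjI)
    next
      case False
      obtain T where "finite T" "card T = N" "T \<subseteq> ?L \<mu>" using infinite_arbitrarily_large[OF False, of N] by (elim exE conjE)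
      then show ?thesis by (intro exI[of _ T] conjI)
    qed
    then obtain T where T: "T \<subseteq> ?L \<mu>" "finite T" "card T = N" by (elim exE conjE)
    obtain g where "bij_betw g {0..<card T} T" using ex_bij_betw_nat_finite[OF T(2)] by (elim exE)
    then have g: "bij_betw g {..<N} T" using T(3) by (simp add: atLeast0LessThan)
    have "\<forall>j\<in>{..<N}. \<exists>x. g j = line_through x b0 \<and> x \<in> cell0 b0 R \<mu> \<and> g j \<in> P"
    proof
      fix j assume "j \<in> {..<N}"
      then have "g j \<in> ?L \<mu>" using g T(1) by (auto simp: bij_betw_def)
      then show "\<exists>x. g j = line_through x b0 \<and> x \<in> cell0 b0 R \<mu> \<and> g j \<in> P" by blast
    qed
    then obtain y where y: "\<forall>j\<in>{..<N}. g j = line_through (y j) b0 \<and> y j \<in> cell0 b0 R \<mu> \<and> g j \<in> P" by (elim bchoice[THEN exE])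
    have "inj_on (\<lambda>j. line_through (y j) b0) {..<N}"
      using g y by (metis (no_types, lifting) bij_betw_def inj_on_cong)
    then show ?thesis using y by (metis lessThan_iff)
  qed
  then have "\<forall>\<mu>\<in>plat0 b0 R. \<exists>y. (\<forall>j<N. y j \<in> cell0 b0 R \<mu> \<and> line_through (y j) b0 \<in> P) \<and> inj_on (\<lambda>j. line_through (y j) b0) {..<N}" by blast
  then obtain y where y: "\<forall>\<mu>\<in>plat0 b0 R. (\<forall>j<N. y \<mu> j \<in> cell0 b0 R \<mu> \<and> line_through (y \<mu> j) b0 \<in> P) \<and> inj_on (\<lambda>j. line_through (y \<mu> j) b0) {..<N}"
    by (elim bchoice[THEN exE])
  have inj: "inj_on (\<lambda>(j, m). line_through (y m j) b0) ({..<N} \<times> plat0 b0 R)"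
  proof (rule inj_onI, clarsimp)
    fix j m j' m' assume j: "j < N" "j' < N" and m: "m \<in> plat0 b0 R" "m' \<in> plat0 b0 R"
      and eq: "line_through (y m j) b0 = line_through (y m' j') b0"
    have yc: "y m j \<in> cell0 b0 R m" "y m' j' \<in> cell0 b0 R m'" using y j m by auto
    have "perp b0 (y m j) = perp b0 (y m' j')" by (rule line_through_eq_perp[OF eq nb])
    then have "y m' j' \<in> cell0 b0 R m" using yc(1) cell0_perp_cong[OF b0] by metis
    then have mm: "m = m'" using yc(2) cell0_iff[OF b0 R m(1)] cell0_iff[OF b0 R m(2)] by metis
    moreover have "inj_on (\<lambda>j. line_through (y m j) b0) {..<N}" using y m by blast
    ultimately show "j = j' \<and> m = m'" using eq j by (metis (no_types, lifting) inj_onD lessThan_iff)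
  qed
  have yc: "y m j \<in> cell0 b0 R m" if "j < N" "m \<in> plat0 b0 R" for j m using y that by blast
  show ?thesis
    by (rule family_density(1)[where y="\<lambda>j m. y m j", OF b0 R yc inj]) (use y in auto)
qed

theorem lower_bound_basis:
  fixes S :: "'a::euclidean_space set"
  assumes S: "compact S" "convex S" "0 \<in> interior S" and b0: "b0 \<in> Basis" and P: "P \<in> Par S b0"
  shows "ennreal (section_vol S b0) \<le> lower_path_density P"
proof -
  let ?n = "DIM('a) - 1" and ?d = "DIM('a)" and ?sv = "section_vol S b0"
  obtain r where r: "r > 0" "cball 0 r \<subseteq> S"
    using S(3) by (meson mem_interior_cball)
  from P obtain Lam where PL: "parallel_lines b0 P" "Lam \<subseteq> \<Union>P" "uniformly_discrete Lam" "stable_sampling S Lam"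
    by (auto simp: Par_def stable_nyquist_def)
  from PL(3) obtain e where e: "e > 0" "\<And>x y. x \<in> Lam \<Longrightarrow> y \<in> Lam \<Longrightarrow> x \<noteq> y \<Longrightarrow> e \<le> dist x y"
    by (auto simp: uniformly_discrete_def)
  from PL(4) obtain \<alpha> where \<alpha>: "\<alpha> > 0"
    "\<And>f. f \<in> PW_space S \<Longrightarrow> (\<lambda>l. (cmod (f l))\<^sup>2) summable_on Lam \<and> \<alpha> * L2_norm_sq f \<le> (\<Sum>\<^sub>\<infinity>l\<in>Lam. (cmod (f l))\<^sup>2)"
    unfolding stable_sampling_def by blast
  \<comment> \<open>The exponent collects the three losses: \<open>?d\<close> factors from packing
    the section by cells, \<open>?n\<close> from passing to subcells of side \<open>l\<close>, and
    \<open>?n\<close> from the guard strip in the cube.\<close>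
  have main: "ennreal ((1 - s) ^ (?d + 2 * ?n) * ?sv) \<le> lower_path_density P" if s: "0 < s" "s < 1" for s
  proof -
    define h where "h = s * r / real ?d"
    have h: "h > 0" "real ?d * h \<le> s * r" using s r by (auto simp: h_def)
    define M where "M = {m \<in> plat0 b0 h. \<forall>v. (\<forall>b\<in>Basis. m \<bullet> b \<le> v \<bullet> b \<and> v \<bullet> b \<le> m \<bullet> b + h) \<longrightarrow> v \<in> S}"
    have M: "finite M" "(1 - s) ^ ?d * ?sv \<le> real (card M) * h ^ ?n"
      unfolding M_def by (rule cell_packing[OF S(1,2) r b0 s h])+
    \<comment> \<open>Makes the side of the subcell \<open>l = (1 - s) * h\<close>.\<close>
    define \<theta> where "\<theta> = s / 2"
    have \<theta>: "0 < \<theta>" "\<theta> < 1/2" using s by (auto simp: \<theta>_def)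
    \<comment> \<open>From \<open>A \<ge> 2 / s\<close> the usable proportion
      \<open>(A - 2) / A\<close> of the side of the cube is at least \<open>1 - s\<close>.\<close>
    define A where "A = nat \<lceil>2 / s\<rceil> + 3"
    have A: "A \<ge> 3" "2 / s \<le> real A" unfolding A_def by (auto intro: order_trans[OF real_nat_ceiling_ge])
    obtain C where C: "C \<ge> 0" "\<And>\<kappa> F. finite F \<Longrightarrow> F \<subseteq> Lam \<Longrightarrow> (\<Sum>l\<in>F. (1 / (1 + h * norm (l - \<kappa>))) ^ (?d + 2)) \<le> C"
    proof -
      have "\<exists>C\<ge>0. \<forall>\<kappa> F. finite F \<longrightarrow> F \<subseteq> Lam \<longrightarrow> (\<Sum>l\<in>F. (1 / (1 + h * norm (l - \<kappa>))) ^ (?d + 2)) \<le> C"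
        by (rule separated_decay_sum[OF e h(1)])
      then obtain C where "C \<ge> 0" "\<forall>\<kappa> F. finite F \<longrightarrow> F \<subseteq> Lam \<longrightarrow> (\<Sum>l\<in>F. (1 / (1 + h * norm (l - \<kappa>))) ^ (?d + 2)) \<le> C" by (elim exE conjE)
      then show ?thesis by (intro that[of C]) simp_all
    qed
    \<comment> \<open>\<open>K\<close> and \<open>c\<close> are the values of \<open>K1\<close> and
      \<open>c0\<close>. They depend neither on \<open>q\<close> nor on \<open>\<mu>\<close>, so
      \<open>q\<close> can be chosen after them and once for all columns.\<close>
    define K where "K = (h ^ ?d * ((2 + 2 * real (?d + 2)) ^ (?d + 2)) ^ ?d)\<^sup>2"
    define c where "c = ((\<theta> ^ (2 * (?d + 2))) ^ ?d)\<^sup>2 * ((1 - 2 * \<theta>) * h) ^ ?d"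
    have c: "c > 0" unfolding c_def using \<theta> h by simp
    have ac: "\<alpha> * c > 0" using \<alpha>(1) c by simp
    \<comment> \<open>The size of the cube is chosen last. The locale is entered with
      \<open>q + 1\<close>, which is positive.\<close>
    obtain q :: nat where "real (card M) * real A ^ ?n * K * C / (\<alpha> * c) < real q" using reals_Archimedean2 by blast
    then have "real (card M) * real A ^ ?n * K * C < real q * (\<alpha> * c)" by (simp only: pos_divide_less_eq[OF ac])
    also have "\<dots> \<le> (1 + real (q + 1)) * (\<alpha> * c)" using ac by (intro mult_right_mono) auto
    finally have q: "real (card M) * real A ^ ?n * K * C < (1 + real (q + 1)) * (\<alpha> * c)" .
    define l where "l = (1 - 2 * \<theta>) * h"
    have l: "l > 0" using \<theta> h by (simp add: l_def)
    define R where "R = real A * real (q + 1) * (1 / l)"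
    have R: "R > 0" using A l by (simp add: R_def)
    define N where "N = card M * ((A - 2) * (q + 1)) ^ ?n"
    have dens: "ennreal (real N / R ^ ?n) \<le> lower_path_density P"
    proof (rule density_from_cells[OF b0 R])
      fix \<mu> assume \<mu>: "\<mu> \<in> plat0 b0 R" and fin: "finite {L \<in> P. \<exists>x. L = line_through x b0 \<and> x \<in> cell0 b0 R \<mu>}"
      interpret W: cell_windows b0 S M h \<theta> A "q + 1" \<mu>
        by unfold_locales (use b0 S h \<theta> A M \<mu> in \<open>auto simp: M_def plat0_def\<close>)
      have Req: "W.R = R" unfolding W.R_def W.\<sigma>_def W.l_def R_def l_def by simp
      have sm: "real (card W.I) * (W.K1 * (1 / (1 + real (q + 1))) ^ W.p * C) < \<alpha> * W.c0"
        by (rule W.small_tail[OF _ C(1)]) (use q in \<open>simp only: W.K1_def W.c0_def W.p_def W.l_def K_def c_def\<close>)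
      have "card W.I \<le> card {L \<in> P. \<exists>x. L = line_through x b0 \<and> x \<in> cell0 b0 W.R \<mu>}"
        by (rule W.cell_line_count[OF PL(1,2) \<alpha> _ sm]) (assumption, fact C(2), fact fin[folded Req])
      then show "N \<le> card {L \<in> P. \<exists>x. L = line_through x b0 \<and> x \<in> cell0 b0 R \<mu>}"
        unfolding Req W.card_I N_def .
    qed
    have "(1 - s) ^ (?d + 2 * ?n) * ?sv = ((1 - s) ^ ?d * ?sv) * ((1 - s) ^ ?n * (1 - s) ^ ?n)"
      unfolding power_add mult_2 by (simp only: mult_ac)
    also have "\<dots> \<le> (real (card M) * h ^ ?n) * ((1 - s) ^ ?n * (1 - s) ^ ?n)"
      using s by (intro mult_right_mono M(2)) auto
    also have "\<dots> \<le> (real (card M) * h ^ ?n) * ((1 - s) ^ ?n * ((real A - 2) / real A) ^ ?n)"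
    proof -
      have A0: "real A > 0" using A(1) by simp
      have "2 \<le> real A * s" using A(2) s by (simp add: pos_divide_le_eq)
      then have "1 - s \<le> (real A - 2) / real A"
        unfolding pos_le_divide_eq[OF A0] by (simp add: algebra_simps)
      then show ?thesis using s h by (intro mult_left_mono power_mono) auto
    qed
    also have "\<dots> = real N / R ^ ?n"
    proof -
      have A0: "real A > 0" "real (A - 2) = real A - 2" using A(1) by (auto simp: of_nat_diff)
      have "real N / R ^ ?n = real (card M) * (((real A - 2) * real (q + 1)) / R) ^ ?n"
        unfolding N_def of_nat_mult of_nat_power A0(2) by (simp only: power_divide times_divide_eq_right)
      also have "((real A - 2) * real (q + 1)) / R = h * ((1 - s) * ((real A - 2) / real A))"
      proof -
        have q0: "real (q + 1) > 0" by simp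
        have "((real A - 2) * real (q + 1)) / R = l * ((real A - 2) / real A)"
          unfolding R_def using l A0(1) q0 by (simp add: divide_simps)
        then show ?thesis by (simp add: l_def \<theta>_def mult_ac)
      qed
      finally show ?thesis by (simp only: power_mult_distrib mult.assoc)
    qed
    finally have "ennreal ((1 - s) ^ (?d + 2 * ?n) * ?sv) \<le> ennreal (real N / R ^ ?n)" by (rule ennreal_leI)
    then show ?thesis using dens by (rule order_trans)
  qed
  show ?thesis
  proof (rule tendsto_upperbound)
    have "((\<lambda>s::real. (1 - s) ^ (?d + 2 * ?n) * ?sv) \<longlongrightarrow> (1 - 0) ^ (?d + 2 * ?n) * ?sv) (at_right 0)"
      by (intro tendsto_intros)
    then have "((\<lambda>s::real. (1 - s) ^ (?d + 2 * ?n) * ?sv) \<longlongrightarrow> ?sv) (at_right 0)" by simp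
    then show "((\<lambda>s::real. ennreal ((1 - s) ^ (?d + 2 * ?n) * ?sv)) \<longlongrightarrow> ennreal ?sv) (at_right 0)"
      by (rule tendsto_ennrealI)
    have "\<forall>\<^sub>F s::real in at_right 0. s \<in> {0<..<1}" by (rule eventually_at_right_real) simp
    then show "\<forall>\<^sub>F s::real in at_right 0. ennreal ((1 - s) ^ (?d + 2 * ?n) * ?sv) \<le> lower_path_density P"
      by eventually_elim (use main in auto)
  qed (rule trivial_limit_at_right_real)
qed

subsection \<open>Reflections\<close>

text \<open>A reflection is enough to exchange a unit vector with \<open>b0\<close>; since it is its
  own inverse, each transport lemma serves both directions.\<close>

locale involutive_isometry =
  fixes U :: "'a::euclidean_space \<Rightarrow> 'a"
  assumes linear_U: "linear U" and U_U [simp]: "U (U x) = x" and inner_U_U: "U x \<bullet> U y = x \<bullet> y"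
begin

lemma U_inner: "U x \<bullet> y = x \<bullet> U y"
  using inner_U_U[of x "U y"] by simp

lemma U_add: "U (x + y) = U x + U y" by (rule linear_add[OF linear_U])
lemma U_diff: "U (x - y) = U x - U y" by (rule linear_diff[OF linear_U])
lemma U_scaleR: "U (c *\<^sub>R x) = c *\<^sub>R U x" by (rule linear_scale[OF linear_U])

lemma norm_U [simp]: "norm (U x) = norm x"
  by (simp add: norm_eq_sqrt_inner inner_U_U)

lemma dist_U [simp]: "dist (U x) (U y) = dist x y"
  unfolding dist_norm U_diff[symmetric] norm_U ..

lemma continuous_on_U [continuous_intros]: "continuous_on A f \<Longrightarrow> continuous_on A (\<lambda>x. U (f x))"
  by (rule bounded_linear.continuous_on[OF linear_U[unfolded linear_conv_bounded_linear]])

lemma U_measurable [measurable]: "U \<in> borel_measurable borel"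
  by (intro borel_measurable_continuous_onI continuous_intros)

lemma inj_U: "inj_on U A" by (rule inj_on_inverseI[of _ U]) simp

lemma image_U_iff: "x \<in> U ` A \<longleftrightarrow> U x \<in> A" by (auto intro: image_eqI[where x="U x"])

lemma image_U_U [simp]: "U ` U ` A = A" by (simp add: image_image)

text \<open>Uniqueness of Haar measure: the push-forward of Lebesgue measure under \<open>U\<close> is again
  translation invariant, and both measures agree on the unit ball.\<close>

lemma nn_integral_U:
  fixes f :: "'a \<Rightarrow> ennreal"
  assumes f [measurable]: "f \<in> borel_measurable borel"
  shows "(\<integral>\<^sup>+x. f (U x) \<partial>lborel) = (\<integral>\<^sup>+x. f x \<partial>lborel)"
proof -
  define g :: "'a \<Rightarrow> ennreal" where "g = indicator (ball 0 1)"
  have g [measurable]: "g \<in> borel_measurable borel" unfolding g_def by (intro borel_measurable_indicator) simp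
  have gU: "g (U x) = g x" for x by (simp add: g_def indicator_def)
  have tr: "(\<integral>\<^sup>+y. F (c + y) \<partial>lborel) = (\<integral>\<^sup>+y. F y \<partial>lborel)" if [measurable]: "F \<in> borel_measurable borel" for F :: "'a \<Rightarrow> ennreal" and c
    by (subst (2) lborel_distr_plus[of c, symmetric]) (simp add: nn_integral_distr)
  have rf: "(\<integral>\<^sup>+y. F (c - y) \<partial>lborel) = (\<integral>\<^sup>+y. F y \<partial>lborel)" if [measurable]: "F \<in> borel_measurable borel" for F :: "'a \<Rightarrow> ennreal" and c
  proof -
    have "(lborel :: 'a measure) = distr lborel borel (\<lambda>x. c + (-1) *\<^sub>R x)"
      using lborel_affine[of "-1::real" c] by (simp add: density_1)
    then have "(\<integral>\<^sup>+y. F y \<partial>lborel) = (\<integral>\<^sup>+y. F y \<partial>distr lborel borel (\<lambda>x. c + (-1) *\<^sub>R x))" by simp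
    also have "\<dots> = (\<integral>\<^sup>+y. F (c - y) \<partial>lborel)" by (simp add: nn_integral_distr)
    finally show ?thesis by simp
  qed
  define G where "G = (\<integral>\<^sup>+y. g y \<partial>lborel)"
  have "(\<integral>\<^sup>+x. f (U x) \<partial>lborel) * G = (\<integral>\<^sup>+x. f (U x) * G \<partial>lborel)"
    by (simp add: nn_integral_multc)
  also have "\<dots> = (\<integral>\<^sup>+x. (\<integral>\<^sup>+y. f (U x) * g (U x + y) \<partial>lborel) \<partial>lborel)"
    by (simp add: nn_integral_cmult tr G_def)
  also have "\<dots> = (\<integral>\<^sup>+y. (\<integral>\<^sup>+x. f (U x) * g (U x + y) \<partial>lborel) \<partial>lborel)"
    by (rule lborel_pair.Fubini'[symmetric]) measurable
  \<comment> \<open>Shifting \<open>x\<close> by \<open>- U y\<close>: as \<open>U\<close> is linear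
    and an involution, \<open>U x\<close> becomes \<open>U x - y\<close> and \<open>U x + y\<close>
    becomes \<open>U x\<close>.\<close>
  also have "\<dots> = (\<integral>\<^sup>+y. (\<integral>\<^sup>+x. f (U x - y) * g (U x) \<partial>lborel) \<partial>lborel)"
  proof (rule nn_integral_cong)
    fix y
    show "(\<integral>\<^sup>+x. f (U x) * g (U x + y) \<partial>lborel) = (\<integral>\<^sup>+x. f (U x - y) * g (U x) \<partial>lborel)"
      by (subst tr[where c="- U y", symmetric]) (auto simp: U_add U_diff)
  qed
  also have "\<dots> = (\<integral>\<^sup>+x. (\<integral>\<^sup>+y. f (U x - y) * g (U x) \<partial>lborel) \<partial>lborel)"
    by (rule lborel_pair.Fubini') measurable
  also have "\<dots> = (\<integral>\<^sup>+x. (\<integral>\<^sup>+y. f y \<partial>lborel) * g x \<partial>lborel)"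
    by (simp add: nn_integral_multc rf gU)
  also have "\<dots> = (\<integral>\<^sup>+y. f y \<partial>lborel) * G" by (simp add: nn_integral_cmult G_def)
  finally have eq: "(\<integral>\<^sup>+x. f (U x) \<partial>lborel) * G = (\<integral>\<^sup>+y. f y \<partial>lborel) * G" .
  have G: "G = emeasure lborel (ball (0::'a) 1)" unfolding G_def g_def by simp
  have "G \<noteq> 0"
  proof
    assume "G = 0"
    then have "ball (0::'a) 1 \<in> null_sets lborel" unfolding G by (intro null_setsI) auto
    then have "negligible (ball (0::'a) 1)" by (simp add: negligible_iff_null_sets null_sets_completionI)
    then show False using open_not_negligible[of "ball (0::'a) 1"] by simp
  qed
  moreover have "G \<noteq> top" unfolding G using emeasure_bounded_finite[of "ball (0::'a) 1"] by (simp add: less_top)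
  ultimately show ?thesis using eq by (metis ennreal_mult_cancel_left mult.commute)
qed

lemma distr_U: "distr lborel borel U = lborel"
proof (rule measure_eqI)
  fix A assume "A \<in> sets (distr lborel borel U)"
  then have A [measurable]: "A \<in> sets borel" by simp
  have "emeasure (distr lborel borel U) A = (\<integral>\<^sup>+x. indicator A x \<partial>distr lborel borel U)" by simp
  also have "\<dots> = (\<integral>\<^sup>+x. indicator A (U x) \<partial>lborel)" by (rule nn_integral_distr) auto
  also have "\<dots> = (\<integral>\<^sup>+x. indicator A x \<partial>lborel)" by (rule nn_integral_U) simp
  finally show "emeasure (distr lborel borel U) A = emeasure lborel A" by simp
qed simp

lemma integral_U:
  fixes f :: "'a \<Rightarrow> 'b::{banach, second_countable_topology}"
  assumes "f \<in> borel_measurable borel"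
  shows "(\<integral>x. f (U x) \<partial>lborel) = (\<integral>x. f x \<partial>lborel)"
  using integral_distr[of U lborel borel f] assms by (simp add: distr_U)

lemma measure_U_compact:
  assumes "compact A"
  shows "measure lebesgue (U ` A) = measure lebesgue A"
proof -
  have A: "A \<in> sets borel" using assms by (rule borel_compact)
  have UA: "U ` A \<in> sets borel" using assms by (intro borel_compact compact_continuous_image continuous_intros)
  have "emeasure lborel A = emeasure (distr lborel borel U) A" by (simp only: distr_U)
  also have "\<dots> = emeasure lborel (U -` A \<inter> space lborel)" by (rule emeasure_distr) (use A in auto)
  also have "U -` A \<inter> space lborel = U ` A" by (auto simp: image_U_iff)
  finally show ?thesis using A UA by (simp add: measure_def)
qed

lemma section_vol_U:
  assumes S: "compact S" and q: "norm q = 1"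
  shows "section_vol (U ` S) (U q) = section_vol S q"
proof -
  have "cyl (U q) (U ` S) 0 = U ` cyl q S 0"
    by (auto simp: cyl_def perp_def image_U_iff U_diff U_scaleR U_inner)
  then show ?thesis using q by (simp add: section_vol_cyl measure_U_compact compact_cyl[OF S])
qed

text \<open>\<open>U\<close> preserves the inner product in the exponent and Lebesgue measure, so
  composing the spectrum with \<open>U\<close> composes the function with \<open>U\<close>. The
  norms are compared on the spectral side through Plancherel.\<close>

lemma PW_space_U:
  assumes S: "compact S" and f: "f \<in> PW_space (U ` S)"
  shows "(\<lambda>x. f (U x)) \<in> PW_space S" "L2_norm_sq (\<lambda>x. f (U x)) = L2_norm_sq f"
proof -
  have US: "compact (U ` S)" by (intro compact_continuous_image continuous_intros S)
  from f obtain g where g: "sqint lborel g" "\<And>w. w \<notin> U ` S \<Longrightarrow> g w = 0" "f = fourier g"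
    unfolding PW_space_eq[OF US] by auto
  have gm [measurable]: "g \<in> borel_measurable borel" using g(1) by (simp add: sqint_def)
  define g' where "g' w = g (U w)" for w
  have "integrable (distr lborel borel U) (\<lambda>w. (cmod (g w))\<^sup>2)" using g(1) by (simp add: distr_U sqint_def)
  then have "integrable lborel (\<lambda>w. (cmod (g (U w)))\<^sup>2)" by (subst (asm) integrable_distr_eq) auto
  then have g'1: "sqint lborel g'" by (simp add: sqint_def g'_def[abs_def])
  have g'2: "g' w = 0" if "w \<notin> S" for w using g(2)[of "U w"] that by (simp add: g'_def image_U_iff)
  have fe: "(\<lambda>x. f (U x)) = fourier g'"
  proof
    fix x
    have "f (U x) = (\<integral>w. g w * chr (U x) w \<partial>lborel)" by (simp add: g(3) fourier_def)
    also have "\<dots> = (\<integral>w. g (U w) * chr (U x) (U w) \<partial>lborel)" by (rule integral_U[symmetric]) measurable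
    also have "\<dots> = fourier g' x" by (simp add: fourier_def g'_def chr_def inner_U_U)
    finally show "f (U x) = fourier g' x" .
  qed
  show "(\<lambda>x. f (U x)) \<in> PW_space S" unfolding PW_space_eq[OF S] fe using g'1 g'2 by blast
  have "L2_norm_sq (fourier g') = (\<integral>w. (cmod (g' w))\<^sup>2 \<partial>lborel)"
    by (rule Plancherel[OF g'1 g'2 compact_imp_bounded[OF S]])
  also have "\<dots> = (\<integral>w. (cmod (g w))\<^sup>2 \<partial>lborel)" unfolding g'_def by (rule integral_U) measurable
  also have "\<dots> = L2_norm_sq (fourier g)"
    by (rule Plancherel[OF g(1,2) compact_imp_bounded[OF US], symmetric])
  finally show "L2_norm_sq (\<lambda>x. f (U x)) = L2_norm_sq f" unfolding fe unfolding g(3) .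
qed

lemma stable_sampling_U:
  assumes S: "compact S" and "stable_sampling S Lam"
  shows "stable_sampling (U ` S) (U ` Lam)"
proof -
  obtain A B where AB: "0 < A" "A \<le> B"
    and sm: "\<And>f. f \<in> PW_space S \<Longrightarrow> (\<lambda>l. (cmod (f l))\<^sup>2) summable_on Lam \<and>
        A * L2_norm_sq f \<le> (\<Sum>\<^sub>\<infinity>l\<in>Lam. (cmod (f l))\<^sup>2) \<and> (\<Sum>\<^sub>\<infinity>l\<in>Lam. (cmod (f l))\<^sup>2) \<le> B * L2_norm_sq f"
    using assms(2) unfolding stable_sampling_def by (elim exE conjE) metis
  have "(\<lambda>l. (cmod (f l))\<^sup>2) summable_on U ` Lam \<and>
        A * L2_norm_sq f \<le> (\<Sum>\<^sub>\<infinity>l\<in>U ` Lam. (cmod (f l))\<^sup>2) \<and> (\<Sum>\<^sub>\<infinity>l\<in>U ` Lam. (cmod (f l))\<^sup>2) \<le> B * L2_norm_sq f"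
    if f: "f \<in> PW_space (U ` S)" for f
    using sm[OF PW_space_U(1)[OF S f]]
    by (simp only: summable_on_reindex[OF inj_U] infsum_reindex[OF inj_U] o_def PW_space_U(2)[OF S f])
  then show ?thesis using AB unfolding stable_sampling_def by metis
qed

lemma uniformly_discrete_U: "uniformly_discrete Lam \<Longrightarrow> uniformly_discrete (U ` Lam)"
  unfolding uniformly_discrete_def by (auto simp: inj_eq[OF inj_U])

lemma diameter_U: "diameter (U ` A) = diameter A"
proof -
  have "(\<lambda>(x, y). dist x y) ` (U ` A \<times> U ` A) = (\<lambda>(x, y). dist x y) ` (A \<times> A)"
    by (force simp: image_iff)
  then show ?thesis by (simp add: diameter_def)
qed

lemma arc_mass_U: "arc_mass ((`) U ` P) a x = arc_mass P a (U x)"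
proof -
  have inj: "inj_on ((`) U) P" by (rule inj_on_inverseI[of _ "(`) U"]) simp
  have "U ` L \<inter> cball x a = U ` (L \<inter> cball (U x) a)" for L
  proof -
    have "dist x (U y) = dist (U x) y" for y using dist_U[of x "U y"] by simp
    then show ?thesis by (auto simp: image_U_iff)
  qed
  then show ?thesis unfolding arc_mass_def infsum_reindex[OF inj] by (simp add: o_def diameter_U)
qed

text \<open>Infima and suprema over all centres of balls are unaffected by moving the centres with
  \<open>U\<close>.\<close>

lemma range_U_comp: "range (\<lambda>x. H (U x)) = range H"
proof -
  have "range U = UNIV" by (rule surjI[of U U]) simp
  then show ?thesis by (metis image_image)
qed

lemma path_density_U:
  "lower_path_density ((`) U ` P) = lower_path_density P"
  "upper_path_density ((`) U ` P) = upper_path_density P"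
  unfolding lower_path_density_def upper_path_density_def arc_mass_U
  by (simp_all only: range_U_comp[of "\<lambda>x. arc_mass P a x / ennreal (measure lebesgue (cball (0::'a) a))" for a])

lemma poly_lengths_U: "poly_lengths (\<lambda>t. U (\<alpha> t)) = poly_lengths \<alpha>"
  by (simp add: poly_lengths_def)

lemma condition_C2_U:
  assumes "condition_C2 P"
  shows "condition_C2 ((`) U ` P)"
proof -
  obtain \<delta> where \<delta>: "\<forall>a>0. \<delta> a \<ge> (0::real)" "\<delta> \<in> o(\<lambda>a. a ^ DIM('a))"
    and C: "\<forall>x::'a. \<forall>\<^sub>F a in at_top. \<exists>\<alpha>::real \<Rightarrow> 'a. rectifiable_curve \<alpha> \<and>
        ennreal (curve_length \<alpha>) = arc_mass P a x + ennreal (\<delta> a) \<and> \<Union>P \<inter> cball x a \<subseteq> \<alpha> ` {0..1}"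
    using assms unfolding condition_C2_def by (elim exE conjE)
  have "\<forall>\<^sub>F a in at_top. \<exists>\<alpha>::real \<Rightarrow> 'a. rectifiable_curve \<alpha> \<and>
        ennreal (curve_length \<alpha>) = arc_mass ((`) U ` P) a x + ennreal (\<delta> a) \<and> \<Union>((`) U ` P) \<inter> cball x a \<subseteq> \<alpha> ` {0..1}" for x
    using spec[OF C, of "U x"]
  proof eventually_elim
    case (elim a)
    then obtain \<alpha> where \<alpha>: "rectifiable_curve \<alpha>" "ennreal (curve_length \<alpha>) = arc_mass P a (U x) + ennreal (\<delta> a)"
      "\<Union>P \<inter> cball (U x) a \<subseteq> \<alpha> ` {0..1}" by (elim exE conjE)
    have "rectifiable_curve (\<lambda>t. U (\<alpha> t))"
      using \<alpha>(1) by (auto simp: rectifiable_curve_def poly_lengths_U intro!: continuous_intros)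
    moreover have "curve_length (\<lambda>t. U (\<alpha> t)) = curve_length \<alpha>" by (simp add: curve_length_def poly_lengths_U)
    moreover have "\<Union>((`) U ` P) \<inter> cball x a \<subseteq> (\<lambda>t. U (\<alpha> t)) ` {0..1}"
    proof
      fix y assume y: "y \<in> \<Union>((`) U ` P) \<inter> cball x a"
      have "dist (U x) (U y) \<le> a" using y by simp
      then have "U y \<in> \<Union>P \<inter> cball (U x) a" using y by (auto simp: image_U_iff)
      then obtain t where t: "t \<in> {0..1}" "U y = \<alpha> t" using \<alpha>(3) by blast
      have "y = U (\<alpha> t)" unfolding t(2)[symmetric] by simp
      then show "y \<in> (\<lambda>t. U (\<alpha> t)) ` {0..1}" using t(1) by (rule image_eqI)
    qed
    ultimately show ?case using \<alpha>(2) by (intro exI[of _ "\<lambda>t. U (\<alpha> t)"]) (simp add: arc_mass_U)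
  qed
  then show ?thesis unfolding condition_C2_def using \<delta> by (intro exI[of _ \<delta>]) simp
qed

lemma line_through_U: "U ` line_through p q = line_through (U p) (U q)"
  unfolding line_through_def image_image by (simp add: U_add U_scaleR)

lemma Par_U:
  assumes S: "compact S" and P: "P \<in> Par S q"
  shows "(`) U ` P \<in> Par (U ` S) (U q)"
proof -
  from P obtain Lam where P1: "parallel_lines q P" "condition_C2 P" and
    L: "Lam \<subseteq> \<Union>P" "uniformly_discrete Lam" "stable_sampling S Lam"
    by (auto simp: Par_def stable_nyquist_def)
  have "parallel_lines (U q) ((`) U ` P)"
    using P1(1) unfolding parallel_lines_def by (auto, metis line_through_U)
  moreover have "U ` Lam \<subseteq> \<Union>((`) U ` P)" using L(1) by auto
  ultimately show ?thesis
    unfolding Par_def stable_nyquist_def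
    using condition_C2_U[OF P1(2)] uniformly_discrete_U[OF L(2)] stable_sampling_U[OF S L(3)] by blast
qed

lemma Hom_U:
  assumes S: "compact S" and P: "P \<in> Hom S q"
  shows "(`) U ` P \<in> Hom (U ` S) (U q)"
  using P Par_U[OF S, of P q] by (simp add: Hom_def homogeneous_def path_density_U)

end

text \<open>The reflection in the hyperplane orthogonal to \<open>w\<close>. For
  \<open>w = 0\<close> the division by zero produces the identity, which is what
  \<open>reflection_exchanging\<close> needs when the two vectors coincide.\<close>

lemma reflection_involutive_isometry:
  fixes w :: "'a::euclidean_space"
  shows "involutive_isometry (\<lambda>x. x - (2 * (x \<bullet> w) / (w \<bullet> w)) *\<^sub>R w)"
proof (rule involutive_isometry.intro)
  show "linear (\<lambda>x. x - (2 * (x \<bullet> w) / (w \<bullet> w)) *\<^sub>R w)"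
    by (rule linearI) (simp_all add: inner_add_left distrib_left add_divide_distrib scaleR_add_left scaleR_diff_right)
next
  fix x y :: 'a
  show "(x - (2 * (x \<bullet> w) / (w \<bullet> w)) *\<^sub>R w) - (2 * ((x - (2 * (x \<bullet> w) / (w \<bullet> w)) *\<^sub>R w) \<bullet> w) / (w \<bullet> w)) *\<^sub>R w = x"
  proof (cases "w = 0")
    case False
    then have "w \<bullet> w \<noteq> 0" by simp
    then have "(x - (2 * (x \<bullet> w) / (w \<bullet> w)) *\<^sub>R w) \<bullet> w = - (x \<bullet> w)" by (simp add: inner_diff_left)
    then show ?thesis by simp
  qed simp
  show "(x - (2 * (x \<bullet> w) / (w \<bullet> w)) *\<^sub>R w) \<bullet> (y - (2 * (y \<bullet> w) / (w \<bullet> w)) *\<^sub>R w) = x \<bullet> y"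
  proof (cases "w = 0")
    case False
    then have ww: "w \<bullet> w \<noteq> 0" by simp
    define k where "k = 1 / (w \<bullet> w)"
    have k: "k * (w \<bullet> w) = 1" using ww by (simp add: k_def)
    have "(x - (2 * (x \<bullet> w) * k) *\<^sub>R w) \<bullet> (y - (2 * (y \<bullet> w) * k) *\<^sub>R w)
        = x \<bullet> y - 4 * (x \<bullet> w) * (y \<bullet> w) * k + 4 * (x \<bullet> w) * (y \<bullet> w) * k * (k * (w \<bullet> w))"
      by (simp add: inner_diff_left inner_diff_right inner_commute[of w y]) (simp add: algebra_simps)
    then show ?thesis unfolding k by (simp add: k_def)
  qed simp
qed

lemma reflection_exchanging:
  fixes a b :: "'a::euclidean_space"
  assumes "norm a = norm b"
  obtains U where "involutive_isometry U" "U a = b"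
proof -
  define w where "w = a - b"
  define U where "U x = x - (2 * (x \<bullet> w) / (w \<bullet> w)) *\<^sub>R w" for x
  have ab: "a \<bullet> a = b \<bullet> b" using assms by (simp add: norm_eq)
  have "U a = b"
  proof (cases "w = 0")
    case False
    have "2 * (a \<bullet> w) = w \<bullet> w" using ab by (simp add: w_def inner_diff_left inner_diff_right inner_commute)
    then show ?thesis using False by (simp add: U_def) (simp add: w_def)
  qed (simp add: U_def w_def)
  moreover have "involutive_isometry U" unfolding U_def by (rule reflection_involutive_isometry)
  ultimately show ?thesis using that by blast
qed

lemma line_through_scaleR:
  assumes "c \<noteq> 0"
  shows "line_through p (c *\<^sub>R q) = line_through p q"
proof -
  have "range (\<lambda>t. t * c) = UNIV" by (rule surjI[where f="\<lambda>t. t / c"]) (use assms in simp)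
  then have "range (\<lambda>t. p + t *\<^sub>R q) = (\<lambda>t. p + t *\<^sub>R q) ` range (\<lambda>t. t * c)" by simp
  then show ?thesis unfolding line_through_def image_image by (simp only: scaleR_scaleR)
qed

lemma Par_scaleR: "c \<noteq> 0 \<Longrightarrow> Par S (c *\<^sub>R q) = Par S q"
  by (simp add: Par_def parallel_lines_def line_through_scaleR)

lemma Hom_scaleR: "c \<noteq> 0 \<Longrightarrow> Hom S (c *\<^sub>R q) = Hom S q"
  by (simp add: Hom_def Par_scaleR)

lemma section_vol_scaleR: "c > 0 \<Longrightarrow> section_vol S (c *\<^sub>R q) = section_vol S q"
proof -
  assume c: "c > 0"
  then have e: "(c *\<^sub>R q) /\<^sub>R norm (c *\<^sub>R q) = q /\<^sub>R norm q" by (simp add: field_simps)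
  show ?thesis unfolding section_vol_def e using c by simp
qed

lemma section_vol_nonneg: "section_vol S q \<ge> 0"
  by (simp add: section_vol_def)

text \<open>The section volume is at most the infimum over \<open>Par\<close>, which is at most the
  infimum over the subclass \<open>Hom\<close>, which is at most the section volume. A reflection
  carries \<open>q\<close> to a basis vector and \<open>S\<close> to another body of the same kind,
  for which both one-sided bounds are available, the upper one with \<open>s\<close> tending to
  0.\<close>

theorem INF_density_unit:
  fixes S :: "'a::euclidean_space set"
  assumes S: "compact S" "convex S" "0 \<in> interior S" "uminus ` S = S" and q: "norm q = 1"
  shows "(INF P\<in>Par S q. lower_path_density P) = ennreal (section_vol S q)"
    and "(INF P\<in>Hom S q. path_density P) = ennreal (section_vol S q)"
proof -
  obtain b0 :: 'a where b0: "b0 \<in> Basis" using nonempty_Basis by blast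
  obtain U where U: "involutive_isometry U" "U q = b0"
    by (rule reflection_exchanging[of q b0]) (use q b0 in auto)
  interpret involutive_isometry U by fact
  have Ub: "U b0 = q" using U(2) U_U[of q] by simp
  have US: "compact (U ` S)" "convex (U ` S)" "uminus ` U ` S = U ` S"
  proof -
    show "compact (U ` S)" by (intro compact_continuous_image continuous_intros S)
    show "convex (U ` S)" by (rule convex_linear_image[OF linear_U S(2)])
    have "uminus ` U ` S = U ` uminus ` S" by (simp add: image_image linear_neg[OF linear_U])
    then show "uminus ` U ` S = U ` S" by (simp only: S(4))
  qed
  have U0: "0 \<in> interior (U ` S)"
  proof -
    obtain r where r: "r > 0" "cball 0 r \<subseteq> S" using S(3) by (meson mem_interior_cball)
    have "cball 0 r \<subseteq> U ` S"
    proof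
      fix x :: 'a assume "x \<in> cball 0 r"
      then have "U x \<in> cball 0 r" by simp
      then show "x \<in> U ` S" using r by (auto simp: image_U_iff)
    qed
    then show ?thesis using r(1) by (meson mem_interior_cball)
  qed
  let ?sv = "section_vol S q"
  have sv: "section_vol (U ` S) b0 = ?sv" using section_vol_U[OF S(1) q] U(2) by simp
  have lower: "ennreal ?sv \<le> lower_path_density P" if P: "P \<in> Par S q" for P
  proof -
    have "(`) U ` P \<in> Par (U ` S) b0" using Par_U[OF S(1) P] by (simp only: U(2))
    from lower_bound_basis[OF US(1,2) U0 b0 this] show ?thesis by (simp only: sv path_density_U)
  qed
  have upper: "(INF P\<in>Hom S q. path_density P) \<le> ennreal ((1 + s) ^ DIM('a) * ?sv)" if s: "s > 0" for s
  proof -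
    have "\<exists>P\<in>Hom (U ` S) b0. path_density P \<le> ennreal ((1 + s) ^ DIM('a) * section_vol (U ` S) b0)"
      by (rule upper_construction[OF US(1,2) U0 US(3) b0 s])
    then obtain P where P: "P \<in> Hom (U ` S) b0" "path_density P \<le> ennreal ((1 + s) ^ DIM('a) * ?sv)"
      unfolding sv by (rule bexE)
    have "(`) U ` P \<in> Hom S q" using Hom_U[OF US(1) P(1)] by (simp only: Ub image_U_U)
    moreover have "path_density ((`) U ` P) = path_density P" by (simp add: path_density_def path_density_U)
    ultimately show ?thesis using P(2) by (metis INF_lower2)
  qed
  have up0: "(INF P\<in>Hom S q. path_density P) \<le> ennreal ?sv"
  proof (rule tendsto_lowerbound)
    have "((\<lambda>s::real. (1 + s) ^ DIM('a) * ?sv) \<longlongrightarrow> (1 + 0) ^ DIM('a) * ?sv) (at_right 0)"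
      by (intro tendsto_intros)
    then have "((\<lambda>s::real. (1 + s) ^ DIM('a) * ?sv) \<longlongrightarrow> ?sv) (at_right 0)" by simp
    then show "((\<lambda>s::real. ennreal ((1 + s) ^ DIM('a) * ?sv)) \<longlongrightarrow> ennreal ?sv) (at_right 0)"
      by (rule tendsto_ennrealI)
    have "\<forall>\<^sub>F s::real in at_right 0. s \<in> {0<..<1}" by (rule eventually_at_right_real) simp
    then show "\<forall>\<^sub>F s::real in at_right 0. (INF P\<in>Hom S q. path_density P) \<le> ennreal ((1 + s) ^ DIM('a) * ?sv)"
      by eventually_elim (use upper in auto)
  qed (rule trivial_limit_at_right_real)
  have HP: "Hom S q \<subseteq> Par S q" by (auto simp: Hom_def)
  have "(INF P\<in>Par S q. lower_path_density P) \<le> (INF P\<in>Hom S q. path_density P)"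
    unfolding path_density_def by (rule INF_superset_mono[OF HP]) simp
  moreover have "ennreal ?sv \<le> (INF P\<in>Par S q. lower_path_density P)" by (rule INF_greatest) (rule lower)
  ultimately show "(INF P\<in>Par S q. lower_path_density P) = ennreal ?sv" "(INF P\<in>Hom S q. path_density P) = ennreal ?sv"
    using up0 by (meson order.antisym order.trans)+
qed

subsection \<open>Minimal sections\<close>

text \<open>Shrinking the cylinder for \<open>q\<close> by \<open>1 - 2 * \<delta>\<close> and
  raising it by \<open>\<delta>\<close> along \<open>q\<close> puts heights between
  \<open>\<delta>\<close> and \<open>1 - \<delta>\<close>, which leaves room when they are measured
  along \<open>q'\<close>. The shrunken base leaves room \<open>2 * \<delta> * r\<close> in
  \<open>S\<close> for the change of the projection. Hence the image lies in the cylinder for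
  \<open>q'\<close>.\<close>

lemma section_vol_lsc:
  fixes S :: "'a::euclidean_space set"
  assumes S: "compact S" "convex S" and r: "r > 0" "cball 0 r \<subseteq> S" and B: "S \<subseteq> cball 0 B"
    and q: "norm q = 1" "norm q' = 1" and \<delta>: "0 < \<delta>" "\<delta> < 1/2"
    and near: "(B + 2) * norm (q - q') \<le> \<delta> * r" "(B + 2) * norm (q - q') \<le> \<delta>"
  shows "(1 - 2 * \<delta>) ^ DIM('a) * section_vol S q \<le> section_vol S q'"
proof -
  have qq: "q \<bullet> q = 1" "q' \<bullet> q' = 1" using q by (auto simp: norm_eq_1)
  have "0 \<in> cball (0::'a) B" using r by (intro subsetD[OF B] subsetD[OF r(2)]) simp
  then have B0: "B \<ge> 0" by simp
  have sub: "(\<lambda>z. (1 - 2 * \<delta>) *\<^sub>R z + \<delta> *\<^sub>R q) ` cyl q S 0 \<subseteq> cyl q' S 0"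
  proof
    fix z assume "z \<in> (\<lambda>z. (1 - 2 * \<delta>) *\<^sub>R z + \<delta> *\<^sub>R q) ` cyl q S 0"
    then obtain z0 where z0: "z0 \<in> cyl q S 0" "z = (1 - 2 * \<delta>) *\<^sub>R z0 + \<delta> *\<^sub>R q" by auto
    have p0: "perp q z0 \<in> S" "0 \<le> z0 \<bullet> q" "z0 \<bullet> q \<le> 1" using z0(1) by (auto simp: cyl_def)
    have "norm z0 \<le> norm (perp q z0) + norm ((z0 \<bullet> q) *\<^sub>R q)"
      using norm_triangle_ineq[of "perp q z0" "(z0 \<bullet> q) *\<^sub>R q"] by (simp add: perp_def)
    also have "\<dots> \<le> B + 1" using p0 B q by (intro add_mono) auto
    finally have nz0: "norm z0 \<le> B + 1" .
    have "norm z \<le> (1 - 2 * \<delta>) * norm z0 + \<delta> * 1"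
      unfolding z0(2) using norm_triangle_ineq[of "(1 - 2 * \<delta>) *\<^sub>R z0" "\<delta> *\<^sub>R q"] \<delta> q by simp
    also have "\<dots> \<le> 1 * (B + 1) + 1 * 1" using nz0 \<delta> B0 by (intro add_mono mult_mono) auto
    finally have nz: "norm z \<le> B + 2" by simp
    have zd: "\<bar>z \<bullet> (q' - q)\<bar> \<le> (B + 2) * norm (q - q')"
      using Cauchy_Schwarz_ineq2[of z "q' - q"] mult_right_mono[OF nz, of "norm (q' - q)"] by (simp add: norm_minus_commute)
    have zq: "z \<bullet> q = (1 - 2 * \<delta>) * (z0 \<bullet> q) + \<delta>" by (simp add: z0(2) inner_add_left qq)
    have t: "\<delta> \<le> z \<bullet> q" "z \<bullet> q \<le> 1 - \<delta>"
    proof -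
      have "0 \<le> (1 - 2 * \<delta>) * (z0 \<bullet> q)" using p0 \<delta> by simp
      then show "\<delta> \<le> z \<bullet> q" by (simp only: zq)
      have "(1 - 2 * \<delta>) * (z0 \<bullet> q) \<le> (1 - 2 * \<delta>) * 1" using p0 \<delta> by (intro mult_left_mono) auto
      then have "(1 - 2 * \<delta>) * (z0 \<bullet> q) \<le> 1 - 2 * \<delta>" by (simp only: mult_1_right)
      then show "z \<bullet> q \<le> 1 - \<delta>" unfolding zq by simp
    qed
    have "z \<bullet> q' = z \<bullet> q + z \<bullet> (q' - q)" by (simp add: inner_diff_right)
    then have t': "0 \<le> z \<bullet> q'" "z \<bullet> q' \<le> 1" using t zd near(2) by linarith+
    have pz: "perp q z = (1 - 2 * \<delta>) *\<^sub>R perp q z0"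
      unfolding perp_def zq by (simp add: z0(2) scaleR_diff_right scaleR_add_left)
    define e where "e = perp q' z - perp q z"
    have "e = - ((z \<bullet> (q' - q)) *\<^sub>R q' + (z \<bullet> q) *\<^sub>R (q' - q))"
      by (simp add: e_def perp_def inner_diff_right algebra_simps)
    then have "norm e \<le> \<bar>z \<bullet> (q' - q)\<bar> * norm q' + \<bar>z \<bullet> q\<bar> * norm (q' - q)"
      using norm_triangle_ineq[of "(z \<bullet> (q' - q)) *\<^sub>R q'" "(z \<bullet> q) *\<^sub>R (q' - q)"] by (simp only: norm_minus_cancel norm_scaleR)
    also have "\<dots> \<le> (B + 2) * norm (q - q') * 1 + (B + 2) * norm (q' - q)"
      using zd t B0 \<delta> q by (intro add_mono mult_mono) auto
    also have "\<dots> \<le> 2 * \<delta> * r" using near(1) by (simp add: norm_minus_commute mult.commute)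
    finally have ne: "norm e \<le> 2 * \<delta> * r" .
    define k where "k = 2 * \<delta>"
    have k: "k > 0" using \<delta> by (simp add: k_def)
    have "norm (e /\<^sub>R k) = inverse k * norm e" using k by simp
    also have "\<dots> \<le> inverse k * (k * r)" using ne k unfolding k_def by (intro mult_left_mono) auto
    also have "\<dots> = r" using k by simp
    finally have "e /\<^sub>R (2 * \<delta>) \<in> S" using r(2) unfolding k_def by (intro subsetD[OF r(2)]) (simp only: mem_cball_0)
    then have "(1 - 2 * \<delta>) *\<^sub>R perp q z0 + (2 * \<delta>) *\<^sub>R (e /\<^sub>R (2 * \<delta>)) \<in> S"
      using p0(1) \<delta> by (intro convexD[OF S(2)]) auto
    moreover have "(2 * \<delta>) *\<^sub>R (e /\<^sub>R (2 * \<delta>)) = e" using \<delta> by simp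
    moreover have "perp q z + e = perp q' z" by (simp add: e_def)
    ultimately have "perp q' z \<in> S" by (simp only: pz)
    then show "z \<in> cyl q' S 0" using t' by (simp add: cyl_def)
  qed
  have "(1 - 2 * \<delta>) ^ DIM('a) * section_vol S q = measure lebesgue ((\<lambda>z. (1 - 2 * \<delta>) *\<^sub>R z + \<delta> *\<^sub>R q) ` cyl q S 0)"
    using \<delta> by (subst measure_lebesgue_affine) (simp add: section_vol_cyl[OF q(1)])
  also have "\<dots> \<le> measure lebesgue (cyl q' S 0)"
  proof (rule measure_mono_fmeasurable[OF sub])
    have "compact ((\<lambda>z. (1 - 2 * \<delta>) *\<^sub>R z + \<delta> *\<^sub>R q) ` cyl q S 0)"
      by (intro compact_continuous_image compact_cyl S continuous_intros)
    then show "(\<lambda>z. (1 - 2 * \<delta>) *\<^sub>R z + \<delta> *\<^sub>R q) ` cyl q S 0 \<in> sets lebesgue" by (intro fmeasurableD lmeasurable_compact)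
    show "cyl q' S 0 \<in> lmeasurable" by (intro lmeasurable_compact compact_cyl S)
  qed
  finally show ?thesis by (simp only: section_vol_cyl[OF q(2)])
qed

text \<open>Lower semicontinuity on the compact unit sphere: along a minimizing sequence converging
  to \<open>q0\<close>, \<open>section_vol_lsc\<close> bounds
  \<open>(1 - 2 * \<delta>) ^ DIM('a)\<close> times the section volume at \<open>q0\<close> by the
  infimum, and then \<open>\<delta>\<close> tends to 0.\<close>

lemma section_vol_attains_min:
  fixes S :: "'a::euclidean_space set"
  assumes S: "compact S" "convex S" "0 \<in> interior S"
  shows "\<exists>q0. norm q0 = 1 \<and> (\<forall>q. norm q = 1 \<longrightarrow> section_vol S q0 \<le> section_vol S q)"
proof -
  let ?\<sigma> = "section_vol S"
  obtain r where r: "r > 0" "cball 0 r \<subseteq> S" using S(3) by (meson mem_interior_cball)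
  obtain B where "\<forall>x\<in>S. norm x \<le> B" using compact_imp_bounded[OF S(1)] unfolding bounded_iff by (elim exE)
  then have B: "S \<subseteq> cball 0 B" by auto
  have "0 \<in> cball (0::'a) B" using r by (intro subsetD[OF B] subsetD[OF r(2)]) simp
  then have B0: "B \<ge> 0" by simp
  define m where "m = (INF q\<in>sphere 0 1. ?\<sigma> q)"
  have bdd: "bdd_below (?\<sigma> ` sphere 0 1)" by (rule bdd_belowI[of _ 0]) (auto simp: section_vol_nonneg)
  have ne: "sphere (0::'a) 1 \<noteq> {}" using vector_choose_size[of 1, where 'a='a] by auto
  have "\<forall>n::nat. \<exists>q\<in>sphere 0 1. ?\<sigma> q < m + 1 / real (Suc n)"
  proof
    fix n
    have "m < m + 1 / real (Suc n)" by simp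
    then show "\<exists>q\<in>sphere 0 1. ?\<sigma> q < m + 1 / real (Suc n)" unfolding m_def by (subst (asm) cINF_less_iff[OF ne bdd])
  qed
  then obtain x where x: "\<And>n::nat. x n \<in> sphere 0 1" "\<And>n. ?\<sigma> (x n) < m + 1 / real (Suc n)" by metis
  have sc: "seq_compact (sphere (0::'a) 1)" by (intro compact_imp_seq_compact compact_sphere)
  obtain q0 \<rho> where q0: "q0 \<in> sphere 0 1" "strict_mono \<rho>" "(x \<circ> \<rho>) \<longlonglongrightarrow> q0"
    by (rule seq_compactE[OF sc allI[OF x(1)]])
  have nq0: "norm q0 = 1" using q0(1) by simp
  have lim: "(\<lambda>n. m + 1 / real (Suc (\<rho> n))) \<longlonglongrightarrow> m + 0"
  proof (rule tendsto_add[OF tendsto_const])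
    have "(\<lambda>n. 1 / real (Suc n)) \<longlonglongrightarrow> 0" by (rule LIMSEQ_Suc[OF lim_1_over_n])
    from LIMSEQ_subseq_LIMSEQ[OF this q0(2)] show "(\<lambda>n. 1 / real (Suc (\<rho> n))) \<longlonglongrightarrow> 0" by (simp only: o_def)
  qed
  have key: "(1 - 2 * \<delta>) ^ DIM('a) * ?\<sigma> q0 \<le> m" if \<delta>: "0 < \<delta>" "\<delta> < 1/2" for \<delta>
  proof -
    define \<eta> where "\<eta> = min (\<delta> * r) \<delta> / (B + 2)"
    have \<eta>: "\<eta> > 0" using \<delta> r B0 by (simp add: \<eta>_def)
    have ev: "\<forall>\<^sub>F n in sequentially. dist ((x \<circ> \<rho>) n) q0 < \<eta>" using q0(3) \<eta> by (rule tendstoD)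
    have "\<forall>\<^sub>F n in sequentially. (1 - 2 * \<delta>) ^ DIM('a) * ?\<sigma> q0 \<le> m + 1 / real (Suc (\<rho> n))"
      using ev
    proof eventually_elim
      case (elim n)
      have "norm (q0 - x (\<rho> n)) \<le> \<eta>" using elim by (simp add: dist_norm norm_minus_commute)
      then have "(B + 2) * norm (q0 - x (\<rho> n)) \<le> (B + 2) * \<eta>" using B0 by (intro mult_left_mono) auto
      also have "\<dots> = min (\<delta> * r) \<delta>" using B0 by (simp add: \<eta>_def)
      finally have n: "(B + 2) * norm (q0 - x (\<rho> n)) \<le> \<delta> * r" "(B + 2) * norm (q0 - x (\<rho> n)) \<le> \<delta>" by auto
      have "norm (x (\<rho> n)) = 1" using x(1)[of "\<rho> n"] by simp
      from section_vol_lsc[OF S(1,2) r B nq0 this \<delta> n] x(2)[of "\<rho> n"] show ?case by linarith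
    qed
    then have "(1 - 2 * \<delta>) ^ DIM('a) * ?\<sigma> q0 \<le> m + 0"
      by (rule tendsto_lowerbound[OF lim]) simp
    then show ?thesis by simp
  qed
  have "?\<sigma> q0 \<le> m"
  proof (rule tendsto_upperbound)
    have "((\<lambda>s::real. (1 - 2 * s) ^ DIM('a) * ?\<sigma> q0) \<longlongrightarrow> (1 - 2 * 0) ^ DIM('a) * ?\<sigma> q0) (at_right 0)"
      by (intro tendsto_intros)
    then show "((\<lambda>s::real. (1 - 2 * s) ^ DIM('a) * ?\<sigma> q0) \<longlongrightarrow> ?\<sigma> q0) (at_right 0)" by simp
    have "\<forall>\<^sub>F s::real in at_right 0. s \<in> {0<..<1/2}" by (rule eventually_at_right_real) simp
    then show "\<forall>\<^sub>F s::real in at_right 0. (1 - 2 * s) ^ DIM('a) * ?\<sigma> q0 \<le> m"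
      by eventually_elim (use key in auto)
  qed (rule trivial_limit_at_right_real)
  moreover have "m \<le> ?\<sigma> q" if "norm q = 1" for q
    unfolding m_def using that by (intro cINF_lower[OF bdd]) simp
  ultimately show ?thesis using nq0 by (meson order_trans)
qed

theorem theorem3p2:
  fixes S :: "'a::euclidean_space set"
  assumes "convex_body S" and "0 \<in> interior S" and "uminus ` S = S"
  shows "(\<forall>q::'a. q \<noteq> 0 \<longrightarrow>
            (INF P\<in>Par S q. lower_path_density P) = ennreal (section_vol S q) \<and>
            (INF P\<in>Hom S q. path_density P) = ennreal (section_vol S q))
       \<and> (\<exists>q0::'a. q0 \<noteq> 0 \<and> (\<forall>q. q \<noteq> 0 \<longrightarrow> section_vol S q0 \<le> section_vol S q) \<and>
            (INF P\<in>(\<Union>q\<in>-{0}. Par S q). lower_path_density P) = ennreal (section_vol S q0) \<and>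
            (INF P\<in>(\<Union>q\<in>-{0}. Hom S q). path_density P) = ennreal (section_vol S q0))"
proof -
  have S: "compact S" "convex S" using assms(1) by (auto simp: convex_body_def)
  have dir: "norm (q /\<^sub>R norm q) = 1" "Par S (q /\<^sub>R norm q) = Par S q" "Hom S (q /\<^sub>R norm q) = Hom S q"
    "section_vol S (q /\<^sub>R norm q) = section_vol S q" if "q \<noteq> 0" for q :: 'a
    using that by (simp_all add: Par_scaleR Hom_scaleR section_vol_scaleR)
  have inf: "(INF P\<in>Par S q. lower_path_density P) = ennreal (section_vol S q)"
    "(INF P\<in>Hom S q. path_density P) = ennreal (section_vol S q)" if q: "q \<noteq> 0" for q :: 'a
    using INF_density_unit[OF S assms(2,3) dir(1)[OF q]] by (simp_all only: dir(2-4)[OF q])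
  obtain q0 :: 'a where nq0: "norm q0 = 1" and q0: "\<forall>q. norm q = 1 \<longrightarrow> section_vol S q0 \<le> section_vol S q"
    using section_vol_attains_min[OF S assms(2)] by (elim exE conjE)
  have q00: "q0 \<noteq> 0" using nq0 by auto
  have min: "section_vol S q0 \<le> section_vol S q" if q: "q \<noteq> 0" for q
    using q0 dir(1)[OF q] dir(4)[OF q] by metis
  \<comment> \<open>Stated for an arbitrary family \<open>X\<close> and density \<open>D\<close>, so
    that one argument serves \<open>Par\<close> and \<open>Hom\<close>: the class at
    \<open>q0\<close> bounds the infimum over the union from above, and minimality of
    \<open>q0\<close> bounds it from below.\<close>
  have union: "(INF P\<in>(\<Union>q\<in>-{0}. X q). D P) = ennreal (section_vol S q0)"
    if X: "\<And>q. q \<noteq> 0 \<Longrightarrow> (INF P\<in>X q. D P) = ennreal (section_vol S q)" for X :: "'a \<Rightarrow> 'a set set set" and D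
  proof (rule antisym)
    have "X q0 \<subseteq> (\<Union>q\<in>-{0}. X q)" using q00 by auto
    then have "(INF P\<in>(\<Union>q\<in>-{0}. X q). D P) \<le> (INF P\<in>X q0. D P)" by (rule INF_superset_mono) simp
    then show "(INF P\<in>(\<Union>q\<in>-{0}. X q). D P) \<le> ennreal (section_vol S q0)" by (simp only: X[OF q00])
    show "ennreal (section_vol S q0) \<le> (INF P\<in>(\<Union>q\<in>-{0}. X q). D P)"
    proof (rule INF_greatest)
      fix P assume "P \<in> (\<Union>q\<in>-{0}. X q)"
      then obtain q where q: "q \<noteq> 0" "P \<in> X q" by auto
      have "ennreal (section_vol S q0) \<le> ennreal (section_vol S q)" by (rule ennreal_leI[OF min[OF q(1)]])
      also have "\<dots> \<le> D P" unfolding X[OF q(1), symmetric] by (rule INF_lower[OF q(2)])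
      finally show "ennreal (section_vol S q0) \<le> D P" .
    qed
  qed
  show ?thesis
    using inf q00 min union[where X="Par S", OF inf(1)] union[where X="Hom S", OF inf(2)] by (intro conjI allI impI exI[of _ q0])
qed

end
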